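(* Let $E$ be a finite directed graph with no sources and no sinks, $Z$ a weight sequence satisfying Condition A(p), and $J$ a closed ideal of $q(\mathcal{D})$ with $J_n=J\cap\mathcal{C}_n$. Then $J$ is fully invariant if and only if (1) $J_{0,v}=J_{n,v}$ for every $v\in E^0$ and $n\ge0$, and (2) $J_0$ is invariant, i.e. $u_e^*J_0u_f\subseteq J_0$ for all $e,f\in E^1$.
   Context: Graph conventions: finite directed graph $E=(E^0,E^1,s,r)$, no sources, no sinks; paths $\alpha=e_1\cdots e_k$, $r(\alpha)=r(e_1)$, $s(\alpha)=s(e_k)$, $|\alpha|=k$. Fock setup: $A=C(E^0)$, $X_E$ graph correspondence, $\mathcal{F}(X_E)$ Fock correspondence, $Q_k$ summand projections, $\mathcal{K}$ compacts, $S_e\delta_\beta=\delta_{e\beta}$ (or $0$). Weight sequence $Z=\{Z_k\}$ (adjointable, commuting with left $A$-action, $Z_0=I$, uniformly bounded, positive invertible, $Z_k\ge\epsilon I$ for $k\ge1$), $Z=\mathrm{diag}(Z_k)$; $\mathcal{T}=C^*(ZS_e)$, $q$ quotient modulo $\mathcal{K}$; $\mathcal{D},F$ the fixed-point and degree-one spectral subspaces of $\mathcal{T}$ for $\gamma_t=\mathrm{Ad}(\sum_ne^{int}Q_n)$; $u_e=q(S_e)$, $u_\alpha=u_{e_1}\cdots u_{e_k}$, $z=q(Z)$. Condition A(p): $\lim_k\|I_p\otimes Z_k-Z_{k+p}\|=0$, $(I_p\otimes Z_k)\delta_{\beta\gamma}=\delta_\beta\otimes Z_k\delta_\gamma$.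 Fixed paths $\xi_v$, $|\xi_v|=p-1$, $s(\xi_v)=v$. $\mathcal{C}_n=C^*(\{u_\alpha z^lu_\beta^*:l\ge0,\ np\le|\alpha|=|\beta|<(n+1)p,\ s(\alpha)=s(\beta)\})$; $\mathcal{C}_v=u_{\xi_v}u_{\xi_v}^*\mathcal{C}_0u_{\xi_v}u_{\xi_v}^*$. For $J_n=J\cap\mathcal{C}_n$, $J_{n,v}=u_{\xi_v}u_{\mu_1}^*J_nu_{\mu_2}u_{\xi_v}^*\subseteq\mathcal{C}_v$ for any paths $\mu_1,\mu_2$ with $|\mu_i|=np+p-1$, $s(\mu_i)=v$ (independent of choice). Fully invariant: closed ideal $J$ of $q(\mathcal{D})$ with (a) $x^*ay\in J$ for $a\in J$, $x,y\in q(F)$, and (b) $a\in q(\mathcal{D})$ with $x^*ay\in J$ for all $x,y\in q(F)$ implies $a\in J$. *)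

theory Defs
  imports "HOL-Analysis.Analysis"
begin

text \<open>Vertices have type 'v, edges type 'e (both finite in the theorem); sE, rE are the
source and range maps.  A path alpha = e_1 ... e_k is represented as (v, [e_1,...,e_k])
where v = s(alpha) = s(e_k); a length-0 path is a vertex (v, []).  Composability:
s(e_i) = r(e_{i+1}).\<close>

type_synonym ('v,'e) path = "'v \<times> 'e list"
type_synonym ('v,'e) vec = "('v,'e) path \<Rightarrow> complex"
type_synonym ('v,'e) op = "('v,'e) vec \<Rightarrow> ('v,'e) vec"

definition is_path :: "('e \<Rightarrow> 'v) \<Rightarrow> ('e \<Rightarrow> 'v) \<Rightarrow> ('v,'e) path \<Rightarrow> bool" where
  "is_path sE rE \<alpha> \<longleftrightarrow>
     (\<forall>i. Suc i < length (snd \<alpha>) \<longrightarrow> sE (snd \<alpha> ! i) = rE (snd \<alpha> ! Suc i)) \<and>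
     (snd \<alpha> \<noteq> [] \<longrightarrow> sE (last (snd \<alpha>)) = fst \<alpha>)"

definition psrc :: "('v,'e) path \<Rightarrow> 'v" where "psrc \<alpha> = fst \<alpha>"

definition prng :: "('e \<Rightarrow> 'v) \<Rightarrow> ('v,'e) path \<Rightarrow> 'v" where
  "prng rE \<alpha> = (if snd \<alpha> = [] then fst \<alpha> else rE (hd (snd \<alpha>)))"

definition plen :: "('v,'e) path \<Rightarrow> nat" where "plen \<alpha> = length (snd \<alpha>)"

text \<open>concatenation alpha beta (requires s(alpha) = r(beta))\<close>
definition pcat :: "('v,'e) path \<Rightarrow> ('v,'e) path \<Rightarrow> ('v,'e) path" where
  "pcat \<alpha> \<beta> = (fst \<beta>, snd \<alpha> @ snd \<beta>)"

text \<open>Since A = C(E^0) is finite dimensional, the Fock correspondence F(X_E) is the Hilbert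
space l2 over the set of all finite paths (including vertices), with orthonormal basis delta_beta;
the A-valued inner product and right action are recorded below.\<close>

definition l2 :: "('e \<Rightarrow> 'v) \<Rightarrow> ('e \<Rightarrow> 'v) \<Rightarrow> ('v,'e) vec set" where
  "l2 sE rE = {x. (\<forall>\<alpha>. \<not> is_path sE rE \<alpha> \<longrightarrow> x \<alpha> = 0) \<and>
                  (\<lambda>\<alpha>. (cmod (x \<alpha>))\<^sup>2) summable_on UNIV}"

definition vzero :: "('v,'e) vec" where "vzero = (\<lambda>_. 0)"
definition vadd :: "('v,'e) vec \<Rightarrow> ('v,'e) vec \<Rightarrow> ('v,'e) vec" where
  "vadd x y = (\<lambda>\<alpha>. x \<alpha> + y \<alpha>)"
definition vsmul :: "complex \<Rightarrow> ('v,'e) vec \<Rightarrow> ('v,'e) vec" where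
  "vsmul c x = (\<lambda>\<alpha>. c * x \<alpha>)"

definition linner :: "('v,'e) vec \<Rightarrow> ('v,'e) vec \<Rightarrow> complex" where
  "linner x y = infsum (\<lambda>\<alpha>. cnj (x \<alpha>) * y \<alpha>) UNIV"

definition lnorm :: "('v,'e) vec \<Rightarrow> real" where
  "lnorm x = sqrt (infsum (\<lambda>\<alpha>. (cmod (x \<alpha>))\<^sup>2) UNIV)"

text \<open>Operators are normalised to be 0 outside l2, so that equality of operators is meaningful.\<close>
definition mkop :: "('e \<Rightarrow> 'v) \<Rightarrow> ('e \<Rightarrow> 'v) \<Rightarrow> ('v,'e) op \<Rightarrow> ('v,'e) op" where
  "mkop sE rE f = (\<lambda>x. if x \<in> l2 sE rE then f x else vzero)"

definition bounded_op :: "('e \<Rightarrow> 'v) \<Rightarrow> ('e \<Rightarrow> 'v) \<Rightarrow> ('v,'e) op \<Rightarrow> bool" where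
  "bounded_op sE rE T \<longleftrightarrow>
     (\<forall>x. x \<notin> l2 sE rE \<longrightarrow> T x = vzero) \<and>
     (\<forall>x\<in>l2 sE rE. T x \<in> l2 sE rE) \<and>
     (\<forall>x\<in>l2 sE rE. \<forall>y\<in>l2 sE rE. \<forall>c. T (vadd x y) = vadd (T x) (T y) \<and> T (vsmul c x) = vsmul c (T x)) \<and>
     (\<exists>C. \<forall>x\<in>l2 sE rE. lnorm (T x) \<le> C * lnorm x)"

definition ozero :: "('v,'e) op" where "ozero = (\<lambda>_. vzero)"
definition oadd :: "('v,'e) op \<Rightarrow> ('v,'e) op \<Rightarrow> ('v,'e) op" where
  "oadd T S = (\<lambda>x. vadd (T x) (S x))"
definition osmul :: "complex \<Rightarrow> ('v,'e) op \<Rightarrow> ('v,'e) op" where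
  "osmul c T = (\<lambda>x. vsmul c (T x))"
definition osub :: "('v,'e) op \<Rightarrow> ('v,'e) op \<Rightarrow> ('v,'e) op" where
  "osub T S = oadd T (osmul (-1) S)"

definition oid :: "('e \<Rightarrow> 'v) \<Rightarrow> ('e \<Rightarrow> 'v) \<Rightarrow> ('v,'e) op" where
  "oid sE rE = mkop sE rE (\<lambda>x. x)"

definition opnorm :: "('e \<Rightarrow> 'v) \<Rightarrow> ('e \<Rightarrow> 'v) \<Rightarrow> ('v,'e) op \<Rightarrow> real" where
  "opnorm sE rE T = Sup {lnorm (T x) | x. x \<in> l2 sE rE \<and> lnorm x \<le> 1}"

definition oadj :: "('e \<Rightarrow> 'v) \<Rightarrow> ('e \<Rightarrow> 'v) \<Rightarrow> ('v,'e) op \<Rightarrow> ('v,'e) op" where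
  "oadj sE rE T = mkop sE rE (\<lambda>y. SOME z. z \<in> l2 sE rE \<and>
                         (\<forall>x\<in>l2 sE rE. linner (T x) y = linner x z))"

definition oclosure :: "('e \<Rightarrow> 'v) \<Rightarrow> ('e \<Rightarrow> 'v) \<Rightarrow> ('v,'e) op set \<Rightarrow> ('v,'e) op set" where
  "oclosure sE rE S = {T. bounded_op sE rE T \<and>
      (\<forall>\<epsilon>>0. \<exists>S0\<in>S. opnorm sE rE (osub T S0) < \<epsilon>)}"

definition cstar_sub :: "('e \<Rightarrow> 'v) \<Rightarrow> ('e \<Rightarrow> 'v) \<Rightarrow> ('v,'e) op set \<Rightarrow> bool" where
  "cstar_sub sE rE B \<longleftrightarrow> B \<subseteq> {T. bounded_op sE rE T} \<and> ozero \<in> B \<and>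
     (\<forall>T\<in>B. \<forall>S\<in>B. oadd T S \<in> B \<and> T \<circ> S \<in> B) \<and>
     (\<forall>T\<in>B. \<forall>c. osmul c T \<in> B) \<and> (\<forall>T\<in>B. oadj sE rE T \<in> B) \<and>
     oclosure sE rE B \<subseteq> B"

definition cstar_gen :: "('e \<Rightarrow> 'v) \<Rightarrow> ('e \<Rightarrow> 'v) \<Rightarrow> ('v,'e) op set \<Rightarrow> ('v,'e) op set" where
  "cstar_gen sE rE X = \<Inter>{B. cstar_sub sE rE B \<and> X \<subseteq> B}"

definition ract :: "('v,'e) vec \<Rightarrow> ('v \<Rightarrow> complex) \<Rightarrow> ('v,'e) vec" where
  "ract x a = (\<lambda>\<alpha>. x \<alpha> * a (psrc \<alpha>))"

definition ainner :: "('v,'e) vec \<Rightarrow> ('v,'e) vec \<Rightarrow> ('v \<Rightarrow> complex)" where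
  "ainner x y = (\<lambda>v. infsum (\<lambda>\<alpha>. cnj (x \<alpha>) * y \<alpha>) {\<alpha>. psrc \<alpha> = v})"

definition theta :: "('e \<Rightarrow> 'v) \<Rightarrow> ('e \<Rightarrow> 'v) \<Rightarrow> ('v,'e) vec \<Rightarrow> ('v,'e) vec \<Rightarrow> ('v,'e) op" where
  "theta sE rE x y = mkop sE rE (\<lambda>z. ract x (ainner y z))"

definition finsums :: "('v,'e) op set \<Rightarrow> ('v,'e) op set" where
  "finsums S = {foldr oadd ts ozero | ts. set ts \<subseteq> S}"

definition compacts :: "('e \<Rightarrow> 'v) \<Rightarrow> ('e \<Rightarrow> 'v) \<Rightarrow> ('v,'e) op set" where
  "compacts sE rE = oclosure sE rE
     (finsums {osmul c (theta sE rE x y) | c x y. x \<in> l2 sE rE \<and> y \<in> l2 sE rE})"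

text \<open>S_e delta_beta = delta_{e beta} if s(e) = r(beta), else 0\<close>
definition Sop :: "('e \<Rightarrow> 'v) \<Rightarrow> ('e \<Rightarrow> 'v) \<Rightarrow> 'e \<Rightarrow> ('v,'e) op" where
  "Sop sE rE e = mkop sE rE (\<lambda>x \<alpha>.
     if is_path sE rE \<alpha> \<and> snd \<alpha> \<noteq> [] \<and> hd (snd \<alpha>) = e then x (fst \<alpha>, tl (snd \<alpha>)) else 0)"

definition Pv :: "('e \<Rightarrow> 'v) \<Rightarrow> ('e \<Rightarrow> 'v) \<Rightarrow> 'v \<Rightarrow> ('v,'e) op" where
  "Pv sE rE v = mkop sE rE (\<lambda>x \<alpha>. if prng rE \<alpha> = v then x \<alpha> else 0)"

text \<open>S_alpha = S_{e_1} ... S_{e_k}; for a vertex path v this is the projection p_v\<close>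
definition Spath :: "('e \<Rightarrow> 'v) \<Rightarrow> ('e \<Rightarrow> 'v) \<Rightarrow> ('v,'e) path \<Rightarrow> ('v,'e) op" where
  "Spath sE rE \<alpha> = Pv sE rE (prng rE \<alpha>) \<circ> foldr (\<circ>) (map (Sop sE rE) (snd \<alpha>)) (oid sE rE)"

definition Qop :: "('e \<Rightarrow> 'v) \<Rightarrow> ('e \<Rightarrow> 'v) \<Rightarrow> nat \<Rightarrow> ('v,'e) op" where
  "Qop sE rE k = mkop sE rE (\<lambda>x \<alpha>. if plen \<alpha> = k then x \<alpha> else 0)"

definition Ut :: "('e \<Rightarrow> 'v) \<Rightarrow> ('e \<Rightarrow> 'v) \<Rightarrow> real \<Rightarrow> ('v,'e) op" where
  "Ut sE rE t = mkop sE rE (\<lambda>x \<alpha>. exp (\<i> * complex_of_real (real (plen \<alpha>) * t)) * x \<alpha>)"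

definition gauge :: "('e \<Rightarrow> 'v) \<Rightarrow> ('e \<Rightarrow> 'v) \<Rightarrow> real \<Rightarrow> ('v,'e) op \<Rightarrow> ('v,'e) op" where
  "gauge sE rE t T = Ut sE rE t \<circ> T \<circ> oadj sE rE (Ut sE rE t)"

text \<open>I_p \<otimes> Z_k on X^{\<otimes>(p+k)}, extended by 0 on the other summands:
 (I_p \<otimes> Z_k) delta_{beta gamma} = delta_beta \<otimes> Z_k delta_gamma\<close>
definition tensId :: "('e \<Rightarrow> 'v) \<Rightarrow> ('e \<Rightarrow> 'v) \<Rightarrow> nat \<Rightarrow> ('v,'e) op \<Rightarrow> nat \<Rightarrow> ('v,'e) op" where
  "tensId sE rE p Z k = mkop sE rE (\<lambda>x \<alpha>.
     if is_path sE rE \<alpha> \<and> plen \<alpha> = p + k then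
       (let \<eta> = (fst \<alpha>, drop p (snd \<alpha>)); \<beta> = (prng rE \<eta>, take p (snd \<alpha>)) in
        Z (\<lambda>\<gamma>. if is_path sE rE \<gamma> \<and> plen \<gamma> = k \<and> prng rE \<gamma> = psrc \<beta>
                 then x (pcat \<beta> \<gamma>) else 0) \<eta>)
     else 0)"

text \<open>Z = diag(Z_k) with Z_k adjointable (right A-linear), commuting with the left A-action,
 Z_0 = I, uniformly bounded, positive invertible, Z_k \<ge> eps I for k \<ge> 1.\<close>
definition weight_seq :: "('e \<Rightarrow> 'v) \<Rightarrow> ('e \<Rightarrow> 'v) \<Rightarrow> ('v,'e) op \<Rightarrow> bool" where
  "weight_seq sE rE Z \<longleftrightarrow> bounded_op sE rE Z \<and>
     (\<forall>k. Z \<circ> Qop sE rE k = Qop sE rE k \<circ> Z) \<and>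
     (\<forall>x\<in>l2 sE rE. \<forall>a. Z (ract x a) = ract (Z x) a) \<and>
     (\<forall>v. Z \<circ> Pv sE rE v = Pv sE rE v \<circ> Z) \<and>
     Z \<circ> Qop sE rE 0 = Qop sE rE 0 \<and>
     oadj sE rE Z = Z \<and>
     (\<forall>k. \<exists>W. bounded_op sE rE W \<and> W \<circ> Z \<circ> Qop sE rE k = Qop sE rE k \<and>
                 Z \<circ> W \<circ> Qop sE rE k = Qop sE rE k) \<and>
     (\<exists>\<epsilon>>0. \<forall>k\<ge>1. \<forall>x\<in>l2 sE rE. Qop sE rE k x = x \<longrightarrow>
          Re (linner x (Z x)) \<ge> \<epsilon> * (lnorm x)\<^sup>2)"

definition condA :: "('e \<Rightarrow> 'v) \<Rightarrow> ('e \<Rightarrow> 'v) \<Rightarrow> nat \<Rightarrow> ('v,'e) op \<Rightarrow> bool" where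
  "condA sE rE p Z \<longleftrightarrow>
     (\<lambda>k. opnorm sE rE (osub (tensId sE rE p Z k) (Z \<circ> Qop sE rE (k + p)))) \<longlonglongrightarrow> 0"

definition toeplitz :: "('e \<Rightarrow> 'v) \<Rightarrow> ('e \<Rightarrow> 'v) \<Rightarrow> ('v,'e) op \<Rightarrow> ('v,'e) op set" where
  "toeplitz sE rE Z = cstar_gen sE rE {Z \<circ> Sop sE rE e | e. True}"

definition fixD :: "('e \<Rightarrow> 'v) \<Rightarrow> ('e \<Rightarrow> 'v) \<Rightarrow> ('v,'e) op \<Rightarrow> ('v,'e) op set" where
  "fixD sE rE Z = {T \<in> toeplitz sE rE Z. \<forall>t. gauge sE rE t T = T}"

definition deg1F :: "('e \<Rightarrow> 'v) \<Rightarrow> ('e \<Rightarrow> 'v) \<Rightarrow> ('v,'e) op \<Rightarrow> ('v,'e) op set" where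
  "deg1F sE rE Z = {T \<in> toeplitz sE rE Z. \<forall>t. gauge sE rE t T = osmul (exp (\<i> * complex_of_real t)) T}"

type_synonym ('v,'e) calk = "('v,'e) op set"

definition qmap :: "('e \<Rightarrow> 'v) \<Rightarrow> ('e \<Rightarrow> 'v) \<Rightarrow> ('v,'e) op \<Rightarrow> ('v,'e) calk" where
  "qmap sE rE T = {oadd T K | K. K \<in> compacts sE rE}"

definition calkin :: "('e \<Rightarrow> 'v) \<Rightarrow> ('e \<Rightarrow> 'v) \<Rightarrow> ('v,'e) calk set" where
  "calkin sE rE = qmap sE rE ` {T. bounded_op sE rE T}"

definition crep :: "('v,'e) calk \<Rightarrow> ('v,'e) op" where "crep a = (SOME T. T \<in> a)"

definition cmul :: "('e \<Rightarrow> 'v) \<Rightarrow> ('e \<Rightarrow> 'v) \<Rightarrow> ('v,'e) calk \<Rightarrow> ('v,'e) calk \<Rightarrow> ('v,'e) calk" where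
  "cmul sE rE a b = qmap sE rE (crep a \<circ> crep b)"
definition cadd :: "('e \<Rightarrow> 'v) \<Rightarrow> ('e \<Rightarrow> 'v) \<Rightarrow> ('v,'e) calk \<Rightarrow> ('v,'e) calk \<Rightarrow> ('v,'e) calk" where
  "cadd sE rE a b = qmap sE rE (oadd (crep a) (crep b))"
definition csmul :: "('e \<Rightarrow> 'v) \<Rightarrow> ('e \<Rightarrow> 'v) \<Rightarrow> complex \<Rightarrow> ('v,'e) calk \<Rightarrow> ('v,'e) calk" where
  "csmul sE rE c a = qmap sE rE (osmul c (crep a))"
definition csub :: "('e \<Rightarrow> 'v) \<Rightarrow> ('e \<Rightarrow> 'v) \<Rightarrow> ('v,'e) calk \<Rightarrow> ('v,'e) calk \<Rightarrow> ('v,'e) calk" where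
  "csub sE rE a b = qmap sE rE (osub (crep a) (crep b))"
definition cadj :: "('e \<Rightarrow> 'v) \<Rightarrow> ('e \<Rightarrow> 'v) \<Rightarrow> ('v,'e) calk \<Rightarrow> ('v,'e) calk" where
  "cadj sE rE a = qmap sE rE (oadj sE rE (crep a))"
definition cnorm :: "('e \<Rightarrow> 'v) \<Rightarrow> ('e \<Rightarrow> 'v) \<Rightarrow> ('v,'e) calk \<Rightarrow> real" where
  "cnorm sE rE a = Inf {opnorm sE rE T | T. T \<in> a}"

definition cclosed :: "('e \<Rightarrow> 'v) \<Rightarrow> ('e \<Rightarrow> 'v) \<Rightarrow> ('v,'e) calk set \<Rightarrow> bool" where
  "cclosed sE rE B \<longleftrightarrow> (\<forall>a\<in>calkin sE rE.
      (\<forall>\<epsilon>>0. \<exists>b\<in>B. cnorm sE rE (csub sE rE a b) < \<epsilon>) \<longrightarrow> a \<in> B)"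

definition ccstar_sub :: "('e \<Rightarrow> 'v) \<Rightarrow> ('e \<Rightarrow> 'v) \<Rightarrow> ('v,'e) calk set \<Rightarrow> bool" where
  "ccstar_sub sE rE B \<longleftrightarrow> B \<subseteq> calkin sE rE \<and> qmap sE rE ozero \<in> B \<and>
     (\<forall>a\<in>B. \<forall>b\<in>B. cadd sE rE a b \<in> B \<and> cmul sE rE a b \<in> B) \<and>
     (\<forall>a\<in>B. \<forall>c. csmul sE rE c a \<in> B) \<and> (\<forall>a\<in>B. cadj sE rE a \<in> B) \<and> cclosed sE rE B"

definition ccstar_gen :: "('e \<Rightarrow> 'v) \<Rightarrow> ('e \<Rightarrow> 'v) \<Rightarrow> ('v,'e) calk set \<Rightarrow> ('v,'e) calk set" where
  "ccstar_gen sE rE X = \<Inter>{B. ccstar_sub sE rE B \<and> X \<subseteq> B}"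

definition closed_ideal :: "('e \<Rightarrow> 'v) \<Rightarrow> ('e \<Rightarrow> 'v) \<Rightarrow> ('v,'e) calk set \<Rightarrow> ('v,'e) calk set \<Rightarrow> bool" where
  "closed_ideal sE rE Alg J \<longleftrightarrow> J \<subseteq> Alg \<and> qmap sE rE ozero \<in> J \<and>
     (\<forall>a\<in>J. \<forall>b\<in>J. cadd sE rE a b \<in> J) \<and> (\<forall>a\<in>J. \<forall>c. csmul sE rE c a \<in> J) \<and>
     (\<forall>a\<in>J. \<forall>b\<in>Alg. cmul sE rE a b \<in> J \<and> cmul sE rE b a \<in> J) \<and> cclosed sE rE J"

definition u :: "('e \<Rightarrow> 'v) \<Rightarrow> ('e \<Rightarrow> 'v) \<Rightarrow> ('v,'e) path \<Rightarrow> ('v,'e) calk" where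
  "u sE rE \<alpha> = qmap sE rE (Spath sE rE \<alpha>)"

definition ue :: "('e \<Rightarrow> 'v) \<Rightarrow> ('e \<Rightarrow> 'v) \<Rightarrow> 'e \<Rightarrow> ('v,'e) calk" where
  "ue sE rE e = qmap sE rE (Sop sE rE e)"

fun zpow :: "('e \<Rightarrow> 'v) \<Rightarrow> ('e \<Rightarrow> 'v) \<Rightarrow> ('v,'e) op \<Rightarrow> nat \<Rightarrow> ('v,'e) calk" where
  "zpow sE rE Z 0 = qmap sE rE (oid sE rE)"
| "zpow sE rE Z (Suc l) = cmul sE rE (qmap sE rE Z) (zpow sE rE Z l)"

definition Cn :: "('e \<Rightarrow> 'v) \<Rightarrow> ('e \<Rightarrow> 'v) \<Rightarrow> nat \<Rightarrow> ('v,'e) op \<Rightarrow> nat \<Rightarrow> ('v,'e) calk set" where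
  "Cn sE rE p Z n = ccstar_gen sE rE
     {cmul sE rE (cmul sE rE (u sE rE \<alpha>) (zpow sE rE Z l)) (cadj sE rE (u sE rE \<beta>)) | \<alpha> \<beta> l.
        is_path sE rE \<alpha> \<and> is_path sE rE \<beta> \<and> n * p \<le> plen \<alpha> \<and> plen \<alpha> = plen \<beta> \<and>
        plen \<alpha> < (n + 1) * p \<and> psrc \<alpha> = psrc \<beta>}"

definition Jnv :: "('e \<Rightarrow> 'v) \<Rightarrow> ('e \<Rightarrow> 'v) \<Rightarrow> nat \<Rightarrow> ('v,'e) op \<Rightarrow> ('v,'e) calk set \<Rightarrow> nat
                   \<Rightarrow> ('v,'e) path \<Rightarrow> ('v,'e) path \<Rightarrow> ('v,'e) path \<Rightarrow> ('v,'e) calk set" where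
  "Jnv sE rE p Z J n \<xi> \<mu>1 \<mu>2 =
     {cmul sE rE (cmul sE rE (cmul sE rE (cmul sE rE (u sE rE \<xi>) (cadj sE rE (u sE rE \<mu>1))) a)
        (u sE rE \<mu>2)) (cadj sE rE (u sE rE \<xi>)) | a. a \<in> J \<inter> Cn sE rE p Z n}"

definition fully_invariant :: "('e \<Rightarrow> 'v) \<Rightarrow> ('e \<Rightarrow> 'v) \<Rightarrow> ('v,'e) op \<Rightarrow> ('v,'e) calk set \<Rightarrow> bool" where
  "fully_invariant sE rE Z J \<longleftrightarrow>
     closed_ideal sE rE (qmap sE rE ` fixD sE rE Z) J \<and>
     (\<forall>a\<in>J. \<forall>x\<in>qmap sE rE ` deg1F sE rE Z. \<forall>y\<in>qmap sE rE ` deg1F sE rE Z.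
        cmul sE rE (cmul sE rE (cadj sE rE x) a) y \<in> J) \<and>
     (\<forall>a\<in>qmap sE rE ` fixD sE rE Z.
        (\<forall>x\<in>qmap sE rE ` deg1F sE rE Z. \<forall>y\<in>qmap sE rE ` deg1F sE rE Z.
           cmul sE rE (cmul sE rE (cadj sE rE x) a) y \<in> J) \<longrightarrow> a \<in> J)"

end

theory Submission
  imports Defs
begin

text \<open>Right-linear operators on the Fock space form a Banach algebra with involution and an ideal of
compact operators, and the concrete operators and cosets of the statement are copies of a corner of
this algebra and of its quotient. In the quotient the edge operators satisfy the Cuntz--Krieger
relations, and Condition A(p) says that \<open>z\<close> commutes with \<open>u\<^sub>\<mu>\<close> for every path of length \<open>p\<close>. Hence the algebras \<open>C\<^sub>n\<close> increase,
compression and expansion by paths of length \<open>p\<close> exchange \<open>C\<^sub>n\<close> and \<open>C\<^sub>n\<^sub>+\<^sub>1\<close>, and the union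
of the \<open>C\<^sub>n\<close> is dense in \<open>q(D)\<close>. An ideal \<open>J\<close> of an inductive limit is the closure of the union of
its traces \<open>J\<^sub>n\<close>, so it is enough to work with these.

Full invariance of \<open>J\<close> is equivalent to invariance under \<open>a \<mapsto> u\<^sub>e* a u\<^sub>f\<close> (down) and
\<open>a \<mapsto> u\<^sub>e a u\<^sub>f*\<close> (up). Every element of \<open>J\<^sub>n\<close> is a sum of
\<open>u\<^sub>\<mu>\<^sub>1 x u\<^sub>\<mu>\<^sub>2*\<close> with \<open>x\<close> in the corner \<open>u\<^sub>\<mu>\<^sub>1* J\<^sub>n u\<^sub>\<mu>\<^sub>2\<close>; condition (1) says that these
corners do not depend on \<open>n\<close>, which allows one to move between levels, and condition (2) handles the moves inside a level.\<close>

section \<open>The Hilbert space of square-summable families\<close>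

text \<open>The hypotheses speak of the weighted operators \<open>ZZ * SE e\<close>, while every
  path argument needs the unweighted ones. The sum of Z S_e S_e* Z over the edges is the square of Z
  cut down to positive lengths, where Z is bounded below; so its square root and inverse stay in the
  Toeplitz algebra and S_e is recovered.

  The length np+p-1 in condition (1) is the largest one occurring in C_n. Compression by such paths
  strips both ends of every generator and leaves \<open>u_\<gamma>* z^l u_\<gamma>\<close> with one
  \<gamma> shorter than p, because z is diagonal on short paths. This form no longer depends on n,
  which makes corners of different levels comparable. Other lengths are reached by adding edges, and
  this is where (2) enters.

  Vectors are indexed by all pairs of a vertex and an edge list, paths or not, so that the operators
  form a single Banach algebra. The relevant unit is therefore not 1 but the projection
  \<open>ee\<close> onto genuine paths, called \<open>E\<close> in the quotient, and it accompanies
  almost every identity.\<close>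

typedef 'i ell2 = "{x :: 'i \<Rightarrow> complex. (\<lambda>i. (cmod (x i))\<^sup>2) summable_on UNIV}"
  morphisms coord Abs_ell2
  by (rule exI[of _ "\<lambda>_. 0"]) simp

setup_lifting type_definition_ell2

lemma coord_summable: "(\<lambda>i. (cmod (coord x i))\<^sup>2) summable_on A"
  using coord[of x] by (intro summable_on_subset_banach[of _ UNIV A]) auto

lemma ell2_eqI: "(\<And>i. coord x i = coord y i) \<Longrightarrow> x = y"
  by (simp add: coord_inject[symmetric] fun_eq_iff)

lemma square_summable_add:
  fixes f g :: "'i \<Rightarrow> complex"
  assumes "(\<lambda>i. (cmod (f i))\<^sup>2) summable_on A" "(\<lambda>i. (cmod (g i))\<^sup>2) summable_on A"
  shows "(\<lambda>i. (cmod (f i + g i))\<^sup>2) summable_on A"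
proof (rule summable_on_comparison_test)
  show "(\<lambda>i. 2 * (cmod (f i))\<^sup>2 + 2 * (cmod (g i))\<^sup>2) summable_on A"
    using assms by (intro summable_on_add summable_on_cmult_right)
  fix i
  have "(cmod (f i + g i))\<^sup>2 \<le> (cmod (f i) + cmod (g i))\<^sup>2"
    by (simp add: norm_triangle_ineq power_mono)
  also have "\<dots> \<le> 2 * (cmod (f i))\<^sup>2 + 2 * (cmod (g i))\<^sup>2"
    using sum_squares_bound[of "cmod (f i)" "cmod (g i)"] by (simp add: power2_sum)
  finally show "(cmod (f i + g i))\<^sup>2 \<le> 2 * (cmod (f i))\<^sup>2 + 2 * (cmod (g i))\<^sup>2" .
qed auto

lemma square_summable_le:
  fixes f g :: "'i \<Rightarrow> complex"
  assumes "(\<lambda>i. (cmod (f i))\<^sup>2) summable_on A" "\<And>i. i \<in> A \<Longrightarrow> cmod (g i) \<le> C * cmod (f i)"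
  shows "(\<lambda>i. (cmod (g i))\<^sup>2) summable_on A"
proof (rule summable_on_comparison_test)
  show "(\<lambda>i. C\<^sup>2 * (cmod (f i))\<^sup>2) summable_on A"
    using assms by (intro summable_on_cmult_right)
  fix i assume "i \<in> A"
  then have "(cmod (g i))\<^sup>2 \<le> (C * cmod (f i))\<^sup>2"
    using assms by (intro power_mono) auto
  then show "(cmod (g i))\<^sup>2 \<le> C\<^sup>2 * (cmod (f i))\<^sup>2" by (simp add: power_mult_distrib)
qed auto

lemma square_summable_inner:
  fixes f g :: "'i \<Rightarrow> complex"
  assumes "(\<lambda>i. (cmod (f i))\<^sup>2) summable_on A" "(\<lambda>i. (cmod (g i))\<^sup>2) summable_on A"
  shows "(\<lambda>i. f i \<bullet> g i) summable_on A"
proof (rule abs_summable_summable[OF summable_on_comparison_test])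
  show "(\<lambda>i. (cmod (f i))\<^sup>2 + (cmod (g i))\<^sup>2) summable_on A"
    using assms by (intro summable_on_add)
  fix i
  have "\<bar>f i \<bullet> g i\<bar> \<le> cmod (f i) * cmod (g i)" by (rule Cauchy_Schwarz_ineq2)
  also have "\<dots> \<le> (cmod (f i))\<^sup>2 + (cmod (g i))\<^sup>2"
    using sum_squares_bound[of "cmod (f i)" "cmod (g i)"] mult_nonneg_nonneg[OF norm_ge_zero[of "f i"] norm_ge_zero[of "g i"]]
    by linarith
  finally show "norm (f i \<bullet> g i) \<le> (cmod (f i))\<^sup>2 + (cmod (g i))\<^sup>2" by simp
qed auto

instantiation ell2 :: (type) real_vector
begin
lift_definition zero_ell2 :: "'a ell2" is "\<lambda>_. 0" by simp
lift_definition plus_ell2 :: "'a ell2 \<Rightarrow> 'a ell2 \<Rightarrow> 'a ell2" is "\<lambda>x y i. x i + y i"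
  by (rule square_summable_add)
lift_definition uminus_ell2 :: "'a ell2 \<Rightarrow> 'a ell2" is "\<lambda>x i. - x i" by simp
lift_definition minus_ell2 :: "'a ell2 \<Rightarrow> 'a ell2 \<Rightarrow> 'a ell2" is "\<lambda>x y i. x i - y i"
proof -
  fix f g :: "'a \<Rightarrow> complex"
  assume "(\<lambda>i. (cmod (f i))\<^sup>2) summable_on UNIV" "(\<lambda>i. (cmod (g i))\<^sup>2) summable_on UNIV"
  then show "(\<lambda>i. (cmod (f i - g i))\<^sup>2) summable_on UNIV"
    using square_summable_add[of f UNIV "\<lambda>i. - g i"] by simp
qed
lift_definition scaleR_ell2 :: "real \<Rightarrow> 'a ell2 \<Rightarrow> 'a ell2" is "\<lambda>r x i. r *\<^sub>R x i"
  by (simp add: power_mult_distrib summable_on_cmult_right)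
instance
  by standard (transfer; simp add: algebra_simps)+
end

lemma coord_simps [simp]:
  "coord 0 i = 0" "coord (x + y) i = coord x i + coord y i" "coord (- x) i = - coord x i"
  "coord (x - y) i = coord x i - coord y i" "coord (r *\<^sub>R x) i = r *\<^sub>R coord x i"
  by (transfer; simp)+

instantiation ell2 :: (type) real_inner
begin
text \<open>The real part of the complex inner product. A real inner product suffices for norms,
  adjoints and positivity; complex scalars act as the operators \<open>diag (\<lambda>_. c)\<close>,
  and the complex product returns as \<open>cip\<close>.\<close>

definition inner_ell2 :: "'a ell2 \<Rightarrow> 'a ell2 \<Rightarrow> real" where
  "inner_ell2 x y = infsum (\<lambda>i. coord x i \<bullet> coord y i) UNIV"
definition norm_ell2 :: "'a ell2 \<Rightarrow> real" where "norm_ell2 x = sqrt (x \<bullet> x)"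
definition sgn_ell2 :: "'a ell2 \<Rightarrow> 'a ell2" where "sgn_ell2 x = x /\<^sub>R norm x"
definition dist_ell2 :: "'a ell2 \<Rightarrow> 'a ell2 \<Rightarrow> real" where "dist_ell2 x y = norm (x - y)"
definition uniformity_ell2 :: "('a ell2 \<times> 'a ell2) filter" where
  "uniformity_ell2 = (INF e\<in>{0 <..}. principal {(x, y). dist x y < e})"
definition open_ell2 :: "'a ell2 set \<Rightarrow> bool" where
  "open_ell2 U = (\<forall>x\<in>U. \<forall>\<^sub>F (x', y) in uniformity. x' = x \<longrightarrow> y \<in> U)"
instance
proof
  fix x y z :: "'a ell2" and r :: real
  have s: "(\<lambda>i. coord x i \<bullet> coord y i) summable_on UNIV" for x y :: "'a ell2"
    by (intro square_summable_inner coord_summable)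
  show "dist x y = norm (x - y)" by (simp add: dist_ell2_def)
  show "sgn x = x /\<^sub>R norm x" by (simp add: sgn_ell2_def)
  show "uniformity = (INF e\<in>{0 <..}. principal {(x :: 'a ell2, y). dist x y < e})"
    by (simp add: uniformity_ell2_def)
  show "open U = (\<forall>x\<in>U. \<forall>\<^sub>F (x', y) in uniformity. x' = x \<longrightarrow> y \<in> U)" for U :: "'a ell2 set"
    by (simp add: open_ell2_def)
  show "x \<bullet> y = y \<bullet> x" by (simp add: inner_ell2_def inner_commute)
  show "(x + y) \<bullet> z = x \<bullet> z + y \<bullet> z"
    by (simp add: inner_ell2_def inner_add_left infsum_add s)
  show "(r *\<^sub>R x) \<bullet> y = r * (x \<bullet> y)"
    by (simp add: inner_ell2_def infsum_cmult_right' flip: scaleR_conv_of_real)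
  show "0 \<le> x \<bullet> x" by (simp add: inner_ell2_def infsum_nonneg)
  show "x \<bullet> x = 0 \<longleftrightarrow> x = 0"
  proof
    assume "x \<bullet> x = 0"
    then have "coord x i \<bullet> coord x i = 0" for i
      using nonneg_infsum_le_0D[of "\<lambda>i. coord x i \<bullet> coord x i" UNIV i] s by (simp add: inner_ell2_def)
    then show "x = 0" by (intro ell2_eqI) simp
  qed (simp add: inner_ell2_def)
  show "norm x = sqrt (x \<bullet> x)" by (simp add: norm_ell2_def)
qed
end

lemma norm_ell2_sq: "(norm x)\<^sup>2 = infsum (\<lambda>i. (cmod (coord x i))\<^sup>2) UNIV"
  by (simp add: power2_norm_eq_inner inner_ell2_def)

lemma sum_coord_le_norm:
  assumes "finite F"
  shows "(\<Sum>i\<in>F. (cmod (coord x i))\<^sup>2) \<le> (norm x)\<^sup>2"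
  unfolding norm_ell2_sq by (rule finite_sum_le_infsum[OF coord_summable assms]) auto

lemma norm_coord_le: "cmod (coord x i) \<le> norm x"
  using sum_coord_le_norm[of "{i}" x] by (auto intro: power2_le_imp_le[OF _ norm_ge_zero])

text \<open>Main source of vectors: a uniform bound on finite partial sums yields square summability
  and the norm estimate at once, so images under an operator can be built coordinatewise without
  handling infinite sums.\<close>

lemma ell2_bounded_sums:
  assumes "\<And>F. finite F \<Longrightarrow> (\<Sum>i\<in>F. (cmod (f i))\<^sup>2) \<le> B\<^sup>2" "0 \<le> B"
  obtains x where "\<And>i. coord x i = f i" "norm x \<le> B"
proof -
  have "(\<lambda>i. (cmod (f i))\<^sup>2) summable_on UNIV"
    by (rule nonneg_bdd_above_summable_on) (use assms in \<open>auto simp: bdd_above_def\<close>)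
  then have c: "coord (Abs_ell2 f) i = f i" for i by (simp add: Abs_ell2_inverse)
  moreover have "(norm (Abs_ell2 f))\<^sup>2 \<le> B\<^sup>2"
    unfolding norm_ell2_sq using coord_summable[of "Abs_ell2 f" UNIV] assms c
    by (intro infsum_le_finite_sums) auto
  ultimately show ?thesis using that[of "Abs_ell2 f"] assms(2) power2_le_imp_le by blast
qed

instance ell2 :: (type) banach
proof
  fix X :: "nat \<Rightarrow> 'a ell2" assume X: "Cauchy X"
  have "Cauchy (\<lambda>n. coord (X n) i)" for i
    unfolding Cauchy_iff
  proof (intro allI impI)
    fix e :: real assume "0 < e"
    then obtain M where M: "\<And>m n. m \<ge> M \<Longrightarrow> n \<ge> M \<Longrightarrow> norm (X m - X n) < e"
      using X unfolding Cauchy_iff by blast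
    have "norm (coord (X m) i - coord (X n) i) < e" if "m \<ge> M" "n \<ge> M" for m n
      using norm_coord_le[of "X m - X n" i] M[OF that] by simp
    then show "\<exists>M. \<forall>m\<ge>M. \<forall>n\<ge>M. norm (coord (X m) i - coord (X n) i) < e" by blast
  qed
  then have "\<exists>l. (\<lambda>n. coord (X n) i) \<longlonglongrightarrow> l" for i
    by (simp add: Cauchy_convergent_iff convergent_def)
  then obtain f where f: "\<And>i. (\<lambda>n. coord (X n) i) \<longlonglongrightarrow> f i" by metis
  \<comment> \<open>Fatou's argument: on finitely many coordinates the Cauchy estimate survives the
    limit in m.\<close>
  have bd: "(\<Sum>i\<in>F. (cmod (coord (X n) i - f i))\<^sup>2) \<le> e\<^sup>2"
    if "\<And>m n. m \<ge> M \<Longrightarrow> n \<ge> M \<Longrightarrow> norm (X m - X n) < e" "n \<ge> M" "finite F" for M n F e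
  proof (rule tendsto_upperbound)
    show "(\<lambda>m. \<Sum>i\<in>F. (cmod (coord (X n) i - coord (X m) i))\<^sup>2) \<longlonglongrightarrow> (\<Sum>i\<in>F. (cmod (coord (X n) i - f i))\<^sup>2)"
      by (intro tendsto_intros f)
    have "(\<Sum>i\<in>F. (cmod (coord (X n) i - coord (X m) i))\<^sup>2) \<le> e\<^sup>2" if "m \<ge> M" for m
    proof -
      have "(\<Sum>i\<in>F. (cmod (coord (X n - X m) i))\<^sup>2) \<le> (norm (X n - X m))\<^sup>2"
        using \<open>finite F\<close> by (rule sum_coord_le_norm)
      also have "\<dots> \<le> e\<^sup>2"
        using \<open>\<And>m n. m \<ge> M \<Longrightarrow> n \<ge> M \<Longrightarrow> norm (X m - X n) < e\<close>[OF \<open>n \<ge> M\<close> \<open>m \<ge> M\<close>]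
        by (intro power_mono) auto
      finally show ?thesis by simp
    qed
    then show "\<forall>\<^sub>F m in sequentially. (\<Sum>i\<in>F. (cmod (coord (X n) i - coord (X m) i))\<^sup>2) \<le> e\<^sup>2"
      by (auto simp: eventually_sequentially)
  qed auto
  have ex: "\<exists>M. \<forall>m n. m \<ge> M \<longrightarrow> n \<ge> M \<longrightarrow> norm (X m - X n) < e" if "e > 0" for e
    using X that unfolding Cauchy_iff by blast
  obtain M where M: "\<And>m n. m \<ge> M \<Longrightarrow> n \<ge> M \<Longrightarrow> norm (X m - X n) < 1" using ex[of 1] by auto
  \<comment> \<open>Square summability of \<open>f\<close> is not known directly, only that of its
    difference from \<open>X M\<close>; the limit is therefore built as \<open>X M\<close> minus
    that difference.\<close>
  obtain d where d: "\<And>i. coord d i = coord (X M) i - f i"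
    by (rule ell2_bounded_sums[of "\<lambda>i. coord (X M) i - f i" 1]) (use bd[OF M] in auto)
  define x where "x = X M - d"
  have x: "coord x i = f i" for i by (simp add: x_def d)
  have "X \<longlonglongrightarrow> x"
    unfolding LIMSEQ_iff
  proof (intro allI impI)
    fix e :: real assume e: "0 < e"
    then obtain N where N: "\<And>m n. m \<ge> N \<Longrightarrow> n \<ge> N \<Longrightarrow> norm (X m - X n) < e/2"
      using ex[of "e/2"] by auto
    have "norm (X n - x) < e" if "n \<ge> N" for n
    proof -
      obtain y where y: "\<And>i. coord y i = coord (X n) i - f i" "norm y \<le> e/2"
        by (rule ell2_bounded_sums[of "\<lambda>i. coord (X n) i - f i" "e/2"])
          (use bd[OF N \<open>n \<ge> N\<close>] e in auto)
      have "y = X n - x" by (intro ell2_eqI) (simp add: y x)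
      then show ?thesis using y e by auto
    qed
    then show "\<exists>no. \<forall>n\<ge>no. norm (X n - x) < e" by blast
  qed
  then show "convergent X" by (auto simp: convergent_def)
qed

text \<open>Multiplication by bounded functions covers scalars, the right action, all diagonal projections
and the gauge unitaries.\<close>

definition bfun :: "('i \<Rightarrow> complex) \<Rightarrow> bool" where
  "bfun a \<longleftrightarrow> (\<exists>C. \<forall>i. cmod (a i) \<le> C)"

definition diag :: "('i \<Rightarrow> complex) \<Rightarrow> 'i ell2 \<Rightarrow> 'i ell2" where
  "diag a x = Abs_ell2 (\<lambda>i. if bfun a then a i * coord x i else 0)"

lemma coord_diag: "bfun a \<Longrightarrow> coord (diag a x) i = a i * coord x i"
proof -
  assume a: "bfun a"
  then obtain C where C: "\<And>i. cmod (a i) \<le> C" by (auto simp: bfun_def)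
  have "(\<lambda>i. (cmod (a i * coord x i))\<^sup>2) summable_on UNIV"
    by (rule square_summable_le[OF coord_summable[of x], where C = C])
      (simp add: norm_mult C mult_right_mono)
  then show ?thesis by (simp add: diag_def a Abs_ell2_inverse)
qed

lemma norm_diag_le:
  assumes "\<And>i. cmod (a i) \<le> C"
  shows "norm (diag a x) \<le> C * norm x"
proof -
  have a: "bfun a" using assms by (auto simp: bfun_def)
  have C: "0 \<le> C" using assms norm_ge_zero order_trans by blast
  obtain y where "\<And>i. coord y i = coord (diag a x) i" "norm y \<le> C * norm x"
  proof (rule ell2_bounded_sums[of "\<lambda>i. coord (diag a x) i" "C * norm x"])
    fix F :: "'a set" assume F: "finite F"
    have "(\<Sum>i\<in>F. (cmod (coord (diag a x) i))\<^sup>2) \<le> (\<Sum>i\<in>F. C\<^sup>2 * (cmod (coord x i))\<^sup>2)"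
      by (intro sum_mono) (simp add: coord_diag a norm_mult power_mult_distrib power_mono assms mult_right_mono)
    also have "\<dots> \<le> C\<^sup>2 * (norm x)\<^sup>2"
      using sum_coord_le_norm[OF F, of x] by (simp add: mult_left_mono flip: sum_distrib_left)
    finally show "(\<Sum>i\<in>F. (cmod (coord (diag a x) i))\<^sup>2) \<le> (C * norm x)\<^sup>2"
      by (simp add: power_mult_distrib)
  qed (use C in auto)
  then show ?thesis using ell2_eqI by metis
qed

lemma bounded_linear_diag: "bfun a \<Longrightarrow> bounded_linear (diag a)"
proof -
  assume a: "bfun a"
  then obtain C where C: "\<And>i. cmod (a i) \<le> C" by (auto simp: bfun_def)
  show ?thesis
    by (rule bounded_linear_intro[of _ C])
      (auto intro!: ell2_eqI simp: coord_diag a algebra_simps norm_diag_le[OF C] mult.commute)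
qed

lemma bfun_indicator [simp]: "bfun (\<lambda>i. of_bool (P i))"
  by (auto simp: bfun_def intro!: exI[of _ 1])

lemma bfun_const [simp]: "bfun (\<lambda>i. c)" by (auto simp: bfun_def)

lemma bfun_finite [simp]: "bfun (\<lambda>i. (a :: 'v::finite \<Rightarrow> complex) (f i))"
  unfolding bfun_def
proof (rule exI[of _ "\<Sum>v\<in>UNIV. cmod (a v)"], rule allI)
  show "cmod (a (f i)) \<le> (\<Sum>v\<in>UNIV. cmod (a v))" for i
    using member_le_sum[of "f i" UNIV "\<lambda>v. cmod (a v)"] by auto
qed

lemma bfun_mult: "bfun a \<Longrightarrow> bfun b \<Longrightarrow> bfun (\<lambda>i. a i * b i)"
proof -
  assume "bfun a" "bfun b"
  then obtain C D where "\<And>i. cmod (a i) \<le> C" "\<And>i. cmod (b i) \<le> D" by (auto simp: bfun_def)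
  then have "cmod (a i * b i) \<le> C * D" for i
    unfolding norm_mult by (intro mult_mono') auto
  then show ?thesis by (auto simp: bfun_def)
qed

lemma bfun_cnj: "bfun a \<Longrightarrow> bfun (\<lambda>i. cnj (a i))"
  by (simp add: bfun_def)

abbreviation restr :: "'i set \<Rightarrow> 'i ell2 \<Rightarrow> 'i ell2" where
  "restr A \<equiv> diag (\<lambda>i. of_bool (i \<in> A))"

lemma inner_diag: "bfun a \<Longrightarrow> diag a x \<bullet> y = x \<bullet> diag (\<lambda>i. cnj (a i)) y"
  by (simp add: inner_ell2_def coord_diag bfun_cnj)
     (intro infsum_cong, simp add: inner_complex_def algebra_simps)

section \<open>Basis vectors, truncations and the Riesz representation\<close>

lift_definition basis :: "'i \<Rightarrow> 'i ell2" is "\<lambda>i j. of_bool (i = j)"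
proof -
  fix i :: 'i
  have "(\<lambda>j. (cmod (of_bool (i = j)))\<^sup>2) summable_on {i}" by simp
  then show "(\<lambda>j. (cmod (of_bool (i = j)))\<^sup>2) summable_on UNIV"
    by (rule summable_on_cong_neutral[THEN iffD1, rotated -1]) auto
qed

lemma coord_basis [simp]: "coord (basis i) j = of_bool (i = j)"
  by transfer simp

lemma norm_ell2_support:
  assumes "finite F" "\<And>i. i \<notin> F \<Longrightarrow> coord x i = 0"
  shows "x \<bullet> y = (\<Sum>i\<in>F. coord x i \<bullet> coord y i)"
proof -
  have "x \<bullet> y = infsum (\<lambda>i. coord x i \<bullet> coord y i) F"
    unfolding inner_ell2_def by (rule infsum_cong_neutral) (use assms in auto)
  then show ?thesis using assms by simp
qed

lemma restr_complement_small:
  assumes "e > 0"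
  obtains F where "finite F" "\<And>A. A \<inter> F = {} \<Longrightarrow> norm (restr A x) < e"
proof -
  let ?f = "\<lambda>i. (cmod (coord x i))\<^sup>2"
  have "(?f has_sum (norm x)\<^sup>2) UNIV"
    unfolding norm_ell2_sq by (rule has_sum_infsum[OF coord_summable])
  then have "\<forall>\<^sub>F F in finite_subsets_at_top UNIV. dist (sum ?f F) ((norm x)\<^sup>2) < e\<^sup>2"
    unfolding has_sum_def using tendstoD assms by (metis zero_less_power)
  then obtain F where F: "finite F" "dist (sum ?f F) ((norm x)\<^sup>2) < e\<^sup>2"
    by (auto simp: eventually_finite_subsets_at_top)
  have "norm (restr A x) < e" if "A \<inter> F = {}" for A
  proof -
    have "(norm (restr A x))\<^sup>2 + sum ?f F \<le> (norm x)\<^sup>2"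
    proof -
      have "(norm (restr A x))\<^sup>2 = infsum ?f A"
        unfolding norm_ell2_sq by (rule infsum_cong_neutral) (auto simp: coord_diag)
      also have "infsum ?f A + sum ?f F = infsum ?f (A \<union> F)"
        using infsum_Un_disjoint[OF coord_summable[of x A] coord_summable[of x F] that] F by simp
      also have "\<dots> \<le> (norm x)\<^sup>2"
        unfolding norm_ell2_sq by (rule infsum_mono_neutral) (auto intro: coord_summable)
      finally show ?thesis by simp
    qed
    then have "(norm (restr A x))\<^sup>2 < e\<^sup>2" using F(2) by (simp add: dist_real_def)
    then show ?thesis using assms by (simp add: power2_less_imp_less)
  qed
  then show ?thesis using that F(1) by blast
qed

lemma restr_tendsto:
  assumes "\<And>i. i \<in> B \<Longrightarrow> \<forall>\<^sub>F n in sequentially. i \<in> A n" "\<And>n. A n \<subseteq> B"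
  shows "(\<lambda>n. restr (A n) x) \<longlonglongrightarrow> restr B x"
  unfolding LIMSEQ_iff
proof (intro allI impI)
  fix e :: real assume "0 < e"
  then obtain F where F: "finite F" "\<And>A. A \<inter> F = {} \<Longrightarrow> norm (restr A x) < e"
    using restr_complement_small by blast
  have "\<forall>\<^sub>F n in sequentially. \<forall>i\<in>F \<inter> B. i \<in> A n"
    using assms(1) F(1) by (intro eventually_ball_finite) auto
  then have "\<forall>\<^sub>F n in sequentially. norm (restr (A n) x - restr B x) < e"
  proof eventually_elim
    case (elim n)
    have "restr (A n) x - restr B x = - restr (B - A n) x"
      using assms(2)[of n] by (intro ell2_eqI) (auto simp: coord_diag)
    then show ?case using F(2)[of "B - A n"] elim by auto
  qed
  then show "\<exists>no. \<forall>n\<ge>no. norm (restr (A n) x - restr B x) < e"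
    by (simp add: eventually_sequentially)
qed

lemma restr_finite_eq:
  assumes "finite F"
  shows "restr F x = (\<Sum>i\<in>F. Re (coord x i) *\<^sub>R basis i + Im (coord x i) *\<^sub>R diag (\<lambda>_. \<i>) (basis i))"
  using assms
proof (induction F rule: finite_induct)
  case empty show ?case by (intro ell2_eqI) (simp add: coord_diag)
next
  case (insert k F)
  have "restr (insert k F) x = Re (coord x k) *\<^sub>R basis k + Im (coord x k) *\<^sub>R diag (\<lambda>_. \<i>) (basis k) + restr F x"
    using insert.hyps
    by (intro ell2_eqI) (auto simp: coord_diag complex_eq_iff)
  then show ?case using insert by simp
qed

text \<open>The maps are only real linear, so a basis vector and its multiple by the imaginary unit
  are tested separately. Finite truncations are real combinations of these, and the tails are
  small.\<close>

lemma ell2_dense_continuous_eq: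
  fixes f g :: "'i ell2 \<Rightarrow> 'b::real_normed_vector"
  assumes "bounded_linear f" "bounded_linear g"
    and "\<And>i. f (basis i) = g (basis i)"
    and "\<And>i. f (diag (\<lambda>_. \<i>) (basis i)) = g (diag (\<lambda>_. \<i>) (basis i))"
  shows "f = g"
proof
  fix x
  interpret h: bounded_linear "\<lambda>x. f x - g x" using assms by (intro bounded_linear_sub)
  have z: "f (restr F x) - g (restr F x) = 0" if "finite F" for F
    by (simp add: restr_finite_eq[OF that] h.sum h.add h.scaleR assms)
  obtain K where K: "\<And>x. norm (f x - g x) \<le> norm x * K" "K > 0" using h.pos_bounded by blast
  have "norm (f x - g x) \<le> e" if "e > 0" for e
  proof -
    obtain F where F: "finite F" "\<And>A. A \<inter> F = {} \<Longrightarrow> norm (restr A x) < e / K"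
      using restr_complement_small[of "e / K"] \<open>e > 0\<close> K by auto
    have "x = restr F x + restr (-F) x" by (intro ell2_eqI) (simp add: coord_diag)
    then have "f x - g x = f (restr (-F) x) - g (restr (-F) x)"
      using h.add[of "restr F x" "restr (-F) x"] z[OF F(1)] by simp
    also have "norm \<dots> \<le> norm (restr (-F) x) * K" by (rule K)
    also have "\<dots> \<le> e" using F(2)[of "-F"] K by (simp add: pos_less_divide_eq less_imp_le)
    finally show ?thesis .
  qed
  then have "norm (f x - g x) \<le> 0" by (rule field_le_epsilon) auto
  then show "f x = g x" by simp
qed

text \<open>The representing vector is forced: \<open>f\<close> on a basis vector is the real part
  of the coordinate, and \<open>f\<close> on its multiple by the imaginary unit is the imaginary
  part. A finite truncation y of it satisfies |y|^2 = f y \<le> C |y|, which bounds all partial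
  sums.\<close>

lemma ell2_Riesz:
  fixes f :: "'i ell2 \<Rightarrow> real"
  assumes "bounded_linear f"
  shows "\<exists>z. \<forall>x. f x = x \<bullet> z"
proof -
  interpret f: bounded_linear f by fact
  obtain C where C: "\<And>x. \<bar>f x\<bar> \<le> norm x * C" "C > 0" using f.pos_bounded by auto
  define g where "g i = Complex (f (basis i)) (f (diag (\<lambda>_. \<i>) (basis i)))" for i
  have "(\<Sum>i\<in>F. (cmod (g i))\<^sup>2) \<le> C\<^sup>2" if F: "finite F" for F
  proof -
    define y where "y = (\<Sum>i\<in>F. Re (g i) *\<^sub>R basis i + Im (g i) *\<^sub>R diag (\<lambda>_. \<i>) (basis i))"
    have c: "coord y j = (if j \<in> F then g j else 0)" for j
    proof -
      have "coord y j = (\<Sum>i\<in>F. coord (Re (g i) *\<^sub>R basis i + Im (g i) *\<^sub>R diag (\<lambda>_. \<i>) (basis i)) j)"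
        unfolding y_def using F by (induction F rule: finite_induct) auto
      also have "\<dots> = (\<Sum>i\<in>F. if i = j then g j else 0)"
        by (intro sum.cong) (auto simp: coord_diag complex_eq_iff)
      finally show ?thesis using F by simp
    qed
    have n: "(norm y)\<^sup>2 = (\<Sum>i\<in>F. (cmod (g i))\<^sup>2)"
      using norm_ell2_support[OF F, of y y] c by (simp add: power2_norm_eq_inner)
    have "f y = (\<Sum>i\<in>F. (cmod (g i))\<^sup>2)"
      by (simp add: y_def f.sum f.add f.scaleR g_def cmod_power2 flip: power2_eq_square)
    then have "(norm y)\<^sup>2 \<le> norm y * C" using C(1)[of y] n by (smt (verit))
    then have "norm y \<le> C"
      using C(2) mult_le_cancel_left_pos[of "norm y" "norm y" C]
      by (cases "norm y = 0") (auto simp: power2_eq_square)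
    then show ?thesis using n by (metis norm_ge_zero power_mono)
  qed
  then obtain z where z: "\<And>i. coord z i = g i" using C(2) ell2_bounded_sums by (metis less_imp_le)
  have "f = (\<lambda>x. x \<bullet> z)"
  proof (rule ell2_dense_continuous_eq)
    show "bounded_linear (\<lambda>x. x \<bullet> z)" by (rule bounded_linear_inner_left)
    have b: "x \<bullet> z = coord x i \<bullet> g i" if "\<And>j. j \<noteq> i \<Longrightarrow> coord x j = 0" for x i
      using norm_ell2_support[of "{i}" x z] that z by simp
    show "f (basis i) = basis i \<bullet> z" for i
      by (subst b[of i]) (auto simp: g_def inner_complex_def)
    show "f (diag (\<lambda>_. \<i>) (basis i)) = diag (\<lambda>_. \<i>) (basis i) \<bullet> z" for i
      by (subst b[of i]) (auto simp: g_def inner_complex_def coord_diag)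
  qed fact
  then show ?thesis by metis
qed

section \<open>Bounded operators commuting with the right action\<close>

lifting_forget ell2.lifting

declare bfun_cnj [simp] bfun_mult [simp]

text \<open>The right action of C(E^0): the first component of an index is the source of the
  path.\<close>

definition rmul :: "('v \<Rightarrow> complex) \<Rightarrow> ('v \<times> 'b) ell2 \<Rightarrow> ('v::finite \<times> 'b) ell2" where
  "rmul a x = diag (\<lambda>i. a (fst i)) x"

lemma coord_rmul [simp]: "coord (rmul a x) i = a (fst i) * coord x i"
  by (simp add: rmul_def coord_diag)

lemma inner_rmul: "rmul a x \<bullet> y = x \<bullet> rmul (\<lambda>v. cnj (a v)) y"
  by (simp add: rmul_def inner_diag)

lemma norm_rmul_le: "(\<And>v. cmod (a v) \<le> C) \<Longrightarrow> norm (rmul a x) \<le> C * norm x"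
  unfolding rmul_def by (rule norm_diag_le)

lemma bounded_linear_rmul: "bounded_linear (rmul a)"
  using bounded_linear_diag[of "\<lambda>i. a (fst i)"] unfolding rmul_def by simp

text \<open>Commuting with all \<open>rmul a\<close> encodes both complex linearity (constant \<open>a\<close>) and linearity
over the coefficient algebra.\<close>

typedef ('v, 'b) rop = "{T :: ('v::finite \<times> 'b) ell2 \<Rightarrow>\<^sub>L ('v \<times> 'b) ell2.
    \<forall>a x. blinfun_apply T (rmul a x) = rmul a (blinfun_apply T x)}"
  morphisms rblin Abs_rop
  by (rule exI[of _ 0]) (auto intro!: ell2_eqI)

setup_lifting type_definition_rop

lift_definition rapp :: "('v::finite, 'b) rop \<Rightarrow> ('v \<times> 'b) ell2 \<Rightarrow> ('v \<times> 'b) ell2" (infixr "\<cdot>" 75)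
  is blinfun_apply .

lemma rmul_linear:
  "rmul a (x + y) = rmul a x + rmul a y" "rmul a (- x) = - rmul a x"
  "rmul a (x - y) = rmul a x - rmul a y" "rmul a (r *\<^sub>R x) = r *\<^sub>R rmul a x" "rmul a 0 = 0"
  by (intro ell2_eqI; simp add: algebra_simps)+

instantiation rop :: (finite, type) real_normed_algebra_1
begin
lift_definition zero_rop :: "('a, 'b) rop" is 0 by (simp add: rmul_linear)
lift_definition one_rop :: "('a, 'b) rop" is id_blinfun by simp
lift_definition plus_rop :: "('a, 'b) rop \<Rightarrow> ('a, 'b) rop \<Rightarrow> ('a, 'b) rop" is "(+)"
  by (simp add: blinfun.add_left rmul_linear)
lift_definition uminus_rop :: "('a, 'b) rop \<Rightarrow> ('a, 'b) rop" is uminus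
  by (simp add: blinfun.minus_left rmul_linear)
lift_definition minus_rop :: "('a, 'b) rop \<Rightarrow> ('a, 'b) rop \<Rightarrow> ('a, 'b) rop" is "(-)"
  by (simp add: blinfun.diff_left rmul_linear)
lift_definition times_rop :: "('a, 'b) rop \<Rightarrow> ('a, 'b) rop \<Rightarrow> ('a, 'b) rop" is "(o\<^sub>L)"
  by simp
lift_definition scaleR_rop :: "real \<Rightarrow> ('a, 'b) rop \<Rightarrow> ('a, 'b) rop" is "(*\<^sub>R)"
  by (simp add: blinfun.scaleR_left rmul_linear)
lift_definition norm_rop :: "('a, 'b) rop \<Rightarrow> real" is norm .
definition sgn_rop :: "('a, 'b) rop \<Rightarrow> ('a, 'b) rop" where "sgn_rop x = scaleR (inverse (norm x)) x"
definition dist_rop :: "('a, 'b) rop \<Rightarrow> ('a, 'b) rop \<Rightarrow> real" where "dist_rop x y = norm (x - y)"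
definition uniformity_rop :: "(('a, 'b) rop \<times> ('a, 'b) rop) filter" where
  "uniformity_rop = (INF e\<in>{0 <..}. principal {(x, y). dist x y < e})"
definition open_rop :: "('a, 'b) rop set \<Rightarrow> bool" where
  "open_rop U = (\<forall>x\<in>U. \<forall>\<^sub>F (x', y) in uniformity. x' = x \<longrightarrow> y \<in> U)"
instance
proof
  fix x y z :: "('a, 'b) rop" and r s :: real
  show "x + y + z = x + (y + z)" "x + y = y + x" "0 + x = x" "- x + x = 0" "x - y = x + - y"
    "r *\<^sub>R (x + y) = r *\<^sub>R x + r *\<^sub>R y" "(r + s) *\<^sub>R x = r *\<^sub>R x + s *\<^sub>R x"
    "r *\<^sub>R s *\<^sub>R x = (r * s) *\<^sub>R x" "1 *\<^sub>R x = x"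
    by (transfer; simp add: algebra_simps)+
  show "x * y * z = x * (y * z)" "(x + y) * z = x * z + y * z" "x * (y + z) = x * y + x * z"
    "1 * x = x" "x * 1 = x" "r *\<^sub>R x * y = r *\<^sub>R (x * y)" "x * r *\<^sub>R y = r *\<^sub>R (x * y)"
    by (transfer; auto intro!: blinfun_eqI simp: blinfun.bilinear_simps)+
  show "norm (x + y) \<le> norm x + norm y" by transfer (rule norm_triangle_ineq)
  show "norm (r *\<^sub>R x) = \<bar>r\<bar> * norm x" by transfer simp
  show "norm x = 0 \<longleftrightarrow> x = 0" by transfer simp
  show "norm (x * y) \<le> norm x * norm y" by transfer (rule norm_blinfun_compose)
  show "dist x y = norm (x - y)" by (simp add: dist_rop_def)
  show "sgn x = scaleR (inverse (norm x)) x" by (simp add: sgn_rop_def)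
  show "uniformity = (INF e\<in>{0 <..}. principal {(x :: ('a, 'b) rop, y). dist x y < e})"
    by (simp add: uniformity_rop_def)
  show "open U = (\<forall>x\<in>U. \<forall>\<^sub>F (x', y) in uniformity. x' = x \<longrightarrow> y \<in> U)" for U :: "('a, 'b) rop set"
    by (simp add: open_rop_def)
  have nz: "basis i \<noteq> 0" for i :: "'a \<times> 'b"
    using coord_basis[of i i] by (metis coord_simps(1) of_bool_eq(2) zero_neq_one)
  show "norm (1 :: ('a, 'b) rop) = 1"
  proof transfer
    have "norm (id_blinfun :: ('a \<times> 'b) ell2 \<Rightarrow>\<^sub>L ('a \<times> 'b) ell2) \<le> 1"
      by (rule norm_blinfun_id_le)
    moreover have "1 \<le> norm (id_blinfun :: ('a \<times> 'b) ell2 \<Rightarrow>\<^sub>L ('a \<times> 'b) ell2)"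
    proof (rule mult_right_le_imp_le)
      show "1 * norm (basis undefined :: ('a \<times> 'b) ell2)
          \<le> norm (id_blinfun :: ('a \<times> 'b) ell2 \<Rightarrow>\<^sub>L ('a \<times> 'b) ell2) * norm (basis undefined :: ('a \<times> 'b) ell2)"
        using norm_blinfun[of id_blinfun "basis undefined :: ('a \<times> 'b) ell2"] by simp
      show "0 < norm (basis undefined :: ('a \<times> 'b) ell2)" using nz[of undefined] by simp
    qed
    ultimately show "norm (id_blinfun :: ('a \<times> 'b) ell2 \<Rightarrow>\<^sub>L ('a \<times> 'b) ell2) = 1"
      by (rule antisym)
  qed
  show "(0 :: ('a, 'b) rop) \<noteq> 1"
  proof transfer
    have "blinfun_apply 0 (basis undefined) \<noteq> blinfun_apply id_blinfun (basis undefined :: ('a \<times> 'b) ell2)"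
      using nz[of undefined] by simp
    then show "(0 :: ('a \<times> 'b) ell2 \<Rightarrow>\<^sub>L ('a \<times> 'b) ell2) \<noteq> id_blinfun" by metis
  qed
qed
end

lemma rapp_simps [simp]:
  "(S + T) \<cdot> x = S \<cdot> x + T \<cdot> x" "(S - T) \<cdot> x = S \<cdot> x - T \<cdot> x" "(- T) \<cdot> x = - (T \<cdot> x)" "0 \<cdot> x = 0"
  "1 \<cdot> x = x" "(S * T) \<cdot> x = S \<cdot> T \<cdot> x" "(r *\<^sub>R T) \<cdot> x = r *\<^sub>R (T \<cdot> x)"
  "T \<cdot> (x + y) = T \<cdot> x + T \<cdot> y" "T \<cdot> (x - y) = T \<cdot> x - T \<cdot> y" "T \<cdot> (- x) = - (T \<cdot> x)" "T \<cdot> 0 = 0"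
  "T \<cdot> (r *\<^sub>R x) = r *\<^sub>R (T \<cdot> x)"
  by (transfer; simp add: blinfun.bilinear_simps)+

lemma rapp_rmul: "T \<cdot> rmul a x = rmul a (T \<cdot> x)" by transfer simp

lemma rop_eqI: "(\<And>x. S \<cdot> x = T \<cdot> x) \<Longrightarrow> S = T" by transfer (rule blinfun_eqI)

lemma norm_rapp: "norm (T \<cdot> x) \<le> norm T * norm x" by transfer (rule norm_blinfun)

lemma norm_rop_bound: "0 \<le> C \<Longrightarrow> (\<And>x. norm (T \<cdot> x) \<le> C * norm x) \<Longrightarrow> norm T \<le> C"
  by transfer (rule norm_blinfun_bound)

lemma bounded_linear_rapp: "bounded_linear (\<lambda>x. T \<cdot> x)"
  by transfer (rule blinfun.bounded_linear_right)

lemma rapp_sum: "(\<Sum>i\<in>A. f i) \<cdot> x = (\<Sum>i\<in>A. f i \<cdot> x)"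
  by (induction A rule: infinite_finite_induct) auto

lemma rop_exists:
  assumes "bounded_linear f" "\<And>a x. f (rmul a x) = rmul a (f x)"
  shows "\<exists>T :: ('v::finite, 'b) rop. \<forall>x. T \<cdot> x = f x"
proof -
  have "rblin (Abs_rop (Blinfun f)) = Blinfun f"
    by (rule Abs_rop_inverse) (simp add: bounded_linear_Blinfun_apply assms)
  then have "Abs_rop (Blinfun f) \<cdot> x = f x" for x
    by (simp add: rapp.rep_eq bounded_linear_Blinfun_apply assms)
  then show ?thesis by blast
qed

instance rop :: (finite, type) banach
proof
  fix X :: "nat \<Rightarrow> ('a, 'b) rop" assume X: "Cauchy X"
  have "Cauchy (\<lambda>n. rblin (X n))"
    using X unfolding Cauchy_iff norm_rop.rep_eq minus_rop.rep_eq .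
  then obtain L where L: "(\<lambda>n. rblin (X n)) \<longlonglongrightarrow> L"
    by (auto simp: Cauchy_convergent_iff convergent_def)
  have "blinfun_apply L (rmul a x) = rmul a (blinfun_apply L x)" for a x
  proof (rule LIMSEQ_unique)
    have "(\<lambda>n. rblin (X n) (rmul a x)) \<longlonglongrightarrow> blinfun_apply L (rmul a x)"
      by (intro tendsto_intros L)
    then show "(\<lambda>n. rmul a (rblin (X n) x)) \<longlonglongrightarrow> blinfun_apply L (rmul a x)"
      by (simp add: rapp_rmul flip: rapp.rep_eq)
    show "(\<lambda>n. rmul a (rblin (X n) x)) \<longlonglongrightarrow> rmul a (blinfun_apply L x)"
      by (intro bounded_linear.tendsto[OF bounded_linear_rmul] tendsto_intros L)
  qed
  then have "rblin (Abs_rop L) = L" by (simp add: Abs_rop_inverse)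
  then have "X \<longlonglongrightarrow> Abs_rop L"
    using L unfolding LIMSEQ_iff norm_rop.rep_eq minus_rop.rep_eq by simp
  then show "convergent X" by (auto simp: convergent_def)
qed

subsection \<open>Adjoints\<close>

text \<open>The adjoint is taken for the real inner product. It commutes with multiplication by the
  imaginary unit, so it is the adjoint for the complex product as well, as \<open>cip_rapp\<close>
  records.\<close>

lemma adjoint_exists:
  fixes T :: "('v::finite, 'b) rop"
  shows "\<exists>S :: ('v, 'b) rop. \<forall>x y. (T \<cdot> x) \<bullet> y = x \<bullet> (S \<cdot> y)"
proof -
  have "\<exists>z. \<forall>x. (T \<cdot> x) \<bullet> y = x \<bullet> z" for y
    by (intro ell2_Riesz bounded_linear_compose[OF bounded_linear_inner_left bounded_linear_rapp])
  then obtain g where g: "\<And>x y. (T \<cdot> x) \<bullet> y = x \<bullet> g y" by metis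
  have eqI: "v = w" if "\<And>x. x \<bullet> v = x \<bullet> w" for v w :: "('v \<times> 'b) ell2"
    using that[of "v - w"] by (metis inner_diff_right inner_eq_zero_iff right_minus_eq)
  have "bounded_linear g"
  proof (rule bounded_linear_intro[of _ "norm T"])
    show "g (x + y) = g x + g y" for x y by (rule eqI) (simp add: inner_add_right flip: g)
    show "g (r *\<^sub>R x) = r *\<^sub>R g x" for r x by (rule eqI) (simp flip: g)
    show "norm (g y) \<le> norm y * norm T" for y
    proof -
      have "norm (g y) * norm (g y) = (T \<cdot> g y) \<bullet> y" by (simp add: g flip: power2_norm_eq_inner power2_eq_square)
      also have "\<dots> \<le> norm (T \<cdot> g y) * norm y" by (rule norm_cauchy_schwarz)
      also have "\<dots> \<le> norm (g y) * (norm y * norm T)"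
        using mult_right_mono[OF norm_rapp[of T "g y"], of "norm y"] by (simp add: ac_simps)
      finally show ?thesis by (cases "norm (g y) = 0") auto
    qed
  qed
  moreover have "g (rmul a y) = rmul a (g y)" for a y
  proof (rule eqI)
    fix x
    have "x \<bullet> g (rmul a y) = (T \<cdot> x) \<bullet> rmul a y" by (simp add: g)
    also have "\<dots> = rmul (\<lambda>v. cnj (a v)) (T \<cdot> x) \<bullet> y" by (simp add: inner_rmul)
    also have "\<dots> = x \<bullet> rmul a (g y)" by (simp add: g inner_rmul flip: rapp_rmul)
    finally show "x \<bullet> g (rmul a y) = x \<bullet> rmul a (g y)" .
  qed
  ultimately obtain S :: "('v, 'b) rop" where "\<And>x. S \<cdot> x = g x" using rop_exists[of g] by blast
  then show ?thesis using g by metis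
qed

definition star :: "('v::finite, 'b) rop \<Rightarrow> ('v, 'b) rop" where
  "star T = (SOME S. \<forall>x y. (T \<cdot> x) \<bullet> y = x \<bullet> (S \<cdot> y))"

lemma inner_star: "(T \<cdot> x) \<bullet> y = x \<bullet> (star T \<cdot> y)"
  unfolding star_def using someI_ex[OF adjoint_exists[of T]] by blast

lemma star_unique:
  assumes "\<And>x y. (T \<cdot> x) \<bullet> y = x \<bullet> (S \<cdot> y)"
  shows "star T = S"
proof (rule rop_eqI)
  fix y
  have "x \<bullet> (star T \<cdot> y - S \<cdot> y) = 0" for x using assms by (simp add: inner_diff_right flip: inner_star)
  then show "star T \<cdot> y = S \<cdot> y" by (metis inner_eq_zero_iff right_minus_eq)
qed

lemma star_simps [simp]:
  "star (S + T) = star S + star T" "star (S - T) = star S - star T" "star (- T) = - star T"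
  "star (r *\<^sub>R T) = r *\<^sub>R star T" "star (S * T) = star T * star S" "star 1 = 1" "star 0 = 0"
  by (rule star_unique; simp add: inner_add_left inner_add_right inner_diff_left inner_diff_right inner_star)+

lemma star_star [simp]: "star (star T) = T"
  by (rule star_unique) (metis inner_commute inner_star)

lemma norm_star_le: "norm (star T) \<le> norm T"
proof (rule norm_rop_bound)
  fix y
  have "norm (star T \<cdot> y) * norm (star T \<cdot> y) = (T \<cdot> star T \<cdot> y) \<bullet> y"
    by (simp add: inner_star flip: power2_norm_eq_inner power2_eq_square)
  also have "\<dots> \<le> norm (T \<cdot> star T \<cdot> y) * norm y" by (rule norm_cauchy_schwarz)
  also have "\<dots> \<le> norm (star T \<cdot> y) * (norm T * norm y)"
    using mult_right_mono[OF norm_rapp[of T "star T \<cdot> y"], of "norm y"] by (simp add: ac_simps)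
  finally show "norm (star T \<cdot> y) \<le> norm T * norm y"
    by (cases "norm (star T \<cdot> y) = 0") auto
qed simp

lemma norm_star [simp]: "norm (star T) = norm T"
  using norm_star_le[of T] norm_star_le[of "star T"] by simp

lemma bounded_linear_star: "bounded_linear star"
  by (rule bounded_linear_intro[of _ 1]) auto

lemma continuous_on_star [continuous_intros]:
  "continuous_on A f \<Longrightarrow> continuous_on A (\<lambda>x. star (f x))"
  by (rule bounded_linear.continuous_on[OF bounded_linear_star])

subsection \<open>Diagonal operators and partial shifts\<close>

lemma diag_not_bfun: "\<not> bfun a \<Longrightarrow> diag a x = 0"
  by (intro ell2_eqI) (simp add: diag_def zero_ell2.abs_eq[symmetric])

definition dg :: "('v::finite \<times> 'b \<Rightarrow> complex) \<Rightarrow> ('v, 'b) rop" where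
  "dg a = (SOME T. \<forall>x. T \<cdot> x = diag a x)"

lemma dg_app [simp]: "dg a \<cdot> x = diag a x"
proof -
  have "bounded_linear (diag a :: ('a \<times> 'b) ell2 \<Rightarrow> _)"
  proof (cases "bfun a")
    case False
    then have "diag a = (\<lambda>x :: ('a \<times> 'b) ell2. 0)" by (simp add: fun_eq_iff diag_not_bfun)
    then show ?thesis by (simp add: bounded_linear_zero)
  qed (rule bounded_linear_diag)
  moreover have "diag a (rmul b x) = rmul b (diag a x)" for b and x :: "('a \<times> 'b) ell2"
    by (cases "bfun a") (auto intro!: ell2_eqI simp: coord_diag diag_not_bfun)
  ultimately have "\<exists>T :: ('a, 'b) rop. \<forall>x. T \<cdot> x = diag a x" by (rule rop_exists)
  then show ?thesis unfolding dg_def by (rule someI2_ex) blast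
qed

lemma rop_coordI: "(\<And>x i. coord (S \<cdot> x) i = coord (T \<cdot> x) i) \<Longrightarrow> S = T"
  by (intro rop_eqI ell2_eqI)

lemma dg_mult: "bfun a \<Longrightarrow> bfun b \<Longrightarrow> dg a * dg b = dg (\<lambda>i. a i * b i)"
  by (intro rop_coordI) (simp add: coord_diag)

lemma star_dg: "bfun a \<Longrightarrow> star (dg a) = dg (\<lambda>i. cnj (a i))"
  by (rule star_unique) (simp add: inner_diag)

lemma norm_dg_le: "(\<And>i. cmod (a i) \<le> C) \<Longrightarrow> norm (dg a) \<le> C"
  by (rule norm_rop_bound) (auto simp: norm_diag_le intro: order_trans[OF norm_ge_zero])

text \<open>A function of the source alone acts as an element of the coefficient algebra on the
  right, with which every \<open>rop\<close> commutes by construction. In particular the complex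
  scalars \<open>sc c\<close> are central.\<close>

lemma dg_central: "dg (\<lambda>i. a (fst i)) * T = T * dg (\<lambda>i. a (fst i))"
  by (rule rop_eqI) (simp add: rapp_rmul flip: rmul_def)

abbreviation sc :: "complex \<Rightarrow> ('v::finite, 'b) rop" where "sc c \<equiv> dg (\<lambda>_. c)"

lemma sc_central: "sc c * T = T * sc c"
  by (rule dg_central[of "\<lambda>_. c"])

text \<open>Pullback along \<open>f\<close>, cut off outside \<open>A\<close>. Injectivity makes it
  a contraction, and preservation of the first component makes it right linear. The edge operators
  arise by letting \<open>f\<close> delete the first edge.\<close>

definition sh :: "('v::finite \<times> 'b) set \<Rightarrow> ('v \<times> 'b \<Rightarrow> 'v \<times> 'b) \<Rightarrow> ('v, 'b) rop" where
  "sh A f = (SOME T. \<forall>x i. coord (T \<cdot> x) i = (if i \<in> A then coord x (f i) else 0))"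

lemma coord_sh:
  assumes "inj_on f A" "\<And>i. i \<in> A \<Longrightarrow> fst (f i) = fst i"
  shows "coord (sh A f \<cdot> x) i = (if i \<in> A then coord x (f i) else 0)"
proof -
  have "\<exists>y. (\<forall>i. coord y i = (if i \<in> A then coord x (f i) else 0)) \<and> norm y \<le> norm x" for x
  proof -
    have "(\<Sum>i\<in>F. (cmod (if i \<in> A then coord x (f i) else 0))\<^sup>2) \<le> (norm x)\<^sup>2" if "finite F" for F
    proof -
      have "(\<Sum>i\<in>F. (cmod (if i \<in> A then coord x (f i) else 0))\<^sup>2) = (\<Sum>i\<in>F \<inter> A. (cmod (coord x (f i)))\<^sup>2)"
        using that by (intro sum.mono_neutral_cong_right) auto
      also have "\<dots> = (\<Sum>j\<in>f ` (F \<inter> A). (cmod (coord x j))\<^sup>2)"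
        using assms(1) by (subst sum.reindex) (auto intro: inj_on_subset)
      also have "\<dots> \<le> (norm x)\<^sup>2" using that by (intro sum_coord_le_norm) auto
      finally show ?thesis .
    qed
    then obtain y where "\<And>i. coord y i = (if i \<in> A then coord x (f i) else 0)" "norm y \<le> norm x"
      by (rule ell2_bounded_sums) auto
    then show ?thesis by blast
  qed
  then obtain g where g: "\<And>x i. coord (g x) i = (if i \<in> A then coord x (f i) else 0)" "\<And>x. norm (g x) \<le> norm x"
    by metis
  have "bounded_linear g"
    by (rule bounded_linear_intro[of _ 1]) (auto intro!: ell2_eqI simp: g)
  moreover have "g (rmul a x) = rmul a (g x)" for a x
    by (intro ell2_eqI) (simp add: g assms)
  ultimately obtain T where "\<And>x. T \<cdot> x = g x" using rop_exists[of g] by blast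
  then have "\<exists>T. \<forall>x i. coord (T \<cdot> x) i = (if i \<in> A then coord x (f i) else 0)"
    using g by metis
  then show ?thesis unfolding sh_def by (rule someI2_ex) blast
qed

lemma star_sh:
  assumes "bij_betw f A B" "\<And>i. i \<in> A \<Longrightarrow> fst (f i) = fst i" "\<And>i. i \<in> A \<Longrightarrow> g (f i) = i"
  shows "star (sh A f) = sh B g"
proof (rule star_unique)
  fix x y
  have f: "inj_on f A" "B = f ` A" using assms(1) by (auto simp: bij_betw_def)
  have g: "inj_on g B" "\<And>j. j \<in> B \<Longrightarrow> fst (g j) = fst j"
    using assms(2,3) unfolding f(2) by (auto simp: inj_on_def simp del: split_paired_All)
  have "(sh A f \<cdot> x) \<bullet> y = infsum (\<lambda>i. coord x (f i) \<bullet> coord y (g (f i))) A"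
    unfolding inner_ell2_def
    by (rule infsum_cong_neutral) (auto simp: coord_sh f assms)
  also have "\<dots> = infsum (\<lambda>j. coord x j \<bullet> coord y (g j)) B"
    by (rule infsum_reindex_bij_betw[OF assms(1)])
  also have "\<dots> = x \<bullet> (sh B g \<cdot> y)"
    unfolding inner_ell2_def
    by (rule infsum_cong_neutral) (auto simp: coord_sh g)
  finally show "(sh A f \<cdot> x) \<bullet> y = x \<bullet> (sh B g \<cdot> y)" .
qed

subsection \<open>The ideal of compact operators\<close>

text \<open>The complex inner product, conjugate linear in \<open>y\<close>: the real part of the
  product of iy with z is the imaginary part of the product of y with z.\<close>

definition cip :: "'i ell2 \<Rightarrow> 'i ell2 \<Rightarrow> complex" where
  "cip y z = Complex (y \<bullet> z) (diag (\<lambda>_. \<i>) y \<bullet> z)"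

lemma cip_infsum: "cip y z = infsum (\<lambda>i. cnj (coord y i) * coord z i) UNIV"
proof -
  let ?h = "\<lambda>i. cnj (coord y i) * coord z i"
  have "?h summable_on UNIV"
  proof (rule abs_summable_summable[OF summable_on_comparison_test])
    show "(\<lambda>i. (cmod (coord y i))\<^sup>2 + (cmod (coord z i))\<^sup>2) summable_on UNIV"
      by (intro summable_on_add coord_summable)
    show "norm (?h i) \<le> (cmod (coord y i))\<^sup>2 + (cmod (coord z i))\<^sup>2" for i
      using sum_squares_bound[of "cmod (coord y i)" "cmod (coord z i)"]
        mult_nonneg_nonneg[OF norm_ge_zero[of "coord y i"] norm_ge_zero[of "coord z i"]]
      unfolding norm_mult complex_mod_cnj by linarith
  qed auto
  then have "Re (infsum ?h UNIV) = infsum (\<lambda>i. Re (?h i)) UNIV" "Im (infsum ?h UNIV) = infsum (\<lambda>i. Im (?h i)) UNIV"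
    by (rule infsum_Re[symmetric], rule infsum_Im[symmetric])
  then show ?thesis
    by (simp add: complex_eq_iff cip_def inner_ell2_def inner_complex_def coord_diag algebra_simps)
qed

lemma cip_simps:
  "cip y (z + w) = cip y z + cip y w" "cip y (r *\<^sub>R z) = r *\<^sub>R cip y z" 
  by (simp_all add: cip_def complex_eq_iff inner_add_right)

lemma cip_rapp: "cip y (T \<cdot> z) = cip (star T \<cdot> y) z"
proof -
  have "star T \<cdot> diag (\<lambda>_. \<i>) y = diag (\<lambda>_. \<i>) (star T \<cdot> y)"
    using rapp_rmul[of "star T" "\<lambda>_. \<i>" y] by (simp add: rmul_def)
  then show ?thesis unfolding cip_def
    by (metis inner_star star_star)
qed

lemma norm_cip_le: "cmod (cip y z) \<le> 2 * norm y * norm z"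
proof -
  have "cmod (cip y z) \<le> \<bar>y \<bullet> z\<bar> + \<bar>diag (\<lambda>_. \<i>) y \<bullet> z\<bar>" unfolding cip_def
    by (metis cmod_le complex.sel)
  moreover have "\<bar>y \<bullet> z\<bar> \<le> norm y * norm z" by (rule Cauchy_Schwarz_ineq2)
  moreover have "\<bar>diag (\<lambda>_. \<i>) y \<bullet> z\<bar> \<le> norm y * norm z"
  proof -
    have "\<bar>diag (\<lambda>_. \<i>) y \<bullet> z\<bar> \<le> norm (diag (\<lambda>_. \<i>) y) * norm z" by (rule Cauchy_Schwarz_ineq2)
    also have "\<dots> \<le> norm y * norm z"
      using norm_diag_le[of "\<lambda>_. \<i>" 1 y] by (intro mult_right_mono) auto
    finally show ?thesis .
  qed
  ultimately show ?thesis by linarith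
qed

lemma cip_scale: "cip (diag (\<lambda>_. c) y) z = cnj c * cip y z"
proof -
  have 1: "diag (\<lambda>_. c) y = Re c *\<^sub>R y + Im c *\<^sub>R diag (\<lambda>_. \<i>) y"
    by (intro ell2_eqI) (simp add: coord_diag complex_eq_iff)
  have 2: "diag (\<lambda>_. \<i>) (diag (\<lambda>_. c) y) = Re c *\<^sub>R diag (\<lambda>_. \<i>) y - Im c *\<^sub>R y"
    by (intro ell2_eqI) (simp add: coord_diag complex_eq_iff)
  show ?thesis unfolding cip_def 2 unfolding 1
    by (simp add: complex_eq_iff inner_add_left inner_diff_left)
qed

lemma inner_scale: "diag (\<lambda>_. c) y \<bullet> z = c \<bullet> cip y z"
  using cip_scale[of c y z] by (simp add: cip_def complex_eq_iff inner_complex_def)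

abbreviation part :: "'v \<Rightarrow> ('v \<times> 'b) ell2 \<Rightarrow> ('v::finite \<times> 'b) ell2" where
  "part v \<equiv> rmul (\<lambda>w. of_bool (w = v))"

lemma rmul_sum_part: "rmul a x = (\<Sum>v\<in>UNIV. diag (\<lambda>_. a v) (part v x))"
proof (rule ell2_eqI)
  fix i
  have c: "coord (sum f A) i = (\<Sum>v\<in>A. coord (f v) i)" for f :: "'a \<Rightarrow> ('a \<times> 'b) ell2" and A
    by (induction A rule: infinite_finite_induct) auto
  have "coord (\<Sum>v\<in>UNIV. diag (\<lambda>_. a v) (part v x)) i = (\<Sum>v\<in>UNIV. if v = fst i then a v * coord x i else 0)"
    unfolding c by (intro sum.cong) (auto simp: coord_diag)
  then show "coord (rmul a x) i = coord (\<Sum>v\<in>UNIV. diag (\<lambda>_. a v) (part v x)) i"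
    by simp
qed

text \<open>The rank-one operator of a Hilbert module, sending z to x times the A-valued product of
  y and z; \<open>cip (part v y) z\<close> is the component of that product at the vertex v.\<close>

definition rtheta :: "('v::finite \<times> 'b) ell2 \<Rightarrow> ('v \<times> 'b) ell2 \<Rightarrow> ('v, 'b) rop" where
  "rtheta x y = (SOME T. \<forall>z. T \<cdot> z = rmul (\<lambda>v. cip (part v y) z) x)"

lemma rtheta_app: "rtheta x y \<cdot> z = rmul (\<lambda>v. cip (part v y) z) x"
proof -
  define g where "g z = rmul (\<lambda>v. cip (part v y) z) x" for z
  have "bounded_linear g"
  proof (rule bounded_linear_intro[of _ "2 * norm y * norm x"])
    show "g (z + w) = g z + g w" "g (r *\<^sub>R z) = r *\<^sub>R g z" for z w r
      by (auto intro!: ell2_eqI simp: g_def cip_simps algebra_simps)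
    show "norm (g z) \<le> norm z * (2 * norm y * norm x)" for z
    proof -
      have "cmod (cip (part v y) z) \<le> 2 * norm y * norm z" for v
      proof -
        have "norm (part v y) \<le> 1 * norm y" by (rule norm_rmul_le) simp
        then show ?thesis using norm_cip_le[of "part v y" z]
          by (smt (verit) mult_right_mono norm_ge_zero)
      qed
      then have "norm (g z) \<le> (2 * norm y * norm z) * norm x"
        unfolding g_def by (rule norm_rmul_le)
      then show ?thesis by (simp add: ac_simps)
    qed
  qed
  moreover have "g (rmul b z) = rmul b (g z)" for b z
  proof -
    have "cip (part v y) (rmul b z) = b v * cip (part v y) z" for v
    proof -
      have "cip (part v y) (rmul b z) = cip (part v y) (dg (\<lambda>i. b (fst i)) \<cdot> z)" by (simp add: rmul_def)
      also have "\<dots> = cip (diag (\<lambda>i. cnj (b (fst i))) (part v y)) z"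
        unfolding cip_rapp by (simp add: star_dg)
      also have "diag (\<lambda>i. cnj (b (fst i))) (part v y) = diag (\<lambda>_. cnj (b v)) (part v y)"
        by (intro ell2_eqI) (simp add: coord_diag)
      finally show ?thesis by (simp add: cip_scale)
    qed
    then show ?thesis by (auto intro!: ell2_eqI simp: g_def)
  qed
  ultimately obtain T where "\<And>z. T \<cdot> z = g z" using rop_exists[of g] by blast
  then have "\<exists>T. \<forall>z. T \<cdot> z = rmul (\<lambda>v. cip (part v y) z) x" by (auto simp: g_def)
  then show ?thesis unfolding rtheta_def by (rule someI2_ex) blast
qed

lemma mult_rtheta: "T * rtheta x y = rtheta (T \<cdot> x) y"
  by (rule rop_eqI) (simp add: rtheta_app rapp_rmul)

lemma inner_rtheta: "(rtheta x y \<cdot> z) \<bullet> w = (\<Sum>v\<in>UNIV. cip (part v y) z \<bullet> cip (part v x) w)"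
  unfolding rtheta_app by (subst rmul_sum_part) (simp add: inner_sum_left inner_scale)

lemma star_rtheta: "star (rtheta x y) = rtheta y x"
proof (rule star_unique)
  show "(rtheta x y \<cdot> z) \<bullet> w = z \<bullet> (rtheta y x \<cdot> w)" for z w
    unfolding inner_commute[of z] inner_rtheta by (simp add: inner_commute)
qed

lemma rtheta_mult: "rtheta x y * T = rtheta x (star T \<cdot> y)"
  using mult_rtheta[of "star T" y x] star_rtheta star_simps(5) star_star by metis

text \<open>The real span is enough, since a complex scalar can be absorbed into the first vector of
  \<open>rtheta\<close>.\<close>

definition rK :: "('v::finite, 'b) rop set" where
  "rK = closure (span (range (case_prod rtheta)))"

lemma closed_rK: "closed rK" by (simp add: rK_def)

lemma rtheta_in_rK: "rtheta x y \<in> rK"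
  unfolding rK_def by (intro subsetD[OF closure_subset] span_base) auto

lemma closure_induct_span:
  assumes "x \<in> closure (span B)" "closed S" "0 \<in> S" "\<And>x y. x \<in> S \<Longrightarrow> y \<in> S \<Longrightarrow> x + y \<in> S"
    "\<And>r x. x \<in> S \<Longrightarrow> r *\<^sub>R x \<in> S" "B \<subseteq> S"
  shows "x \<in> S"
proof -
  have "span B \<subseteq> S"
    using assms by (intro span_minimal) (auto simp: subspace_def)
  then show ?thesis using assms closure_minimal by blast
qed

lemma subspace_closure_span: "subspace (closure (span B) :: 'a::real_normed_vector set)"
proof -
  let ?C = "closure (span B)"
  have sc: "r *\<^sub>R x \<in> ?C" if "x \<in> ?C" for r x
  proof -
    have "closed {x. r *\<^sub>R x \<in> ?C}"
      using continuous_closed_vimage[of ?C "\<lambda>x. r *\<^sub>R x"] by (auto simp: vimage_def intro!: continuous_intros)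
    moreover have "span B \<subseteq> {x. r *\<^sub>R x \<in> ?C}"
      by (auto intro!: subsetD[OF closure_subset] span_scale)
    ultimately show ?thesis using that closure_minimal by blast
  qed
  have 1: "x + y \<in> ?C" if "x \<in> span B" "y \<in> ?C" for x y
  proof -
    have "closed {y. x + y \<in> ?C}"
      using continuous_closed_vimage[of ?C "\<lambda>y. x + y"] by (auto simp: vimage_def intro!: continuous_intros)
    moreover have "span B \<subseteq> {y. x + y \<in> ?C}"
      using that(1) by (auto intro!: subsetD[OF closure_subset] span_add)
    ultimately show ?thesis using that(2) closure_minimal by blast
  qed
  have "x + y \<in> ?C" if "x \<in> ?C" "y \<in> ?C" for x y
  proof -
    have "closed {x. x + y \<in> ?C}"
      using continuous_closed_vimage[of ?C "\<lambda>x. x + y"] by (auto simp: vimage_def intro!: continuous_intros)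
    then have "?C \<subseteq> {x. x + y \<in> ?C}" using 1[OF _ that(2)] by (intro closure_minimal) auto
    then show ?thesis using that(1) by auto
  qed
  then show ?thesis using sc by (auto simp: subspace_def span_0 intro!: subsetD[OF closure_subset])
qed

lemma subspace_rK: "subspace rK"
  unfolding rK_def by (rule subspace_closure_span)

lemmas rK_add = subspace_add[OF subspace_rK]
lemmas rK_diff = subspace_diff[OF subspace_rK]
lemmas rK_scaleR = subspace_scale[OF subspace_rK]
lemmas rK_zero = subspace_0[OF subspace_rK]
lemmas rK_neg = subspace_neg[OF subspace_rK]
lemmas rK_sum = subspace_sum[OF subspace_rK]

lemma rK_linear_image:
  assumes "bounded_linear f" "\<And>x y. f (rtheta x y) \<in> rK" "T \<in> rK"
  shows "f T \<in> rK"
proof -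
  interpret bounded_linear f by fact
  have "closed {T. f T \<in> rK}"
    using continuous_closed_vimage[OF closed_rK, of f] continuous_on by (auto simp: vimage_def isCont)
  moreover have "range (case_prod rtheta) \<subseteq> {T. f T \<in> rK}" using assms(2) by auto
  ultimately show ?thesis
    using closure_induct_span[OF assms(3)[unfolded rK_def], of "{T. f T \<in> rK}"]
    by (auto simp: rK_zero rK_add rK_scaleR zero add scaleR)
qed

lemma rK_mult_left: "T \<in> rK \<Longrightarrow> S * T \<in> rK"
  by (rule rK_linear_image[of "\<lambda>T. S * T"])
     (auto simp: mult_rtheta rtheta_in_rK bounded_linear_mult_right)

lemma rK_mult_right: "T \<in> rK \<Longrightarrow> T * S \<in> rK"
  by (rule rK_linear_image[of "\<lambda>T. T * S"])
     (auto simp: rtheta_mult rtheta_in_rK bounded_linear_mult_left)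

lemma rK_star: "T \<in> rK \<Longrightarrow> star T \<in> rK"
  by (rule rK_linear_image[OF bounded_linear_star]) (auto simp: star_rtheta rtheta_in_rK)

subsection \<open>The quotient by the compact operators\<close>

lifting_forget rop.lifting

quotient_type ('v, 'b) calq = "('v::finite, 'b) rop" / "\<lambda>S T. S - T \<in> rK"
proof (rule equivpI)
  show "reflp (\<lambda>S T :: ('v, 'b) rop. S - T \<in> rK)" by (auto simp: reflp_def rK_zero)
  show "symp (\<lambda>S T :: ('v, 'b) rop. S - T \<in> rK)"
    unfolding symp_def by (metis minus_diff_eq rK_neg)
  show "transp (\<lambda>S T :: ('v, 'b) rop. S - T \<in> rK)"
    unfolding transp_def by (metis diff_add_cancel add_diff_eq rK_add)
qed

lemma mult_diff_rK:
  assumes "S - S' \<in> rK" "T - T' \<in> rK" shows "S * T - S' * T' \<in> rK"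
proof -
  have "S * T - S' * T' = (S - S') * T + S' * (T - T')" by (simp add: algebra_simps)
  then show ?thesis using assms by (simp add: rK_add rK_mult_left rK_mult_right)
qed

lemma add_diff_rK:
  assumes "S - S' \<in> rK" "T - T' \<in> rK" shows "(S + T) - (S' + T') \<in> rK"
proof -
  have "(S + T) - (S' + T') = (S - S') + (T - T')" by (simp add: algebra_simps)
  then show ?thesis using rK_add[OF assms] by metis
qed

lemma minus_diff_rK:
  assumes "S - S' \<in> rK" "T - T' \<in> rK" shows "(S - T) - (S' - T') \<in> rK"
proof -
  have "(S - T) - (S' - T') = (S - S') - (T - T')" by (simp add: algebra_simps)
  then show ?thesis using rK_diff[OF assms] by metis
qed

instantiation calq :: (finite, type) "{ring, monoid_mult}"
begin
lift_definition zero_calq :: "('a, 'b) calq" is 0 .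
lift_definition one_calq :: "('a, 'b) calq" is 1 .
lift_definition plus_calq :: "('a, 'b) calq \<Rightarrow> ('a, 'b) calq \<Rightarrow> ('a, 'b) calq" is "(+)"
  by (rule add_diff_rK)
lift_definition uminus_calq :: "('a, 'b) calq \<Rightarrow> ('a, 'b) calq" is uminus
  by (subst minus_diff_minus) (rule rK_neg)
lift_definition minus_calq :: "('a, 'b) calq \<Rightarrow> ('a, 'b) calq \<Rightarrow> ('a, 'b) calq" is "(-)"
  by (rule minus_diff_rK)
lift_definition times_calq :: "('a, 'b) calq \<Rightarrow> ('a, 'b) calq \<Rightarrow> ('a, 'b) calq" is "(*)"
  by (rule mult_diff_rK)
instance
  by standard (transfer; simp add: algebra_simps rK_zero)+
end

lift_definition qq :: "('v::finite, 'b) rop \<Rightarrow> ('v, 'b) calq" is "\<lambda>T. T" .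

lift_definition qstar :: "('v::finite, 'b) calq \<Rightarrow> ('v, 'b) calq" is star
  by (subst star_simps(2)[symmetric]) (rule rK_star)

lemma qq_simps:
  "qq (S + T) = qq S + qq T" "qq (S - T) = qq S - qq T" "qq (- T) = - qq T" "qq 0 = 0" "qq 1 = 1"
  "qq (S * T) = qq S * qq T" "qq (star T) = qstar (qq T)"
  by (transfer; simp add: rK_zero)+

lemma qq_eq_iff: "qq S = qq T \<longleftrightarrow> S - T \<in> rK" by transfer simp

lemma qq_surj: "\<exists>T. a = qq T" by transfer (metis diff_self rK_zero)

lemma qq_sum: "qq (\<Sum>i\<in>A. f i) = (\<Sum>i\<in>A. qq (f i))"
  by (induction A rule: infinite_finite_induct) (auto simp: qq_simps)

lemma qstar_simps [simp]:
  "qstar (a + b) = qstar a + qstar b" "qstar (a - b) = qstar a - qstar b" "qstar (- a) = - qstar a"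
  "qstar 0 = 0" "qstar (a * b) = qstar b * qstar a" "qstar (qstar a) = a" "qstar 1 = 1"
  by (transfer; simp add: rK_zero)+

instantiation calq :: (finite, type) topological_space
begin
text \<open>The quotient topology. Only closed sets and closures are used in the algebraic part, and
  they are tested on preimages under \<open>qq\<close>; the quotient norm of the statement is
  compared with this topology in the transfer.\<close>

definition open_calq :: "('a, 'b) calq set \<Rightarrow> bool" where
  "open_calq B \<longleftrightarrow> open (qq -` B)"
instance
  by standard (auto simp: open_calq_def vimage_Int vimage_Union)
end

lemma closed_calq: "closed B \<longleftrightarrow> closed (qq -` B)"
  by (simp add: closed_def open_calq_def vimage_Compl)

lemma closed_calq_mult: "closed B \<Longrightarrow> closed {x :: ('v::finite, 'b) calq. a * x * b \<in> B}"
proof -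
  assume B: "closed B"
  obtain S T where "a = qq S" "b = qq T" using qq_surj by metis
  then have "qq -` {x. a * x * b \<in> B} = (\<lambda>X. S * X * T) -` (qq -` B)" by (auto simp: qq_simps)
  moreover have "closed ((\<lambda>X. S * X * T) -` (qq -` B))"
    using B by (intro continuous_closed_vimage[of "qq -` B" "\<lambda>X. S * X * T"])
      (auto simp: closed_calq intro!: continuous_intros)
  ultimately show ?thesis by (simp add: closed_calq)
qed

lemma closed_calq_0: "closed {0 :: ('v::finite, 'b) calq}"
proof -
  have "qq -` {0 :: ('v, 'b) calq} = rK"
    using qq_eq_iff[of _ 0] by (auto simp: qq_simps)
  then show ?thesis by (simp add: closed_calq closed_rK)
qed

section \<open>Ideals of inductive limits\<close>

text \<open>The limit \<open>X\<close> of this iteration solves \<open>2 X = S + X\<^sup>2\<close>, so that \<open>1 - X\<close> is a square root of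
\<open>1 - S\<close>. It replaces the continuous functional calculus.\<close>

primrec sqit :: "'a::real_normed_algebra \<Rightarrow> nat \<Rightarrow> 'a" where
  "sqit S 0 = 0"
| "sqit S (Suc n) = (1/2) *\<^sub>R (S + sqit S n * sqit S n)"

lemma sqit_real: "0 \<le> sqit (1::real) n" "sqit (1::real) n \<le> 1" "sqit (1::real) n \<le> sqit 1 (Suc n)"
proof (induction n)
  case (Suc n)
  { case 1 show ?case using Suc by simp next
    case 2 show ?case using Suc mult_mono[of "sqit (1::real) n" 1 "sqit (1::real) n" 1] by simp next
    case 3 show ?case
      using Suc mult_mono[of "sqit (1::real) n" "sqit (1::real) (Suc n)" "sqit (1::real) n" "sqit (1::real) (Suc n)"] by simp }
qed auto

lemma norm_sqit: "norm S \<le> 1 \<Longrightarrow> norm (sqit S n) \<le> sqit 1 n"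
proof (induction n)
  case (Suc n)
  have "norm (sqit S n * sqit S n) \<le> sqit 1 n * sqit 1 n"
    by (rule order_trans[OF norm_mult_ineq]) (use Suc sqit_real in \<open>auto intro!: mult_mono\<close>)
  then show ?case using Suc.prems norm_triangle_ineq[of S "sqit S n * sqit S n"] by simp
qed auto

lemma norm_sqit_le_1: "norm S \<le> 1 \<Longrightarrow> norm (sqit S n) \<le> 1"
  using norm_sqit sqit_real(2) order_trans by blast

text \<open>The increments are dominated by those of the scalar iteration started from 1, which is
  increasing and bounded. Hence convergence holds up to and including norm 1, where a contraction
  argument would fail.\<close>

lemma norm_sqit_step:
  assumes "norm S \<le> 1"
  shows "norm (sqit S (Suc n) - sqit S n) \<le> sqit 1 (Suc n) - sqit 1 n"
proof (induction n)
  case 0 then show ?case using assms by simp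
next
  case (Suc n)
  define X where "X = sqit S (Suc n)"
  define Y where "Y = sqit S n"
  define x y :: real where "x = sqit 1 (Suc n)" and "y = sqit 1 n"
  have b: "norm X \<le> x" "norm Y \<le> y" "norm (X - Y) \<le> x - y" "0 \<le> y" "y \<le> x"
    using norm_sqit[OF assms] Suc sqit_real unfolding X_def Y_def x_def y_def by blast+
  have "norm (X * X - Y * Y) = norm (X * (X - Y) + (X - Y) * Y)" by (simp add: algebra_simps)
  also have "\<dots> \<le> norm X * norm (X - Y) + norm (X - Y) * norm Y"
    by (intro order_trans[OF norm_triangle_ineq] add_mono norm_mult_ineq)
  also have "\<dots> \<le> x * (x - y) + (x - y) * y" using b by (intro add_mono mult_mono) auto
  also have "\<dots> = x * x - y * y" by (simp add: algebra_simps)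
  finally have "norm (X * X - Y * Y) \<le> x * x - y * y" .
  moreover have "sqit S (Suc (Suc n)) - sqit S (Suc n) = (1/2) *\<^sub>R (X * X - Y * Y)"
    unfolding X_def Y_def by (simp add: algebra_simps)
  moreover have "sqit (1::real) (Suc (Suc n)) - sqit 1 (Suc n) = (x * x - y * y) / 2"
    unfolding x_def y_def by (simp add: algebra_simps)
  ultimately show ?case by simp
qed

lemma convergent_sqit:
  fixes S :: "'a::{real_normed_algebra, banach}"
  assumes "norm S \<le> 1"
  shows "convergent (sqit S)"
proof -
  have "Bseq (sqit (1::real))"
    by (rule BseqI'[of _ 1]) (use sqit_real in auto)
  moreover have "incseq (sqit (1::real))"
    by (rule incseq_SucI) (rule sqit_real)
  ultimately have "convergent (sqit (1::real))" using Bseq_monoseq_convergent by (blast intro: incseq_imp_monoseq)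
  then have C: "Cauchy (sqit (1::real))" by (simp add: Cauchy_convergent_iff)
  have step: "norm (sqit S (n + k) - sqit S n) \<le> sqit 1 (n + k) - sqit 1 n" for n k
  proof (induction k)
    case (Suc k)
    have "norm (sqit S (n + Suc k) - sqit S n) \<le> norm (sqit S (Suc (n + k)) - sqit S (n + k)) + norm (sqit S (n + k) - sqit S n)"
      by (metis add_Suc_right diff_add_cancel add_diff_eq norm_triangle_ineq)
    then show ?case using Suc norm_sqit_step[OF assms, of "n + k"] by (simp del: sqit.simps)
  qed simp
  have "Cauchy (sqit S)"
  proof (rule metric_CauchyI)
    fix e :: real assume "0 < e"
    then obtain M where M: "\<And>m n. m \<ge> M \<Longrightarrow> n \<ge> M \<Longrightarrow> dist (sqit (1::real) m) (sqit 1 n) < e"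
      using C unfolding Cauchy_def by blast
    have le: "dist (sqit S m) (sqit S n) < e" if "n \<le> m" "n \<ge> M" for m n
    proof -
      have "norm (sqit S m - sqit S n) \<le> sqit 1 m - sqit 1 n" using step[of n "m - n"] that(1) by simp
      then show ?thesis using M[of m n] that by (simp add: dist_norm)
    qed
    have "dist (sqit S m) (sqit S n) < e" if "m \<ge> M" "n \<ge> M" for m n
      using le[of n m] le[of m n] that by (cases "n \<le> m") (auto simp: dist_commute)
    then show "\<exists>M. \<forall>m\<ge>M. \<forall>n\<ge>M. dist (sqit S m) (sqit S n) < e" by blast
  qed
  then show ?thesis by (rule Cauchy_convergent)
qed

text \<open>Identifies the limit from a known solution. Iterates have norm at most 1 and Y has norm
  below 1, so writing X^2 - Y^2 as X(X - Y) + (X - Y)Y shows that each step contracts by k = (1 +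
  |Y|)/2.\<close>

lemma sqit_tendsto:
  assumes "norm S \<le> 1" "Y + Y = S + Y * Y" "norm Y < 1"
  shows "sqit S \<longlonglongrightarrow> Y"
proof -
  define k where "k = (1 + norm Y) / 2"
  have k: "0 \<le> k" "k < 1" using assms by (auto simp: k_def)
  have Y: "Y = (1/2) *\<^sub>R (S + Y * Y)" unfolding assms(2)[symmetric]
    by (metis scaleR_half_double)
  have "norm (sqit S n - Y) \<le> k ^ n * norm Y" for n
  proof (induction n)
    case (Suc n)
    let ?X = "sqit S n"
    have "sqit S (Suc n) - Y = (1/2) *\<^sub>R (S + ?X * ?X) - (1/2) *\<^sub>R (S + Y * Y)" using Y by simp
    also have "\<dots> = (1/2) *\<^sub>R (?X * (?X - Y) + (?X - Y) * Y)" by (simp add: algebra_simps)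
    finally have "norm (sqit S (Suc n) - Y) = norm (?X * (?X - Y) + (?X - Y) * Y) / 2" by simp
    also have "\<dots> \<le> (norm ?X * norm (?X - Y) + norm (?X - Y) * norm Y) / 2"
      by (intro divide_right_mono order_trans[OF norm_triangle_ineq] add_mono norm_mult_ineq) auto
    also have "\<dots> \<le> (1 * norm (?X - Y) + norm (?X - Y) * norm Y) / 2"
      using norm_sqit_le_1[OF assms(1), of n] by (intro divide_right_mono add_mono mult_right_mono) auto
    also have "\<dots> = k * norm (?X - Y)" by (simp add: k_def field_simps)
    also have "\<dots> \<le> k * (k ^ n * norm Y)" using Suc k by (intro mult_left_mono) auto
    finally show ?case by simp
  qed simp
  moreover have "(\<lambda>n. k ^ n * norm Y) \<longlonglongrightarrow> 0"
    using LIMSEQ_power_zero[of k] k by (intro tendsto_mult_left_zero) auto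
  ultimately have "(\<lambda>n. sqit S n - Y) \<longlonglongrightarrow> 0"
    by (rule Lim_null_comparison[OF always_eventually[OF allI]])
  then show ?thesis by (simp add: LIM_zero_iff)
qed

lemma star_sqit: "star S = S \<Longrightarrow> star (sqit S n) = sqit S n"
  by (induction n) auto

lemma selfadj_square: "star T = T \<Longrightarrow> x \<bullet> (T \<cdot> T \<cdot> y) = (T \<cdot> x) \<bullet> (T \<cdot> y)"
  by (metis inner_star)

text \<open>Makes e - T^2 admissible for the iteration: expanding the square of the norm, the cross
  terms contribute -2|Tx|^2, which outweighs |TTx|^2.\<close>

lemma norm_unit_minus_square:
  assumes "star T = T" "T * e = T" "norm e \<le> 1" "norm T \<le> 1"
  shows "norm (e - T * T) \<le> 1"
proof (rule norm_rop_bound)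
  fix x
  have "(e \<cdot> x) \<bullet> (T \<cdot> T \<cdot> x) = (T \<cdot> x) \<bullet> (T \<cdot> x)"
    using assms(2) by (metis selfadj_square[OF assms(1)] rapp_simps(6))
  then have "(e \<cdot> x) \<bullet> (T \<cdot> T \<cdot> x) = (T \<cdot> x) \<bullet> (T \<cdot> x)" "(T \<cdot> T \<cdot> x) \<bullet> (e \<cdot> x) = (T \<cdot> x) \<bullet> (T \<cdot> x)"
    by (simp_all add: inner_commute)
  then have eq: "(norm ((e - T * T) \<cdot> x))\<^sup>2 = (norm (e \<cdot> x))\<^sup>2 - 2 * (norm (T \<cdot> x))\<^sup>2 + (norm (T \<cdot> T \<cdot> x))\<^sup>2"
    by (simp add: power2_norm_eq_inner inner_diff_left inner_diff_right)
  have "norm (T \<cdot> T \<cdot> x) \<le> norm (T \<cdot> x)"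
    using norm_rapp[of T "T \<cdot> x"] mult_right_mono[OF assms(4), of "norm (T \<cdot> x)"] by simp
  then have "(norm (T \<cdot> T \<cdot> x))\<^sup>2 \<le> (norm (T \<cdot> x))\<^sup>2" by (intro power_mono) auto
  moreover have "norm (e \<cdot> x) \<le> norm x"
    using norm_rapp[of e x] mult_right_mono[OF assms(3), of "norm x"] by simp
  then have "(norm (e \<cdot> x))\<^sup>2 \<le> (norm x)\<^sup>2" by (intro power_mono) auto
  ultimately have "(norm ((e - T * T) \<cdot> x))\<^sup>2 \<le> (norm x)\<^sup>2"
    using eq zero_le_power2[of "norm (T \<cdot> x)"] by linarith
  then show "norm ((e - T * T) \<cdot> x) \<le> 1 * norm x" by (auto intro: power2_le_imp_le)
qed simp

text \<open>A discrete heat flow. Each application of P loses at least \<tau>|Gy|^2 of the squared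
  norm, and |G P^m x| does not increase with m since G and P commute; so m losses of at least the
  last size fit into |x|^2.\<close>

lemma power_decay:
  assumes "star G = G" "0 \<le> \<tau>" "\<tau> * (norm G)\<^sup>2 \<le> 1"
  defines "P \<equiv> 1 - \<tau> *\<^sub>R (G * G)"
  shows "norm (P ^ m \<cdot> x) \<le> norm x" "real m * \<tau> * (norm (G \<cdot> P ^ m \<cdot> x))\<^sup>2 \<le> (norm x)\<^sup>2"
proof -
  have drop: "(norm (P \<cdot> y))\<^sup>2 \<le> (norm y)\<^sup>2 - \<tau> * (norm (G \<cdot> y))\<^sup>2" for y
  proof -
    have "(norm (P \<cdot> y))\<^sup>2 = (norm y)\<^sup>2 - 2 * \<tau> * (norm (G \<cdot> y))\<^sup>2 + \<tau>\<^sup>2 * (norm (G \<cdot> G \<cdot> y))\<^sup>2"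
      using selfadj_square[OF assms(1), of y y] inner_commute[of "G \<cdot> G \<cdot> y" y]
      by (simp add: P_def power2_norm_eq_inner inner_diff_left inner_diff_right power2_eq_square[of \<tau>] algebra_simps)
    moreover have "\<tau>\<^sup>2 * (norm (G \<cdot> G \<cdot> y))\<^sup>2 \<le> \<tau> * (norm (G \<cdot> y))\<^sup>2"
    proof -
      have "(norm (G \<cdot> G \<cdot> y))\<^sup>2 \<le> (norm G * norm (G \<cdot> y))\<^sup>2" by (intro power_mono norm_rapp) auto
      then have "\<tau>\<^sup>2 * (norm (G \<cdot> G \<cdot> y))\<^sup>2 \<le> \<tau>\<^sup>2 * ((norm G)\<^sup>2 * (norm (G \<cdot> y))\<^sup>2)"
        by (simp add: power_mult_distrib mult_left_mono)
      also have "\<dots> = \<tau> * (\<tau> * (norm G)\<^sup>2) * (norm (G \<cdot> y))\<^sup>2" by (simp add: power2_eq_square)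
      also have "\<dots> \<le> \<tau> * 1 * (norm (G \<cdot> y))\<^sup>2"
        using assms(2,3) by (intro mult_right_mono mult_left_mono) auto
      finally show ?thesis by simp
    qed
    ultimately show ?thesis by linarith
  qed
  have contr: "norm (P \<cdot> y) \<le> norm y" for y
  proof -
    have "(norm (P \<cdot> y))\<^sup>2 \<le> (norm y)\<^sup>2" 
      using drop[of y] mult_nonneg_nonneg[OF assms(2) zero_le_power2[of "norm (G \<cdot> y)"]] by linarith
    then show ?thesis by (auto intro: power2_le_imp_le)
  qed
  show "norm (P ^ m \<cdot> x) \<le> norm x"
    by (induction m) (auto intro: order_trans[OF contr])
  have comm: "G \<cdot> P \<cdot> y = P \<cdot> G \<cdot> y" for y by (simp add: P_def)
  have "real m * \<tau> * (norm (G \<cdot> P ^ m \<cdot> x))\<^sup>2 + (norm (P ^ m \<cdot> x))\<^sup>2 \<le> (norm x)\<^sup>2"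
  proof (induction m)
    case (Suc m)
    let ?y = "P ^ m \<cdot> x"
    have "norm (G \<cdot> P ^ Suc m \<cdot> x) \<le> norm (G \<cdot> ?y)" using contr[of "G \<cdot> ?y"] by (simp add: comm)
    then have "(norm (G \<cdot> P ^ Suc m \<cdot> x))\<^sup>2 \<le> (norm (G \<cdot> ?y))\<^sup>2" by (intro power_mono) auto
    then have "real (Suc m) * \<tau> * (norm (G \<cdot> P ^ Suc m \<cdot> x))\<^sup>2 \<le> real (Suc m) * \<tau> * (norm (G \<cdot> ?y))\<^sup>2"
      using assms(2) by (intro mult_left_mono) auto
    moreover have "(norm (P ^ Suc m \<cdot> x))\<^sup>2 \<le> (norm ?y)\<^sup>2 - \<tau> * (norm (G \<cdot> ?y))\<^sup>2" using drop[of ?y] by simp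
    ultimately show ?case using Suc by (simp add: algebra_simps)
  qed simp
  then show "real m * \<tau> * (norm (G \<cdot> P ^ m \<cdot> x))\<^sup>2 \<le> (norm x)\<^sup>2"
    using zero_le_power2[of "norm (P ^ m \<cdot> x)"] by linarith
qed

section \<open>Positive parts and approximation inside a closed ideal\<close>

definition salg :: "('v::finite, 'b) rop set \<Rightarrow> bool" where
  "salg A \<longleftrightarrow> subspace A \<and> (\<forall>x\<in>A. \<forall>y\<in>A. x * y \<in> A) \<and> (\<forall>x\<in>A. star x \<in> A)"

lemma salgD:
  assumes "salg A"
  shows "0 \<in> A" "x \<in> A \<Longrightarrow> y \<in> A \<Longrightarrow> x + y \<in> A" "x \<in> A \<Longrightarrow> y \<in> A \<Longrightarrow> x - y \<in> A" "x \<in> A \<Longrightarrow> r *\<^sub>R x \<in> A"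
    "x \<in> A \<Longrightarrow> y \<in> A \<Longrightarrow> x * y \<in> A" "x \<in> A \<Longrightarrow> star x \<in> A"
  using assms by (auto simp: salg_def subspace_0 subspace_add subspace_diff subspace_scale)

lemma sqit_in_salg: "salg A \<Longrightarrow> S \<in> A \<Longrightarrow> sqit S n \<in> A"
  by (induction n) (auto simp: salgD)

text \<open>Modulo \<open>J\<close>, the element \<open>V = c* c - \<epsilon>\<close> agrees with \<open>W = r - \<epsilon>\<close> where \<open>r\<close> is small, and \<open>|W| = -W\<close>.
So \<open>G = |V| + V\<close> lies in \<open>J\<close> as well as in \<open>C\<close>, and it dominates \<open>c* c\<close> up to \<open>\<epsilon>\<close>.\<close>

lemma ideal_positive_part:
  fixes e c a :: "('v::finite, 'b) rop"
  assumes e: "star e = e" "e * e = e" "norm e \<le> 1"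
    and D: "salg D" "e \<in> D" "\<And>x. x \<in> D \<Longrightarrow> e * x = x" "\<And>x. x \<in> D \<Longrightarrow> x * e = x"
    and J: "J \<subseteq> D" "closed J" "subspace J" "\<And>x y. x \<in> J \<Longrightarrow> y \<in> D \<Longrightarrow> x * y \<in> J" "\<And>x y. x \<in> J \<Longrightarrow> y \<in> D \<Longrightarrow> y * x \<in> J"
    and C: "salg C" "e \<in> C" "closed C"
    and ac: "a \<in> J" "c \<in> D" "c \<in> C" and \<epsilon>: "0 < \<epsilon>" "norm (star c * c - star a * a) \<le> \<epsilon> / 2"
  obtains G where "G \<in> J" "G \<in> C" "star G = G" "\<And>y. (norm (c \<cdot> y))\<^sup>2 \<le> \<epsilon> * (norm y)\<^sup>2 + y \<bullet> (G \<cdot> y)"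
proof -
  define r where "r = star c * c - star a * a"
  define V where "V = star c * c - \<epsilon> *\<^sub>R e"
  define W where "W = r - \<epsilon> *\<^sub>R e"
  \<comment> \<open>Scales V and W to norm at most 1, as the iteration requires, and keeps
    t\<epsilon> \<le> 1.\<close>
  define t where "t = 1 / (norm V + norm W + \<epsilon> + 1)"
  have pos: "0 < norm V + norm W + \<epsilon> + 1" using \<epsilon>(1) by (simp add: add_pos_pos add_nonneg_pos)
  have t: "0 < t" "t * norm V \<le> 1" "t * norm W \<le> 1" "t * \<epsilon> \<le> 1"
    using pos \<epsilon>(1) by (auto simp: t_def field_simps)
  have aD: "a \<in> D" using ac J by blast
  have VW: "V \<in> D" "W \<in> D" "V \<in> C" "r \<in> D"
    using ac aD D(1,2) C(1,2) by (auto simp: V_def W_def r_def salgD)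
  have sa: "star V = V" "star W = W" "star r = r" by (auto simp: V_def W_def r_def e)
  have aaJ: "star a * a \<in> J" using ac aD D(1) J by (auto simp: salgD)
  have VmW: "V - W \<in> J" using aaJ by (simp add: V_def W_def r_def)
  let ?S = "\<lambda>V. e - (t *\<^sub>R V) * (t *\<^sub>R V)"
  have nS: "norm (?S U) \<le> 1" if "star U = U" "U \<in> D" "t * norm U \<le> 1" for U
    by (rule norm_unit_minus_square) (use that t e D in auto)
  \<comment> \<open>The limit satisfies (e - X)^2 = (tV)^2 inside the corner with unit e, so X
    stands for e - t|V|.\<close>
  obtain X where X: "sqit (?S V) \<longlonglongrightarrow> X"
    using convergent_sqit[OF nS[of V]] sa VW t by (auto simp: convergent_def)
  have SD: "?S V \<in> D" "?S W \<in> D" "?S V \<in> C"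
    by (intro salgD[OF D(1)] salgD[OF C(1)] VW D(2) C(2))+
  have XC: "X \<in> C"
    by (rule closed_sequentially[OF C(3) _ X]) (rule sqit_in_salg[OF C(1) SD(3)])
  have "star (?S V) = ?S V" using e sa by simp
  then have "(\<lambda>n. star (sqit (?S V) n)) \<longlonglongrightarrow> X" using X by (simp only: star_sqit)
  moreover have "(\<lambda>n. star (sqit (?S V) n)) \<longlonglongrightarrow> star X"
    by (rule bounded_linear.tendsto[OF bounded_linear_star X])
  ultimately have sX: "star X = X" using LIMSEQ_unique by blast
  have nX: "norm X \<le> 1"
    by (rule LIMSEQ_le_const2[OF tendsto_norm[OF X]]) (use norm_sqit_le_1[OF nS[of V]] sa VW t in auto)
  have Xe: "X * e = X" "e * X = X"
  proof -
    have 1: "sqit (?S V) n * e = sqit (?S V) n" "e * sqit (?S V) n = sqit (?S V) n" for n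
      using D sqit_in_salg[OF D(1) SD(1)] by auto
    have "(\<lambda>n. sqit (?S V) n * e) \<longlonglongrightarrow> X * e" "(\<lambda>n. e * sqit (?S V) n) \<longlonglongrightarrow> e * X"
      by (intro tendsto_intros X)+
    then show "X * e = X" "e * X = X" unfolding 1 using X LIMSEQ_unique by blast+
  qed
  \<comment> \<open>Since |r| \<le> \<epsilon>/2, the operator W is strictly negative on the corner,
    so t|W| = -tW and the expected limit is e + tW. Its norm is below 1, which is what
    identification of the limit needs.\<close>
  have Wlim: "sqit (?S W) \<longlonglongrightarrow> e + t *\<^sub>R W"
  proof (rule sqit_tendsto)
    show "norm (?S W) \<le> 1" using nS sa VW t by blast
    have "e * W = W" "W * e = W" using D VW by auto
    then show "(e + t *\<^sub>R W) + (e + t *\<^sub>R W) = ?S W + (e + t *\<^sub>R W) * (e + t *\<^sub>R W)"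
      by (simp add: algebra_simps e)
    have "norm (e + t *\<^sub>R W) = norm ((1 - t * \<epsilon>) *\<^sub>R e + t *\<^sub>R r)"
      by (simp add: W_def algebra_simps)
    also have "\<dots> \<le> (1 - t * \<epsilon>) * norm e + t * norm r"
      using t by (intro order_trans[OF norm_triangle_ineq]) auto
    also have "\<dots> \<le> (1 - t * \<epsilon>) * 1 + t * (\<epsilon> / 2)"
      using t e \<epsilon> by (intro add_mono mult_left_mono) (auto simp: r_def)
    also have "\<dots> < 1" using t \<epsilon> by simp
    finally show "norm (e + t *\<^sub>R W) < 1" .
  qed
  have JD: "x * y - x' * y' \<in> J" if "x - x' \<in> J" "y - y' \<in> J" "y \<in> D" "x' \<in> D" for x y x' y'
  proof -
    have "x * y - x' * y' = (x - x') * y + x' * (y - y')" by (simp add: algebra_simps)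
    then show ?thesis using that J by (metis subspace_add)
  qed
  \<comment> \<open>The iteration is polynomial, so inputs congruent modulo J have congruent
    iterates.\<close>
  have "sqit (?S V) n - sqit (?S W) n \<in> J" for n
  proof (induction n)
    case 0 then show ?case using J by (simp add: subspace_0)
  next
    case (Suc n)
    have "?S V - ?S W = - (t *\<^sub>R t *\<^sub>R (V * V - W * W))" by (simp add: algebra_simps)
    then have "?S V - ?S W \<in> J" using JD[OF VmW VmW] VW J(3) by (metis subspace_neg subspace_scale)
    moreover have "sqit (?S V) n * sqit (?S V) n - sqit (?S W) n * sqit (?S W) n \<in> J"
      by (intro JD Suc sqit_in_salg[OF D(1)] SD)
    ultimately have "(1/2) *\<^sub>R ((?S V - ?S W) + (sqit (?S V) n * sqit (?S V) n - sqit (?S W) n * sqit (?S W) n)) \<in> J"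
      using J(3) by (intro subspace_scale subspace_add) auto
    then show ?case by (simp add: algebra_simps)
  qed
  then have XJ: "X - (e + t *\<^sub>R W) \<in> J"
    by (intro closed_sequentially[OF J(2) _ tendsto_diff[OF X Wlim]]) auto
  define G where "G = (1/t) *\<^sub>R (e - X) + V"
  show ?thesis
  proof (rule that)
    have "G = - ((1/t) *\<^sub>R (X - (e + t *\<^sub>R W))) + (V - W)"
      using t by (simp add: G_def algebra_simps)
    then show "G \<in> J" using XJ VmW J(3) by (metis subspace_add subspace_neg subspace_scale)
    show "G \<in> C" using C XC VW by (auto simp: G_def salgD)
    show "star G = G" by (simp add: G_def e sX sa)
    fix y
    have e2: "(e \<cdot> y) \<bullet> (e \<cdot> y) = y \<bullet> (e \<cdot> y)" by (metis e(1,2) inner_star rapp_simps(6))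
    have "norm (e \<cdot> y) \<le> norm y"
      using norm_rapp[of e y] mult_right_mono[OF e(3), of "norm y"] by simp
    then have ey: "y \<bullet> (e \<cdot> y) \<le> (norm y)\<^sup>2"
      using e2 by (metis norm_ge_zero power2_norm_eq_inner power_mono)
    have "y \<bullet> (X \<cdot> y) = (e \<cdot> y) \<bullet> (X \<cdot> e \<cdot> y)"
      using Xe e(1) by (metis inner_star rapp_simps(6))
    also have "\<dots> \<le> norm (e \<cdot> y) * norm (X \<cdot> e \<cdot> y)" by (rule norm_cauchy_schwarz)
    also have "\<dots> \<le> norm (e \<cdot> y) * norm (e \<cdot> y)"
      using norm_rapp[of X "e \<cdot> y"] mult_right_mono[OF nX, of "norm (e \<cdot> y)"] by (intro mult_left_mono) auto
    also have "\<dots> = y \<bullet> (e \<cdot> y)" using e2 by (simp flip: power2_norm_eq_inner power2_eq_square)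
    finally have "0 \<le> y \<bullet> ((e - X) \<cdot> y)" by (simp add: inner_diff_right)
    then have "0 \<le> (1/t) * (y \<bullet> ((e - X) \<cdot> y))" using t by (intro mult_nonneg_nonneg) auto
    then have VG: "y \<bullet> (V \<cdot> y) \<le> y \<bullet> (G \<cdot> y)" by (simp add: G_def inner_add_right)
    have "star c * c = \<epsilon> *\<^sub>R e + V" by (simp add: V_def)
    then have "(norm (c \<cdot> y))\<^sup>2 = y \<bullet> ((\<epsilon> *\<^sub>R e + V) \<cdot> y)"
      by (metis inner_star power2_norm_eq_inner rapp_simps(6))
    also have "\<dots> = \<epsilon> * (y \<bullet> (e \<cdot> y)) + y \<bullet> (V \<cdot> y)" by (simp add: inner_add_right)
    also have "\<dots> \<le> \<epsilon> * (norm y)\<^sup>2 + y \<bullet> (G \<cdot> y)"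
      using ey VG \<epsilon> by (intro add_mono mult_left_mono) auto
    finally show "(norm (c \<cdot> y))\<^sup>2 \<le> \<epsilon> * (norm y)\<^sup>2 + y \<bullet> (G \<cdot> y)" .
  qed
qed

text \<open>Put P = 1 - \<tau>G^2. Multiplying c by a power of P changes it only by an element of J
  \<inter> C, because G lies there. On the range of P^m the operator G is small, and c* c is
  dominated by \<epsilon> + G, so the remainder c P^m is small; the approximant is c - c
  P^m.\<close>

lemma ideal_approx:
  fixes e c a :: "('v::finite, 'b) rop"
  assumes e: "star e = e" "e * e = e" "norm e \<le> 1"
    and D: "salg D" "e \<in> D" "\<And>x. x \<in> D \<Longrightarrow> e * x = x" "\<And>x. x \<in> D \<Longrightarrow> x * e = x"
    and J: "J \<subseteq> D" "closed J" "subspace J" "\<And>x y. x \<in> J \<Longrightarrow> y \<in> D \<Longrightarrow> x * y \<in> J" "\<And>x y. x \<in> J \<Longrightarrow> y \<in> D \<Longrightarrow> y * x \<in> J"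
    and C: "salg C" "e \<in> C" "closed C"
    and ac: "a \<in> J" "c \<in> D" "c \<in> C" and \<epsilon>: "0 < \<epsilon>" "norm (star c * c - star a * a) \<le> \<epsilon> / 2"
  shows "\<exists>b\<in>J \<inter> C. (norm (c - b))\<^sup>2 \<le> 2 * \<epsilon>"
proof -
  obtain G where G: "G \<in> J" "G \<in> C" "star G = G"
    "\<And>y. (norm (c \<cdot> y))\<^sup>2 \<le> \<epsilon> * (norm y)\<^sup>2 + y \<bullet> (G \<cdot> y)"
    using ideal_positive_part[OF e D J C ac \<epsilon>] by blast
  define \<tau> where "\<tau> = 1 / ((norm G)\<^sup>2 + 1)"
  have p: "0 < (norm G)\<^sup>2 + 1" by (simp add: add_nonneg_pos)
  have \<tau>: "0 < \<tau>" "\<tau> * (norm G)\<^sup>2 \<le> 1" using p by (auto simp: \<tau>_def field_simps)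
  define P where "P = 1 - \<tau> *\<^sub>R (G * G)"
  have cP: "c - c * P ^ m \<in> J \<inter> C \<and> c * P ^ m \<in> D \<inter> C" for m
  proof (induction m)
    case 0 then show ?case using J(3) C ac by (simp add: subspace_0 salgD)
  next
    case (Suc m)
    let ?c = "c * P ^ m"
    have "c * P ^ Suc m = ?c * P" unfolding power_Suc2 by (simp add: mult.assoc)
    also have "\<dots> = ?c - \<tau> *\<^sub>R (?c * (G * G))" by (simp add: P_def algebra_simps)
    finally have eq: "c * P ^ Suc m = ?c - \<tau> *\<^sub>R (?c * (G * G))" .
    have GD: "G \<in> D" using G J by blast
    have GG: "G * G \<in> J" "G * G \<in> C" using G GD J C by (auto simp: salgD)
    have cG: "\<tau> *\<^sub>R (?c * (G * G)) \<in> J" "\<tau> *\<^sub>R (?c * (G * G)) \<in> C"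
      using GG Suc J C by (auto simp: salgD intro!: subspace_scale[OF J(3)])
    have "c - (?c - \<tau> *\<^sub>R (?c * (G * G))) = (c - ?c) + \<tau> *\<^sub>R (?c * (G * G))" by simp
    then have "c - c * P ^ Suc m \<in> J \<inter> C"
      unfolding eq using cG Suc J C by (metis IntD1 IntD2 IntI salgD(2) subspace_add)
    moreover have "c * P ^ Suc m \<in> D \<inter> C"
      unfolding eq using cG Suc J(1) C D(1) by (auto simp: salgD)
    ultimately show ?case by blast
  qed
  \<comment> \<open>With m\<tau>\<epsilon>^2 > 1 the energy bound turns into |G P^m x| \<le>
    \<epsilon>|x|.\<close>
  obtain m :: nat where m: "real m > 1 / (\<tau> * \<epsilon>\<^sup>2)" using reals_Archimedean2 by blast
  then have m: "1 < real m * \<tau> * \<epsilon>\<^sup>2" using \<tau> \<epsilon>(1) by (simp add: field_simps)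
  then have mt: "0 < real m * \<tau>" using \<epsilon>(1) by (smt (verit) zero_less_mult_iff zero_less_power)
  have "(norm (c * P ^ m))\<^sup>2 \<le> 2 * \<epsilon>"
  proof -
    have "norm (c * P ^ m) \<le> sqrt (2 * \<epsilon>)"
    proof (rule norm_rop_bound)
      fix x
      let ?y = "P ^ m \<cdot> x"
      have y: "norm ?y \<le> norm x" "real m * \<tau> * (norm (G \<cdot> ?y))\<^sup>2 \<le> (norm x)\<^sup>2"
        using power_decay[OF G(3), of \<tau> m x] \<tau> by (auto simp: P_def)
      have "real m * \<tau> * (norm (G \<cdot> ?y))\<^sup>2 \<le> real m * \<tau> * (\<epsilon> * norm x)\<^sup>2"
        using y(2) mult_right_mono[of 1 "real m * \<tau> * \<epsilon>\<^sup>2" "(norm x)\<^sup>2"] m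
        by (simp add: power_mult_distrib mult.assoc)
      then have "(norm (G \<cdot> ?y))\<^sup>2 \<le> (\<epsilon> * norm x)\<^sup>2"
        using mult_le_cancel_left_pos[OF mt] by blast
      then have Gy: "norm (G \<cdot> ?y) \<le> \<epsilon> * norm x" using \<epsilon>(1) by (auto intro: power2_le_imp_le)
      have "(norm (c \<cdot> ?y))\<^sup>2 \<le> \<epsilon> * (norm ?y)\<^sup>2 + ?y \<bullet> (G \<cdot> ?y)" by (rule G)
      also have "\<dots> \<le> \<epsilon> * (norm ?y)\<^sup>2 + norm ?y * norm (G \<cdot> ?y)" by (simp add: norm_cauchy_schwarz)
      also have "\<dots> \<le> \<epsilon> * (norm x)\<^sup>2 + norm x * (\<epsilon> * norm x)"
        using y Gy \<epsilon>(1) by (intro add_mono mult_left_mono mult_mono power_mono) auto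
      also have "\<dots> = (sqrt (2 * \<epsilon>) * norm x)\<^sup>2" using \<epsilon>(1) by (simp add: power_mult_distrib power2_eq_square)
      finally show "norm ((c * P ^ m) \<cdot> x) \<le> sqrt (2 * \<epsilon>) * norm x"
        using \<epsilon>(1) by (auto intro: power2_le_imp_le)
    qed (use \<epsilon> in simp)
    then have "(norm (c * P ^ m))\<^sup>2 \<le> (sqrt (2 * \<epsilon>))\<^sup>2" by (intro power_mono) auto
    then show ?thesis using \<epsilon>(1) by simp
  qed
  then show ?thesis using cP[of m] by (intro bexI[of _ "c - c * P ^ m"]) auto
qed

text \<open>Continuity of x \<mapsto> x* x provides the hypothesis of \<open>ideal_approx\<close>
  for an approximant c of a taken from some level. The result concerns operators with a local unit
  e, since the estimates evaluate on vectors; the quotient is treated by applying it to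
  preimages.\<close>

theorem ideal_dense:
  fixes e a :: "('v::finite, 'b) rop"
  assumes e: "star e = e" "e * e = e" "norm e \<le> 1"
    and D: "salg D" "e \<in> D" "\<And>x. x \<in> D \<Longrightarrow> e * x = x" "\<And>x. x \<in> D \<Longrightarrow> x * e = x"
    and J: "J \<subseteq> D" "closed J" "subspace J" "\<And>x y. x \<in> J \<Longrightarrow> y \<in> D \<Longrightarrow> x * y \<in> J" "\<And>x y. x \<in> J \<Longrightarrow> y \<in> D \<Longrightarrow> y * x \<in> J"
    and C: "\<And>n. salg (C n)" "\<And>n. e \<in> C n" "\<And>n. closed (C n)"
    and dense: "\<And>d \<eta>. d \<in> D \<Longrightarrow> 0 < \<eta> \<Longrightarrow> \<exists>n. \<exists>c\<in>D \<inter> C n. norm (d - c) < \<eta>"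
  shows "J \<subseteq> closure (\<Union>n. J \<inter> C n)"
proof
  fix a assume a: "a \<in> J"
  show "a \<in> closure (\<Union>n. J \<inter> C n)"
    unfolding closure_approachable
  proof (intro allI impI)
    fix \<delta> :: real assume \<delta>: "0 < \<delta>"
    \<comment> \<open>Chosen so that the bound 2\<epsilon> equals (\<delta>/2)^2.\<close>
    define \<epsilon> where "\<epsilon> = \<delta>\<^sup>2 / 8"
    have \<epsilon>: "0 < \<epsilon>" using \<delta> by (simp add: \<epsilon>_def)
    have "continuous_on UNIV (\<lambda>x :: ('v, 'b) rop. star x * x)" by (intro continuous_intros)
    then have "isCont (\<lambda>x :: ('v, 'b) rop. star x * x) a"
      using continuous_on_eq_continuous_at[OF open_UNIV] by blast
    then obtain d where d: "0 < d" "\<And>x. norm (x - a) < d \<Longrightarrow> norm (star x * x - star a * a) < \<epsilon> / 2"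
      unfolding continuous_at_eps_delta dist_norm using \<epsilon> by (metis half_gt_zero)
    obtain n c where c: "c \<in> D" "c \<in> C n" "norm (a - c) < min d (\<delta> / 2)"
      using dense[of a "min d (\<delta> / 2)"] a J(1) d(1) \<delta> by auto
    then have "norm (star c * c - star a * a) \<le> \<epsilon> / 2" using d(2)[of c] by (simp add: norm_minus_commute)
    then obtain b where b: "b \<in> J \<inter> C n" "(norm (c - b))\<^sup>2 \<le> 2 * \<epsilon>"
      using ideal_approx[OF e D J C(1) C(2) C(3) a c(1,2) \<epsilon>] by blast
    have "(norm (c - b))\<^sup>2 \<le> (\<delta> / 2)\<^sup>2" using b(2) by (simp add: \<epsilon>_def power_divide)
    then have "norm (c - b) \<le> \<delta> / 2" using \<delta> by (auto intro: power2_le_imp_le)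
    then have "dist b a < \<delta>"
      using c(3) norm_triangle_ineq[of "a - c" "c - b"] by (simp add: dist_norm norm_minus_commute)
    then show "\<exists>y\<in>\<Union>n. J \<inter> C n. dist y a < \<delta>" using b(1) by blast
  qed
qed

section \<open>Paths\<close>

lemma is_path_Nil [simp]: "is_path sE rE (v, [])"
  by (simp add: is_path_def)

lemma prng_simps [simp]: "prng rE (v, []) = v" "prng rE (v, e # es) = rE e"
  by (simp_all add: prng_def)

lemma plen_simps [simp]: "plen (v, es) = length es" "plen (pcat \<alpha> \<beta>) = plen \<alpha> + plen \<beta>"
  by (simp_all add: plen_def pcat_def)

lemma psrc_simps [simp]: "psrc (v, es) = v" "psrc (pcat \<alpha> \<beta>) = psrc \<beta>"
  by (simp_all add: psrc_def pcat_def)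

text \<open>Replaces the index condition by recursion on the edge list, on which all later
  inductions over paths rest.\<close>

lemma is_path_Cons [simp]:
  "is_path sE rE (v, e # es) \<longleftrightarrow> is_path sE rE (v, es) \<and> sE e = prng rE (v, es)"
proof (cases es)
  case (Cons f fs)
  have "(\<forall>i. Suc i < length (e # es) \<longrightarrow> sE ((e # es) ! i) = rE ((e # es) ! Suc i)) \<longleftrightarrow>
      sE e = rE f \<and> (\<forall>i. Suc i < length es \<longrightarrow> sE (es ! i) = rE (es ! Suc i))" (is "?L \<longleftrightarrow> ?R")
  proof
    assume L: ?L
    have "sE e = rE f" using L[rule_format, of 0] Cons by simp
    moreover have "sE (es ! i) = rE (es ! Suc i)" if "Suc i < length es" for i
      using L[rule_format, of "Suc i"] that by simp
    ultimately show ?R by blast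
  next
    assume R: ?R
    show ?L
    proof (intro allI impI)
      fix i assume "Suc i < length (e # es)"
      then show "sE ((e # es) ! i) = rE ((e # es) ! Suc i)"
        using R Cons by (cases i) auto
    qed
  qed
  then show ?thesis using Cons by (auto simp: is_path_def)
qed (auto simp: is_path_def)

lemma pcat_simps [simp]: "pcat (w, []) (v, bs) = (v, bs)" "pcat (w, e # es) (v, bs) = (v, e # snd (pcat (w, es) (v, bs)))"
  by (simp_all add: pcat_def)

lemma prng_pcat: "psrc \<alpha> = prng rE \<beta> \<Longrightarrow> prng rE (pcat \<alpha> \<beta>) = prng rE \<alpha>"
  by (cases \<alpha>; cases \<beta>; cases "snd \<alpha>") (auto simp: pcat_def prng_def)

lemma is_path_pcat:
  assumes "is_path sE rE \<alpha>" "is_path sE rE \<beta>" "psrc \<alpha> = prng rE \<beta>"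
  shows "is_path sE rE (pcat \<alpha> \<beta>)"
proof -
  obtain w es v bs where ab: "\<alpha> = (w, es)" "\<beta> = (v, bs)" by fastforce
  have "is_path sE rE (w, es) \<Longrightarrow> w = prng rE (v, bs) \<Longrightarrow>
      is_path sE rE (v, es @ bs) \<and> prng rE (v, es @ bs) = prng rE (w, es)" for es
    by (induction es) (use assms ab in auto)
  then show ?thesis using assms ab by (auto simp: pcat_def)
qed

lemma path_split:
  assumes "is_path sE rE \<alpha>" "k \<le> plen \<alpha>"
  obtains \<beta> \<gamma> where "\<alpha> = pcat \<beta> \<gamma>" "is_path sE rE \<beta>" "is_path sE rE \<gamma>" "psrc \<beta> = prng rE \<gamma>"
    "plen \<beta> = k" "plen \<gamma> = plen \<alpha> - k"
proof -
  obtain v es where a: "\<alpha> = (v, es)" by fastforce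
  let ?w = "prng rE (v, drop k es)"
  have "is_path sE rE (v, es) \<Longrightarrow> k \<le> length es \<Longrightarrow>
    is_path sE rE (prng rE (v, drop k es), take k es) \<and> is_path sE rE (v, drop k es) \<and>
    (prng rE (prng rE (v, drop k es), take k es) = prng rE (v, es))" for k
  proof (induction es arbitrary: k)
    case (Cons e es)
    show ?case
    proof (cases k)
      case (Suc j)
      then show ?thesis using Cons.IH[of j] Cons.prems by auto
    qed (use Cons in auto)
  qed auto
  then show ?thesis using that[of "(?w, take k es)" "(v, drop k es)"] assms a by (auto simp: pcat_def)
qed

definition PK :: "('e \<Rightarrow> 'v) \<Rightarrow> ('e \<Rightarrow> 'v) \<Rightarrow> nat \<Rightarrow> ('v, 'e) path set" where
  "PK sE rE k = {\<alpha>. is_path sE rE \<alpha> \<and> plen \<alpha> = k}"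

lemma PK_0: "PK sE rE 0 = range (\<lambda>v. (v, []))"
  by (auto simp: PK_def plen_def)

lemma PK_Suc: "PK sE rE (Suc k) = (\<lambda>(e, \<alpha>). (fst \<alpha>, e # snd \<alpha>)) ` {(e, \<alpha>). \<alpha> \<in> PK sE rE k \<and> sE e = prng rE \<alpha>}"
proof -
  have "\<alpha> \<in> (\<lambda>(e, \<alpha>). (fst \<alpha>, e # snd \<alpha>)) ` {(e, \<alpha>). \<alpha> \<in> PK sE rE k \<and> sE e = prng rE \<alpha>}"
    if a: "\<alpha> \<in> PK sE rE (Suc k)" for \<alpha>
  proof -
    obtain v e es where "\<alpha> = (v, e # es)" using a by (cases \<alpha>; cases "snd \<alpha>") (auto simp: PK_def)
    then show ?thesis using a by (auto simp: PK_def intro!: image_eqI[of _ _ "(e, (v, es))"])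
  qed
  then show ?thesis by (auto simp: PK_def)
qed

lemma finite_PK: "finite (PK sE rE k :: ('v::finite, 'e::finite) path set)"
proof (induction k)
  case (Suc k)
  have "finite {(e, \<alpha>). \<alpha> \<in> PK sE rE k \<and> sE e = prng rE \<alpha>}"
    by (rule finite_subset[of _ "UNIV \<times> PK sE rE k"]) (use Suc in auto)
  then show ?case by (simp add: PK_Suc)
qed (simp add: PK_0)

text \<open>Paths grow at their range end: the absence of sinks supplies an edge whose source is the
  current range, and the source v stays fixed.\<close>

lemma PK_exists:
  assumes "\<forall>v. \<exists>e. sE e = v"
  shows "\<exists>\<kappa>\<in>PK sE rE k. psrc \<kappa> = v"
proof (induction k)
  case 0 show ?case by (auto simp: PK_def intro!: bexI[of _ "(v, [])"])
next
  case (Suc k)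
  then obtain es where "(v, es) \<in> PK sE rE k" by (metis psrc_def prod.collapse)
  moreover obtain e where "sE e = prng rE (v, es)" using assms by blast
  ultimately show ?case by (intro bexI[of _ "(v, e # es)"]) (auto simp: PK_def)
qed

section \<open>Cuntz--Krieger families\<close>

abbreviation qsc :: "complex \<Rightarrow> ('v::finite, 'b) calq" where "qsc c \<equiv> qq (sc c)"

lemma qsc_central: "qsc c * a = a * qsc c"
  using qq_surj[of a] by (metis qq_simps(6) sc_central)

lemma qsc_assoc: "x * (qsc c * a) * y = qsc c * (x * a * y)"
proof -
  have "x * (qsc c * a) * y = (x * qsc c) * a * y" by (simp add: mult.assoc)
  also have "x * qsc c = qsc c * x" by (rule qsc_central[symmetric])
  finally show ?thesis by (simp add: mult.assoc)
qed

definition qalg :: "('v::finite, 'b) calq set \<Rightarrow> bool" where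
  "qalg B \<longleftrightarrow> 0 \<in> B \<and> (\<forall>a\<in>B. \<forall>b\<in>B. a + b \<in> B \<and> a * b \<in> B) \<and> (\<forall>a\<in>B. \<forall>c. qsc c * a \<in> B) \<and>
    (\<forall>a\<in>B. qstar a \<in> B) \<and> closed B"

lemma qalgD:
  assumes "qalg B"
  shows "0 \<in> B" "a \<in> B \<Longrightarrow> b \<in> B \<Longrightarrow> a + b \<in> B" "a \<in> B \<Longrightarrow> b \<in> B \<Longrightarrow> a * b \<in> B"
    "a \<in> B \<Longrightarrow> qsc c * a \<in> B" "a \<in> B \<Longrightarrow> qstar a \<in> B" "closed B"
  using assms unfolding qalg_def by blast+

lemma qalg_sum: "qalg B \<Longrightarrow> (\<And>i. i \<in> I \<Longrightarrow> f i \<in> B) \<Longrightarrow> (\<Sum>i\<in>I. f i) \<in> B"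
  by (induction I rule: infinite_finite_induct) (auto simp: qalgD)

lemma closed_corner: "closed {a :: ('v::finite, 'b) calq. E * a * E = a}"
proof -
  obtain e where e: "E = qq e" using qq_surj by blast
  have "qq -` {a. E * a * E = a} = (\<lambda>X. e * X * e - X) -` rK"
    by (auto simp: e qq_eq_iff simp flip: qq_simps(6))
  moreover have "closed ((\<lambda>X. e * X * e - X) -` rK)"
    by (intro continuous_closed_vimage[OF closed_rK]) (auto intro!: continuous_intros)
  ultimately show ?thesis by (simp add: closed_calq)
qed

lemma corner_sides:
  fixes E :: "'a::ring"
  assumes "E * E = E" "E * a * E = a"
  shows "E * a = a" "a * E = a"
proof -
  have "E * (E * a * E) = E * a * E" "(E * a * E) * E = E * a * E"
    using assms(1) by (metis mult.assoc)+
  then show "E * a = a" "a * E = a" unfolding assms(2) by blast+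
qed

lemma corner_mult:
  fixes E :: "'a::ring"
  assumes "E * a = a" "b * E = b"
  shows "E * (a * b) * E = a * b"
proof -
  have "E * (a * b) * E = (E * a) * (b * E)" by (simp add: mult.assoc)
  then show ?thesis using assms by simp
qed

lemma qalg_compress:
  fixes E :: "('v::finite, 'b) calq"
  assumes B: "qalg B" and E: "E * E = E" "qstar E = E" "(\<Sum>i\<in>I. qstar (w i) * w i) = E"
    and w: "\<And>i. i \<in> I \<Longrightarrow> w i \<in> X"
  shows "qalg {a. E * a * E = a \<and> (\<forall>x\<in>X. \<forall>y\<in>X. x * a * qstar y \<in> B)}" (is "qalg ?S")
proof -
  have "?S = {a. E * a * E = a} \<inter> (\<Inter>x\<in>X. \<Inter>y\<in>X. {a. x * a * qstar y \<in> B})" by auto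
  then have "closed ?S"
    by (simp only:) (intro closed_Int closed_INT ballI closed_corner closed_calq_mult qalgD(6)[OF B])
  moreover have "a + b \<in> ?S" if "a \<in> ?S" "b \<in> ?S" for a b
    using that B by (auto simp: algebra_simps qalgD)
  moreover have "a * b \<in> ?S" if a: "a \<in> ?S" and b: "b \<in> ?S" for a b
  proof -
    have Ea: "E * a = a" "b * E = b" "a * E = a"
      using a b corner_sides[OF E(1)] by auto
    have "x * (a * b) * qstar y \<in> B" if "x \<in> X" "y \<in> X" for x y
    proof -
      have "x * (a * b) * qstar y = x * (a * (\<Sum>i\<in>I. qstar (w i) * w i) * b) * qstar y"
        by (simp add: E Ea)
      also have "\<dots> = (\<Sum>i\<in>I. (x * a * qstar (w i)) * (w i * b * qstar y))"
        by (simp add: sum_distrib_left sum_distrib_right mult.assoc)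
      also have "\<dots> \<in> B"
      proof (rule qalg_sum[OF B])
        show "(x * a * qstar (w i)) * (w i * b * qstar y) \<in> B" if "i \<in> I" for i
          by (rule qalgD(3)[OF B]) (use a b w[OF that] \<open>x \<in> X\<close> \<open>y \<in> X\<close> in auto)
      qed
      finally show ?thesis .
    qed
    moreover have "E * (a * b) * E = a * b" using Ea by (intro corner_mult)
    ultimately show ?thesis by blast
  qed
  moreover have "qsc c * a \<in> ?S" if a: "a \<in> ?S" for a c
  proof -
    have "x * (qsc c * a) * y = qsc c * (x * a * y)" for x y by (rule qsc_assoc)
    then show ?thesis using a B by (auto simp: qalgD)
  qed
  moreover have "qstar a \<in> ?S" if a: "a \<in> ?S" for a
  proof -
    have "x * qstar a * qstar y \<in> B" if "x \<in> X" "y \<in> X" for x y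
      using qalgD(5)[OF B, of "y * a * qstar x"] a that by (simp add: mult.assoc)
    moreover have "E * qstar a * E = qstar a"
    proof -
      have "E * a * E = a" using a by blast
      from arg_cong[OF this, of qstar] show ?thesis by (simp add: E mult.assoc)
    qed
    ultimately show ?thesis by blast
  qed
  ultimately show ?thesis unfolding qalg_def using B by (auto simp: qalgD)
qed

text \<open>The relations satisfied by the images of the operators modulo compacts. E is the unit of
  a corner and need not be 1; \<open>z_pu\<close> is what remains of Condition A(p). The elements
  \<open>pu\<close> form a parameter with a defining equation so that an instance may present them
  as \<open>qq (SP \<alpha>)\<close>.\<close>

locale ck_family =
  fixes sE rE :: "'e::finite \<Rightarrow> 'v::finite"
    and U :: "'e \<Rightarrow> ('v, 'b) calq" and P :: "'v \<Rightarrow> ('v, 'b) calq"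
    and z E :: "('v, 'b) calq" and p :: nat
    and pu :: "('v, 'e) path \<Rightarrow> ('v, 'b) calq"
  defines "pu \<alpha> \<equiv> foldr (\<lambda>e x. U e * x) (snd \<alpha>) (P (fst \<alpha>))"
  assumes no_sinks: "\<forall>v. \<exists>e. sE e = v"
    and P_mult: "P v * P w = (if v = w then P v else 0)"
    and P_star [simp]: "qstar (P v) = P v"
    and E_sum: "(\<Sum>v\<in>UNIV. P v) = E"
    and UU: "qstar (U e) * U f = (if e = f then P (sE e) else 0)"
    and sum_U: "(\<Sum>e\<in>UNIV. U e * qstar (U e)) = E"
    and PU: "P v * U e = (if v = rE e then U e else 0)"
    and z_star: "qstar z = z" and zP: "z * P v = P v * z" and Ez: "E * z = z"
    and p_pos: "1 \<le> p"
    and z_pu: "\<mu> \<in> PK sE rE p \<Longrightarrow> z * pu \<mu> = pu \<mu> * z"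
begin

abbreviation "PP \<equiv> PK sE rE"

section \<open>Path elements and their relations\<close>

lemma E_mult: "E * P v = P v" "P v * E = P v"
  by (simp_all add: P_mult sum_distrib_left sum_distrib_right flip: E_sum)

lemma E_E [simp]: "E * E = E"
proof -
  have "E * E = (\<Sum>v\<in>UNIV. E * P v)" unfolding E_sum[symmetric] by (simp add: sum_distrib_left)
  then show ?thesis by (simp add: E_mult E_sum)
qed

lemma qstar_sum: "qstar (\<Sum>i\<in>A. f i) = (\<Sum>i\<in>A. qstar (f i))"
  by (induction A rule: infinite_finite_induct) auto

lemma E_star [simp]: "qstar E = E"
  by (simp add: qstar_sum flip: E_sum)

lemma EU: "E * U e = U e"
proof -
  have "E * U e = (\<Sum>v\<in>UNIV. P v * U e)" by (simp add: sum_distrib_right flip: E_sum)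
  then show ?thesis by (simp add: PU)
qed

text \<open>The source relation comes from the others: expand E U_e over the edges, and only the
  summand U_e (U_e* U_e) survives.\<close>

lemma UP: "U e * P v = (if v = sE e then U e else 0)"
proof -
  have 1: "U e * P (sE e) = U e"
  proof -
    have "U e = (\<Sum>f\<in>UNIV. U f * qstar (U f)) * U e" by (simp add: sum_U EU)
    also have "\<dots> = (\<Sum>f\<in>UNIV. if f = e then U e * P (sE e) else 0)"
      by (intro sum.cong[THEN trans[OF sum_distrib_right]]) (auto simp: mult.assoc UU)
    finally show ?thesis by simp
  qed
  have "U e * P v = U e * (P (sE e) * P v)" by (simp add: 1 flip: mult.assoc)
  then show ?thesis by (auto simp: P_mult 1)
qed

lemma pu_simps [simp]: "pu (v, []) = P v" "pu (v, e # es) = U e * pu (v, es)"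
  by (simp_all add: pu_def)

lemma pu_src: "pu \<alpha> * P w = (if w = psrc \<alpha> then pu \<alpha> else 0)"
proof -
  obtain v es where "\<alpha> = (v, es)" by fastforce
  moreover have "pu (v, es) * P w = (if w = v then pu (v, es) else 0)"
    by (induction es) (auto simp: P_mult mult.assoc)
  ultimately show ?thesis by simp
qed

lemma pu_rng: "is_path sE rE \<alpha> \<Longrightarrow> P w * pu \<alpha> = (if w = prng rE \<alpha> then pu \<alpha> else 0)"
proof -
  assume a: "is_path sE rE \<alpha>"
  obtain v es where "\<alpha> = (v, es)" by fastforce
  then show ?thesis using a by (cases es) (auto simp: P_mult PU simp flip: mult.assoc)
qed

lemma pu_rng_self: "is_path sE rE \<alpha> \<Longrightarrow> P (prng rE \<alpha>) * pu \<alpha> = pu \<alpha>"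
  by (simp add: pu_rng)

lemma pu_src_self: "pu \<alpha> * P (psrc \<alpha>) = pu \<alpha>"
  by (simp add: pu_src)

lemma pu_star_src: "P (psrc \<alpha>) * qstar (pu \<alpha>) = qstar (pu \<alpha>)"
  using arg_cong[OF pu_src_self[of \<alpha>], of qstar] by simp

lemma pu_star_rng: "is_path sE rE \<alpha> \<Longrightarrow> qstar (pu \<alpha>) * P (prng rE \<alpha>) = qstar (pu \<alpha>)"
  using arg_cong[OF pu_rng_self[of \<alpha>], of qstar] by simp

lemma pu_E: "is_path sE rE \<alpha> \<Longrightarrow> E * pu \<alpha> = pu \<alpha>" "pu \<alpha> * E = pu \<alpha>"
proof -
  show "E * pu \<alpha> = pu \<alpha>" if "is_path sE rE \<alpha>"
  proof -
    have "E * pu \<alpha> = (E * P (prng rE \<alpha>)) * pu \<alpha>" using pu_rng_self[OF that] by (simp add: mult.assoc)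
    then show ?thesis using pu_rng_self[OF that] by (simp add: E_mult)
  qed
  have "pu \<alpha> * E = pu \<alpha> * (P (psrc \<alpha>) * E)" by (simp add: pu_src_self flip: mult.assoc)
  then show "pu \<alpha> * E = pu \<alpha>" by (simp add: E_mult pu_src_self)
qed

lemma pu_star_E: "is_path sE rE \<alpha> \<Longrightarrow> qstar (pu \<alpha>) * E = qstar (pu \<alpha>)" "E * qstar (pu \<alpha>) = qstar (pu \<alpha>)"
  using arg_cong[OF pu_E(1)[of \<alpha>], of qstar] arg_cong[OF pu_E(2)[of \<alpha>], of qstar] by auto

lemma pu_pcat:
  assumes "is_path sE rE \<beta>" "psrc \<alpha> = prng rE \<beta>"
  shows "pu (pcat \<alpha> \<beta>) = pu \<alpha> * pu \<beta>"
proof -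
  obtain w es v bs where ab: "\<alpha> = (w, es)" "\<beta> = (v, bs)" by fastforce
  have "pu (v, es @ bs) = pu (w, es) * pu (v, bs)"
    by (induction es) (use assms ab pu_rng_self[of \<beta>] in \<open>auto simp: mult.assoc\<close>)
  then show ?thesis by (simp add: ab pcat_def)
qed

lemma pu_mult_zero: "is_path sE rE \<beta> \<Longrightarrow> psrc \<alpha> \<noteq> prng rE \<beta> \<Longrightarrow> pu \<alpha> * pu \<beta> = 0"
proof -
  assume a: "is_path sE rE \<beta>" "psrc \<alpha> \<noteq> prng rE \<beta>"
  have "pu \<alpha> * pu \<beta> = (pu \<alpha> * P (prng rE \<beta>)) * pu \<beta>" using pu_rng_self[OF a(1)] by (simp add: mult.assoc)
  then show ?thesis using a by (simp add: pu_src)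
qed

lemma pu_edge: "pu (sE e, [e]) = U e" "is_path sE rE (sE e, [e])" "prng rE (sE e, [e]) = rE e"
  by (auto simp: UP)

lemma U_pu_zero: "is_path sE rE \<alpha> \<Longrightarrow> sE e \<noteq> prng rE \<alpha> \<Longrightarrow> U e * pu \<alpha> = 0"
  using pu_mult_zero[of \<alpha> "(sE e, [e])"] by (simp add: UP)

lemma pu_star_pu:
  assumes "is_path sE rE \<alpha>" "is_path sE rE \<beta>" "plen \<alpha> = plen \<beta>"
  shows "qstar (pu \<alpha>) * pu \<beta> = (if \<alpha> = \<beta> then P (psrc \<alpha>) else 0)"
proof -
  obtain w es v bs where ab: "\<alpha> = (w, es)" "\<beta> = (v, bs)" by fastforce
  have "length es = length bs \<Longrightarrow> is_path sE rE (w, es) \<Longrightarrow> is_path sE rE (v, bs) \<Longrightarrow>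
     qstar (pu (w, es)) * pu (v, bs) = (if (w, es) = (v, bs) then P w else 0)"
  proof (induction es bs rule: list_induct2)
    case Nil then show ?case by (auto simp: P_mult)
  next
    case (Cons e es f bs)
    have "qstar (pu (w, e # es)) * pu (v, f # bs) = qstar (pu (w, es)) * (qstar (U e) * U f) * pu (v, bs)"
      by (simp add: mult.assoc)
    also have "\<dots> = (if e = f then qstar (pu (w, es)) * pu (v, bs) else 0)"
      using Cons.prems pu_star_rng[of "(w, es)"] by (auto simp: UU)
    finally show ?case using Cons by auto
  qed
  then show ?thesis using assms ab by simp
qed

lemma pu_star_pu_self: "is_path sE rE \<alpha> \<Longrightarrow> qstar (pu \<alpha>) * pu \<alpha> = P (psrc \<alpha>)"
  by (simp add: pu_star_pu)

lemma sum_pu: "(\<Sum>\<alpha>\<in>PP k. pu \<alpha> * qstar (pu \<alpha>)) = E"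
proof (induction k)
  case 0
  show ?case unfolding PK_0 by (subst sum.reindex) (auto simp: inj_on_def P_mult E_sum)
next
  case (Suc k)
  let ?A = "{(e, \<alpha>). \<alpha> \<in> PP k \<and> sE e = prng rE \<alpha>}"
  have "(\<Sum>\<alpha>\<in>PP (Suc k). pu \<alpha> * qstar (pu \<alpha>)) = (\<Sum>(e, \<alpha>)\<in>?A. U e * (pu \<alpha> * qstar (pu \<alpha>)) * qstar (U e))"
    unfolding PK_Suc
    by (subst sum.reindex) (auto simp: inj_on_def mult.assoc prod_eq_iff intro!: sum.cong)
  \<comment> \<open>Pairs that do not compose contribute zero, so the sum may run over a full
    product and factor.\<close>
  also have "\<dots> = (\<Sum>(e, \<alpha>)\<in>UNIV \<times> PP k. U e * (pu \<alpha> * qstar (pu \<alpha>)) * qstar (U e))"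
  proof (rule sum.mono_neutral_left)
    show "\<forall>i\<in>UNIV \<times> PP k - ?A. (case i of (e, \<alpha>) \<Rightarrow> U e * (pu \<alpha> * qstar (pu \<alpha>)) * qstar (U e)) = 0"
      by (auto simp: PK_def simp flip: mult.assoc) (metis U_pu_zero mult_zero_left)
  qed (auto simp: finite_PK)
  also have "\<dots> = (\<Sum>e\<in>UNIV. U e * (\<Sum>\<alpha>\<in>PP k. pu \<alpha> * qstar (pu \<alpha>)) * qstar (U e))"
    by (simp add: sum.cartesian_product[symmetric] sum_distrib_left sum_distrib_right)
  also have "\<dots> = E"
  proof -
    have "U e * E * qstar (U e) = U e * qstar (U e)" for e
      using pu_E(2)[of "(sE e, [e])"] by (simp add: UP)
    then show ?thesis by (simp add: Suc sum_U)
  qed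
  finally show ?case .
qed

text \<open>The matrix of x with respect to the orthogonal range projections of the paths of length
  k.\<close>

lemma corner_expand:
  assumes "E * x = x" "x * E = x"
  shows "x = (\<Sum>\<alpha>\<in>PP k. \<Sum>\<beta>\<in>PP k. pu \<alpha> * (qstar (pu \<alpha>) * x * pu \<beta>) * qstar (pu \<beta>))"
proof -
  have "x = (\<Sum>\<alpha>\<in>PP k. pu \<alpha> * qstar (pu \<alpha>)) * x * (\<Sum>\<beta>\<in>PP k. pu \<beta> * qstar (pu \<beta>))"
    using assms by (simp add: sum_pu)
  also have "\<dots> = (\<Sum>\<alpha>\<in>PP k. \<Sum>\<beta>\<in>PP k. pu \<alpha> * (qstar (pu \<alpha>) * x * pu \<beta>) * qstar (pu \<beta>))"
    unfolding sum_distrib_right sum_distrib_left by (rule sum.swap[THEN trans]) (simp add: mult.assoc)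
  finally show ?thesis .
qed

section \<open>Powers of z and their diagonality\<close>

definition zp :: "nat \<Rightarrow> ('v, 'b) calq" where "zp l = E * z ^ l"

lemma zE: "z * E = z"
  using arg_cong[OF Ez, of qstar] by (simp add: z_star)

text \<open>The factor E in \<open>zp\<close> is there for this case: the zeroth power has to be the
  unit of the corner and not 1.\<close>

lemma zp_0 [simp]: "zp 0 = E" by (simp add: zp_def)
lemma zp_Suc: "zp (Suc l) = z * zp l"
  by (simp add: zp_def Ez zE flip: mult.assoc)
lemma zp_E: "E * zp l = zp l" by (simp add: zp_def flip: mult.assoc)

lemma zp_E': "zp l * E = zp l"
  by (induction l) (auto simp: zp_Suc mult.assoc)

lemma zp_P: "zp l * P v = P v * zp l"
proof (induction l)
  case (Suc l)
  have "zp (Suc l) * P v = (z * P v) * zp l" by (simp add: zp_Suc Suc mult.assoc)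
  then show ?case by (simp add: zP zp_Suc mult.assoc)
qed (simp add: E_mult)

lemma zp_pu: "\<mu> \<in> PP p \<Longrightarrow> zp l * pu \<mu> = pu \<mu> * zp l"
proof (induction l)
  case 0 then show ?case by (simp add: pu_E PK_def)
next
  case (Suc l)
  then have "zp (Suc l) * pu \<mu> = (z * pu \<mu>) * zp l" by (simp add: zp_Suc mult.assoc)
  then show ?case using Suc.prems by (simp add: z_pu zp_Suc mult.assoc)
qed

text \<open>Condition A(p) in the form used below: after inserting E over paths of length p, the
  power of z slides through \<open>u_\<gamma>\<close> and ends up between it and its
  adjoint.\<close>

lemma zp_expand: "zp l = (\<Sum>\<gamma>\<in>PP p. pu \<gamma> * zp l * qstar (pu \<gamma>))"
proof -
  have "zp l = zp l * (\<Sum>\<gamma>\<in>PP p. pu \<gamma> * qstar (pu \<gamma>))" by (simp add: sum_pu zp_E')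
  also have "\<dots> = (\<Sum>\<gamma>\<in>PP p. zp l * pu \<gamma> * qstar (pu \<gamma>))" by (simp add: sum_distrib_left mult.assoc)
  finally show ?thesis by (simp add: zp_pu)
qed

text \<open>Expanding \<open>z\<close> over paths of length \<open>p\<close> shows that it is diagonal on shorter paths.\<close>

lemma zp_diagonal:
  assumes "is_path sE rE \<gamma>" "is_path sE rE \<gamma>'" "plen \<gamma> = plen \<gamma>'" "plen \<gamma> \<le> p" "\<gamma> \<noteq> \<gamma>'"
  shows "qstar (pu \<gamma>) * zp l * pu \<gamma>' = 0"
proof -
  have "qstar (pu \<gamma>) * pu \<kappa> = 0 \<or> qstar (pu \<kappa>) * pu \<gamma>' = 0" if \<kappa>: "\<kappa> \<in> PP p" for \<kappa>
  proof -
    obtain \<kappa>1 \<kappa>2 where k: "\<kappa> = pcat \<kappa>1 \<kappa>2" "is_path sE rE \<kappa>1" "is_path sE rE \<kappa>2" "psrc \<kappa>1 = prng rE \<kappa>2" "plen \<kappa>1 = plen \<gamma>"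
    proof -
      have "is_path sE rE \<kappa>" "plen \<gamma> \<le> plen \<kappa>" using \<kappa> assms(4) by (auto simp: PK_def)
      then show ?thesis using path_split that by metis
    qed
    have pk: "pu \<kappa> = pu \<kappa>1 * pu \<kappa>2" using k by (simp add: pu_pcat)
    show ?thesis
    proof (cases "\<kappa>1 = \<gamma>")
      case False
      then have "qstar (pu \<gamma>) * pu \<kappa>1 = 0" using k assms pu_star_pu by auto
      then show ?thesis by (simp add: pk flip: mult.assoc)
    next
      case True
      then have "qstar (pu \<kappa>1) * pu \<gamma>' = 0" using k assms pu_star_pu by auto
      then show ?thesis by (simp add: pk mult.assoc)
    qed
  qed
  moreover have "qstar (pu \<gamma>) * (pu \<kappa> * zp l * qstar (pu \<kappa>)) * pu \<gamma>' =
      (qstar (pu \<gamma>) * pu \<kappa>) * zp l * (qstar (pu \<kappa>) * pu \<gamma>')" for \<kappa> by (simp add: mult.assoc)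
  ultimately have "qstar (pu \<gamma>) * (pu \<kappa> * zp l * qstar (pu \<kappa>)) * pu \<gamma>' = 0" if "\<kappa> \<in> PP p" for \<kappa>
    using that by (metis mult_zero_left mult_zero_right)
  then show ?thesis
    by (subst zp_expand) (simp add: sum_distrib_left sum_distrib_right)
qed

section \<open>The algebras of the levels, their inclusions and compressions\<close>

definition gens :: "nat \<Rightarrow> ('v, 'b) calq set" where
  "gens n = {pu \<alpha> * zp l * qstar (pu \<beta>) | \<alpha> \<beta> l. is_path sE rE \<alpha> \<and> is_path sE rE \<beta> \<and>
     n * p \<le> plen \<alpha> \<and> plen \<alpha> = plen \<beta> \<and> plen \<alpha> < (n + 1) * p \<and> psrc \<alpha> = psrc \<beta>}"

definition C :: "nat \<Rightarrow> ('v, 'b) calq set" where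
  "C n = \<Inter>{B. qalg B \<and> gens n \<subseteq> B}"

lemma qalg_C: "qalg (C n)"
proof -
  have "closed (C n)" unfolding C_def by (intro closed_Inter) (auto simp: qalgD)
  then show ?thesis unfolding qalg_def by (auto simp: C_def qalgD)
qed

lemma gens_C: "gens n \<subseteq> C n" by (auto simp: C_def)

lemma C_induct: "a \<in> C n \<Longrightarrow> qalg B \<Longrightarrow> gens n \<subseteq> B \<Longrightarrow> a \<in> B" by (auto simp: C_def)

lemma gen_in_C:
  assumes "is_path sE rE \<alpha>" "is_path sE rE \<beta>" "n * p \<le> plen \<alpha>" "plen \<alpha> = plen \<beta>" "plen \<alpha> < (n + 1) * p" "psrc \<alpha> = psrc \<beta>"
  shows "pu \<alpha> * zp l * qstar (pu \<beta>) \<in> C n"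
  using assms gens_C[of n] unfolding gens_def by blast

lemma gen_in_C_0:
  assumes "is_path sE rE \<alpha>" "is_path sE rE \<beta>" "n * p \<le> plen \<alpha>" "plen \<alpha> = plen \<beta>" "plen \<alpha> < (n + 1) * p" "psrc \<alpha> = psrc \<beta>"
  shows "pu \<alpha> * qstar (pu \<beta>) \<in> C n"
  using gen_in_C[OF assms, of 0] by (simp add: pu_E)

lemma gen_expand: "pu \<alpha> * zp l * qstar (pu \<beta>) = (\<Sum>\<gamma>\<in>PP p. (pu \<alpha> * pu \<gamma>) * zp l * qstar (pu \<beta> * pu \<gamma>))"
  by (subst zp_expand) (simp add: sum_distrib_left sum_distrib_right mult.assoc)

text \<open>Expanding the power of z over paths \<gamma> of length p lengthens both \<alpha> and
  \<beta> by exactly p, which is the difference between consecutive levels.\<close>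

lemma C_mono_Suc: "C n \<subseteq> C (Suc n)"
proof
  fix a assume "a \<in> C n"
  then show "a \<in> C (Suc n)"
  proof (rule C_induct[OF _ qalg_C], intro subsetI)
    fix g assume "g \<in> gens n"
    then obtain \<alpha> \<beta> l where g: "g = pu \<alpha> * zp l * qstar (pu \<beta>)" "is_path sE rE \<alpha>" "is_path sE rE \<beta>"
      "n * p \<le> plen \<alpha>" "plen \<alpha> = plen \<beta>" "plen \<alpha> < (n + 1) * p" "psrc \<alpha> = psrc \<beta>"
      unfolding gens_def by blast
    show "g \<in> C (Suc n)" unfolding g(1) gen_expand
    proof (rule qalg_sum[OF qalg_C])
      fix \<gamma> assume \<gamma>: "\<gamma> \<in> PP p"
      show "pu \<alpha> * pu \<gamma> * zp l * qstar (pu \<beta> * pu \<gamma>) \<in> C (Suc n)"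
      proof (cases "psrc \<alpha> = prng rE \<gamma>")
        case True
        then have "pu (pcat \<alpha> \<gamma>) * zp l * qstar (pu (pcat \<beta> \<gamma>)) \<in> C (Suc n)"
          using g \<gamma> by (intro gen_in_C) (auto simp: PK_def intro!: is_path_pcat)
        then show ?thesis using True g \<gamma> by (simp add: pu_pcat PK_def)
      next
        case False
        then show ?thesis using \<gamma> qalgD(1)[OF qalg_C] by (simp add: pu_mult_zero PK_def)
      qed
    qed
  qed
qed

lemma C_mono: "m \<le> n \<Longrightarrow> C m \<subseteq> C n"
  by (rule lift_Suc_mono_le[of C]) (rule C_mono_Suc)

lemma C_corner: "a \<in> C n \<Longrightarrow> E * a * E = a"
proof -
  assume "a \<in> C n"
  \<comment> \<open>With B everything and X = {E} the compression condition is void, so this says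
    that the corner itself is a closed star-algebra.\<close>
  moreover have "qalg {a. E * a * E = a \<and> (\<forall>x\<in>{E}. \<forall>y\<in>{E}. x * a * qstar y \<in> (UNIV :: ('v, 'b) calq set))}"
    by (rule qalg_compress[where I = "{()}" and w = "\<lambda>_. E"]) (auto simp: qalg_def)
  moreover have "gens n \<subseteq> {a. E * a * E = a \<and> (\<forall>x\<in>{E}. \<forall>y\<in>{E}. x * a * qstar y \<in> (UNIV :: ('v, 'b) calq set))}"
  proof
    fix g assume "g \<in> gens n"
    then obtain \<alpha> \<beta> l where g: "g = pu \<alpha> * zp l * qstar (pu \<beta>)" "is_path sE rE \<alpha>" "is_path sE rE \<beta>"
      unfolding gens_def by blast
    have "E * g * E = (E * pu \<alpha>) * zp l * (qstar (pu \<beta>) * E)" by (simp add: g(1) mult.assoc)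
    then show "g \<in> {a. E * a * E = a \<and> (\<forall>x\<in>{E}. \<forall>y\<in>{E}. x * a * qstar y \<in> (UNIV :: ('v, 'b) calq set))}"
      using g by (simp add: pu_E pu_star_E)
  qed
  ultimately show ?thesis using C_induct by blast
qed

lemma gens_corner: "g \<in> gens n \<Longrightarrow> E * g * E = g"
  using C_corner gens_C by blast

lemma C_E: "a \<in> C n \<Longrightarrow> E * a = a" "a \<in> C n \<Longrightarrow> a * E = a"
  using C_corner corner_sides[OF E_E] by auto

lemma P_in_C: "P v \<in> C n"
proof -
  have "P v \<in> C 0"
    using gen_in_C_0[of "(v, [])" "(v, [])" 0] p_pos by (simp add: P_mult)
  then show ?thesis using C_mono[of 0 n] by auto
qed

lemma E_in_C: "E \<in> C n"
  using qalg_sum[OF qalg_C, of UNIV P n] P_in_C by (simp add: E_sum)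

lemma z_in_C: "z \<in> C n"
proof -
  have "P v * zp 1 * P v \<in> C 0" for v
    using gen_in_C[of "(v, [])" "(v, [])" 0 1] p_pos by simp
  then have "(\<Sum>v\<in>UNIV. P v * zp 1 * P v) \<in> C 0" by (intro qalg_sum[OF qalg_C])
  moreover have "(\<Sum>v\<in>UNIV. P v * zp 1 * P v) = z"
  proof -
    have "P v * zp 1 * P v = P v * z" for v
    proof -
      have "P v * zp 1 * P v = P v * P v * zp 1" by (simp add: zp_P mult.assoc)
      then show ?thesis by (simp add: P_mult zp_Suc zE)
    qed
    then show ?thesis by (simp add: E_sum Ez flip: sum_distrib_right)
  qed
  ultimately show ?thesis using C_mono[of 0 n] by auto
qed

text \<open>An extra edge raises the length by one: the generator either stays in level n or just
  crosses into level n+1, and C_n is contained in C_(n+1).\<close>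

lemma U_C_Ustar: "a \<in> C n \<Longrightarrow> U e * a * qstar (U f) \<in> C (Suc n)"
proof -
  assume a: "a \<in> C n"
  \<comment> \<open>One edge per source vertex suffices for the insertion: the initial projections
    U_(g v)* U_(g v) are the P_v, which sum to E.\<close>
  obtain g where g: "\<And>v. sE (g v) = v" using no_sinks by metis
  have "qalg {a. E * a * E = a \<and> (\<forall>x\<in>range U. \<forall>y\<in>range U. x * a * qstar y \<in> C (Suc n))}"
    by (rule qalg_compress[where I = UNIV and w = "\<lambda>v. U (g v)"]) (auto simp: qalg_C UU g E_sum)
  moreover have "gens n \<subseteq> {a. E * a * E = a \<and> (\<forall>x\<in>range U. \<forall>y\<in>range U. x * a * qstar y \<in> C (Suc n))}"
  proof
    fix b assume b: "b \<in> gens n"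
    then obtain \<alpha> \<beta> l where g: "b = pu \<alpha> * zp l * qstar (pu \<beta>)" "is_path sE rE \<alpha>" "is_path sE rE \<beta>"
      "n * p \<le> plen \<alpha>" "plen \<alpha> = plen \<beta>" "plen \<alpha> < (n + 1) * p" "psrc \<alpha> = psrc \<beta>"
      unfolding gens_def by blast
    have "U e * b * qstar (U f) \<in> C (Suc n)" for e f
    proof (cases "sE e = prng rE \<alpha> \<and> sE f = prng rE \<beta>")
      case True
      obtain v es bs where ab: "\<alpha> = (v, es)" "\<beta> = (v, bs)" using g(7) by (metis psrc_def prod.collapse)
      have "pu (v, e # es) * zp l * qstar (pu (v, f # bs)) \<in> C n \<union> C (Suc n)"
      proof (cases "Suc (length es) < (n + 1) * p")
        case T: True
        have "pu (v, e # es) * zp l * qstar (pu (v, f # bs)) \<in> C n"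
          by (rule gen_in_C) (use g ab True T in auto)
        then show ?thesis by blast
      next
        case F: False
        have "pu (v, e # es) * zp l * qstar (pu (v, f # bs)) \<in> C (Suc n)"
          by (rule gen_in_C) (use g ab True F p_pos in auto)
        then show ?thesis by blast
      qed
      then show ?thesis using C_mono_Suc by (auto simp: g(1) ab mult.assoc)
    next
      case False
      then have "U e * pu \<alpha> = 0 \<or> U f * pu \<beta> = 0" using U_pu_zero g by blast
      moreover have "U e * b * qstar (U f) = (U e * pu \<alpha>) * zp l * qstar (U f * pu \<beta>)"
        by (simp add: g(1) mult.assoc)
      ultimately have "U e * b * qstar (U f) = 0" by (metis mult_zero_left mult_zero_right qstar_simps(4))
      then show ?thesis using qalgD(1)[OF qalg_C] by simp
    qed
    then show "b \<in> {a. E * a * E = a \<and> (\<forall>x\<in>range U. \<forall>y\<in>range U. x * a * qstar y \<in> C (Suc n))}"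
      using gens_corner[OF b] by auto
  qed
  ultimately show ?thesis using C_induct[OF a] by blast
qed

text \<open>Stripping an edge shortens the paths by one, which leaves the level only from its
  smallest length np. There the generator is first lengthened by p, and the length np+p-1 after
  stripping is again admissible; this is why \<open>strip\<close> allows length (n+1)p.\<close>

lemma Ustar_C_U: "a \<in> C n \<Longrightarrow> qstar (U e) * a * U f \<in> C n"
proof -
  assume a: "a \<in> C n"
  let ?X = "range (\<lambda>e. qstar (U e))"
  have strip: "qstar (U e) * (pu \<alpha> * zp l * qstar (pu \<beta>)) * U f \<in> C n"
    if g: "is_path sE rE \<alpha>" "is_path sE rE \<beta>" "n * p < plen \<alpha>" "plen \<alpha> = plen \<beta>" "plen \<alpha> \<le> (n + 1) * p" "psrc \<alpha> = psrc \<beta>"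
    for \<alpha> \<beta> l e f
  proof -
    obtain v e' es f' bs where ab: "\<alpha> = (v, e' # es)" "\<beta> = (v, f' # bs)"
    proof -
      have "snd \<alpha> \<noteq> []" "snd \<beta> \<noteq> []" using g(3,4) by (auto simp: plen_def)
      then show ?thesis using that g(6) by (metis psrc_def prod.collapse neq_Nil_conv)
    qed
    have "qstar (U e) * (pu \<alpha> * zp l * qstar (pu \<beta>)) * U f
       = (qstar (U e) * U e') * (pu (v, es) * zp l * qstar (pu (v, bs))) * (qstar (U f') * U f)"
      by (simp add: ab mult.assoc)
    also have "\<dots> \<in> C n"
    proof (cases "e = e' \<and> f = f'")
      case True
      then have "(qstar (U e) * U e') * (pu (v, es) * zp l * qstar (pu (v, bs))) * (qstar (U f') * U f)
        = (P (sE e) * pu (v, es)) * zp l * (qstar (pu (v, bs)) * P (sE f))" by (simp add: UU mult.assoc)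
      also have "\<dots> = pu (v, es) * zp l * qstar (pu (v, bs))"
        using g ab True pu_rng_self[of "(v, es)"] pu_star_rng[of "(v, bs)"] by simp
      also have "\<dots> \<in> C n" by (rule gen_in_C) (use g ab in auto)
      finally show ?thesis .
    next
      case False
      then show ?thesis using qalgD(1)[OF qalg_C] by (auto simp: UU)
    qed
    finally show ?thesis .
  qed
  have "qalg {a. E * a * E = a \<and> (\<forall>x\<in>?X. \<forall>y\<in>?X. x * a * qstar y \<in> C n)}"
    by (rule qalg_compress[where I = UNIV and w = "\<lambda>e. qstar (U e)"]) (auto simp: qalg_C sum_U)
  moreover have "gens n \<subseteq> {a. E * a * E = a \<and> (\<forall>x\<in>?X. \<forall>y\<in>?X. x * a * qstar y \<in> C n)}"
  proof
    fix b assume b: "b \<in> gens n"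
    then obtain \<alpha> \<beta> l where g: "b = pu \<alpha> * zp l * qstar (pu \<beta>)" "is_path sE rE \<alpha>" "is_path sE rE \<beta>"
      "n * p \<le> plen \<alpha>" "plen \<alpha> = plen \<beta>" "plen \<alpha> < (n + 1) * p" "psrc \<alpha> = psrc \<beta>"
      unfolding gens_def by blast
    have "qstar (U e) * b * U f \<in> C n" for e f
    proof (cases "plen \<alpha> = n * p")
      case False
      then show ?thesis unfolding g(1) using g by (intro strip) auto
    next
      case True
      have "qstar (U e) * (\<Sum>\<gamma>\<in>PP p. (pu \<alpha> * pu \<gamma>) * zp l * qstar (pu \<beta> * pu \<gamma>)) * U f \<in> C n"
        unfolding sum_distrib_left sum_distrib_right
      proof (rule qalg_sum[OF qalg_C])
        fix \<gamma> assume \<gamma>: "\<gamma> \<in> PP p"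
        show "qstar (U e) * ((pu \<alpha> * pu \<gamma>) * zp l * qstar (pu \<beta> * pu \<gamma>)) * U f \<in> C n"
        proof (cases "psrc \<alpha> = prng rE \<gamma>")
          case T: True
          have "qstar (U e) * (pu (pcat \<alpha> \<gamma>) * zp l * qstar (pu (pcat \<beta> \<gamma>))) * U f \<in> C n"
            using g \<gamma> T True p_pos by (intro strip) (auto simp: PK_def intro!: is_path_pcat)
          then show ?thesis using T g \<gamma> by (simp add: pu_pcat PK_def)
        next
          case False
          then show ?thesis using \<gamma> qalgD(1)[OF qalg_C] by (simp add: pu_mult_zero PK_def)
        qed
      qed
      then show ?thesis unfolding g(1) gen_expand .
    qed
    then show "b \<in> {a. E * a * E = a \<and> (\<forall>x\<in>?X. \<forall>y\<in>?X. x * a * qstar y \<in> C n)}"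
      using gens_corner[OF b] by auto
  qed
  ultimately show ?thesis using C_induct[OF a] by force
qed

text \<open>Since np+p-1 is the greatest length in level n, the compressing paths absorb \<alpha>
  and \<beta> completely. What is left is z^l between two tails of equal length below p, and
  diagonality of z forces the tails to coincide.\<close>

lemma compress_gen:
  assumes "g \<in> gens n" "\<mu>1 \<in> PP (n * p + p - 1)" "\<mu>2 \<in> PP (n * p + p - 1)"
  shows "qstar (pu \<mu>1) * g * pu \<mu>2 = 0 \<or>
    (\<exists>\<gamma> l. is_path sE rE \<gamma> \<and> plen \<gamma> < p \<and> psrc \<gamma> = psrc \<mu>1 \<and> psrc \<gamma> = psrc \<mu>2 \<and>
       qstar (pu \<mu>1) * g * pu \<mu>2 = qstar (pu \<gamma>) * zp l * pu \<gamma>)"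
proof -
  obtain \<alpha> \<beta> l where g: "g = pu \<alpha> * zp l * qstar (pu \<beta>)" "is_path sE rE \<alpha>" "is_path sE rE \<beta>"
    "n * p \<le> plen \<alpha>" "plen \<alpha> = plen \<beta>" "plen \<alpha> < (n + 1) * p" "psrc \<alpha> = psrc \<beta>"
    using assms(1) unfolding gens_def by blast
  have le: "plen \<alpha> \<le> n * p + p - 1" "n * p + p - 1 - plen \<alpha> < p" using g p_pos by auto
  have one: "qstar (pu \<mu>) * pu \<alpha>' = 0 \<or> (\<exists>\<gamma>. is_path sE rE \<gamma> \<and> plen \<gamma> = n * p + p - 1 - plen \<alpha> \<and>
      psrc \<gamma> = psrc \<mu> \<and> qstar (pu \<mu>) * pu \<alpha>' = qstar (pu \<gamma>))"
    if "\<mu> \<in> PP (n * p + p - 1)" "is_path sE rE \<alpha>'" "plen \<alpha>' = plen \<alpha>" for \<mu> \<alpha>'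
  proof -
    obtain \<mu>1 \<gamma> where m: "\<mu> = pcat \<mu>1 \<gamma>" "is_path sE rE \<mu>1" "is_path sE rE \<gamma>" "psrc \<mu>1 = prng rE \<gamma>"
      "plen \<mu>1 = plen \<alpha>" "plen \<gamma> = plen \<mu> - plen \<alpha>"
    proof -
      have "is_path sE rE \<mu>" "plen \<alpha> \<le> plen \<mu>" using \<open>\<mu> \<in> PP _\<close> le by (auto simp: PK_def)
      then show ?thesis using path_split that by metis
    qed
    have "qstar (pu \<mu>) * pu \<alpha>' = qstar (pu \<gamma>) * (qstar (pu \<mu>1) * pu \<alpha>')"
      using m by (simp add: pu_pcat mult.assoc)
    also have "\<dots> = (if \<mu>1 = \<alpha>' then qstar (pu \<gamma>) else 0)"
      using m that pu_star_rng[of \<gamma>] by (auto simp: pu_star_pu)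
    finally have "qstar (pu \<mu>) * pu \<alpha>' = (if \<mu>1 = \<alpha>' then qstar (pu \<gamma>) else 0)" .
    moreover have "plen \<gamma> = n * p + p - 1 - plen \<alpha>" "psrc \<gamma> = psrc \<mu>" using m that by (auto simp: PK_def)
    ultimately show ?thesis using m(3) by metis
  qed
  have eq: "qstar (pu \<mu>1) * g * pu \<mu>2 = (qstar (pu \<mu>1) * pu \<alpha>) * zp l * qstar (qstar (pu \<mu>2) * pu \<beta>)"
    by (simp add: g(1) mult.assoc)
  show ?thesis
  proof (cases "qstar (pu \<mu>1) * pu \<alpha> = 0 \<or> qstar (pu \<mu>2) * pu \<beta> = 0")
    case True
    then have "qstar (pu \<mu>1) * g * pu \<mu>2 = 0" unfolding eq by (metis mult_zero_left mult_zero_right qstar_simps(4))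
    then show ?thesis by blast
  next
    case False
    obtain \<gamma>1 where 1: "is_path sE rE \<gamma>1" "plen \<gamma>1 = n * p + p - 1 - plen \<alpha>" "psrc \<gamma>1 = psrc \<mu>1"
      "qstar (pu \<mu>1) * pu \<alpha> = qstar (pu \<gamma>1)"
      using one[OF assms(2) g(2)] False by auto
    obtain \<gamma>2 where 2: "is_path sE rE \<gamma>2" "plen \<gamma>2 = n * p + p - 1 - plen \<alpha>" "psrc \<gamma>2 = psrc \<mu>2"
      "qstar (pu \<mu>2) * pu \<beta> = qstar (pu \<gamma>2)"
      using one[OF assms(3) g(3)] g False by auto
    have "qstar (pu \<mu>1) * g * pu \<mu>2 = qstar (pu \<gamma>1) * zp l * pu \<gamma>2" unfolding eq 1(4) 2(4) by simp
    moreover have "plen \<gamma>1 < p" "plen \<gamma>1 = plen \<gamma>2" using 1 2 le by auto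
    ultimately show ?thesis
      using zp_diagonal[OF 1(1) 2(1), of l] 1(1,3) 2(3) by (metis less_imp_le)
  qed
qed

text \<open>For a generator the surviving tail has one source, shared by both compressing paths. The
  vanishing passes to products because, with E inserted over paths \<mu>, the source of \<mu>
  differs from at least one of two distinct outer sources: elements of C_n are block diagonal by
  source.\<close>

lemma compress_zero:
  assumes "a \<in> C n" "\<mu>1 \<in> PP (n * p + p - 1)" "\<mu>2 \<in> PP (n * p + p - 1)" "psrc \<mu>1 \<noteq> psrc \<mu>2"
  shows "qstar (pu \<mu>1) * a * pu \<mu>2 = 0"
proof -
  let ?L = "n * p + p - 1"
  define S where "S = {a. E * a * E = a \<and> (\<forall>\<mu>1\<in>PP ?L. \<forall>\<mu>2\<in>PP ?L. psrc \<mu>1 \<noteq> psrc \<mu>2 \<longrightarrow> qstar (pu \<mu>1) * a * pu \<mu>2 \<in> {0})}"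
  have "S = {a. E * a * E = a} \<inter> (\<Inter>\<mu>1\<in>PP ?L. \<Inter>\<mu>2\<in>{\<mu>2\<in>PP ?L. psrc \<mu>1 \<noteq> psrc \<mu>2}. {a. qstar (pu \<mu>1) * a * pu \<mu>2 \<in> {0}})"
    unfolding S_def by auto
  then have cl: "closed S"
    by (simp only:) (intro closed_Int closed_INT ballI closed_corner closed_calq_mult closed_calq_0)
  have mult: "a * b \<in> S" if a: "a \<in> S" and b: "b \<in> S" for a b
  proof -
    have ab: "E * a * E = a" "E * b * E = b" using a b by (auto simp: S_def)
    then have Ea: "E * a = a" "b * E = b" "a * E = a" using corner_sides[OF E_E] by auto
    have "qstar (pu \<mu>1) * (a * b) * pu \<mu>2 = 0" if "\<mu>1 \<in> PP ?L" "\<mu>2 \<in> PP ?L" "psrc \<mu>1 \<noteq> psrc \<mu>2" for \<mu>1 \<mu>2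
    proof -
      have "qstar (pu \<mu>1) * (a * b) * pu \<mu>2 = qstar (pu \<mu>1) * (a * (\<Sum>\<mu>\<in>PP ?L. pu \<mu> * qstar (pu \<mu>)) * b) * pu \<mu>2"
        by (simp add: sum_pu Ea)
      also have "\<dots> = (\<Sum>\<mu>\<in>PP ?L. (qstar (pu \<mu>1) * a * pu \<mu>) * (qstar (pu \<mu>) * b * pu \<mu>2))"
        by (simp add: sum_distrib_left sum_distrib_right mult.assoc)
      also have "\<dots> = 0"
      proof (rule sum.neutral, rule ballI)
        fix \<mu> assume "\<mu> \<in> PP ?L"
        then have "qstar (pu \<mu>1) * a * pu \<mu> = 0 \<or> qstar (pu \<mu>) * b * pu \<mu>2 = 0"
          using a b that unfolding S_def by (cases "psrc \<mu>1 = psrc \<mu>") auto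
        then show "(qstar (pu \<mu>1) * a * pu \<mu>) * (qstar (pu \<mu>) * b * pu \<mu>2) = 0" by auto
      qed
      finally show ?thesis .
    qed
    moreover have "E * (a * b) * E = a * b" using Ea by (intro corner_mult)
    ultimately show ?thesis by (auto simp: S_def)
  qed
  have "x * (qsc c * a) * y = qsc c * (x * a * y)" for x y a :: "('v, 'b) calq" and c by (rule qsc_assoc)
  then have scl: "qsc c * a \<in> S" if "a \<in> S" for a c using that by (auto simp: S_def)
  have str: "qstar a \<in> S" if "a \<in> S" for a
  proof -
    have "qstar (pu \<mu>1) * qstar a * pu \<mu>2 = 0" if "\<mu>1 \<in> PP ?L" "\<mu>2 \<in> PP ?L" "psrc \<mu>1 \<noteq> psrc \<mu>2" for \<mu>1 \<mu>2
    proof -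
      have "qstar (pu \<mu>2) * a * pu \<mu>1 = 0" using \<open>a \<in> S\<close> that by (auto simp: S_def)
      from arg_cong[OF this, of qstar] show ?thesis by (simp add: mult.assoc)
    qed
    moreover have "E * qstar a * E = qstar a"
    proof -
      have "E * a * E = a" using \<open>a \<in> S\<close> by (simp add: S_def)
      from arg_cong[OF this, of qstar] show ?thesis by (simp add: mult.assoc)
    qed
    ultimately show ?thesis by (auto simp: S_def)
  qed
  have "qalg S"
    unfolding qalg_def using cl mult scl str by (auto simp: S_def algebra_simps)
  moreover have "gens n \<subseteq> S"
    using compress_gen[of _ n] C_corner gens_C unfolding S_def by fastforce
  ultimately show ?thesis using C_induct[OF assms(1)] assms(2-4) by (auto simp: S_def)
qed

text \<open>Compressed generators have the form \<open>u_\<gamma>* z^l u_\<gamma>\<close> with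
  \<gamma> shorter than p, without reference to n. Such an element is rebuilt at level m as a
  product of three generators of C_m, using an auxiliary path \<kappa> in front of \<gamma>.\<close>

lemma transport:
  assumes "a \<in> C n" "\<mu>1 \<in> PP (n * p + p - 1)" "\<mu>2 \<in> PP (n * p + p - 1)"
    "\<nu>1 \<in> PP (m * p + p - 1)" "\<nu>2 \<in> PP (m * p + p - 1)" "psrc \<nu>1 = psrc \<mu>1" "psrc \<nu>2 = psrc \<mu>2"
  shows "pu \<nu>1 * (qstar (pu \<mu>1) * a * pu \<mu>2) * qstar (pu \<nu>2) \<in> C m"
proof -
  let ?L = "n * p + p - 1" and ?M = "m * p + p - 1"
  define X where "X = {pu \<nu> * qstar (pu \<mu>) | \<nu> \<mu>. \<nu> \<in> PP ?M \<and> \<mu> \<in> PP ?L \<and> psrc \<nu> = psrc \<mu>}"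
  obtain h where h: "\<And>v. h v \<in> PP ?M" "\<And>v. psrc (h v) = v" using PK_exists[OF no_sinks] by metis
  have "qalg {a. E * a * E = a \<and> (\<forall>x\<in>X. \<forall>y\<in>X. x * a * qstar y \<in> C m)}"
  proof (rule qalg_compress[where I = "PP ?L" and w = "\<lambda>\<mu>. pu (h (psrc \<mu>)) * qstar (pu \<mu>)"])
    have "qstar (pu (h (psrc \<mu>)) * qstar (pu \<mu>)) * (pu (h (psrc \<mu>)) * qstar (pu \<mu>)) = pu \<mu> * qstar (pu \<mu>)" for \<mu>
    proof -
      have "qstar (pu (h (psrc \<mu>)) * qstar (pu \<mu>)) * (pu (h (psrc \<mu>)) * qstar (pu \<mu>))
        = pu \<mu> * (qstar (pu (h (psrc \<mu>))) * pu (h (psrc \<mu>))) * qstar (pu \<mu>)" by (simp add: mult.assoc)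
      then show ?thesis using h by (simp add: pu_star_pu_self PK_def pu_src)
    qed
    then show "(\<Sum>\<mu>\<in>PP ?L. qstar (pu (h (psrc \<mu>)) * qstar (pu \<mu>)) * (pu (h (psrc \<mu>)) * qstar (pu \<mu>))) = E"
      by (simp add: sum_pu)
    show "pu (h (psrc \<mu>)) * qstar (pu \<mu>) \<in> X" if "\<mu> \<in> PP ?L" for \<mu>
      unfolding X_def using h that by blast
  qed (auto simp: qalg_C)
  moreover have "gens n \<subseteq> {a. E * a * E = a \<and> (\<forall>x\<in>X. \<forall>y\<in>X. x * a * qstar y \<in> C m)}"
  proof
    fix g assume g: "g \<in> gens n"
    have "x * g * qstar y \<in> C m" if xy: "x \<in> X" "y \<in> X" for x y
    proof -
      obtain \<mu>1 \<nu>1 where x: "x = pu \<nu>1 * qstar (pu \<mu>1)" "\<nu>1 \<in> PP ?M" "\<mu>1 \<in> PP ?L" "psrc \<nu>1 = psrc \<mu>1"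
        using xy unfolding X_def by blast
      obtain \<mu>2 \<nu>2 where y: "y = pu \<nu>2 * qstar (pu \<mu>2)" "\<nu>2 \<in> PP ?M" "\<mu>2 \<in> PP ?L" "psrc \<nu>2 = psrc \<mu>2"
        using xy unfolding X_def by blast
      have eq: "x * g * qstar y = pu \<nu>1 * (qstar (pu \<mu>1) * g * pu \<mu>2) * qstar (pu \<nu>2)"
        by (simp add: x(1) y(1) mult.assoc)
      show ?thesis
        using compress_gen[OF g x(3) y(3)]
      proof
        assume "qstar (pu \<mu>1) * g * pu \<mu>2 = 0"
        then show ?thesis unfolding eq using qalgD(1)[OF qalg_C] by simp
      next
        assume "\<exists>\<gamma> l. is_path sE rE \<gamma> \<and> plen \<gamma> < p \<and> psrc \<gamma> = psrc \<mu>1 \<and> psrc \<gamma> = psrc \<mu>2 \<and>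
          qstar (pu \<mu>1) * g * pu \<mu>2 = qstar (pu \<gamma>) * zp l * pu \<gamma>"
        then obtain \<gamma> l where \<gamma>: "is_path sE rE \<gamma>" "plen \<gamma> < p" "psrc \<gamma> = psrc \<mu>1" "psrc \<gamma> = psrc \<mu>2"
          "qstar (pu \<mu>1) * g * pu \<mu>2 = qstar (pu \<gamma>) * zp l * pu \<gamma>" by blast
        \<comment> \<open>The length of \<kappa> makes \<kappa>\<gamma> a longest path of level m,
          and since \<gamma> is shorter than p, \<kappa> itself still has a length belonging to
          level m.\<close>
        obtain \<kappa> where \<kappa>: "\<kappa> \<in> PP (?M - plen \<gamma>)" "psrc \<kappa> = prng rE \<gamma>" using PK_exists[OF no_sinks] by blast
        have len: "plen \<kappa> + plen \<gamma> = ?M" "m * p \<le> plen \<kappa>" "plen \<kappa> < (m + 1) * p"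
          using \<kappa> \<gamma>(2) p_pos by (auto simp: PK_def)
        have \<kappa>\<gamma>: "pu (pcat \<kappa> \<gamma>) = pu \<kappa> * pu \<gamma>" "is_path sE rE (pcat \<kappa> \<gamma>)"
          using \<kappa> \<gamma> by (auto simp: PK_def pu_pcat intro!: is_path_pcat)
        have red: "qstar (pu (pcat \<kappa> \<gamma>)) * pu \<kappa> = qstar (pu \<gamma>)"
        proof -
          have "qstar (pu (pcat \<kappa> \<gamma>)) * pu \<kappa> = qstar (pu \<gamma>) * (qstar (pu \<kappa>) * pu \<kappa>)"
            by (simp add: \<kappa>\<gamma> mult.assoc)
          then show ?thesis using \<kappa> \<gamma> pu_star_rng[of \<gamma>] by (simp add: pu_star_pu_self PK_def)
        qed
        have "x * g * qstar y = pu \<nu>1 * (qstar (pu \<gamma>) * zp l * pu \<gamma>) * qstar (pu \<nu>2)"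
          unfolding eq \<gamma>(5) ..
        also have "pu \<gamma> = qstar (qstar (pu (pcat \<kappa> \<gamma>)) * pu \<kappa>)" by (simp only: red qstar_simps)
        also have "qstar (qstar (qstar (pu (pcat \<kappa> \<gamma>)) * pu \<kappa>)) = qstar (pu (pcat \<kappa> \<gamma>)) * pu \<kappa>" by simp
        also have "pu \<nu>1 * (qstar (pu (pcat \<kappa> \<gamma>)) * pu \<kappa> * zp l * qstar (qstar (pu (pcat \<kappa> \<gamma>)) * pu \<kappa>)) * qstar (pu \<nu>2)
          = (pu \<nu>1 * qstar (pu (pcat \<kappa> \<gamma>))) * (pu \<kappa> * zp l * qstar (pu \<kappa>)) * (pu (pcat \<kappa> \<gamma>) * qstar (pu \<nu>2))"
          by (simp add: mult.assoc)
        also have "\<dots> \<in> C m"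
        proof (rule qalgD(3)[OF qalg_C], rule qalgD(3)[OF qalg_C])
          show "pu \<nu>1 * qstar (pu (pcat \<kappa> \<gamma>)) \<in> C m"
            by (rule gen_in_C_0) (use \<kappa>\<gamma>(2) \<gamma> x len p_pos in \<open>auto simp: PK_def\<close>)
          show "pu \<kappa> * zp l * qstar (pu \<kappa>) \<in> C m"
            by (rule gen_in_C) (use \<kappa> len in \<open>auto simp: PK_def\<close>)
          show "pu (pcat \<kappa> \<gamma>) * qstar (pu \<nu>2) \<in> C m"
            by (rule gen_in_C_0) (use \<kappa>\<gamma>(2) \<gamma> y len p_pos in \<open>auto simp: PK_def\<close>)
        qed
        finally show ?thesis .
      qed
    qed
    then show "g \<in> {a. E * a * E = a \<and> (\<forall>x\<in>X. \<forall>y\<in>X. x * a * qstar y \<in> C m)}"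
      using gens_corner[OF g] by auto
  qed
  ultimately have "\<forall>x\<in>X. \<forall>y\<in>X. x * a * qstar y \<in> C m" using C_induct[OF assms(1)] by blast
  moreover have "pu \<nu>1 * qstar (pu \<mu>1) \<in> X" "pu \<nu>2 * qstar (pu \<mu>2) \<in> X"
    unfolding X_def using assms by blast+
  ultimately have "(pu \<nu>1 * qstar (pu \<mu>1)) * a * qstar (pu \<nu>2 * qstar (pu \<mu>2)) \<in> C m" by blast
  then show ?thesis by (simp add: mult.assoc)
qed

end

context ck_family
begin

lemma pu_star_C_pu:
  assumes "a \<in> C n" "plen \<alpha> = plen \<beta>"
  shows "qstar (pu \<alpha>) * a * pu \<beta> \<in> C n"
proof -
  obtain v es w fs where ab: "\<alpha> = (v, es)" "\<beta> = (w, fs)" by fastforce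
  have "length es = length fs \<Longrightarrow> a \<in> C n \<Longrightarrow> qstar (pu (v, es)) * a * pu (w, fs) \<in> C n" for a
  proof (induction es fs arbitrary: a rule: list_induct2)
    case Nil
    then show ?case using qalgD(3)[OF qalg_C] P_in_C by simp
  next
    case (Cons e es f fs)
    have "qstar (pu (v, es)) * (qstar (U e) * a * U f) * pu (w, fs) \<in> C n"
      by (rule Cons.IH) (rule Ustar_C_U[OF Cons.prems])
    then show ?case by (simp add: mult.assoc)
  qed
  then show ?thesis using assms ab by simp
qed

text \<open>Counts one level per edge. The bound is crude, but only membership in the union of the
  levels matters.\<close>

lemma pu_C_pu_star:
  assumes "a \<in> C n" "plen \<alpha> = plen \<beta>"
  shows "pu \<alpha> * a * qstar (pu \<beta>) \<in> C (n + plen \<alpha>)"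
proof -
  obtain v es w fs where ab: "\<alpha> = (v, es)" "\<beta> = (w, fs)" by fastforce
  have "length es = length fs \<Longrightarrow> pu (v, es) * a * qstar (pu (w, fs)) \<in> C (n + length es)"
  proof (induction es fs rule: list_induct2)
    case Nil
    then show ?case using qalgD(3)[OF qalg_C] P_in_C assms(1) by simp
  next
    case (Cons e es f fs)
    show ?case using U_C_Ustar[OF Cons.IH, of e f] by (simp add: mult.assoc)
  qed
  then show ?thesis using assms ab by simp
qed

section \<open>The union of the levels and its grading\<close>

definition Cinf :: "('v, 'b) calq set" where "Cinf = (\<Union>n. C n)"

lemma Cinf_ops:
  "a \<in> Cinf \<Longrightarrow> b \<in> Cinf \<Longrightarrow> a + b \<in> Cinf" "a \<in> Cinf \<Longrightarrow> b \<in> Cinf \<Longrightarrow> a * b \<in> Cinf"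
  "a \<in> Cinf \<Longrightarrow> qstar a \<in> Cinf" "a \<in> Cinf \<Longrightarrow> qsc c * a \<in> Cinf" "0 \<in> Cinf"
proof -
  have *: "\<exists>k. a \<in> C k \<and> b \<in> C k" if ab: "a \<in> Cinf" "b \<in> Cinf" for a b
  proof -
    obtain m n where "a \<in> C m" "b \<in> C n" using ab unfolding Cinf_def by blast
    then show ?thesis using C_mono[of m "max m n"] C_mono[of n "max m n"] by auto
  qed
  show "a + b \<in> Cinf" "a * b \<in> Cinf" if ab: "a \<in> Cinf" "b \<in> Cinf"
  proof -
    obtain k where "a \<in> C k" "b \<in> C k" using *[OF ab] by blast
    then have "a + b \<in> C k" "a * b \<in> C k" using qalgD(2,3)[OF qalg_C] by simp_all
    then show "a + b \<in> Cinf" "a * b \<in> Cinf" unfolding Cinf_def by blast+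
  qed
  show "qstar a \<in> Cinf" "qsc c * a \<in> Cinf" if a: "a \<in> Cinf"
  proof -
    obtain k where "a \<in> C k" using a unfolding Cinf_def by blast
    then have "qstar a \<in> C k" "qsc c * a \<in> C k" using qalgD(4,5)[OF qalg_C] by simp_all
    then show "qstar a \<in> Cinf" "qsc c * a \<in> Cinf" unfolding Cinf_def by blast+
  qed
  show "0 \<in> Cinf" using qalgD(1)[OF qalg_C] by (auto simp: Cinf_def)
qed

lemma Cinf_sum: "(\<And>i. i \<in> I \<Longrightarrow> f i \<in> Cinf) \<Longrightarrow> (\<Sum>i\<in>I. f i) \<in> Cinf"
  by (induction I rule: infinite_finite_induct) (auto simp: Cinf_ops)

text \<open>The degree with respect to the gauge action, detected by compressing with long paths: the
quotient carries no gauge action here.\<close>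

definition compressible :: "nat \<Rightarrow> int \<Rightarrow> ('v, 'b) calq \<Rightarrow> bool" where
  "compressible m k a \<longleftrightarrow> (\<forall>\<alpha> \<beta>. is_path sE rE \<alpha> \<and> is_path sE rE \<beta> \<and> m \<le> plen \<beta> \<and>
      int (plen \<alpha>) = int (plen \<beta>) + k \<longrightarrow> qstar (pu \<alpha>) * a * pu \<beta> \<in> Cinf)"

definition grade :: "int \<Rightarrow> ('v, 'b) calq set" where
  "grade k = {a. E * a = a \<and> a * E = a \<and> (\<exists>m. compressible m k a)}"

lemma compressibleD:
  "compressible m k a \<Longrightarrow> is_path sE rE \<alpha> \<Longrightarrow> is_path sE rE \<beta> \<Longrightarrow> m \<le> plen \<beta> \<Longrightarrow>
    int (plen \<alpha>) = int (plen \<beta>) + k \<Longrightarrow> qstar (pu \<alpha>) * a * pu \<beta> \<in> Cinf"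
  unfolding compressible_def by blast

lemma gradeE:
  assumes "a \<in> grade k"
  obtains m where "E * a = a" "a * E = a" "compressible m k a"
  using assms unfolding grade_def by blast

lemma gradeI:
  assumes "E * a = a" "a * E = a"
    "\<And>\<alpha> \<beta>. is_path sE rE \<alpha> \<Longrightarrow> is_path sE rE \<beta> \<Longrightarrow> m \<le> plen \<beta> \<Longrightarrow> int (plen \<alpha>) = int (plen \<beta>) + k \<Longrightarrow> qstar (pu \<alpha>) * a * pu \<beta> \<in> Cinf"
  shows "a \<in> grade k"
  using assms unfolding grade_def compressible_def by blast

text \<open>Expand over paths of one sufficiently large length: the matrix entries lie in the union
  by definition of the grade, and multiplying back by path elements of equal length keeps them
  there.\<close>

lemma grade_0: "a \<in> grade 0 \<Longrightarrow> a \<in> Cinf"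
proof -
  assume "a \<in> grade 0"
  then obtain m where a: "E * a = a" "a * E = a"
    "compressible m 0 a"
    by (rule gradeE)
  have "pu \<alpha> * (qstar (pu \<alpha>) * a * pu \<beta>) * qstar (pu \<beta>) \<in> Cinf" if ab: "\<alpha> \<in> PP m" "\<beta> \<in> PP m" for \<alpha> \<beta>
  proof -
    have "qstar (pu \<alpha>) * a * pu \<beta> \<in> Cinf" by (rule compressibleD[OF a(3)]) (use ab in \<open>auto simp: PK_def\<close>)
    then obtain n where "qstar (pu \<alpha>) * a * pu \<beta> \<in> C n" unfolding Cinf_def by blast
    then show ?thesis using pu_C_pu_star[of _ n \<alpha> \<beta>] ab unfolding Cinf_def PK_def by auto
  qed
  then show ?thesis by (subst corner_expand[OF a(1,2), of m]) (intro Cinf_sum)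
qed

lemma grade_add: assumes "a \<in> grade k" "b \<in> grade k" shows "a + b \<in> grade k"
proof -
  obtain m where a: "E * a = a" "a * E = a"
    "compressible m k a"
    using assms(1) by (rule gradeE)
  obtain n where b: "E * b = b" "b * E = b"
    "compressible n k b"
    using assms(2) by (rule gradeE)
  show ?thesis
    by (rule gradeI[of _ "max m n"]) (use a b in \<open>auto simp: distrib_left distrib_right intro!: Cinf_ops(1) compressibleD[OF a(3)] compressibleD[OF b(3)]\<close>)
qed

lemma grade_qsc: assumes "a \<in> grade k" shows "qsc c * a \<in> grade k"
proof -
  have 1: "E * (qsc c * a) = qsc c * (E * a)" "(qsc c * a) * E = qsc c * (a * E)"
    using qsc_assoc[of E c a 1] by (simp_all add: mult.assoc)
  obtain m where a: "E * a = a" "a * E = a"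
    "compressible m k a"
    using assms by (rule gradeE)
  show ?thesis
    by (rule gradeI[of _ m]) (use a in \<open>auto simp: 1 qsc_assoc intro!: Cinf_ops(4) compressibleD[OF a(3)]\<close>)
qed

lemma grade_star: assumes "a \<in> grade k" shows "qstar a \<in> grade (- k)"
proof -
  obtain m where a: "E * a = a" "a * E = a"
    "compressible m k a"
    using assms(1) by (rule gradeE)
  \<comment> \<open>Adjoints exchange the two paths, whose lengths differ by |k|; hence the larger
    threshold.\<close>
  have "qstar (pu \<alpha>) * qstar a * pu \<beta> \<in> Cinf"
    if "is_path sE rE \<alpha>" "is_path sE rE \<beta>" "m + nat \<bar>k\<bar> \<le> plen \<beta>" "int (plen \<alpha>) = int (plen \<beta>) + - k" for \<alpha> \<beta>
  proof -
    have "qstar (qstar (pu \<beta>) * a * pu \<alpha>) \<in> Cinf"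
      using that by (intro Cinf_ops(3) compressibleD[OF a(3)]) auto
    then show ?thesis by (simp add: mult.assoc)
  qed
  moreover have "E * qstar a = qstar a" "qstar a * E = qstar a"
    using arg_cong[OF a(1), of qstar] arg_cong[OF a(2), of qstar] by auto
  ultimately show ?thesis unfolding grade_def compressible_def by blast
qed

lemma grade_mult: assumes "a \<in> grade j" "b \<in> grade k" shows "a * b \<in> grade (j + k)"
proof -
  obtain m where a: "E * a = a" "a * E = a"
    "compressible m j a"
    using assms(1) by (rule gradeE)
  obtain n where b: "E * b = b" "b * E = b"
    "compressible n k b"
    using assms(2) by (rule gradeE)
  have "qstar (pu \<alpha>) * (a * b) * pu \<beta> \<in> Cinf"
    if \<alpha>\<beta>: "is_path sE rE \<alpha>" "is_path sE rE \<beta>" "m + n + nat \<bar>k\<bar> \<le> plen \<beta>" "int (plen \<alpha>) = int (plen \<beta>) + (j + k)" for \<alpha> \<beta>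
  proof -
    \<comment> \<open>The intermediate length is forced by the degree of b, and the threshold keeps
      it at least m so that a can be compressed too.\<close>
    define L where "L = nat (int (plen \<beta>) + k)"
    have L: "int L = int (plen \<beta>) + k" "m \<le> L" "n \<le> plen \<beta>" using \<alpha>\<beta>(3) by (auto simp: L_def)
    have "qstar (pu \<alpha>) * (a * b) * pu \<beta> = qstar (pu \<alpha>) * (a * E * b) * pu \<beta>" by (simp add: a)
    also have "\<dots> = qstar (pu \<alpha>) * (a * (\<Sum>\<gamma>\<in>PP L. pu \<gamma> * qstar (pu \<gamma>)) * b) * pu \<beta>" by (simp add: sum_pu)
    also have "\<dots> = (\<Sum>\<gamma>\<in>PP L. (qstar (pu \<alpha>) * a * pu \<gamma>) * (qstar (pu \<gamma>) * b * pu \<beta>))"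
      by (simp add: sum_distrib_left sum_distrib_right mult.assoc)
    also have "\<dots> \<in> Cinf"
    proof (rule Cinf_sum)
      fix \<gamma> assume "\<gamma> \<in> PP L"
      then have \<gamma>: "is_path sE rE \<gamma>" "plen \<gamma> = L" by (auto simp: PK_def)
      show "(qstar (pu \<alpha>) * a * pu \<gamma>) * (qstar (pu \<gamma>) * b * pu \<beta>) \<in> Cinf"
        by (intro Cinf_ops(2) compressibleD[OF a(3)] compressibleD[OF b(3)]) (use \<alpha>\<beta> \<gamma> L in auto)
    qed
    finally show ?thesis .
  qed
  moreover have "E * (a * b) = a * b" "a * b * E = a * b"
    by (simp add: a flip: mult.assoc, simp add: b mult.assoc)
  ultimately show ?thesis unfolding grade_def compressible_def by blast
qed

text \<open>Multiplying \<open>u_\<beta>\<close> by u_e gives a path element one longer, and z,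
  which lies in C_0, is then compressed by paths of equal length.\<close>

lemma grade_zU: "z * U e \<in> grade 1"
proof -
  have "qstar (pu \<alpha>) * (z * U e) * pu \<beta> \<in> Cinf"
    if "is_path sE rE \<alpha>" "is_path sE rE \<beta>" "int (plen \<alpha>) = int (plen \<beta>) + 1" for \<alpha> \<beta>
  proof (cases "sE e = prng rE \<beta>")
    case True
    have "qstar (pu \<alpha>) * z * pu (fst \<beta>, e # snd \<beta>) \<in> C 0"
      using that by (intro pu_star_C_pu z_in_C) (auto simp: plen_def)
    then show ?thesis by (auto simp: Cinf_def mult.assoc)
  next
    case False
    then show ?thesis using U_pu_zero[of \<beta> e] that by (simp add: mult.assoc Cinf_ops)
  qed
  moreover have "E * (z * U e) = z * U e" by (simp add: Ez flip: mult.assoc)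
  moreover have "U e * E = U e" using pu_E(2)[of "(sE e, [e])"] by (simp add: UP)
  then have "z * U e * E = z * U e" by (simp add: mult.assoc)
  ultimately show ?thesis unfolding grade_def compressible_def by blast
qed

end

section \<open>Invariance of an ideal and the two conditions\<close>

locale ck_ideal = ck_family sE rE U P z E p pu
  for sE rE :: "'e::finite \<Rightarrow> 'v::finite"
    and U :: "'e \<Rightarrow> ('v, 'b) calq" and P :: "'v \<Rightarrow> ('v, 'b) calq"
    and z E :: "('v, 'b) calq" and p :: nat and pu +
  fixes D F J :: "('v, 'b) calq set" and \<xi> :: "'v \<Rightarrow> ('v, 'e) path"
  assumes xi: "\<xi> v \<in> PK sE rE (p - 1)" "psrc (\<xi> v) = v"
    and D_corner: "d \<in> D \<Longrightarrow> E * d = d" "d \<in> D \<Longrightarrow> d * E = d"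
    and D_P: "P v \<in> D" and D_star: "d \<in> D \<Longrightarrow> qstar d \<in> D"
    and D_U: "d \<in> D \<Longrightarrow> U e * d * qstar (U f) \<in> D"
    and F_U: "U e \<in> F" and F_D: "x \<in> F \<Longrightarrow> qstar (U e) * x \<in> D" and F_E: "x \<in> F \<Longrightarrow> E * x = x"
    and J_D: "J \<subseteq> D" and J_0: "0 \<in> J" and J_add: "a \<in> J \<Longrightarrow> b \<in> J \<Longrightarrow> a + b \<in> J"
    and J_ideal: "a \<in> J \<Longrightarrow> d \<in> D \<Longrightarrow> a * d \<in> J" "a \<in> J \<Longrightarrow> d \<in> D \<Longrightarrow> d * a \<in> J"
    and J_closed: "closed J" and J_dense: "J \<subseteq> closure (\<Union>n. J \<inter> C n)"
begin

lemma J_sum: "(\<And>i. i \<in> I \<Longrightarrow> f i \<in> J) \<Longrightarrow> (\<Sum>i\<in>I. f i) \<in> J"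
  by (induction I rule: infinite_finite_induct) (auto simp: J_0 J_add)

definition down :: bool where "down \<longleftrightarrow> (\<forall>a\<in>J. \<forall>e f. qstar (U e) * a * U f \<in> J)"
definition up :: bool where "up \<longleftrightarrow> (\<forall>a\<in>J. \<forall>e f. U e * a * qstar (U f) \<in> J)"

lemma fully_invariant_iff_down_up:
  "(\<forall>a\<in>J. \<forall>x\<in>F. \<forall>y\<in>F. qstar x * a * y \<in> J) \<and>
   (\<forall>a\<in>D. (\<forall>x\<in>F. \<forall>y\<in>F. qstar x * a * y \<in> J) \<longrightarrow> a \<in> J) \<longleftrightarrow> down \<and> up" (is "?a \<and> ?b \<longleftrightarrow> _")
proof
  assume ab: "?a \<and> ?b"
  then have down unfolding down_def using F_U by blast
  moreover have "U e * a * qstar (U f) \<in> J" if a: "a \<in> J" for a e f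
  proof -
    have "qstar x * (U e * a * qstar (U f)) * y \<in> J" if "x \<in> F" "y \<in> F" for x y
    proof -
      have "qstar x * (U e * a * qstar (U f)) * y = qstar (qstar (U e) * x) * a * (qstar (U f) * y)"
        by (simp add: mult.assoc)
      also have "\<dots> \<in> J" using J_ideal(1)[OF J_ideal(2)[OF a D_star[OF F_D]] F_D] that by blast
      finally show ?thesis .
    qed
    moreover have "U e * a * qstar (U f) \<in> D" using a J_D D_U by blast
    ultimately show ?thesis using ab by blast
  qed
  ultimately show "down \<and> up" unfolding up_def by blast
next
  assume du: "down \<and> up"
  have edge: "a = (\<Sum>e\<in>UNIV. \<Sum>f\<in>UNIV. U e * (qstar (U e) * a * U f) * qstar (U f))" if "a \<in> D" for a
  proof -
    have "a = (\<Sum>e\<in>UNIV. U e * qstar (U e)) * a * (\<Sum>f\<in>UNIV. U f * qstar (U f))"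
      using D_corner[OF that] by (simp add: sum_U)
    also have "\<dots> = (\<Sum>e\<in>UNIV. \<Sum>f\<in>UNIV. U e * (qstar (U e) * a * U f) * qstar (U f))"
      unfolding sum_distrib_right sum_distrib_left by (rule sum.swap[THEN trans]) (simp add: mult.assoc)
    finally show ?thesis .
  qed
  have "qstar x * a * y \<in> J" if "a \<in> J" "x \<in> F" "y \<in> F" for a x y
  proof -
    have "qstar x * a * y = qstar x * (\<Sum>e\<in>UNIV. \<Sum>f\<in>UNIV. U e * (qstar (U e) * a * U f) * qstar (U f)) * y"
      using edge that J_D by auto
    also have "\<dots> = (\<Sum>e\<in>UNIV. \<Sum>f\<in>UNIV. qstar (qstar (U e) * x) * (qstar (U e) * a * U f) * (qstar (U f) * y))"
      unfolding sum_distrib_right sum_distrib_left by (simp add: mult.assoc)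
    also have "\<dots> \<in> J"
    proof (intro J_sum)
      fix e f
      have "qstar (U e) * a * U f \<in> J" using that du by (auto simp: down_def)
      then show "qstar (qstar (U e) * x) * (qstar (U e) * a * U f) * (qstar (U f) * y) \<in> J"
        using J_ideal(1)[OF J_ideal(2)[OF _ D_star[OF F_D]] F_D] that by blast
    qed
    finally show ?thesis .
  qed
  moreover have "a \<in> J" if "a \<in> D" "\<forall>x\<in>F. \<forall>y\<in>F. qstar x * a * y \<in> J" for a
    by (subst edge[OF that(1)]) (use that F_U du in \<open>auto simp: up_def intro!: J_sum\<close>)
  ultimately show "?a \<and> ?b" by blast
qed

lemma pu_D: "is_path sE rE \<alpha> \<Longrightarrow> pu \<alpha> * qstar (pu \<alpha>) \<in> D"
proof -
  obtain v es where a: "\<alpha> = (v, es)" by fastforce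
  have "pu (v, es) * qstar (pu (v, es)) \<in> D"
  proof (induction es)
    case Nil show ?case using D_P[of v] by (simp add: P_mult)
  next
    case (Cons e es) show ?case using D_U[OF Cons, of e e] by (simp add: mult.assoc)
  qed
  then show ?thesis by (simp add: a)
qed

lemma down_pu:
  assumes down "a \<in> J" "plen \<alpha> = plen \<beta>"
  shows "qstar (pu \<alpha>) * a * pu \<beta> \<in> J"
proof -
  obtain v es w fs where ab: "\<alpha> = (v, es)" "\<beta> = (w, fs)" by fastforce
  have "length es = length fs \<Longrightarrow> a \<in> J \<Longrightarrow> qstar (pu (v, es)) * a * pu (w, fs) \<in> J" for a
  proof (induction es fs arbitrary: a rule: list_induct2)
    case Nil
    then show ?case using J_ideal D_P by simp
  next
    case (Cons e es f fs)
    have "qstar (pu (v, es)) * (qstar (U e) * a * U f) * pu (w, fs) \<in> J"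
      by (rule Cons.IH) (use Cons.prems assms(1) in \<open>auto simp: down_def\<close>)
    then show ?case by (simp add: mult.assoc)
  qed
  then show ?thesis using assms ab by simp
qed

lemma up_pu:
  assumes up "a \<in> J" "plen \<alpha> = plen \<beta>"
  shows "pu \<alpha> * a * qstar (pu \<beta>) \<in> J"
proof -
  obtain v es w fs where ab: "\<alpha> = (v, es)" "\<beta> = (w, fs)" by fastforce
  have "length es = length fs \<Longrightarrow> pu (v, es) * a * qstar (pu (w, fs)) \<in> J"
  proof (induction es fs rule: list_induct2)
    case Nil
    then show ?case using J_ideal D_P assms(2) by simp
  next
    case (Cons e es f fs)
    then have "U e * (pu (v, es) * a * qstar (pu (w, fs))) * qstar (U f) \<in> J"
      using assms(1) by (auto simp: up_def)
    then show ?case by (simp add: mult.assoc)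
  qed
  then show ?thesis using assms ab by simp
qed

definition Jn :: "nat \<Rightarrow> ('v, 'e) path \<Rightarrow> ('v, 'e) path \<Rightarrow> ('v, 'e) path \<Rightarrow> ('v, 'b) calq set" where
  "Jn n \<zeta> \<mu>1 \<mu>2 = {pu \<zeta> * qstar (pu \<mu>1) * a * pu \<mu>2 * qstar (pu \<zeta>) | a. a \<in> J \<inter> C n}"

definition cond1 :: bool where
  "cond1 \<longleftrightarrow> (\<forall>v n \<mu>1 \<mu>2 \<nu>1 \<nu>2. \<mu>1 \<in> PP (n * p + p - 1) \<and> psrc \<mu>1 = v \<and> \<mu>2 \<in> PP (n * p + p - 1) \<and> psrc \<mu>2 = v \<and>
     \<nu>1 \<in> PP (p - 1) \<and> psrc \<nu>1 = v \<and> \<nu>2 \<in> PP (p - 1) \<and> psrc \<nu>2 = v \<longrightarrow> Jn 0 (\<xi> v) \<nu>1 \<nu>2 = Jn n (\<xi> v) \<mu>1 \<mu>2)"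

definition cond2 :: bool where
  "cond2 \<longleftrightarrow> (\<forall>e f. \<forall>a\<in>J \<inter> C 0. qstar (U e) * a * U f \<in> J \<inter> C 0)"

text \<open>The witness a is replaced by its compression re-expanded along the new paths. It stays
  in J by invariance in both directions and belongs to the other level by \<open>transport\<close>,
  while the compressed element is unchanged.\<close>

lemma Jn_transport:
  assumes "down" "up" "\<mu>1 \<in> PP (m * p + p - 1)" "\<mu>2 \<in> PP (m * p + p - 1)"
    "\<nu>1 \<in> PP (n * p + p - 1)" "\<nu>2 \<in> PP (n * p + p - 1)" "psrc \<nu>1 = psrc \<mu>1" "psrc \<nu>2 = psrc \<mu>2"
  shows "Jn n \<zeta> \<nu>1 \<nu>2 \<subseteq> Jn m \<zeta> \<mu>1 \<mu>2"
proof
  fix b assume "b \<in> Jn n \<zeta> \<nu>1 \<nu>2"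
  then obtain a where a: "a \<in> J" "a \<in> C n" "b = pu \<zeta> * qstar (pu \<nu>1) * a * pu \<nu>2 * qstar (pu \<zeta>)"
    unfolding Jn_def by blast
  let ?x = "qstar (pu \<nu>1) * a * pu \<nu>2"
  let ?a = "pu \<mu>1 * ?x * qstar (pu \<mu>2)"
  have "?a \<in> C m" by (rule transport) (use assms a in auto)
  moreover have "?a \<in> J"
    using assms a by (intro up_pu down_pu) (auto simp: PK_def)
  moreover have "b = pu \<zeta> * qstar (pu \<mu>1) * ?a * pu \<mu>2 * qstar (pu \<zeta>)"
  proof -
    have "qstar (pu \<mu>1) * ?a * pu \<mu>2 = (P (psrc \<nu>1) * qstar (pu \<nu>1)) * a * (pu \<nu>2 * P (psrc \<nu>2))"
      using assms pu_star_pu_self by (simp add: PK_def mult.assoc[symmetric]) (simp add: mult.assoc)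
    also have "\<dots> = ?x" by (simp add: pu_star_src pu_src_self)
    finally have "qstar (pu \<mu>1) * ?a * pu \<mu>2 = ?x" .
    then have "pu \<zeta> * (qstar (pu \<mu>1) * ?a * pu \<mu>2) * qstar (pu \<zeta>) = pu \<zeta> * ?x * qstar (pu \<zeta>)" by simp
    then show ?thesis unfolding a(3) by (simp add: mult.assoc)
  qed
  ultimately show "b \<in> Jn m \<zeta> \<mu>1 \<mu>2" unfolding Jn_def by blast
qed

lemma down_up_imp_cond1: assumes down up shows cond1
  unfolding cond1_def
proof (intro allI impI, elim conjE)
  fix v n \<mu>1 \<mu>2 \<nu>1 \<nu>2
  assume h: "\<mu>1 \<in> PP (n * p + p - 1)" "psrc \<mu>1 = v" "\<mu>2 \<in> PP (n * p + p - 1)" "psrc \<mu>2 = v"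
    "\<nu>1 \<in> PP (p - 1)" "psrc \<nu>1 = v" "\<nu>2 \<in> PP (p - 1)" "psrc \<nu>2 = v"
  show "Jn 0 (\<xi> v) \<nu>1 \<nu>2 = Jn n (\<xi> v) \<mu>1 \<mu>2"
  proof (rule antisym)
    show "Jn 0 (\<xi> v) \<nu>1 \<nu>2 \<subseteq> Jn n (\<xi> v) \<mu>1 \<mu>2"
      by (rule Jn_transport) (use assms h in auto)
    show "Jn n (\<xi> v) \<mu>1 \<mu>2 \<subseteq> Jn 0 (\<xi> v) \<nu>1 \<nu>2"
      by (rule Jn_transport) (use assms h in auto)
  qed
qed

lemma down_imp_cond2: "down \<Longrightarrow> cond2"
  unfolding cond2_def down_def using Ustar_C_U by auto

text \<open>Under condition (1) these corners determine every \<open>J\<^sub>n\<close>.\<close>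

definition X :: "'v \<Rightarrow> ('v, 'b) calq set" where
  "X v = {qstar (pu \<nu>1) * b * pu \<nu>2 | \<nu>1 \<nu>2 b. \<nu>1 \<in> PP (p - 1) \<and> \<nu>2 \<in> PP (p - 1) \<and> psrc \<nu>1 = v \<and> psrc \<nu>2 = v \<and> b \<in> J \<inter> C 0}"

text \<open>The element \<open>u_\<xi>\<close> is a partial isometry with initial projection P_v, so
  conjugation by it is injective on the corner at v. This frees condition (1) from the auxiliary
  paths \<xi>.\<close>

lemma conj_cancel:
  assumes "pu (\<xi> v) * x * qstar (pu (\<xi> v)) = pu (\<xi> v) * y * qstar (pu (\<xi> v))"
    and "P v * x * P v = x" "P v * y * P v = y"
  shows "x = y"
proof -
  have "qstar (pu (\<xi> v)) * (pu (\<xi> v) * w * qstar (pu (\<xi> v))) * pu (\<xi> v) = P v * w * P v" for w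
    using pu_star_pu_self[of "\<xi> v"] xi[of v] by (simp add: PK_def mult.assoc[symmetric]) (simp add: mult.assoc)
  then show ?thesis using assms by metis
qed

lemma P_corner_pu: "psrc \<mu>1 = v \<Longrightarrow> psrc \<mu>2 = v \<Longrightarrow> P v * (qstar (pu \<mu>1) * a * pu \<mu>2) * P v = qstar (pu \<mu>1) * a * pu \<mu>2"
proof -
  assume v: "psrc \<mu>1 = v" "psrc \<mu>2 = v"
  have "P v * (qstar (pu \<mu>1) * a * pu \<mu>2) * P v = (P v * qstar (pu \<mu>1)) * a * (pu \<mu>2 * P v)" by (simp add: mult.assoc)
  then show ?thesis using pu_star_src[of \<mu>1] pu_src_self[of \<mu>2] v by simp
qed

text \<open>Condition (1) with \<xi> cancelled: the corner at v is realized at every level and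
  between any prescribed pair of longest paths ending in v. The converse is
  \<open>level_X\<close>.\<close>

lemma X_level:
  assumes cond1 "x \<in> X v" "\<mu>1 \<in> PP (n * p + p - 1)" "\<mu>2 \<in> PP (n * p + p - 1)" "psrc \<mu>1 = v" "psrc \<mu>2 = v"
  shows "\<exists>a\<in>J \<inter> C n. x = qstar (pu \<mu>1) * a * pu \<mu>2"
proof -
  obtain \<nu>1 \<nu>2 b where x: "x = qstar (pu \<nu>1) * b * pu \<nu>2" "\<nu>1 \<in> PP (p - 1)" "\<nu>2 \<in> PP (p - 1)" "psrc \<nu>1 = v" "psrc \<nu>2 = v" "b \<in> J \<inter> C 0"
    using assms(2) unfolding X_def by blast
  have "pu (\<xi> v) * x * qstar (pu (\<xi> v)) \<in> Jn 0 (\<xi> v) \<nu>1 \<nu>2"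
    unfolding Jn_def x(1) using x(6) by (auto simp: mult.assoc intro!: exI[of _ b])
  also have "Jn 0 (\<xi> v) \<nu>1 \<nu>2 = Jn n (\<xi> v) \<mu>1 \<mu>2"
    using assms x unfolding cond1_def by blast
  finally obtain a where a: "a \<in> J \<inter> C n"
    "pu (\<xi> v) * x * qstar (pu (\<xi> v)) = pu (\<xi> v) * (qstar (pu \<mu>1) * a * pu \<mu>2) * qstar (pu (\<xi> v))"
    unfolding Jn_def by (auto simp: mult.assoc)
  have "x = qstar (pu \<mu>1) * a * pu \<mu>2"
    by (rule conj_cancel[OF a(2)]) (use x assms P_corner_pu in auto)
  then show ?thesis using a by blast
qed

lemma level_X:
  assumes cond1 "a \<in> J \<inter> C n" "\<mu>1 \<in> PP (n * p + p - 1)" "\<mu>2 \<in> PP (n * p + p - 1)" "psrc \<mu>1 = v" "psrc \<mu>2 = v"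
  shows "qstar (pu \<mu>1) * a * pu \<mu>2 \<in> X v"
proof -
  let ?x = "qstar (pu \<mu>1) * a * pu \<mu>2"
  have "pu (\<xi> v) * ?x * qstar (pu (\<xi> v)) \<in> Jn n (\<xi> v) \<mu>1 \<mu>2"
    unfolding Jn_def using assms(2) by (auto simp: mult.assoc intro!: exI[of _ a])
  also have "Jn n (\<xi> v) \<mu>1 \<mu>2 = Jn 0 (\<xi> v) (\<xi> v) (\<xi> v)"
    using assms xi[of v] unfolding cond1_def by blast
  finally obtain b where b: "b \<in> J \<inter> C 0"
    "pu (\<xi> v) * ?x * qstar (pu (\<xi> v)) = pu (\<xi> v) * (qstar (pu (\<xi> v)) * b * pu (\<xi> v)) * qstar (pu (\<xi> v))"
    unfolding Jn_def by (auto simp: mult.assoc)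
  have "?x = qstar (pu (\<xi> v)) * b * pu (\<xi> v)"
    by (rule conj_cancel[OF b(2)]) (use xi assms P_corner_pu in auto)
  then show ?thesis unfolding X_def using b xi[of v] by blast
qed

text \<open>One step of the shift by an edge. The path \<nu>e has length p and is regrouped as
  g\<eta>; its first edge g is absorbed into J_0 by condition (2), and \<eta> again has length p-1,
  now with source s(e). If the sources differ, \<open>compress_zero\<close> at level 0 kills the
  term.\<close>

lemma X_edge:
  assumes cond2 "x \<in> X v" "rE e = v" "rE f = v"
  shows "sE e \<noteq> sE f \<Longrightarrow> qstar (U e) * x * U f = 0" "sE e = sE f \<Longrightarrow> qstar (U e) * x * U f \<in> X (sE e)"
proof -
  obtain \<nu>1 \<nu>2 b where x: "x = qstar (pu \<nu>1) * b * pu \<nu>2" "\<nu>1 \<in> PP (p - 1)" "\<nu>2 \<in> PP (p - 1)" "psrc \<nu>1 = v" "psrc \<nu>2 = v" "b \<in> J \<inter> C 0"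
    using assms(2) unfolding X_def by blast
  \<comment> \<open>The regrouping of \<nu>e: the appended edge moves the boundary from the last
    edge to the first one.\<close>
  have rot: "\<exists>g \<eta>. \<eta> \<in> PP (p - 1) \<and> psrc \<eta> = sE e \<and> pu \<nu> * U e = U g * pu \<eta>"
    if "\<nu> \<in> PP (p - 1)" "psrc \<nu> = rE e" for \<nu> e
  proof -
    have path: "is_path sE rE (pcat \<nu> (sE e, [e]))" using that by (intro is_path_pcat) (auto simp: PK_def)
    have "snd \<nu> @ [e] \<noteq> []" by simp
    then obtain g es where ge: "snd \<nu> @ [e] = g # es" by (cases "snd \<nu> @ [e]") auto
    have "is_path sE rE (sE e, g # es)" using path ge by (simp add: pcat_def)
    moreover have "length (snd \<nu> @ [e]) = p" using that p_pos by (auto simp: PK_def plen_def)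
    ultimately have "(sE e, es) \<in> PP (p - 1)" unfolding ge by (auto simp: PK_def)
    moreover have "pu \<nu> * U e = pu (pcat \<nu> (sE e, [e]))" using that pu_pcat[of "(sE e, [e])" \<nu>] pu_edge(1)[of e] by simp
    then have "pu \<nu> * U e = U g * pu (sE e, es)" using ge by (simp add: pcat_def)
    ultimately show ?thesis by (intro exI[of _ g] exI[of _ "(sE e, es)"]) auto
  qed
  obtain g \<eta> where 1: "\<eta> \<in> PP (p - 1)" "psrc \<eta> = sE e" "pu \<nu>1 * U e = U g * pu \<eta>" using rot[of \<nu>1 e] x assms by auto
  obtain h \<theta> where 2: "\<theta> \<in> PP (p - 1)" "psrc \<theta> = sE f" "pu \<nu>2 * U f = U h * pu \<theta>" using rot[of \<nu>2 f] x assms by auto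
  have "qstar (U e) * x * U f = qstar (pu \<nu>1 * U e) * b * (pu \<nu>2 * U f)" by (simp add: x(1) mult.assoc)
  also have "\<dots> = qstar (pu \<eta>) * (qstar (U g) * b * U h) * pu \<theta>" by (simp add: 1 2 mult.assoc)
  finally have eq: "qstar (U e) * x * U f = qstar (pu \<eta>) * (qstar (U g) * b * U h) * pu \<theta>" .
  have b': "qstar (U g) * b * U h \<in> J \<inter> C 0" using assms(1) x(6) unfolding cond2_def by blast
  show "qstar (U e) * x * U f = 0" if "sE e \<noteq> sE f"
    unfolding eq by (rule compress_zero[of _ 0]) (use b' 1 2 that in auto)
  show "qstar (U e) * x * U f \<in> X (sE e)" if "sE e = sE f"
    unfolding eq X_def using b' 1(1,2) 2(1,2) that
    by (intro CollectI exI[of _ \<eta>] exI[of _ \<theta>] exI[of _ "qstar (U g) * b * U h"]) simp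
qed

text \<open>For a length of the form np+p-1 the element is an element of J between two range
  projections of D, by condition (1). A shorter path is prolonged by edges on its source side until
  it has such a length, the corner following by \<open>X_edge\<close>; the induction is on the
  missing length k.\<close>

lemma X_up:
  assumes cond1 cond2
  shows "L + k = n * p + p - 1 \<Longrightarrow> x \<in> X v \<Longrightarrow> \<alpha> \<in> PP L \<Longrightarrow> \<beta> \<in> PP L \<Longrightarrow> psrc \<alpha> = v \<Longrightarrow> psrc \<beta> = v \<Longrightarrow>
    pu \<alpha> * x * qstar (pu \<beta>) \<in> J"
proof (induction k arbitrary: L x v \<alpha> \<beta>)
  case 0
  then obtain a where a: "a \<in> J \<inter> C n" "x = qstar (pu \<alpha>) * a * pu \<beta>"
    using X_level[OF assms(1) 0(2), of \<alpha> n \<beta>] by auto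
  have "pu \<alpha> * x * qstar (pu \<beta>) = (pu \<alpha> * qstar (pu \<alpha>)) * a * (pu \<beta> * qstar (pu \<beta>))"
    by (simp add: a(2) mult.assoc)
  also have "\<dots> \<in> J"
    using a 0 J_ideal(1)[OF J_ideal(2)[OF _ pu_D] pu_D] by (auto simp: PK_def)
  finally show ?case .
next
  case (Suc k)
  have xP: "P v * x * P v = x" using Suc.prems(2) P_corner_pu unfolding X_def by auto
  have "pu \<alpha> * x * qstar (pu \<beta>) = (pu \<alpha> * E) * x * (E * qstar (pu \<beta>))" by (simp add: pu_E pu_star_E)
  also have "\<dots> = pu \<alpha> * ((\<Sum>e\<in>UNIV. U e * qstar (U e)) * x * (\<Sum>f\<in>UNIV. U f * qstar (U f))) * qstar (pu \<beta>)"
    by (simp add: sum_U mult.assoc)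
  also have "\<dots> = (\<Sum>f\<in>UNIV. \<Sum>e\<in>UNIV. (pu \<alpha> * U e) * (qstar (U e) * x * U f) * qstar (pu \<beta> * U f))"
    unfolding sum_distrib_right sum_distrib_left by (simp add: mult.assoc)
  also have "\<dots> \<in> J"
  proof (intro J_sum)
    fix e f
    show "(pu \<alpha> * U e) * (qstar (U e) * x * U f) * qstar (pu \<beta> * U f) \<in> J"
    proof (cases "rE e = v \<and> rE f = v")
      case False
      then have "pu \<alpha> * U e = 0 \<or> pu \<beta> * U f = 0"
        using pu_mult_zero[of "(sE e, [e])" \<alpha>] pu_mult_zero[of "(sE f, [f])" \<beta>] Suc.prems pu_edge by auto
      then have "(pu \<alpha> * U e) * (qstar (U e) * x * U f) * qstar (pu \<beta> * U f) = 0"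
        by (metis mult_zero_left mult_zero_right qstar_simps(4))
      then show ?thesis using J_0 by simp
    next
      case True
      have *: "pu \<alpha>' * U e' = pu (pcat \<alpha>' (sE e', [e'])) \<and> pcat \<alpha>' (sE e', [e']) \<in> PP (Suc L)"
        if "\<alpha>' \<in> PP L" "psrc \<alpha>' = v" "rE e' = v" for \<alpha>' e'
        using that pu_pcat[of "(sE e', [e'])" \<alpha>'] pu_edge(1)[of e'] by (auto simp: PK_def intro!: is_path_pcat)
      show ?thesis
      proof (cases "sE e = sE f")
        case False
        then show ?thesis using X_edge(1)[OF assms(2) Suc.prems(2), of e f] True J_0 by simp
      next
        case s: True
        have "qstar (U e) * x * U f \<in> X (sE e)" using X_edge(2)[OF assms(2) Suc.prems(2), of e f] True s by auto
        then have "pu (pcat \<alpha> (sE e, [e])) * (qstar (U e) * x * U f) * qstar (pu (pcat \<beta> (sE f, [f]))) \<in> J"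
          using Suc.prems True s *[of \<alpha> e] *[of \<beta> f] by (intro Suc.IH[where L = "Suc L"]) auto
        then show ?thesis using * Suc.prems True by simp
      qed
    qed
  qed
  finally show ?case .
qed

lemma X_in_J:
  assumes cond1 cond2 "x \<in> X v" "\<alpha> \<in> PP L" "\<beta> \<in> PP L" "psrc \<alpha> = v" "psrc \<beta> = v"
  shows "pu \<alpha> * x * qstar (pu \<beta>) \<in> J"
proof (rule X_up[OF assms(1,2)])
  \<comment> \<open>Any target above L of the right form would do; n = L gives one without a
    division.\<close>
  have "L \<le> L * p" using p_pos by simp
  then show "L + (L * p + p - 1 - L) = L * p + p - 1" using p_pos by linarith
qed (use assms in auto)

lemma level_expand:
  assumes "a \<in> C n"
  shows "a = (\<Sum>\<mu>1\<in>PP (n * p + p - 1). \<Sum>\<mu>2\<in>PP (n * p + p - 1). pu \<mu>1 * (qstar (pu \<mu>1) * a * pu \<mu>2) * qstar (pu \<mu>2))"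
  by (rule corner_expand) (use C_E assms in auto)

text \<open>The matrix entries of a over the longest paths of level n lie in the corners
  \<open>X\<close>. Multiplying by an edge or its adjoint only changes the outer paths by one edge,
  and \<open>X_in_J\<close> covers every length.\<close>

lemma cond_imp_level:
  assumes cond1 cond2 "a \<in> J \<inter> C n"
  shows "qstar (U e) * a * U f \<in> J" "U e * a * qstar (U f) \<in> J"
proof -
  let ?L = "n * p + p - 1"
  have parts: "qstar (pu \<mu>1) * a * pu \<mu>2 = 0 \<or> (psrc \<mu>1 = psrc \<mu>2 \<and> qstar (pu \<mu>1) * a * pu \<mu>2 \<in> X (psrc \<mu>1))"
    if "\<mu>1 \<in> PP ?L" "\<mu>2 \<in> PP ?L" for \<mu>1 \<mu>2
  proof (cases "psrc \<mu>1 = psrc \<mu>2")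
    case True
    then show ?thesis using level_X[OF assms(1,3) that] by auto
  next
    case False
    then show ?thesis using compress_zero[of a n \<mu>1 \<mu>2] that assms(3) by auto
  qed
  have "U e * a * qstar (U f) = (\<Sum>\<mu>1\<in>PP ?L. \<Sum>\<mu>2\<in>PP ?L. (U e * pu \<mu>1) * (qstar (pu \<mu>1) * a * pu \<mu>2) * qstar (U f * pu \<mu>2))"
    using assms(3) by (subst level_expand[of a n]) (auto simp: sum_distrib_left sum_distrib_right mult.assoc)
  also have "\<dots> \<in> J"
  proof (intro J_sum)
    fix \<mu>1 \<mu>2 assume m: "\<mu>1 \<in> PP ?L" "\<mu>2 \<in> PP ?L"
    show "(U e * pu \<mu>1) * (qstar (pu \<mu>1) * a * pu \<mu>2) * qstar (U f * pu \<mu>2) \<in> J"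
    proof (cases "sE e = prng rE \<mu>1 \<and> sE f = prng rE \<mu>2 \<and> qstar (pu \<mu>1) * a * pu \<mu>2 \<noteq> 0")
      case False
      then have "U e * pu \<mu>1 = 0 \<or> U f * pu \<mu>2 = 0 \<or> qstar (pu \<mu>1) * a * pu \<mu>2 = 0"
        using U_pu_zero[of \<mu>1 e] U_pu_zero[of \<mu>2 f] m by (auto simp: PK_def)
      then have "(U e * pu \<mu>1) * (qstar (pu \<mu>1) * a * pu \<mu>2) * qstar (U f * pu \<mu>2) = 0"
        by (metis mult_zero_left mult_zero_right qstar_simps(4))
      then show ?thesis using J_0 by simp
    next
      case True
      have up: "U e' * pu \<mu> = pu (fst \<mu>, e' # snd \<mu>)" "sE e' = prng rE \<mu> \<Longrightarrow> \<mu> \<in> PP ?L \<Longrightarrow> (fst \<mu>, e' # snd \<mu>) \<in> PP (Suc ?L)" for e' \<mu>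
        by (auto simp: PK_def plen_def)
      have "pu (fst \<mu>1, e # snd \<mu>1) * (qstar (pu \<mu>1) * a * pu \<mu>2) * qstar (pu (fst \<mu>2, f # snd \<mu>2)) \<in> J"
        using parts[OF m] True m up(2)[of e \<mu>1] up(2)[of f \<mu>2]
        by (intro X_in_J[OF assms(1,2), where L = "Suc ?L"]) (auto simp: psrc_def)
      then show ?thesis by (simp only: up(1))
    qed
  qed
  finally show "U e * a * qstar (U f) \<in> J" .
  show "qstar (U e) * a * U f \<in> J"
  \<comment> \<open>For n = 0 the paths may have length 0 and offer no edge to strip; there
    condition (2) is the claim itself.\<close>
  proof (cases "n = 0")
    case True
    then show ?thesis using assms(2,3) unfolding cond2_def by blast
  next
    case False
    then have Lpos: "?L = Suc (?L - 1)" using p_pos by (cases n) auto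
    have "qstar (U e) * a * U f = (\<Sum>\<mu>1\<in>PP ?L. \<Sum>\<mu>2\<in>PP ?L. (qstar (U e) * pu \<mu>1) * (qstar (pu \<mu>1) * a * pu \<mu>2) * qstar (qstar (U f) * pu \<mu>2))"
      using assms(3) by (subst level_expand[of a n]) (auto simp: sum_distrib_left sum_distrib_right mult.assoc)
    also have "\<dots> \<in> J"
    proof (intro J_sum)
      fix \<mu>1 \<mu>2 assume m: "\<mu>1 \<in> PP ?L" "\<mu>2 \<in> PP ?L"
      have strip: "qstar (U e') * pu \<mu> = 0 \<or> (\<exists>\<mu>'\<in>PP (?L - 1). psrc \<mu>' = psrc \<mu> \<and> qstar (U e') * pu \<mu> = pu \<mu>')"
        if mu: "\<mu> \<in> PP ?L" for \<mu> e'
      proof -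
        obtain v g es where g: "\<mu> = (v, g # es)"
          using mu Lpos by (cases \<mu>; cases "snd \<mu>") (auto simp: PK_def)
        have es: "is_path sE rE (v, es)" "sE g = prng rE (v, es)" "(v, es) \<in> PP (?L - 1)" using mu g by (auto simp: PK_def)
        have "qstar (U e') * pu \<mu> = (qstar (U e') * U g) * pu (v, es)" by (simp add: g mult.assoc)
        also have "\<dots> = (if e' = g then pu (v, es) else 0)" using es pu_rng_self[OF es(1)] by (simp add: UU)
        finally have "qstar (U e') * pu \<mu> = (if e' = g then pu (v, es) else 0)" .
        moreover have "psrc (v, es) = psrc \<mu>" by (simp add: g)
        ultimately show ?thesis using es(3) by metis
      qed
      show "(qstar (U e) * pu \<mu>1) * (qstar (pu \<mu>1) * a * pu \<mu>2) * qstar (qstar (U f) * pu \<mu>2) \<in> J"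
      proof (cases "qstar (U e) * pu \<mu>1 = 0 \<or> qstar (U f) * pu \<mu>2 = 0 \<or> qstar (pu \<mu>1) * a * pu \<mu>2 = 0")
        case True
        then have "(qstar (U e) * pu \<mu>1) * (qstar (pu \<mu>1) * a * pu \<mu>2) * qstar (qstar (U f) * pu \<mu>2) = 0"
          by (metis mult_zero_left mult_zero_right qstar_simps(4))
        then show ?thesis using J_0 by simp
      next
        case nz: False
        obtain \<mu>1' where 1: "\<mu>1' \<in> PP (?L - 1)" "psrc \<mu>1' = psrc \<mu>1" "qstar (U e) * pu \<mu>1 = pu \<mu>1'"
          using strip[OF m(1), of e] nz by auto
        obtain \<mu>2' where 2: "\<mu>2' \<in> PP (?L - 1)" "psrc \<mu>2' = psrc \<mu>2" "qstar (U f) * pu \<mu>2 = pu \<mu>2'"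
          using strip[OF m(2), of f] nz by auto
        show ?thesis unfolding 1(3) 2(3)
          using parts[OF m] nz 1 2 by (intro X_in_J[OF assms(1,2)]) auto
      qed
    qed
    finally show ?thesis .
  qed
qed

lemma J_closure:
  assumes "\<And>n a. a \<in> J \<inter> C n \<Longrightarrow> x * a * y \<in> J" "a \<in> J"
  shows "x * a * y \<in> J"
proof -
  have "closed {a. x * a * y \<in> J}" by (rule closed_calq_mult[OF J_closed])
  moreover have "(\<Union>n. J \<inter> C n) \<subseteq> {a. x * a * y \<in> J}" using assms(1) by auto
  ultimately have "closure (\<Union>n. J \<inter> C n) \<subseteq> {a. x * a * y \<in> J}" by (rule closure_minimal[rotated])
  then show ?thesis using J_dense assms(2) by auto
qed

theorem fully_invariant_iff:
  "(\<forall>a\<in>J. \<forall>x\<in>F. \<forall>y\<in>F. qstar x * a * y \<in> J) \<and>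
   (\<forall>a\<in>D. (\<forall>x\<in>F. \<forall>y\<in>F. qstar x * a * y \<in> J) \<longrightarrow> a \<in> J) \<longleftrightarrow> cond1 \<and> cond2"
proof -
  have "down \<and> up" if "cond1 \<and> cond2"
    unfolding down_def up_def using that cond_imp_level J_closure by metis
  then show ?thesis
    unfolding fully_invariant_iff_down_up using down_up_imp_cond1 down_imp_cond2 by blast
qed

end

section \<open>Neumann series and square roots in closed algebras\<close>

definition csalg :: "('v::finite, 'b) rop set \<Rightarrow> bool" where
  "csalg A \<longleftrightarrow> salg A \<and> closed A \<and> (\<forall>T\<in>A. \<forall>c. sc c * T \<in> A)"

lemma csalgD: "csalg A \<Longrightarrow> salg A" "csalg A \<Longrightarrow> closed A" "csalg A \<Longrightarrow> T \<in> A \<Longrightarrow> sc c * T \<in> A"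
  by (auto simp: csalg_def)

lemma norm_projection:
  assumes "star R = R" "R * R = (R :: ('v::finite, 'b) rop)"
  shows "norm (R \<cdot> x) \<le> norm x"
proof -
  have "norm (R \<cdot> x) * norm (R \<cdot> x) = x \<bullet> (R \<cdot> x)"
    using assms by (metis inner_star rapp_simps(6) power2_eq_square power2_norm_eq_inner)
  also have "\<dots> \<le> norm x * norm (R \<cdot> x)" by (rule norm_cauchy_schwarz)
  finally show ?thesis by (cases "norm (R \<cdot> x) = 0") auto
qed

text \<open>In the square of the norm of (R - tG)x, coercivity gains 2t\<epsilon> while the
  quadratic term costs at most t^2 |G|^2. For small t the net factor is at most 1 -
  t\<epsilon>.\<close>

lemma coercive_contraction:
  fixes G R :: "('v::finite, 'b) rop"
  assumes R: "star R = R" "R * R = R" and G: "R * G = G" "G * R = G"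
    and \<epsilon>: "0 < \<epsilon>" "\<And>x. \<epsilon> * (norm (R \<cdot> x))\<^sup>2 \<le> x \<bullet> (G \<cdot> x)"
  shows "\<exists>t0>0. \<forall>t. 0 < t \<longrightarrow> t \<le> t0 \<longrightarrow> norm (R - t *\<^sub>R G) < 1"
proof -
  \<comment> \<open>The first bound gives t|G|^2 \<le> \<epsilon>, the second keeps 1 - t\<epsilon>
    nonnegative under the root.\<close>
  define t0 where "t0 = min (\<epsilon> / ((norm G)\<^sup>2 + 1)) (1 / \<epsilon>)"
  have p: "0 < (norm G)\<^sup>2 + 1" by (simp add: add_nonneg_pos)
  have "norm (R - t *\<^sub>R G) < 1" if t: "0 < t" "t \<le> t0" for t
  proof -
    have tG: "t * (norm G)\<^sup>2 \<le> \<epsilon>" "t * \<epsilon> \<le> 1"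
    proof -
      have "t * ((norm G)\<^sup>2 + 1) \<le> \<epsilon>" using t p by (simp add: t0_def field_simps)
      then show "t * (norm G)\<^sup>2 \<le> \<epsilon>" using t by (simp add: distrib_left)
      show "t * \<epsilon> \<le> 1" using t \<epsilon>(1) by (simp add: t0_def field_simps)
    qed
    have "norm ((R - t *\<^sub>R G) \<cdot> x) \<le> sqrt (1 - t * \<epsilon>) * norm x" for x
    proof -
      let ?y = "R \<cdot> x"
      have GR: "G \<cdot> x = G \<cdot> ?y" using G by (metis rapp_simps(6))
      have RG: "?y \<bullet> (G \<cdot> x) = x \<bullet> (G \<cdot> x)" using R G by (metis inner_star rapp_simps(6))
      have "(norm ((R - t *\<^sub>R G) \<cdot> x))\<^sup>2 = (norm ?y)\<^sup>2 - 2 * t * (x \<bullet> (G \<cdot> x)) + t\<^sup>2 * (norm (G \<cdot> x))\<^sup>2"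
        using RG inner_commute[of "G \<cdot> x" ?y]
        by (simp add: power2_norm_eq_inner inner_diff_left inner_diff_right power2_eq_square[of t] algebra_simps)
      also have "\<dots> \<le> (norm ?y)\<^sup>2 - 2 * t * (\<epsilon> * (norm ?y)\<^sup>2) + t * \<epsilon> * (norm ?y)\<^sup>2"
      proof (intro add_mono diff_mono mult_left_mono)
        have "(norm (G \<cdot> x))\<^sup>2 \<le> (norm G * norm ?y)\<^sup>2" unfolding GR by (intro power_mono norm_rapp) auto
        then have "t\<^sup>2 * (norm (G \<cdot> x))\<^sup>2 \<le> t * (t * (norm G)\<^sup>2) * (norm ?y)\<^sup>2"
          using t by (simp add: power2_eq_square power_mult_distrib mult_left_mono ac_simps)
        also have "\<dots> \<le> t * \<epsilon> * (norm ?y)\<^sup>2" using t tG by (intro mult_right_mono mult_left_mono) auto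
        finally show "t\<^sup>2 * (norm (G \<cdot> x))\<^sup>2 \<le> t * \<epsilon> * (norm ?y)\<^sup>2" .
      qed (use t \<epsilon> in auto)
      also have "\<dots> = (1 - t * \<epsilon>) * (norm ?y)\<^sup>2" by (simp add: algebra_simps)
      also have "\<dots> \<le> (1 - t * \<epsilon>) * (norm x)\<^sup>2"
        using tG norm_projection[OF R, of x] by (intro mult_left_mono power_mono) auto
      also have "\<dots> = (sqrt (1 - t * \<epsilon>) * norm x)\<^sup>2" using tG by (simp add: power_mult_distrib)
      finally show ?thesis using tG by (auto intro: power2_le_imp_le)
    qed
    then have "norm (R - t *\<^sub>R G) \<le> sqrt (1 - t * \<epsilon>)" using tG by (intro norm_rop_bound) auto
    also have "\<dots> < 1" using t \<epsilon> by (simp add: real_sqrt_lt_1_iff)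
    finally show ?thesis .
  qed
  moreover have "0 < t0" using \<epsilon> p by (simp add: t0_def)
  ultimately show ?thesis by blast
qed

text \<open>The projection R is not assumed to lie in T. With A = R - tG, the elements R - A^n R are
  polynomials in G without constant term, hence in T, and they converge to R. Once R is available,
  the geometric series of A yields the inverse of G on the range of R.\<close>

lemma neumann:
  fixes G R :: "('v::finite, 'b) rop"
  assumes T: "csalg T" "G \<in> T"
    and R: "star R = R" "R * R = R" and G: "R * G = G" "G * R = G"
    and \<epsilon>: "0 < \<epsilon>" "\<And>x. \<epsilon> * (norm (R \<cdot> x))\<^sup>2 \<le> x \<bullet> (G \<cdot> x)"
  shows "R \<in> T" "\<exists>W\<in>T. W * G = R"
proof -
  obtain t where t: "0 < t" "norm (R - t *\<^sub>R G) < 1" using coercive_contraction[OF R G \<epsilon>] by blast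
  define A where "A = R - t *\<^sub>R G"
  define B where "B n = R - A ^ n * R" for n
  have sT: "salg T" using T csalgD by blast
  have AR: "A * R = A" by (simp add: A_def R G algebra_simps)
  have Bstep: "B (Suc n) = B n + t *\<^sub>R (A ^ n * R * G)" for n
  proof -
    have "A ^ Suc n * R = A ^ n * (A * R)" by (simp add: power_Suc2 mult.assoc del: power_Suc)
    also have "\<dots> = A ^ n * R - t *\<^sub>R (A ^ n * R * G)" unfolding AR by (simp add: A_def algebra_simps G)
    finally show ?thesis by (simp add: B_def)
  qed
  have AG: "A ^ n * R * G = G - B n * G" for n by (simp add: B_def algebra_simps G)
  have BT: "B n \<in> T" for n
  proof (induction n)
    case 0 then show ?case by (simp add: B_def salgD[OF sT])
  next
    case (Suc n) then show ?case
      unfolding Bstep AG using T(2) by (intro salgD[OF sT])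
  qed
  have small: "norm (A ^ n * R) \<le> norm A ^ n * norm R" for n
    by (rule order_trans[OF norm_mult_ineq]) (simp add: mult_right_mono norm_power_ineq)
  have "(\<lambda>n. norm A ^ n * norm R) \<longlonglongrightarrow> 0"
    using LIMSEQ_power_zero[of "norm A"] t by (intro tendsto_mult_left_zero) (auto simp: A_def)
  then have "(\<lambda>n. A ^ n * R) \<longlonglongrightarrow> 0"
    using small by (rule Lim_null_comparison[OF always_eventually[OF allI], rotated])
  then have BR: "B \<longlonglongrightarrow> R" using tendsto_diff[OF tendsto_const, of "\<lambda>n. A ^ n * R" 0 sequentially R] by (simp add: B_def[abs_def])
  then show RT: "R \<in> T" using closed_sequentially[OF csalgD(2)[OF T(1)]] BT by blast
  define W where "W n = t *\<^sub>R (\<Sum>k<n. A ^ k * R)" for n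
  have "summable (\<lambda>k. A ^ k * R)"
  proof (rule summable_comparison_test'[of "\<lambda>n. norm A ^ n * norm R" 0])
    show "summable (\<lambda>n. norm A ^ n * norm R)" using t by (intro summable_mult2 summable_geometric) (auto simp: A_def)
  qed (use small in auto)
  then obtain w where w: "(\<lambda>n. \<Sum>k<n. A ^ k * R) \<longlonglongrightarrow> w" by (auto simp: summable_def sums_def)
  then have Ww: "W \<longlonglongrightarrow> t *\<^sub>R w" unfolding W_def[abs_def] by (intro tendsto_intros)
  have ART: "A ^ k * R \<in> T" for k
    using salgD(3)[OF sT RT BT[of k]] by (simp add: B_def)
  have "W n \<in> T" for n
  proof -
    have "(\<Sum>k<n. A ^ k * R) \<in> T" by (induction n) (auto simp: salgD[OF sT] ART)
    then show ?thesis by (simp add: W_def salgD[OF sT])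
  qed
  then have wT: "t *\<^sub>R w \<in> T" using closed_sequentially[OF csalgD(2)[OF T(1)] _ Ww] by blast
  have "W n * G = B n" for n
  proof (induction n)
    case 0 then show ?case by (simp add: W_def B_def)
  next
    case (Suc n)
    have "W (Suc n) * G = W n * G + t *\<^sub>R (A ^ n * R * G)" by (simp add: W_def algebra_simps)
    then show ?case using Suc Bstep by simp
  qed
  then have "(\<lambda>n. W n * G) \<longlonglongrightarrow> R" using BR by simp
  moreover have "(\<lambda>n. W n * G) \<longlonglongrightarrow> t *\<^sub>R w * G" by (intro tendsto_intros Ww)
  ultimately have "t *\<^sub>R w * G = R" using LIMSEQ_unique by blast
  then show "\<exists>W\<in>T. W * G = R" using wT by blast
qed

text \<open>R - sH solves the equation of the iteration for S = R - s^2 H^2 and has norm below 1 by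
  coercivity, so the iteration, which involves only H^2 and R, converges to it.\<close>

lemma square_root_in_algebra:
  fixes H R :: "('v::finite, 'b) rop"
  assumes T: "csalg T" "H * H \<in> T" "R \<in> T"
    and R: "star R = R" "R * R = R" and H: "star H = H" "R * H = H" "H * R = H"
    and \<epsilon>: "0 < \<epsilon>" "\<And>x. \<epsilon> * (norm (R \<cdot> x))\<^sup>2 \<le> x \<bullet> (H \<cdot> x)"
  shows "H \<in> T"
proof -
  obtain t0 where t0: "0 < t0" "\<And>t. 0 < t \<Longrightarrow> t \<le> t0 \<Longrightarrow> norm (R - t *\<^sub>R H) < 1"
    using coercive_contraction[OF R H(2,3) \<epsilon>] by blast
  define s where "s = min t0 (1 / (norm H + 1))"
  have p: "0 < norm H + 1" by (simp add: add_nonneg_pos)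
  have s: "0 < s" "norm (R - s *\<^sub>R H) < 1" "s * norm H \<le> 1"
  proof -
    show "0 < s" using t0 p by (simp add: s_def)
    then show "norm (R - s *\<^sub>R H) < 1" using t0 by (simp add: s_def)
    have "s * (norm H + 1) \<le> 1" using p by (simp add: s_def min_def field_simps)
    then show "s * norm H \<le> 1" using \<open>0 < s\<close> by (simp add: distrib_left)
  qed
  define Y where "Y = R - s *\<^sub>R H"
  define S where "S = R - (s *\<^sub>R H) * (s *\<^sub>R H)"
  have sT: "salg T" using T csalgD by blast
  have "norm R \<le> 1" by (rule norm_rop_bound) (auto simp: norm_projection[OF R])
  then have nS: "norm S \<le> 1"
    unfolding S_def using H s by (intro norm_unit_minus_square) auto
  have "Y + Y = S + Y * Y" by (simp add: Y_def S_def algebra_simps R H)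
  then have lim: "sqit S \<longlonglongrightarrow> Y" using s by (intro sqit_tendsto nS) (auto simp: Y_def)
  have "S \<in> T" using salgD(3)[OF sT T(3) salgD(4)[OF sT salgD(4)[OF sT T(2)]], of s s] by (simp add: S_def)
  then have "Y \<in> T" using closed_sequentially[OF csalgD(2)[OF T(1)] _ lim] sqit_in_salg[OF sT] by blast
  then have "(1/s) *\<^sub>R (R - Y) \<in> T" using T(3) by (intro salgD[OF sT])
  then show ?thesis using s by (simp add: Y_def)
qed

section \<open>Operators on the Fock space\<close>

lemma coord_sum: "coord (\<Sum>i\<in>A. f i) j = (\<Sum>i\<in>A. coord (f i) j)"
  by (induction A rule: infinite_finite_induct) auto

lemma cnj_of_bool [simp]: "cnj (of_bool b) = of_bool b"
  by (cases b) auto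

lemma bfun_if [simp]: "bfun a \<Longrightarrow> bfun (\<lambda>i. if Q i then a i else 0)"
  by (auto simp: bfun_def) (metis norm_ge_zero order_trans norm_zero)

lemma bfun_cis [simp]: "bfun (\<lambda>i. cis (f i))"
  by (auto simp: bfun_def intro!: exI[of _ 1])

text \<open>A sum of rank-one projections. It makes every level compact, since a finite graph has
  finitely many paths of each length.\<close>

lemma dg_finite_rK: "finite A \<Longrightarrow> dg (\<lambda>i. of_bool (i \<in> A)) \<in> (rK :: ('v::finite, 'b) rop set)"
proof -
  assume A: "finite A"
  have 1: "dg (\<lambda>i. of_bool (i \<in> A)) = (\<Sum>j\<in>A. rtheta (basis j) (basis j :: ('v \<times> 'b) ell2))"
  proof (rule rop_coordI)
    fix x :: "('v \<times> 'b) ell2" and i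
    have "coord (rtheta (basis j) (basis j) \<cdot> x) i = (if j = i then coord x i else 0)" for j
    proof (cases "j = i")
      case True
      have "part (fst i) (basis i) = (basis i :: ('v \<times> 'b) ell2)" by (intro ell2_eqI) auto
      moreover have "cip (basis i) x = coord x i"
      proof -
        have "basis i \<bullet> x = Re (coord x i)" "diag (\<lambda>_. \<i>) (basis i) \<bullet> x = Im (coord x i)"
          using norm_ell2_support[of "{i}" "basis i" x] norm_ell2_support[of "{i}" "diag (\<lambda>_. \<i>) (basis i)" x]
          by (auto simp: coord_diag inner_complex_def)
        then show ?thesis by (simp add: cip_def complex_eq_iff)
      qed
      ultimately show ?thesis using True by (simp add: rtheta_app)
    qed (simp add: rtheta_app)
    then show "coord (dg (\<lambda>i. of_bool (i \<in> A)) \<cdot> x) i = coord ((\<Sum>j\<in>A. rtheta (basis j) (basis j)) \<cdot> x) i"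
      using A by (simp add: rapp_sum coord_sum coord_diag)
  qed
  show ?thesis unfolding 1 by (intro rK_sum rtheta_in_rK)
qed

locale fock =
  fixes sE rE :: "'e::finite \<Rightarrow> 'v::finite"
begin

definition ee :: "('v, 'e list) rop" where "ee = dg (\<lambda>\<alpha>. of_bool (is_path sE rE \<alpha>))"
definition PV :: "'v \<Rightarrow> ('v, 'e list) rop" where "PV v = dg (\<lambda>\<alpha>. of_bool (is_path sE rE \<alpha> \<and> prng rE \<alpha> = v))"
definition QK :: "nat \<Rightarrow> ('v, 'e list) rop" where "QK k = dg (\<lambda>\<alpha>. of_bool (\<alpha> \<in> PK sE rE k))"
definition QL :: "nat \<Rightarrow> ('v, 'e list) rop" where "QL k = dg (\<lambda>\<alpha>. of_bool (\<alpha> \<in> (\<Union>j<k. PK sE rE j)))"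
definition UT :: "real \<Rightarrow> ('v, 'e list) rop" where
  "UT t = dg (\<lambda>\<alpha>. if is_path sE rE \<alpha> then cis (real (plen \<alpha>) * t) else 0)"
definition SE :: "'e \<Rightarrow> ('v, 'e list) rop" where
  "SE e = sh {\<alpha>. is_path sE rE \<alpha> \<and> snd \<alpha> \<noteq> [] \<and> hd (snd \<alpha>) = e} (\<lambda>\<alpha>. (fst \<alpha>, tl (snd \<alpha>)))"

lemma coord_ee: "coord (ee \<cdot> x) \<alpha> = (if is_path sE rE \<alpha> then coord x \<alpha> else 0)"
  by (simp add: ee_def coord_diag)
lemma coord_PV: "coord (PV v \<cdot> x) \<alpha> = (if is_path sE rE \<alpha> \<and> prng rE \<alpha> = v then coord x \<alpha> else 0)"
  by (simp add: PV_def coord_diag)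
lemma coord_QK: "coord (QK k \<cdot> x) \<alpha> = (if is_path sE rE \<alpha> \<and> plen \<alpha> = k then coord x \<alpha> else 0)"
  by (simp add: QK_def coord_diag PK_def)
lemma coord_QL: "coord (QL k \<cdot> x) \<alpha> = (if is_path sE rE \<alpha> \<and> plen \<alpha> < k then coord x \<alpha> else 0)"
  by (auto simp: QL_def coord_diag PK_def)
lemma coord_UT: "coord (UT t \<cdot> x) \<alpha> = (if is_path sE rE \<alpha> then cis (real (plen \<alpha>) * t) * coord x \<alpha> else 0)"
  by (simp add: UT_def coord_diag)

lemma coord_SE: "coord (SE e \<cdot> x) \<alpha> = (if is_path sE rE \<alpha> \<and> snd \<alpha> \<noteq> [] \<and> hd (snd \<alpha>) = e then coord x (fst \<alpha>, tl (snd \<alpha>)) else 0)"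
  unfolding SE_def
  by (subst coord_sh) (auto simp: inj_on_def prod_eq_iff intro: list.expand)

lemma star_SE: "star (SE e) = sh {\<gamma>. is_path sE rE \<gamma> \<and> prng rE \<gamma> = sE e} (\<lambda>\<gamma>. (fst \<gamma>, e # snd \<gamma>))"
  unfolding SE_def
proof (rule star_sh)
  show "bij_betw (\<lambda>\<alpha>. (fst \<alpha>, tl (snd \<alpha>))) {\<alpha>. is_path sE rE \<alpha> \<and> snd \<alpha> \<noteq> [] \<and> hd (snd \<alpha>) = e}
     {\<gamma>. is_path sE rE \<gamma> \<and> prng rE \<gamma> = sE e}"
  proof (rule bij_betw_byWitness[where f' = "\<lambda>\<gamma>. (fst \<gamma>, e # snd \<gamma>)"])
    show "(\<lambda>\<alpha>. (fst \<alpha>, tl (snd \<alpha>))) ` {\<alpha>. is_path sE rE \<alpha> \<and> snd \<alpha> \<noteq> [] \<and> hd (snd \<alpha>) = e} \<subseteq> {\<gamma>. is_path sE rE \<gamma> \<and> prng rE \<gamma> = sE e}"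
    proof
      fix \<gamma> assume "\<gamma> \<in> (\<lambda>\<alpha>. (fst \<alpha>, tl (snd \<alpha>))) ` {\<alpha>. is_path sE rE \<alpha> \<and> snd \<alpha> \<noteq> [] \<and> hd (snd \<alpha>) = e}"
      then obtain \<alpha> where a: "\<gamma> = (fst \<alpha>, tl (snd \<alpha>))" "is_path sE rE \<alpha>" "snd \<alpha> \<noteq> []" "hd (snd \<alpha>) = e" by blast
      then have "\<alpha> = (fst \<alpha>, e # tl (snd \<alpha>))" by (cases \<alpha>; cases "snd \<alpha>") auto
      then have "is_path sE rE (fst \<alpha>, e # tl (snd \<alpha>))" using a(2) by simp
      then show "\<gamma> \<in> {\<gamma>. is_path sE rE \<gamma> \<and> prng rE \<gamma> = sE e}" by (auto simp: a(1))
    qed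
  qed (auto simp: prod_eq_iff)
qed (auto simp: prod_eq_iff)

lemma coord_star_SE: "coord (star (SE e) \<cdot> x) \<gamma> = (if is_path sE rE \<gamma> \<and> prng rE \<gamma> = sE e then coord x (fst \<gamma>, e # snd \<gamma>) else 0)"
  unfolding star_SE by (subst coord_sh) (auto simp: inj_on_def prod_eq_iff)

lemmas coords = coord_ee coord_PV coord_QK coord_QL coord_UT coord_SE coord_star_SE

lemma star_simps' [simp]: "star ee = ee" "star (PV v) = PV v" "star (QK k) = QK k" "star (QL k) = QL k"
  by (simp_all add: ee_def PV_def QK_def QL_def star_dg)

lemma ee_ee [simp]: "ee * ee = ee" by (rule rop_coordI) (simp add: coords)

lemma norm_ee: "norm ee \<le> 1" unfolding ee_def by (rule norm_dg_le) simp

lemma ee_mult [simp]: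
  "ee * PV v = PV v" "PV v * ee = PV v" "ee * QK k = QK k" "QK k * ee = QK k" "ee * UT t = UT t" "UT t * ee = UT t"
  "ee * SE e = SE e" "SE e * ee = SE e" "ee * star (SE e) = star (SE e)" "star (SE e) * ee = star (SE e)"
  "ee * star (UT t) = star (UT t)" "star (UT t) * ee = star (UT t)"
proof -
  show 1: "ee * PV v = PV v" "PV v * ee = PV v" "ee * QK k = QK k" "QK k * ee = QK k" "ee * UT t = UT t" "UT t * ee = UT t"
    "ee * SE e = SE e"
    by (rule rop_coordI, simp add: coords)+
  show 2: "SE e * ee = SE e"
  proof (rule rop_coordI)
    fix x \<alpha>
    show "coord ((SE e * ee) \<cdot> x) \<alpha> = coord (SE e \<cdot> x) \<alpha>"
      by (cases \<alpha>; cases "snd \<alpha>") (auto simp: coords)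
  qed
  show "ee * star (SE e) = star (SE e)" "star (SE e) * ee = star (SE e)"
    "ee * star (UT t) = star (UT t)" "star (UT t) * ee = star (UT t)"
    using arg_cong[OF 2, of star] arg_cong[OF 1(7), of star] arg_cong[OF 1(6), of star] arg_cong[OF 1(5), of star] by simp_all
qed

lemma PV_mult: "PV v * PV w = (if v = w then PV v else 0)"
  by (rule rop_coordI) (simp add: coords)
lemma PV_sum: "(\<Sum>v\<in>UNIV. PV v) = ee"
  by (rule rop_coordI) (simp add: rapp_sum coord_sum coords)
lemma PV_QK: "PV v * QK k = QK k * PV v"
  by (rule rop_coordI) (simp add: coords)
lemma SE_SE: "star (SE e) * SE f = (if e = f then PV (sE e) else 0)"
  by (rule rop_coordI) (auto simp: coords)
lemma PV_SE: "PV v * SE e = (if v = rE e then SE e else 0)"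
proof (rule rop_coordI)
  fix x \<alpha>
  show "coord ((PV v * SE e) \<cdot> x) \<alpha> = coord ((if v = rE e then SE e else 0) \<cdot> x) \<alpha>"
    by (cases \<alpha>; cases "snd \<alpha>") (auto simp: coords)
qed

definition RR :: "('v, 'e list) rop" where "RR = ee - QK 0"

text \<open>Every path of positive length starts with exactly one edge and no vertex does. The
  defect from the unit \<open>ee\<close> is the compact Q_0, so the Cuntz--Krieger relation holds in
  the quotient.\<close>

lemma SE_sum: "(\<Sum>e\<in>UNIV. SE e * star (SE e)) = RR"
proof (rule rop_coordI)
  fix x and \<alpha> :: "('v, 'e) path"
  obtain v es where a: "\<alpha> = (v, es)" by fastforce
  show "coord ((\<Sum>e\<in>UNIV. SE e * star (SE e)) \<cdot> x) \<alpha> = coord (RR \<cdot> x) \<alpha>"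
  proof (cases es)
    case Nil
    then show ?thesis by (simp add: a RR_def rapp_sum coord_sum coords)
  next
    case (Cons f fs)
    have "coord ((SE e * star (SE e)) \<cdot> x) \<alpha> = (if e = f then coord (RR \<cdot> x) \<alpha> else 0)" for e
      by (auto simp: a Cons RR_def coords)
    then show ?thesis by (simp add: rapp_sum coord_sum del: rapp_simps(6))
  qed
qed

lemma QK_rK: "QK k \<in> rK" unfolding QK_def by (rule dg_finite_rK[OF finite_PK])
lemma QL_rK: "QL k \<in> rK" unfolding QL_def by (rule dg_finite_rK) (simp add: finite_PK)

lemma QK_SE: "QK (Suc k) * SE e = SE e * QK k"
proof (rule rop_coordI)
  fix x \<alpha>
  show "coord ((QK (Suc k) * SE e) \<cdot> x) \<alpha> = coord ((SE e * QK k) \<cdot> x) \<alpha>"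
    by (cases \<alpha>; cases "snd \<alpha>") (auto simp: coords)
qed

lemma RR_simps [simp]: "star RR = RR" "RR * RR = RR" "RR * SE e = SE e" "ee * RR = RR" "RR * ee = RR"
proof -
  show "star RR = RR" by (simp add: RR_def)
  show "RR * RR = RR" "ee * RR = RR" "RR * ee = RR" by (rule rop_coordI, simp add: RR_def coords)+
  show "RR * SE e = SE e"
  proof (rule rop_coordI)
    fix x \<alpha>
    show "coord ((RR * SE e) \<cdot> x) \<alpha> = coord (SE e \<cdot> x) \<alpha>"
      by (cases \<alpha>; cases "snd \<alpha>") (auto simp: RR_def coords)
  qed
qed

lemma UT_UT [simp]: "UT t * star (UT t) = ee" "star (UT t) * UT t = ee"
proof -
  have "star (UT t) = dg (\<lambda>\<alpha>. cnj (if is_path sE rE \<alpha> then cis (real (plen \<alpha>) * t) else 0))"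
    unfolding UT_def by (rule star_dg) simp
  also have "(\<lambda>\<alpha>. cnj (if is_path sE rE \<alpha> then cis (real (plen \<alpha>) * t) else 0)) =
      (\<lambda>\<alpha>. if is_path sE rE \<alpha> then cis (real (plen \<alpha>) * (- t)) else 0)" by (auto simp: cis_cnj)
  finally have "star (UT t) = UT (- t)" by (simp add: UT_def)
  then show "UT t * star (UT t) = ee" "star (UT t) * UT t = ee"
    by (auto intro!: rop_coordI simp: coords cis_mult simp flip: mult.assoc)
qed

lemma UT_SE: "UT t * SE e = sc (cis t) * (SE e * UT t)"
proof (rule rop_coordI)
  fix x and \<alpha> :: "('v, 'e) path"
  obtain v es where a: "\<alpha> = (v, es)" by fastforce
  show "coord ((UT t * SE e) \<cdot> x) \<alpha> = coord ((sc (cis t) * (SE e * UT t)) \<cdot> x) \<alpha>"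
  proof (cases es)
    case (Cons f fs)
    have "cis (real (Suc (length fs)) * t) = cis t * cis (real (length fs) * t)"
      unfolding cis_mult by (simp add: algebra_simps)
    then show ?thesis by (auto simp: a Cons coords coord_diag)
  qed (simp add: a coords coord_diag)
qed

lemma norm_UT: "norm (UT t) \<le> 1"
  unfolding UT_def by (rule norm_dg_le) auto

definition ga :: "real \<Rightarrow> ('v, 'e list) rop \<Rightarrow> ('v, 'e list) rop" where
  "ga t T = UT t * T * star (UT t)"

lemma ga_simps: "ga t (S + T) = ga t S + ga t T" "ga t (S - T) = ga t S - ga t T" "ga t 0 = 0"
  "ga t (star T) = star (ga t T)" "ga t (r *\<^sub>R T) = r *\<^sub>R ga t T"
  by (simp_all add: ga_def algebra_simps)

lemma ga_sc: "ga t (sc c * T) = sc c * ga t T"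
proof -
  have "ga t (sc c * T) = (UT t * sc c) * T * star (UT t)" by (simp add: ga_def mult.assoc)
  then show ?thesis by (simp add: ga_def mult.assoc flip: sc_central)
qed

text \<open>The unitaries U_t are unitary only on the corner, which is why a factor in the middle
  must absorb \<open>ee\<close>.\<close>

lemma ga_mult: "S * ee = S \<Longrightarrow> ga t (S * T) = ga t S * ga t T"
proof -
  assume S: "S * ee = S"
  have "ga t S * ga t T = UT t * S * (star (UT t) * UT t) * T * star (UT t)" by (simp only: ga_def mult.assoc)
  also have "\<dots> = UT t * (S * ee) * T * star (UT t)" by (simp only: UT_UT mult.assoc)
  finally show ?thesis unfolding S by (simp add: ga_def mult.assoc)
qed

lemma norm_ga: "norm (ga t T) \<le> norm T"
proof -
  have "norm (ga t T) \<le> norm (UT t) * norm T * norm (star (UT t))"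
    unfolding ga_def by (intro order_trans[OF norm_mult_ineq] mult_right_mono norm_mult_ineq) auto
  also have "\<dots> \<le> 1 * norm T * 1" using norm_UT[of t] by (intro mult_mono) auto
  finally show ?thesis by simp
qed

lemma ga_SE: "ga t (SE e) = sc (cis t) * SE e"
proof -
  have "ga t (SE e) = sc (cis t) * SE e * (UT t * star (UT t))" unfolding ga_def UT_SE by (simp add: mult.assoc)
  then show ?thesis by (simp add: mult.assoc)
qed

section \<open>Path operators and the decomposition by length\<close>

definition SP :: "('v, 'e) path \<Rightarrow> ('v, 'e list) rop" where
  "SP \<alpha> = foldr (\<lambda>e x. SE e * x) (snd \<alpha>) (PV (fst \<alpha>))"

lemma SP_simps [simp]: "SP (v, []) = PV v" "SP (v, e # es) = SE e * SP (v, es)"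
  by (simp_all add: SP_def)

lemma QK_SP: "QK (k + plen \<alpha>) * SP \<alpha> = SP \<alpha> * QK k"
proof -
  obtain v es where a: "\<alpha> = (v, es)" by fastforce
  have "QK (k + length es) * SP (v, es) = SP (v, es) * QK k"
  proof (induction es)
    case Nil then show ?case by (simp add: PV_QK)
  next
    case (Cons e es)
    have "QK (Suc (k + length es)) * (SE e * SP (v, es)) = SE e * (QK (k + length es) * SP (v, es))"
      using QK_SE by (simp flip: mult.assoc)
    then show ?case using Cons by (simp add: mult.assoc)
  qed
  then show ?thesis by (simp add: a)
qed

lemma SP_PV: "SP \<alpha> * PV (psrc \<alpha>) = SP \<alpha>"
proof -
  obtain v es where a: "\<alpha> = (v, es)" by fastforce
  have "SP (v, es) * PV v = SP (v, es)" by (induction es) (auto simp: PV_mult mult.assoc)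
  then show ?thesis by (simp add: a)
qed

lemma ee_SP: "ee * SP \<alpha> = SP \<alpha>" "SP \<alpha> * ee = SP \<alpha>"
proof -
  obtain v es where a: "\<alpha> = (v, es)" by fastforce
  show "ee * SP \<alpha> = SP \<alpha>" unfolding a by (cases es) (auto simp flip: mult.assoc)
  have "SP (v, es) * ee = SP (v, es)" by (induction es) (auto simp: mult.assoc)
  then show "SP \<alpha> * ee = SP \<alpha>" by (simp add: a)
qed

lemma star_SP_SP:
  assumes "\<alpha> \<in> PK sE rE k" "\<beta> \<in> PK sE rE k"
  shows "star (SP \<alpha>) * SP \<beta> = (if \<alpha> = \<beta> then PV (psrc \<alpha>) else 0)"
proof -
  obtain w es v bs where ab: "\<alpha> = (w, es)" "\<beta> = (v, bs)" by fastforce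
  have rng: "PV (prng rE \<alpha>) * SP \<alpha> = SP \<alpha>" if "is_path sE rE \<alpha>" for \<alpha>
  proof -
    obtain v es where "\<alpha> = (v, es)" by fastforce
    then show ?thesis by (cases es) (auto simp: PV_mult PV_SE simp flip: mult.assoc)
  qed
  have "length es = length bs \<Longrightarrow> is_path sE rE (w, es) \<Longrightarrow> is_path sE rE (v, bs) \<Longrightarrow>
     star (SP (w, es)) * SP (v, bs) = (if (w, es) = (v, bs) then PV w else 0)"
  proof (induction es bs rule: list_induct2)
    case Nil then show ?case by (auto simp: PV_mult)
  next
    case (Cons e es f bs)
    have "star (SP (w, e # es)) * SP (v, f # bs) = star (SP (w, es)) * (star (SE e) * SE f) * SP (v, bs)"
      by (simp add: mult.assoc)
    also have "\<dots> = (if e = f then star (SP (w, es)) * SP (v, bs) else 0)"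
      using Cons.prems rng[of "(v, bs)"] by (auto simp: SE_SE mult.assoc)
    finally show ?case using Cons by auto
  qed
  then show ?thesis using assms ab by (simp add: PK_def)
qed

lemma QL_tendsto: "(\<lambda>M. QL M \<cdot> x) \<longlonglongrightarrow> ee \<cdot> x"
proof -
  have "(\<lambda>M. restr (\<Union>j<M. PK sE rE j) x) \<longlonglongrightarrow> restr {\<alpha>. is_path sE rE \<alpha>} x"
  proof (rule restr_tendsto)
    fix i assume "i \<in> {\<alpha>. is_path sE rE \<alpha>}"
    then show "\<forall>\<^sub>F n in sequentially. i \<in> (\<Union>j<n. PK sE rE j)"
      by (auto simp: PK_def eventually_sequentially intro!: exI[of _ "Suc (plen i)"])
  qed (auto simp: PK_def)
  then show ?thesis by (simp add: QL_def ee_def)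
qed

lemma QL_Suc: "QL (Suc M) = QL M + QK M"
  by (rule rop_coordI) (auto simp: coords)

lemma QK_QL: "N \<le> M \<Longrightarrow> QK M * QL N = 0"
  by (rule rop_coordI) (auto simp: coords)

text \<open>Such an operator is the orthogonal sum of its blocks T Q_k. Beyond a level N its norm is
  controlled by the supremum of the block norms, which is small, and the part below N is
  compact.\<close>

lemma level_shift_compact:
  assumes T: "T * ee = T" "\<And>k. T * QK k = QK (k + p) * T" and lim: "(\<lambda>k. norm (T * QK k)) \<longlonglongrightarrow> 0"
  shows "T \<in> rK"
proof -
  have "\<exists>S\<in>rK. dist S T < \<epsilon>" if \<epsilon>: "0 < \<epsilon>" for \<epsilon>
  proof -
    obtain N where N: "\<And>k. N \<le> k \<Longrightarrow> norm (T * QK k) < \<epsilon> / 2"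
      using LIMSEQ_D[OF lim, of "\<epsilon> / 2"] \<epsilon> by auto
    \<comment> \<open>Pythagoras in the domain and in the range: T sends different levels to
      different levels.\<close>
    have fin: "(norm (T \<cdot> (QL M - QL N) \<cdot> x))\<^sup>2 \<le> (\<epsilon> / 2)\<^sup>2 * (norm ((QL M - QL N) \<cdot> x))\<^sup>2" if "N \<le> M" for M x
      using that
    proof (induction M rule: dec_induct)
      case (step M)
      let ?y = "(QL M - QL N) \<cdot> x" and ?q = "QK M \<cdot> x"
      have split: "(QL (Suc M) - QL N) \<cdot> x = ?y + ?q" by (simp add: QL_Suc)
      have Qy: "QK M \<cdot> ?y = 0"
        using QK_QL[of M M] QK_QL[of N M] step by (simp flip: rapp_simps(6))
      have Qq: "QK M \<cdot> ?q = ?q" by (intro ell2_eqI) (simp add: coords)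
      have o1: "?y \<bullet> ?q = 0"
        using inner_star[of "QK M" ?y ?q] Qy Qq by simp
      have TQ: "T \<cdot> QK M \<cdot> w = QK (M + p) \<cdot> T \<cdot> w" for w using T(2) by (metis rapp_simps(6))
      have o2: "(T \<cdot> ?y) \<bullet> (T \<cdot> ?q) = 0"
      proof -
        have "(T \<cdot> ?y) \<bullet> (T \<cdot> ?q) = (T \<cdot> ?y) \<bullet> (QK (M + p) \<cdot> T \<cdot> ?q)" using TQ[of ?q] Qq by simp
        also have "\<dots> = (QK (M + p) \<cdot> T \<cdot> ?y) \<bullet> (T \<cdot> ?q)" 
          using inner_star[of "QK (M + p)" "T \<cdot> ?y" "T \<cdot> ?q"] by (simp only: star_simps')
        also have "\<dots> = 0" using TQ[of ?y] Qy by simp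
        finally show ?thesis .
      qed
      have "norm (T \<cdot> ?q) \<le> (\<epsilon> / 2) * norm ?q"
      proof -
        have "norm (T \<cdot> ?q) = norm ((T * QK M) \<cdot> ?q)" using Qq by simp
        also have "\<dots> \<le> norm (T * QK M) * norm ?q" by (rule norm_rapp)
        also have "\<dots> \<le> (\<epsilon> / 2) * norm ?q" using N[of M] step by (intro mult_right_mono) auto
        finally show ?thesis .
      qed
      then have q: "(norm (T \<cdot> ?q))\<^sup>2 \<le> (\<epsilon> / 2)\<^sup>2 * (norm ?q)\<^sup>2"
        by (metis norm_ge_zero power_mono power_mult_distrib)
      have "(norm (T \<cdot> (?y + ?q)))\<^sup>2 = (norm (T \<cdot> ?y))\<^sup>2 + (norm (T \<cdot> ?q))\<^sup>2"
        using o2 by (simp only: rapp_simps(8)) (simp add: norm_add_Pythagorean orthogonal_def)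
      also have "\<dots> \<le> (\<epsilon> / 2)\<^sup>2 * (norm ?y)\<^sup>2 + (\<epsilon> / 2)\<^sup>2 * (norm ?q)\<^sup>2" using step.IH q by (rule add_mono)
      also have "\<dots> = (\<epsilon> / 2)\<^sup>2 * (norm (?y + ?q))\<^sup>2"
        using o1 by (subst norm_add_Pythagorean) (simp_all add: orthogonal_def distrib_left)
      finally show ?case unfolding split .
    qed simp
    have "norm ((T - T * QL N) \<cdot> x) \<le> (\<epsilon> / 2) * norm x" for x
    proof (rule tendsto_upperbound)
      have "(\<lambda>M. norm (T \<cdot> (QL M \<cdot> x - QL N \<cdot> x))) \<longlonglongrightarrow> norm (T \<cdot> (ee \<cdot> x - QL N \<cdot> x))"
        by (intro tendsto_norm bounded_linear.tendsto[OF bounded_linear_rapp] tendsto_diff QL_tendsto tendsto_const)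
      moreover have "T \<cdot> ee \<cdot> x = T \<cdot> x" using T(1) by (metis rapp_simps(6))
      ultimately show "(\<lambda>M. norm (T \<cdot> (QL M - QL N) \<cdot> x)) \<longlonglongrightarrow> norm ((T - T * QL N) \<cdot> x)" by simp
      have "norm (T \<cdot> (QL M - QL N) \<cdot> x) \<le> (\<epsilon> / 2) * norm x" if "N \<le> M" for M
      proof -
        have "norm (T \<cdot> (QL M - QL N) \<cdot> x) \<le> (\<epsilon> / 2) * norm ((QL M - QL N) \<cdot> x)"
        proof (rule power2_le_imp_le)
          show "(norm (T \<cdot> (QL M - QL N) \<cdot> x))\<^sup>2 \<le> ((\<epsilon> / 2) * norm ((QL M - QL N) \<cdot> x))\<^sup>2"
            using fin[OF that, of x] by (simp only: power_mult_distrib)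
        qed (use \<epsilon> in simp)
        also have "\<dots> \<le> (\<epsilon> / 2) * norm x"
        proof (intro mult_left_mono)
          have "QL M - QL N = dg (\<lambda>\<alpha>. of_bool (is_path sE rE \<alpha> \<and> N \<le> plen \<alpha> \<and> plen \<alpha> < M))"
            using that by (intro rop_coordI) (auto simp: coords coord_diag)
          moreover have "norm (dg (\<lambda>\<alpha>. of_bool (is_path sE rE \<alpha> \<and> N \<le> plen \<alpha> \<and> plen \<alpha> < M)) \<cdot> x) \<le> 1 * norm x"
            unfolding dg_app by (rule norm_diag_le) simp
          ultimately show "norm ((QL M - QL N) \<cdot> x) \<le> norm x" by (simp only:)
        qed (use \<epsilon> in simp)
        finally show ?thesis .
      qed
      then show "\<forall>\<^sub>F M in sequentially. norm (T \<cdot> (QL M - QL N) \<cdot> x) \<le> (\<epsilon> / 2) * norm x"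
        by (auto simp: eventually_sequentially)
    qed simp
    then have "norm (T - T * QL N) \<le> \<epsilon> / 2" using \<epsilon> by (intro norm_rop_bound) auto
    then show ?thesis using \<epsilon> rK_mult_left[OF QL_rK, of T N]
      by (intro bexI[of _ "T * QL N"]) (auto simp: dist_norm norm_minus_commute)
  qed
  then show ?thesis using closed_approachable[OF closed_rK] by blast
qed

end

section \<open>Complex scalars and closed star-algebras of operators\<close>

lemma sc_mult: "sc c * sc d = sc (c * d)" by (simp add: dg_mult)

lemma sc_zero: "sc 0 = 0" by (rule rop_coordI) (simp add: coord_diag)

lemma sc_one: "sc 1 = 1" by (rule rop_coordI) (simp add: coord_diag)

lemma star_sc: "star (sc c) = sc (cnj c)" by (simp add: star_dg)

lemma sc_real: "sc (complex_of_real r) * T = r *\<^sub>R T"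
  by (rule rop_coordI) (simp add: coord_diag scaleR_conv_of_real[where 'a = complex])

lemma sc_assoc: "S * (sc c * T) = sc c * (S * T)"
  by (metis mult.assoc sc_central)

lemma sc_pull: "(sc c * S) * (sc d * T) = sc (c * d) * (S * T)"
proof -
  have "(sc c * S) * (sc d * T) = sc c * (S * (sc d * T))" by (simp add: mult.assoc)
  also have "\<dots> = (sc c * sc d) * (S * T)" unfolding sc_assoc[of S] by (simp add: mult.assoc)
  finally show ?thesis by (simp only: sc_mult)
qed

lemma sc_add: "sc c * T + sc d * T = sc (c + d) * T"
  by (rule rop_coordI) (simp add: coord_diag algebra_simps)

lemma csalgI:
  assumes "0 \<in> A" "\<And>S T. S \<in> A \<Longrightarrow> T \<in> A \<Longrightarrow> S + T \<in> A" "\<And>S T. S \<in> A \<Longrightarrow> T \<in> A \<Longrightarrow> S * T \<in> A"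
    "\<And>c T. T \<in> A \<Longrightarrow> sc c * T \<in> A" "\<And>T. T \<in> A \<Longrightarrow> star T \<in> A" "closed A"
  shows "csalg A"
proof -
  have "r *\<^sub>R T \<in> A" if "T \<in> A" for r T using assms(4)[OF that, of "complex_of_real r"] by (simp add: sc_real)
  then show ?thesis using assms by (auto simp: csalg_def salg_def subspace_def)
qed

lemma csalg_ops:
  assumes "csalg A"
  shows "0 \<in> A" "S \<in> A \<Longrightarrow> T \<in> A \<Longrightarrow> S + T \<in> A" "S \<in> A \<Longrightarrow> T \<in> A \<Longrightarrow> S - T \<in> A" "T \<in> A \<Longrightarrow> r *\<^sub>R T \<in> A"
    "S \<in> A \<Longrightarrow> T \<in> A \<Longrightarrow> S * T \<in> A" "T \<in> A \<Longrightarrow> star T \<in> A" "T \<in> A \<Longrightarrow> sc c * T \<in> A"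
  by (simp_all add: salgD[OF csalgD(1)[OF assms]] csalgD(3)[OF assms])

lemma csalg_sum: "csalg A \<Longrightarrow> (\<And>i. i \<in> I \<Longrightarrow> f i \<in> A) \<Longrightarrow> (\<Sum>i\<in>I. f i) \<in> A"
  by (induction I rule: infinite_finite_induct) (auto simp: csalg_ops)

lemma csalg_closure:
  assumes "0 \<in> A" "\<And>S T. S \<in> A \<Longrightarrow> T \<in> A \<Longrightarrow> S + T \<in> A" "\<And>S T. S \<in> A \<Longrightarrow> T \<in> A \<Longrightarrow> S * T \<in> A"
    "\<And>c T. T \<in> A \<Longrightarrow> sc c * T \<in> A" "\<And>T. T \<in> A \<Longrightarrow> star T \<in> A"
  shows "csalg (closure A)"
proof (rule csalgI)
  fix S T :: "('a, 'b) rop" assume "S \<in> closure A" "T \<in> closure A"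
  then obtain s t where st: "\<And>n. s n \<in> A" "s \<longlonglongrightarrow> S" "\<And>n. t n \<in> A" "t \<longlonglongrightarrow> T"
    by (auto simp: closure_sequential)
  show "S + T \<in> closure A" unfolding closure_sequential
    by (rule exI[of _ "\<lambda>n. s n + t n"]) (use st assms(2) in \<open>auto intro: tendsto_add\<close>)
  show "S * T \<in> closure A" unfolding closure_sequential
    by (rule exI[of _ "\<lambda>n. s n * t n"]) (use st assms(3) in \<open>auto intro: tendsto_mult\<close>)
next
  fix T :: "('a, 'b) rop" and c assume "T \<in> closure A"
  then obtain t where t: "\<And>n. t n \<in> A" "t \<longlonglongrightarrow> T" by (auto simp: closure_sequential)
  show "sc c * T \<in> closure A" unfolding closure_sequential
    by (rule exI[of _ "\<lambda>n. sc c * t n"]) (use t assms(4) in \<open>auto intro: tendsto_mult_left\<close>)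
  show "star T \<in> closure A" unfolding closure_sequential
    by (rule exI[of _ "\<lambda>n. star (t n)"]) (use t assms(5) in \<open>auto intro: bounded_linear.tendsto[OF bounded_linear_star]\<close>)
qed (use assms(1) closure_subset in auto)

section \<open>The weighted Toeplitz algebra\<close>

text \<open>In \<open>Z_condA\<close> the operator I_p \<otimes> Z_k appears as the sum of
  \<open>SP \<beta> * (ZZ * QK k) * star (SP \<beta>)\<close> over paths \<beta> of length p;
  \<open>tensId_op_of\<close> proves the agreement with the coordinate definition.\<close>

locale weighted_fock = fock sE rE for sE rE :: "'e::finite \<Rightarrow> 'v::finite" +
  fixes ZZ :: "('v, 'e list) rop" and p :: nat
  assumes no_sinks: "\<forall>v. \<exists>e. sE e = v" and p_pos: "1 \<le> p"
    and Z_ee: "ee * ZZ = ZZ" and Z_star [simp]: "star ZZ = ZZ"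
    and Z_QK: "ZZ * QK k = QK k * ZZ" and Z_PV: "ZZ * PV v = PV v * ZZ"
    and Z_low: "\<exists>\<epsilon>>0. \<forall>k\<ge>1. \<forall>x. QK k \<cdot> x = x \<longrightarrow> \<epsilon> * (norm x)\<^sup>2 \<le> x \<bullet> (ZZ \<cdot> x)"
    and Z_condA: "(\<lambda>k. norm ((\<Sum>\<beta>\<in>PK sE rE p. SP \<beta> * (ZZ * QK k) * star (SP \<beta>)) - ZZ * QK (k + p))) \<longlonglongrightarrow> 0"
begin

lemma Z_ee': "ZZ * ee = ZZ"
  using arg_cong[OF Z_ee, of star] by simp

lemma Z_RR: "ZZ * RR = RR * ZZ" by (simp add: RR_def algebra_simps Z_ee Z_ee' Z_QK)

text \<open>Z on positive lengths, the part visible in the Z S_e, since the range of S_e contains no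
  vertex component.\<close>

definition HH :: "('v, 'e list) rop" where "HH = ZZ * RR"

lemma HH_simps [simp]: "star HH = HH" "RR * HH = HH" "HH * RR = HH" "ee * HH = HH" "HH * ee = HH"
  by (simp_all add: HH_def Z_RR mult.assoc[symmetric]) (simp_all add: mult.assoc Z_RR[symmetric] Z_ee flip: Z_RR)

text \<open>Z respects the orthogonal levels, so the lower bounds on the single levels add up on
  finite sums of levels and pass to the limit. The vertices are removed by subtracting
  \<open>QL 1\<close>, which is Q_0.\<close>

lemma Z_lower: "\<exists>\<epsilon>>0. \<forall>x. \<epsilon> * (norm (RR \<cdot> x))\<^sup>2 \<le> x \<bullet> (HH \<cdot> x)"
proof -
  obtain \<epsilon> where \<epsilon>: "\<epsilon> > 0" "\<And>k x. k \<ge> 1 \<Longrightarrow> QK k \<cdot> x = x \<Longrightarrow> \<epsilon> * (norm x)\<^sup>2 \<le> x \<bullet> (ZZ \<cdot> x)"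
    using Z_low by blast
  have "\<epsilon> * (norm (RR \<cdot> x))\<^sup>2 \<le> x \<bullet> (HH \<cdot> x)" for x
  proof -
    define y where "y M = (QL (Suc M) - QL 1) \<cdot> x" for M
    have fin: "\<epsilon> * (norm (y M))\<^sup>2 \<le> y M \<bullet> (ZZ \<cdot> y M)" for M
    proof (induction M)
      case 0 then show ?case by (simp add: y_def)
    next
      case (Suc M)
      let ?q = "QK (Suc M) \<cdot> x"
      have split: "y (Suc M) = y M + ?q" by (simp add: y_def QL_Suc[of "Suc M"])
      have Qy: "QK (Suc M) \<cdot> y M = 0"
        unfolding y_def using QK_QL[of "Suc M" "Suc M"] QK_QL[of 1 "Suc M"] by (simp flip: rapp_simps(6))
      have Qq: "QK (Suc M) \<cdot> ?q = ?q" by (intro ell2_eqI) (simp add: coords)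
      have ZQ: "ZZ \<cdot> QK k \<cdot> w = QK k \<cdot> ZZ \<cdot> w" for k w using Z_QK by (metis rapp_simps(6))
      have QI: "(QK k \<cdot> v) \<bullet> w = v \<bullet> (QK k \<cdot> w)" for k v w using inner_star[of "QK k" v w] by simp
      have o1: "y M \<bullet> ?q = 0" using QI[of "Suc M" "y M" ?q] Qy Qq by simp
      have o2: "y M \<bullet> (ZZ \<cdot> ?q) = 0" using QI[of "Suc M" "y M" "ZZ \<cdot> ?q"] Qy Qq ZQ[of "Suc M" ?q] by simp
      have o3: "?q \<bullet> (ZZ \<cdot> y M) = 0" using QI[of "Suc M" ?q "ZZ \<cdot> y M"] ZQ[of "Suc M" "y M"] Qy Qq by simp
      have "(norm (y M + ?q))\<^sup>2 = (norm (y M))\<^sup>2 + (norm ?q)\<^sup>2"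
        using o1 by (simp add: norm_add_Pythagorean orthogonal_def)
      then have "\<epsilon> * (norm (y (Suc M)))\<^sup>2 = \<epsilon> * (norm (y M))\<^sup>2 + \<epsilon> * (norm ?q)\<^sup>2"
        unfolding split by (simp add: distrib_left)
      also have "\<dots> \<le> y M \<bullet> (ZZ \<cdot> y M) + ?q \<bullet> (ZZ \<cdot> ?q)" using Suc \<epsilon>(2)[OF _ Qq] by (intro add_mono) auto
      also have "\<dots> = y (Suc M) \<bullet> (ZZ \<cdot> y (Suc M))"
        unfolding split using o2 o3 by (simp add: inner_add_left inner_add_right)
      finally show ?case .
    qed
    have "QL 1 = QK 0" by (rule rop_coordI) (auto simp: coords)
    then have lim: "y \<longlonglongrightarrow> RR \<cdot> x"
      unfolding y_def[abs_def] RR_def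
      using tendsto_diff[OF LIMSEQ_Suc[OF QL_tendsto[of x]] tendsto_const[of "QL 1 \<cdot> x"]] by simp
    have "\<epsilon> * (norm (RR \<cdot> x))\<^sup>2 \<le> (RR \<cdot> x) \<bullet> (ZZ \<cdot> RR \<cdot> x)"
    proof (rule LIMSEQ_le)
      show "(\<lambda>M. \<epsilon> * (norm (y M))\<^sup>2) \<longlonglongrightarrow> \<epsilon> * (norm (RR \<cdot> x))\<^sup>2" by (intro tendsto_intros lim)
      show "(\<lambda>M. y M \<bullet> (ZZ \<cdot> y M)) \<longlonglongrightarrow> (RR \<cdot> x) \<bullet> (ZZ \<cdot> RR \<cdot> x)"
        by (intro tendsto_intros lim bounded_linear.tendsto[OF bounded_linear_rapp])
    qed (use fin in auto)
    also have "\<dots> = x \<bullet> (HH \<cdot> x)"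
      using inner_star[of RR x "ZZ \<cdot> RR \<cdot> x"] HH_simps(2) by (metis HH_def RR_simps(1) rapp_simps(6))
    finally show ?thesis .
  qed
  then show ?thesis using \<epsilon>(1) by blast
qed

definition TT :: "('v, 'e list) rop set" where "TT = \<Inter>{B. csalg B \<and> (\<forall>e. ZZ * SE e \<in> B)}"

lemma csalg_TT: "csalg TT"
  unfolding TT_def by (rule csalgI) (auto simp: csalg_ops csalgD intro!: closed_Inter)

lemma ZS_in_TT: "ZZ * SE e \<in> TT" by (auto simp: TT_def)

lemma TT_induct: "T \<in> TT \<Longrightarrow> csalg B \<Longrightarrow> (\<And>e. ZZ * SE e \<in> B) \<Longrightarrow> T \<in> B" by (auto simp: TT_def)

lemma TT_corner: assumes "T \<in> TT" shows "ee * T = T" "T * ee = T"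
proof -
  have "csalg {T. ee * T = T \<and> T * ee = T}"
  proof (rule csalgI)
    have "closed {T. ee * T = T}" "closed {T. T * ee = T}" by (intro closed_Collect_eq continuous_intros)+
    then show "closed {T. ee * T = T \<and> T * ee = T}" by (rule closed_Collect_conj)
    show "star T \<in> {T. ee * T = T \<and> T * ee = T}" if "T \<in> {T. ee * T = T \<and> T * ee = T}" for T
    proof -
      have "ee * T = T" "T * ee = T" using that by auto
      from this[THEN arg_cong[of _ _ star]] show ?thesis by simp
    qed
  qed (auto simp: distrib_left distrib_right sc_assoc mult.assoc, metis mult.assoc)
  then have "T \<in> {T. ee * T = T \<and> T * ee = T}"
    by (rule TT_induct[OF assms]) (simp add: mult.assoc, simp add: Z_ee flip: mult.assoc)
  then show "ee * T = T" "T * ee = T" by auto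
qed

lemma HH_square: "HH * HH = (\<Sum>e\<in>UNIV. (ZZ * SE e) * star (ZZ * SE e))"
proof -
  have "(\<Sum>e\<in>UNIV. (ZZ * SE e) * star (ZZ * SE e)) = ZZ * (\<Sum>e\<in>UNIV. SE e * star (SE e)) * ZZ"
    by (simp add: sum_distrib_left sum_distrib_right mult.assoc)
  also have "\<dots> = ZZ * RR * ZZ" by (simp only: SE_sum)
  also have "\<dots> = ZZ * (RR * RR) * ZZ" by simp
  also have "\<dots> = HH * HH" by (simp only: HH_def mult.assoc Z_RR[symmetric])
  finally show ?thesis by simp
qed

text \<open>The square of HH is a sum of products of generators, and it is coercive with constant
  \<epsilon>^2 because |HH x| \<ge> \<epsilon>|RR x|. The Neumann argument for the square yields RR,
  the square root iteration then yields HH, and the Neumann argument for HH yields its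
  inverse.\<close>

lemma RR_HH_in_TT: "RR \<in> TT" "HH \<in> TT" "\<exists>W\<in>TT. W * HH = RR"
proof -
  obtain \<epsilon> where \<epsilon>: "0 < \<epsilon>" "\<And>x. \<epsilon> * (norm (RR \<cdot> x))\<^sup>2 \<le> x \<bullet> (HH \<cdot> x)" using Z_lower by blast
  have H2: "HH * HH \<in> TT"
    unfolding HH_square by (intro csalg_sum[OF csalg_TT] csalg_ops[OF csalg_TT] ZS_in_TT)
  have low2: "\<epsilon>\<^sup>2 * (norm (RR \<cdot> x))\<^sup>2 \<le> x \<bullet> ((HH * HH) \<cdot> x)" for x
  proof -
    have "\<epsilon> * norm (RR \<cdot> x) \<le> norm (HH \<cdot> x)"
    proof (cases "norm (RR \<cdot> x) = 0")
      case False
      have "\<epsilon> * (norm (RR \<cdot> x))\<^sup>2 \<le> x \<bullet> (HH \<cdot> x)" by (rule \<epsilon>)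
      also have "\<dots> = (RR \<cdot> x) \<bullet> (HH \<cdot> x)" by (metis HH_simps(2) RR_simps(1) inner_star rapp_simps(6))
      also have "\<dots> \<le> norm (RR \<cdot> x) * norm (HH \<cdot> x)" by (rule norm_cauchy_schwarz)
      finally show ?thesis using False by (simp add: power2_eq_square)
    qed simp
    then have "(\<epsilon> * norm (RR \<cdot> x))\<^sup>2 \<le> (norm (HH \<cdot> x))\<^sup>2" using \<epsilon>(1) by (intro power_mono) auto
    also have "\<dots> = x \<bullet> ((HH * HH) \<cdot> x)"
      using selfadj_square[OF HH_simps(1), of x x] by (simp add: power2_norm_eq_inner)
    finally show ?thesis by (simp only: power_mult_distrib)
  qed
  have HR: "RR * (HH * HH) = HH * HH" "(HH * HH) * RR = HH * HH"
    by (simp flip: mult.assoc, simp add: mult.assoc)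
  show R: "RR \<in> TT"
    by (rule neumann(1)[OF csalg_TT H2 RR_simps(1,2) HR, of "\<epsilon>\<^sup>2"]) (use \<epsilon> low2 in auto)
  show H: "HH \<in> TT"
    by (rule square_root_in_algebra[OF csalg_TT H2 R RR_simps(1,2) HH_simps(1-3) \<epsilon>])
  show "\<exists>W\<in>TT. W * HH = RR"
    by (rule neumann(2)[OF csalg_TT H RR_simps(1,2) HH_simps(2,3) \<epsilon>])
qed

text \<open>S_e ends in positive lengths, so Z S_e equals HH S_e, and the weight is removed by the
  inverse of HH on the range of RR.\<close>

lemma SE_in_TT: "SE e \<in> TT"
proof -
  obtain W where W: "W \<in> TT" "W * HH = RR" using RR_HH_in_TT by blast
  have "W * (ZZ * SE e) = W * HH * SE e" by (simp add: HH_def mult.assoc)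
  then have "W * (ZZ * SE e) = SE e" using W by simp
  then show ?thesis using csalg_ops(5)[OF csalg_TT W(1) ZS_in_TT] by metis
qed

section \<open>Fixed points and degree one for the gauge action\<close>

definition DD :: "('v, 'e list) rop set" where "DD = {T \<in> TT. \<forall>t. ga t T = T}"
definition FF :: "('v, 'e list) rop set" where "FF = {T \<in> TT. \<forall>t. ga t T = sc (cis t) * T}"

lemma DD_ops: "0 \<in> DD" "S \<in> DD \<Longrightarrow> T \<in> DD \<Longrightarrow> S + T \<in> DD" "S \<in> DD \<Longrightarrow> T \<in> DD \<Longrightarrow> S * T \<in> DD"
  "T \<in> DD \<Longrightarrow> star T \<in> DD" "T \<in> DD \<Longrightarrow> r *\<^sub>R T \<in> DD" "T \<in> DD \<Longrightarrow> sc c * T \<in> DD"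
  by (auto simp: DD_def csalg_ops[OF csalg_TT] ga_simps ga_sc ga_mult TT_corner)

lemma SE_in_FF: "SE e \<in> FF" by (simp add: FF_def SE_in_TT ga_SE)

lemma ga_star_SE: "ga t (star (SE e)) = sc (cis (- t)) * star (SE e)"
  by (simp add: ga_simps ga_SE star_sc cis_cnj) (rule sc_central[symmetric])

lemma FF_DD: assumes "T \<in> FF" shows "star (SE e) * T \<in> DD"
proof -
  have T: "T \<in> TT" "\<And>t. ga t T = sc (cis t) * T" using assms by (auto simp: FF_def)
  have "ga t (star (SE e) * T) = star (SE e) * T" for t
    by (simp add: ga_mult ga_star_SE T(2) sc_pull cis_mult sc_one)
  then show ?thesis using T(1) SE_in_TT csalg_ops[OF csalg_TT] by (simp add: DD_def)
qed

lemma DD_up: assumes "T \<in> DD" shows "SE e * T * star (SE f) \<in> DD"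
proof -
  have T: "T \<in> TT" "\<And>t. ga t T = T" using assms by (auto simp: DD_def)
  have "(SE e * T) * ee = SE e * T" using TT_corner[OF T(1)] by (simp add: mult.assoc)
  then have "ga t (SE e * T * star (SE f)) = (sc (cis t) * (SE e * T)) * (sc (cis (- t)) * star (SE f))" for t
    by (simp add: ga_mult ga_SE T(2) ga_star_SE TT_corner[OF T(1)] mult.assoc)
  then have "ga t (SE e * T * star (SE f)) = SE e * T * star (SE f)" for t
    by (simp add: sc_pull cis_mult sc_one)
  then show ?thesis using T(1) SE_in_TT csalg_ops[OF csalg_TT] by (simp add: DD_def)
qed

lemma PV_in_DD: "PV v \<in> DD"
proof -
  obtain e where "sE e = v" using no_sinks by blast
  then show ?thesis using FF_DD[OF SE_in_FF, of e e] by (simp add: SE_SE)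
qed

lemma ee_in_DD: "ee \<in> DD"
proof -
  have "(\<Sum>v\<in>A. PV v) \<in> DD" for A by (induction A rule: infinite_finite_induct) (auto simp: DD_ops PV_in_DD)
  then show ?thesis by (simp flip: PV_sum)
qed

text \<open>Z preserves each length, and there U_t is a scalar.\<close>

lemma ga_ZZ: "ga t ZZ = ZZ"
proof -
  have "UT t * ZZ = ZZ * UT t"
  proof (rule rop_coordI)
    fix x and \<alpha> :: "('v, 'e) path"
    show "coord ((UT t * ZZ) \<cdot> x) \<alpha> = coord ((ZZ * UT t) \<cdot> x) \<alpha>"
    proof (cases "is_path sE rE \<alpha>")
      case True
      let ?k = "plen \<alpha>"
      have ZQ: "ZZ \<cdot> QK k \<cdot> w = QK k \<cdot> ZZ \<cdot> w" for k w using Z_QK by (metis rapp_simps(6))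
      have QU: "QK ?k \<cdot> UT t \<cdot> x = rmul (\<lambda>_. cis (real ?k * t)) (QK ?k \<cdot> x)"
        by (intro ell2_eqI) (auto simp: coords)
      have "coord (ZZ \<cdot> UT t \<cdot> x) \<alpha> = coord (QK ?k \<cdot> ZZ \<cdot> UT t \<cdot> x) \<alpha>" using True by (simp add: coord_QK)
      also have "\<dots> = coord (rmul (\<lambda>_. cis (real ?k * t)) (QK ?k \<cdot> ZZ \<cdot> x)) \<alpha>"
        by (simp only: ZQ[symmetric] QU rapp_rmul)
      also have "\<dots> = coord (UT t \<cdot> ZZ \<cdot> x) \<alpha>" using True by (simp add: coords)
      finally show ?thesis by simp
    next
      case False
      have "coord (ZZ \<cdot> w) \<alpha> = 0" for w using Z_ee False by (metis coord_ee rapp_simps(6))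
      then show ?thesis using False by (simp add: coords)
    qed
  qed
  then show ?thesis by (simp add: ga_def mult.assoc Z_ee')
qed

text \<open>The commutator of Z and \<open>S_\<mu>\<close> shifts lengths by p. Multiplying the
  difference in Condition A(p) on the right by \<open>S_\<mu>\<close> singles out the summand
  \<beta> = \<mu> and gives minus the k-th block of the commutator, so the blocks tend to
  zero.\<close>

lemma Z_SP_compact:
  assumes "\<mu> \<in> PK sE rE p"
  shows "ZZ * SP \<mu> - SP \<mu> * ZZ \<in> rK"
proof (rule level_shift_compact)
  let ?T = "ZZ * SP \<mu> - SP \<mu> * ZZ"
  have \<mu>: "plen \<mu> = p" using assms by (simp add: PK_def)
  show "?T * ee = ?T" by (simp add: algebra_simps ee_SP Z_ee')
  show "?T * QK k = QK (k + p) * ?T" for k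
  proof -
    have "SP \<mu> * QK k = QK (k + p) * SP \<mu>" using QK_SP[of k \<mu>] \<mu> by simp
    then have "ZZ * SP \<mu> * QK k = (ZZ * QK (k + p)) * SP \<mu>" "(SP \<mu> * QK k) * ZZ = QK (k + p) * (SP \<mu> * ZZ)"
      by (simp_all add: mult.assoc)
    then have "ZZ * SP \<mu> * QK k = QK (k + p) * (ZZ * SP \<mu>)" "SP \<mu> * ZZ * QK k = QK (k + p) * (SP \<mu> * ZZ)"
      by (simp_all add: mult.assoc Z_QK)
    then show ?thesis by (simp add: left_diff_distrib right_diff_distrib)
  qed
  let ?A = "\<lambda>k. (\<Sum>\<beta>\<in>PK sE rE p. SP \<beta> * (ZZ * QK k) * star (SP \<beta>)) - ZZ * QK (k + p)"
  have eq: "?T * QK k = - (?A k * SP \<mu>)" for k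
  proof -
    have "SP \<beta> * (ZZ * QK k) * star (SP \<beta>) * SP \<mu> = (if \<beta> = \<mu> then SP \<mu> * ZZ * QK k else 0)" if "\<beta> \<in> PK sE rE p" for \<beta>
    proof -
      have "SP \<beta> * (ZZ * QK k) * star (SP \<beta>) * SP \<mu> = SP \<beta> * (ZZ * QK k) * (star (SP \<beta>) * SP \<mu>)" by (simp add: mult.assoc)
      also have "\<dots> = (if \<beta> = \<mu> then SP \<mu> * (ZZ * QK k * PV (psrc \<mu>)) else 0)"
        using star_SP_SP[OF that assms] by (simp add: mult.assoc)
      also have "SP \<mu> * (ZZ * QK k * PV (psrc \<mu>)) = SP \<mu> * ((ZZ * PV (psrc \<mu>)) * QK k)"
        by (simp add: mult.assoc PV_QK)
      also have "\<dots> = (SP \<mu> * PV (psrc \<mu>)) * ZZ * QK k" unfolding Z_PV by (simp only: mult.assoc)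
      finally show ?thesis by (simp only: SP_PV)
    qed
    then have "?A k * SP \<mu> = SP \<mu> * ZZ * QK k - ZZ * QK (k + p) * SP \<mu>"
      using assms finite_PK[of sE rE p] by (simp add: left_diff_distrib sum_distrib_right)
    also have "ZZ * QK (k + p) * SP \<mu> = ZZ * SP \<mu> * QK k" using QK_SP[of k \<mu>] \<mu> by (simp add: mult.assoc)
    finally show ?thesis by (simp add: left_diff_distrib)
  qed
  have "norm (norm (?T * QK k)) \<le> norm (?A k) * norm (SP \<mu>)" for k
    unfolding eq norm_minus_cancel real_norm_def abs_norm_cancel by (rule norm_mult_ineq)
  moreover have "(\<lambda>k. norm (?A k) * norm (SP \<mu>)) \<longlonglongrightarrow> 0" by (intro tendsto_mult_left_zero Z_condA)
  ultimately show "(\<lambda>k. norm (?T * QK k)) \<longlonglongrightarrow> 0"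
    by (rule Lim_null_comparison[OF always_eventually[OF allI]])
qed

lemma qq_SP: "qq (SP \<alpha>) = foldr (\<lambda>e. (*) (qq (SE e))) (snd \<alpha>) (qq (PV (fst \<alpha>)))"
proof -
  have "qq (SP (v, es)) = foldr (\<lambda>e. (*) (qq (SE e))) es (qq (PV v))" for v es
    by (induction es) (auto simp: qq_simps)
  then show ?thesis by (metis prod.collapse)
qed

sublocale ck: ck_family sE rE "\<lambda>e. qq (SE e)" "\<lambda>v. qq (PV v)" "qq ZZ" "qq ee" p "\<lambda>\<alpha>. qq (SP \<alpha>)"
proof -
  show "ck_family sE rE (\<lambda>e. qq (SE e)) (\<lambda>v. qq (PV v)) (qq ZZ) (qq ee) p"
  proof
    show "(\<Sum>e\<in>UNIV. qq (SE e) * qstar (qq (SE e))) = qq ee"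
    proof -
      have "(\<Sum>e\<in>UNIV. qq (SE e) * qstar (qq (SE e))) = qq (\<Sum>e\<in>UNIV. SE e * star (SE e))"
        by (simp only: qq_sum qq_simps)
      also have "\<dots> = qq ee" using rK_neg[OF QK_rK[of 0]] unfolding SE_sum by (simp add: qq_eq_iff RR_def)
      finally show ?thesis .
    qed
    show "qq ZZ * foldr (\<lambda>e. (*) (qq (SE e))) (snd \<mu>) (qq (PV (fst \<mu>))) =
        foldr (\<lambda>e. (*) (qq (SE e))) (snd \<mu>) (qq (PV (fst \<mu>))) * qq ZZ" if "\<mu> \<in> PK sE rE p" for \<mu>
      using Z_SP_compact[OF that] unfolding qq_SP[symmetric] by (simp add: qq_eq_iff flip: qq_simps)
    show "(\<Sum>v\<in>UNIV. qq (PV v)) = qq ee" by (simp add: PV_sum flip: qq_sum)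
  qed (use no_sinks p_pos in \<open>simp_all add: PV_mult SE_SE PV_SE Z_PV Z_ee flip: qq_simps\<close>)
  show "qq (SP \<alpha>) \<equiv> foldr (\<lambda>e. (*) (qq (SE e))) (snd \<alpha>) (qq (PV (fst \<alpha>)))" for \<alpha>
    by (rule eq_reflection) (rule qq_SP)
qed

subsection \<open>Density of the levels in the fixed-point algebra\<close>

text \<open>Two notions of degree are carried together: the gauge degree, on which averaging acts,
  and the grade in the quotient, which in degree zero places the class in some C_n.\<close>

definition homog :: "int \<Rightarrow> ('v, 'e list) rop set" where
  "homog k = {T \<in> TT. (\<forall>t. ga t T = sc (cis (of_int k * t)) * T) \<and> qq T \<in> ck.grade k}"

lemma homog_0: "T \<in> homog 0 \<Longrightarrow> T \<in> DD \<and> qq T \<in> ck.Cinf"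
  using ck.grade_0 by (auto simp: homog_def DD_def sc_one)

lemma homog_add: "S \<in> homog k \<Longrightarrow> T \<in> homog k \<Longrightarrow> S + T \<in> homog k"
  by (auto simp: homog_def csalg_ops[OF csalg_TT] ga_simps distrib_left qq_simps ck.grade_add)

lemma homog_sc: "T \<in> homog k \<Longrightarrow> sc c * T \<in> homog k"
  by (auto simp: homog_def csalg_ops[OF csalg_TT] ga_sc qq_simps ck.grade_qsc)
     (simp add: sc_mult mult.commute flip: mult.assoc)

lemma homog_star: "T \<in> homog k \<Longrightarrow> star T \<in> homog (- k)"
  by (auto simp: homog_def csalg_ops[OF csalg_TT] ga_simps qq_simps ck.grade_star star_sc cis_cnj)
     (rule sc_central[symmetric])

lemma homog_mult: "S \<in> homog j \<Longrightarrow> T \<in> homog k \<Longrightarrow> S * T \<in> homog (j + k)"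
  by (auto simp: homog_def csalg_ops[OF csalg_TT] ga_mult TT_corner qq_simps ck.grade_mult
      sc_pull cis_mult distrib_right)

lemma homog_ZS: "ZZ * SE e \<in> homog 1"
  using ck.grade_zU[of e] by (simp add: homog_def ZS_in_TT ga_mult Z_ee' ga_ZZ ga_SE sc_assoc[of ZZ] qq_simps)

lemma homog_zero: "0 \<in> homog 0"
  using homog_sc[OF homog_mult[OF homog_star[OF homog_ZS] homog_ZS], of 0] by (simp add: sc_zero)

definition HS :: "('v, 'e list) rop set" where
  "HS = {sum_list ts | ts. set ts \<subseteq> (\<Union>k. homog k)}"

lemma HS_add: "S \<in> HS \<Longrightarrow> T \<in> HS \<Longrightarrow> S + T \<in> HS"
  unfolding HS_def by (clarsimp, metis set_append sum_list_append Un_least)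

lemma HS_map:
  assumes "\<And>S T. f (S + T) = f S + f T" "f 0 = 0" "\<And>S. S \<in> (\<Union>k. homog k) \<Longrightarrow> f S \<in> HS" "T \<in> HS"
  shows "f T \<in> HS"
proof -
  have z: "0 \<in> HS" unfolding HS_def by (auto intro!: exI[of _ "[]"])
  have "set ts \<subseteq> (\<Union>k. homog k) \<Longrightarrow> f (sum_list ts) \<in> HS" for ts
    by (induction ts) (auto simp: assms(1,2) z intro!: HS_add assms(3))
  then show ?thesis using assms(4) unfolding HS_def by blast
qed

lemma homog_HS: "T \<in> homog k \<Longrightarrow> T \<in> HS"
  unfolding HS_def by (auto intro!: exI[of _ "[T]"])

text \<open>Finite sums of homogeneous elements form a star-algebra that contains the generators,
  which have degree one.\<close>

lemma TT_closure: "TT \<subseteq> closure HS"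
proof -
  have "csalg (closure HS)"
  proof (rule csalg_closure)
    show "0 \<in> HS" using homog_HS[OF homog_zero] .
    show "S * T \<in> HS" if "S \<in> HS" "T \<in> HS" for S T
    proof (rule HS_map[of "\<lambda>S. S * T", OF _ _ _ that(1)])
      fix S assume "S \<in> (\<Union>k. homog k)"
      then show "S * T \<in> HS"
        by (intro HS_map[of "\<lambda>T. S * T", OF _ _ _ that(2)]) (auto simp: distrib_left intro: homog_HS[OF homog_mult])
    qed (auto simp: distrib_right)
    show "sc c * T \<in> HS" if "T \<in> HS" for c T
      by (rule HS_map[of "\<lambda>T. sc c * T", OF _ _ _ that]) (auto simp: distrib_left intro: homog_HS[OF homog_sc])
    show "star T \<in> HS" if "T \<in> HS" for T
      by (rule HS_map[of star, OF _ _ _ that]) (auto intro: homog_HS[OF homog_star])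
  qed (rule HS_add)
  then show ?thesis using TT_induct homog_HS[OF homog_ZS] closure_subset by blast
qed

text \<open>Averaging over the two gauge angles \<open>0\<close> and \<open>\<pi> / k\<close> removes the degree \<open>k\<close>, fixes degree zero and
preserves all other degrees.\<close>

lemma kill_degrees:
  assumes d: "d \<in> DD"
  shows "set ts \<subseteq> (\<Union>k. homog k) \<Longrightarrow> w \<in> homog 0 \<Longrightarrow> \<exists>w'\<in>homog 0. norm (d - w') \<le> norm (d - (w + sum_list ts))"
proof (induction "length ts" arbitrary: ts w)
  case 0 then show ?case by auto
next
  case (Suc n)
  then obtain T us where ts: "ts = T # us" "length us = n" by (cases ts) auto
  obtain k where k: "T \<in> homog k" using Suc.prems ts by auto
  show ?case
  \<comment> \<open>A summand of degree zero must survive; it is moved into the accumulator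
    \<open>w\<close>.\<close>
  proof (cases "k = 0")
    case True
    then have "\<exists>w'\<in>homog 0. norm (d - w') \<le> norm (d - ((w + T) + sum_list us))"
      using Suc.prems ts k homog_add by (intro Suc.hyps(1)) auto
    then show ?thesis by (simp add: ts add.assoc)
  next
    case False
    define \<tau> where "\<tau> = pi / of_int k"
    define A where "A S = (1/2) *\<^sub>R (S + ga \<tau> S)" for S
    have Aadd: "A (S + S') = A S + A S'" for S S' by (simp add: A_def ga_simps scaleR_add_right)
    have Ahom: "A S = sc ((1 + cis (of_int j * \<tau>)) / 2) * S" if "S \<in> homog j" for S j
    proof -
      have "A S = (1/2) *\<^sub>R (sc 1 * S + sc (cis (of_int j * \<tau>)) * S)" using that by (simp add: A_def homog_def sc_one)
      also have "\<dots> = (1/2) *\<^sub>R (sc (1 + cis (of_int j * \<tau>)) * S)" by (simp only: sc_add)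
      also have "\<dots> = sc (complex_of_real (1/2)) * (sc (1 + cis (of_int j * \<tau>)) * S)" by (simp only: sc_real)
      finally show ?thesis by (simp add: sc_mult flip: mult.assoc)
    qed
    have "(1 + cis (of_int k * \<tau>)) / 2 = 0" using False by (simp add: \<tau>_def)
    then have AT: "A T = 0" using Ahom[OF k] by (simp only: sc_zero mult_zero_left)
    have Aw: "A w = w" using Ahom[OF Suc.prems(2)] by (simp add: sc_one)
    have Ad: "A d = d" using d by (simp add: A_def DD_def scaleR_half_double)
    have Asum: "A (sum_list us) = sum_list (map A us)"
      by (induction us) (auto simp: Aadd A_def[of 0] ga_simps)
    have "set (map A us) \<subseteq> (\<Union>k. homog k)"
      using Suc.prems(1) Ahom homog_sc unfolding ts by fastforce
    then have "\<exists>w'\<in>homog 0. norm (d - w') \<le> norm (d - (w + sum_list (map A us)))"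
      using Suc.prems ts by (intro Suc.hyps(1)) auto
    \<comment> \<open>The averaging map is a contraction and fixes d and w, so removing T brings the
      sum no farther from d.\<close>
    moreover have "norm (d - (w + sum_list (map A us))) \<le> norm (d - (w + sum_list ts))"
    proof -
      have "A (d - (w + sum_list ts)) = A d - A (w + sum_list ts)"
        using Aadd[of "d - (w + sum_list ts)" "w + sum_list ts"] by simp
      also have "\<dots> = d - (w + sum_list (map A us))" by (simp add: ts Aadd AT Aw Ad Asum)
      finally have "norm (d - (w + sum_list (map A us))) = norm (A (d - (w + sum_list ts)))" by simp
      also have "\<dots> \<le> norm (d - (w + sum_list ts))" (is "_ \<le> norm ?X")
      proof -
        have "norm (?X + ga \<tau> ?X) \<le> norm ?X + norm ?X"
          by (rule order_trans[OF norm_triangle_ineq]) (simp add: norm_ga)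
        then show ?thesis by (simp add: A_def)
      qed
      finally show ?thesis .
    qed
    ultimately show ?thesis by (meson order_trans)
  qed
qed

lemma DD_dense: "d \<in> DD \<Longrightarrow> 0 < \<eta> \<Longrightarrow> \<exists>c\<in>DD. qq c \<in> ck.Cinf \<and> norm (d - c) < \<eta>"
proof -
  assume d: "d \<in> DD" and \<eta>: "0 < \<eta>"
  then have "d \<in> closure HS" using TT_closure by (auto simp: DD_def)
  then obtain s where "s \<in> HS" "dist s d < \<eta>" using \<eta> closure_approachable by blast
  then obtain ts where ts: "set ts \<subseteq> (\<Union>k. homog k)" "norm (d - sum_list ts) < \<eta>"
    unfolding HS_def by (auto simp: dist_norm norm_minus_commute)
  then show ?thesis using kill_degrees[OF d ts(1) homog_zero] homog_0 by fastforce
qed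

lemma qq_DD_corner: "a \<in> qq ` DD \<Longrightarrow> qq ee * a = a" "a \<in> qq ` DD \<Longrightarrow> a * qq ee = a"
  by (auto simp: DD_def TT_corner simp flip: qq_simps)

text \<open>The approximation theorem is applied to the preimages \<open>L B\<close> inside the
  corner of operators, where norms and vectors are available; its conclusion is then pushed through
  \<open>qq\<close>, whose preimages of closed sets are closed.\<close>

lemma J_dense:
  assumes J: "J \<subseteq> qq ` DD" "0 \<in> J" "\<And>a b. a \<in> J \<Longrightarrow> b \<in> J \<Longrightarrow> a + b \<in> J" "\<And>a c. a \<in> J \<Longrightarrow> qsc c * a \<in> J"
    "\<And>a d. a \<in> J \<Longrightarrow> d \<in> qq ` DD \<Longrightarrow> a * d \<in> J" "\<And>a d. a \<in> J \<Longrightarrow> d \<in> qq ` DD \<Longrightarrow> d * a \<in> J" "closed J"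
  shows "J \<subseteq> closure (\<Union>n. J \<inter> ck.C n)"
proof -
  define L where "L B = {T. ee * T = T \<and> T * ee = T \<and> qq T \<in> B}" for B
  have qscale: "qq (r *\<^sub>R T) = qsc (complex_of_real r) * qq T" for r and T :: "('v, 'e list) rop"
    by (simp add: sc_real flip: qq_simps)
  have sub: "subspace (L B)" if "0 \<in> B" "\<And>a b. a \<in> B \<Longrightarrow> b \<in> B \<Longrightarrow> a + b \<in> B" "\<And>a c. a \<in> B \<Longrightarrow> qsc c * a \<in> B" for B
    using that by (auto simp: L_def subspace_def qq_simps distrib_left distrib_right qscale)
  have alg: "salg (L B)" if "0 \<in> B" "\<And>a b. a \<in> B \<Longrightarrow> b \<in> B \<Longrightarrow> a + b \<in> B" "\<And>a c. a \<in> B \<Longrightarrow> qsc c * a \<in> B"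
    "\<And>a b. a \<in> B \<Longrightarrow> b \<in> B \<Longrightarrow> a * b \<in> B" "\<And>a. a \<in> B \<Longrightarrow> qstar a \<in> B" for B
  proof -
    have "S * T \<in> L B" if "S \<in> L B" "T \<in> L B" for S T
    proof -
      have "ee * (S * T) = (ee * S) * T" "S * T * ee = S * (T * ee)" by (simp_all add: mult.assoc)
      then show ?thesis using that \<open>\<And>a b. a \<in> B \<Longrightarrow> b \<in> B \<Longrightarrow> a * b \<in> B\<close> by (auto simp: L_def qq_simps)
    qed
    moreover have "star T \<in> L B" if "T \<in> L B" for T
    proof -
      have "ee * T = T" "T * ee = T" using that by (auto simp: L_def)
      from this[THEN arg_cong[of _ _ star]] have "ee * star T = star T" "star T * ee = star T" by simp_all
      then show ?thesis using that \<open>\<And>a. a \<in> B \<Longrightarrow> qstar a \<in> B\<close> by (auto simp: L_def qq_simps)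
    qed
    ultimately show ?thesis using sub[OF that(1-3)] by (auto simp: salg_def)
  qed
  have clo: "closed (L B)" if "closed B" for B
  proof -
    have "closed {T. ee * T = T}" "closed {T. T * ee = T}" by (intro closed_Collect_eq continuous_intros)+
    moreover have "closed {T. qq T \<in> B}" using that by (simp add: closed_calq vimage_def)
    ultimately show ?thesis unfolding L_def by (intro closed_Collect_conj)
  qed
  have lift: "\<exists>T\<in>L B. qq T = a" if "a \<in> B" "qq ee * a = a" "a * qq ee = a" for a B
  proof -
    obtain T where T: "a = qq T" using qq_surj by blast
    have "qq (ee * T * ee) = a" using that(2,3) by (simp add: qq_simps flip: T)
    moreover have "ee * (ee * T * ee) = ee * T * ee" "ee * T * ee * ee = ee * T * ee"
      by (simp_all add: mult.assoc) (simp add: flip: mult.assoc)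
    ultimately show ?thesis using that(1) by (intro bexI[of _ "ee * T * ee"]) (auto simp: L_def)
  qed
  have Dops: "0 \<in> qq ` DD" "\<And>a b. a \<in> qq ` DD \<Longrightarrow> b \<in> qq ` DD \<Longrightarrow> a + b \<in> qq ` DD" "\<And>a c. a \<in> qq ` DD \<Longrightarrow> qsc c * a \<in> qq ` DD"
    "\<And>a b. a \<in> qq ` DD \<Longrightarrow> b \<in> qq ` DD \<Longrightarrow> a * b \<in> qq ` DD" "\<And>a. a \<in> qq ` DD \<Longrightarrow> qstar a \<in> qq ` DD"
    using DD_ops by (auto simp flip: qq_simps)
  have "L J \<subseteq> closure (\<Union>n. L J \<inter> L (ck.C n))"
  proof (rule ideal_dense[where e = ee and D = "L (qq ` DD)"])
    show "salg (L (qq ` DD))" by (rule alg) (use Dops in auto)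
    show "ee \<in> L (qq ` DD)" using ee_in_DD by (auto simp: L_def)
    show "L J \<subseteq> L (qq ` DD)" using J(1) by (auto simp: L_def)
    show "subspace (L J)" by (rule sub) (use J in auto)
    show "closed (L J)" by (rule clo) (rule J)
    show "x * y \<in> L J" "y * x \<in> L J" if "x \<in> L J" "y \<in> L (qq ` DD)" for x y
    proof -
      have "ee * (x * y) = (ee * x) * y" "x * y * ee = x * (y * ee)" "ee * (y * x) = (ee * y) * x" "y * x * ee = y * (x * ee)"
        by (simp_all add: mult.assoc)
      then show "x * y \<in> L J" "y * x \<in> L J" using that J(5,6) by (auto simp: L_def qq_simps)
    qed
    show "salg (L (ck.C n))" "ee \<in> L (ck.C n)" "closed (L (ck.C n))" for n
      using ck.qalg_C[of n] ck.E_in_C[of n] by (auto intro!: alg clo simp: qalgD) (auto simp: L_def)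
    fix d \<eta> assume d: "d \<in> L (qq ` DD)" and \<eta>: "(0::real) < \<eta>"
    then obtain d0 where d0: "d0 \<in> DD" "qq d = qq d0" by (auto simp: L_def)
    obtain c where c: "c \<in> DD" "qq c \<in> ck.Cinf" "norm (d0 - c) < \<eta>" using DD_dense[OF d0(1) \<eta>] by blast
    obtain n where n: "qq c \<in> ck.C n" using c(2) unfolding ck.Cinf_def by blast
    \<comment> \<open>Only d0 lies in DD, and d agrees with it modulo compacts. Shifting the
      approximant by d - d0 keeps its class and its distance.\<close>
    let ?c = "c + (d - d0)"
    have q: "qq ?c = qq c" using d0(2) by (simp add: qq_simps)
    have "ee * ?c = ?c" "?c * ee = ?c"
      using d d0(1) c(1) TT_corner by (auto simp: L_def DD_def distrib_left distrib_right left_diff_distrib right_diff_distrib)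
    then have "?c \<in> L (qq ` DD) \<inter> L (ck.C n)" using c(1) n q by (auto simp: L_def)
    moreover have "norm (d - ?c) < \<eta>" using c(3) by simp
    ultimately show "\<exists>n. \<exists>c\<in>L (qq ` DD) \<inter> L (ck.C n). norm (d - c) < \<eta>" by blast
  qed (auto simp: norm_ee L_def)
  also have "\<dots> \<subseteq> qq -` closure (\<Union>n. J \<inter> ck.C n)"
  proof (rule closure_minimal)
    show "(\<Union>n. L J \<inter> L (ck.C n)) \<subseteq> qq -` closure (\<Union>n. J \<inter> ck.C n)"
      using closure_subset[of "\<Union>n. J \<inter> ck.C n"] by (auto simp: L_def)
    show "closed (qq -` closure (\<Union>n. J \<inter> ck.C n))" using closed_calq closed_closure by blast
  qed
  finally have *: "qq T \<in> closure (\<Union>n. J \<inter> ck.C n)" if "T \<in> L J" for T using that by auto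
  show ?thesis
  proof
    fix a assume a: "a \<in> J"
    then have "a \<in> qq ` DD" using J(1) by blast
    then obtain T where "T \<in> L J" "qq T = a" using lift[OF a qq_DD_corner] by blast
    then show "a \<in> closure (\<Union>n. J \<inter> ck.C n)" using *[of T] by simp
  qed
qed

lemma ck_idealI:
  assumes "\<And>v. \<xi> v \<in> PK sE rE (p - 1)" "\<And>v. psrc (\<xi> v) = v"
    and J: "J \<subseteq> qq ` DD" "0 \<in> J" "\<And>a b. a \<in> J \<Longrightarrow> b \<in> J \<Longrightarrow> a + b \<in> J" "\<And>a c. a \<in> J \<Longrightarrow> qsc c * a \<in> J"
    "\<And>a d. a \<in> J \<Longrightarrow> d \<in> qq ` DD \<Longrightarrow> a * d \<in> J" "\<And>a d. a \<in> J \<Longrightarrow> d \<in> qq ` DD \<Longrightarrow> d * a \<in> J" "closed J"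
  shows "ck_ideal sE rE (\<lambda>e. qq (SE e)) (\<lambda>v. qq (PV v)) (qq ZZ) (qq ee) p (qq ` DD) (qq ` FF) J \<xi>"
proof
  show "J \<subseteq> closure (\<Union>n. J \<inter> ck.C n)" by (rule J_dense[OF J])
  show "qq ee * x = x" if "x \<in> qq ` FF" for x
    using that by (auto simp: FF_def TT_corner simp flip: qq_simps)
  show "qstar (qq (SE e)) * x \<in> qq ` DD" if "x \<in> qq ` FF" for e x
    using that FF_DD by (auto simp flip: qq_simps)
  show "qq (SE e) * d * qstar (qq (SE f)) \<in> qq ` DD" if "d \<in> qq ` DD" for d e f
    using that DD_up by (auto simp flip: qq_simps)
  show "qstar d \<in> qq ` DD" if "d \<in> qq ` DD" for d using that DD_ops by (auto simp flip: qq_simps)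
qed (use assms qq_DD_corner PV_in_DD SE_in_FF in auto)

end

section \<open>Transfer to the concrete operators\<close>

context fock
begin

definition cvec :: "('v \<times> 'e list) ell2 set" where "cvec = {y. ee \<cdot> y = y}"
definition crn :: "('v, 'e list) rop set" where "crn = {T. ee * T = T \<and> T * ee = T}"

lemma cvecI: "T \<in> crn \<Longrightarrow> T \<cdot> y \<in> cvec"
  unfolding cvec_def crn_def by (metis (mono_tags, lifting) mem_Collect_eq rapp_simps(6))

lemma ee_cvec: "ee \<cdot> y \<in> cvec" by (simp add: cvec_def flip: rapp_simps(6))

lemma cvec_ops: "0 \<in> cvec" "x \<in> cvec \<Longrightarrow> y \<in> cvec \<Longrightarrow> x + y \<in> cvec" "x \<in> cvec \<Longrightarrow> y \<in> cvec \<Longrightarrow> x - y \<in> cvec"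
  "x \<in> cvec \<Longrightarrow> rmul a x \<in> cvec" "x \<in> cvec \<Longrightarrow> r *\<^sub>R x \<in> cvec"
  by (auto simp: cvec_def rapp_rmul)

lemma crn_app: "T \<in> crn \<Longrightarrow> T \<cdot> ee \<cdot> y = T \<cdot> y"
  unfolding crn_def by (metis (mono_tags, lifting) mem_Collect_eq rapp_simps(6))

lemma crn_ops:
  "0 \<in> crn" "ee \<in> crn" "S \<in> crn \<Longrightarrow> T \<in> crn \<Longrightarrow> S + T \<in> crn" "S \<in> crn \<Longrightarrow> T \<in> crn \<Longrightarrow> S - T \<in> crn"
  "S \<in> crn \<Longrightarrow> T \<in> crn \<Longrightarrow> S * T \<in> crn" "T \<in> crn \<Longrightarrow> sc c * T \<in> crn" "T \<in> crn \<Longrightarrow> star T \<in> crn"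
proof -
  show "S * T \<in> crn" if "S \<in> crn" "T \<in> crn"
  proof -
    have "ee * (S * T) = (ee * S) * T" "S * T * ee = S * (T * ee)" by (simp_all add: mult.assoc)
    then show ?thesis using that by (simp add: crn_def)
  qed
  show "sc c * T \<in> crn" if "T \<in> crn"
    using that by (simp add: crn_def sc_assoc[of ee] mult.assoc)
  show "star T \<in> crn" if "T \<in> crn"
  proof -
    have "ee * T = T" "T * ee = T" using that by (auto simp: crn_def)
    from this[THEN arg_cong[of _ _ star]] show ?thesis by (simp add: crn_def)
  qed
qed (auto simp: crn_def distrib_left distrib_right left_diff_distrib right_diff_distrib)

lemma closed_crn: "closed crn"
proof -
  have "closed {T. ee * T = T}" "closed {T. T * ee = T}" by (intro closed_Collect_eq continuous_intros)+
  then show ?thesis unfolding crn_def by (intro closed_Collect_conj)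
qed

lemma compress_crn: "ee * T * ee \<in> crn"
  by (simp add: crn_def mult.assoc) (simp flip: mult.assoc)

lemma coord_l2: "y \<in> cvec \<Longrightarrow> coord y \<in> l2 sE rE"
proof -
  assume "y \<in> cvec"
  then have "coord y \<alpha> = 0" if "\<not> is_path sE rE \<alpha>" for \<alpha>
    using coord_ee[of y \<alpha>] that by (simp add: cvec_def)
  then show ?thesis unfolding l2_def using coord_summable[of y UNIV] by blast
qed

lemma l2_coord: assumes "x \<in> l2 sE rE" obtains y where "y \<in> cvec" "x = coord y"
proof -
  have "coord (Abs_ell2 x) = x" using assms by (simp add: l2_def Abs_ell2_inverse)
  moreover from this have "Abs_ell2 x \<in> cvec"
    unfolding cvec_def using assms by (auto intro!: ell2_eqI simp: coord_ee l2_def)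
  ultimately show ?thesis using that by metis
qed

lemma vec_simps:
  "vadd (coord x) (coord y) = coord (x + y)" "vsmul c (coord x) = coord (rmul (\<lambda>_. c) (x :: ('v \<times> 'e list) ell2))" "vzero = coord 0"
  "lnorm (coord x) = norm x" "linner (coord x) (coord y) = cip x y" "ract (coord x) a = coord (rmul a x)"
  by (auto simp: vadd_def vsmul_def vzero_def lnorm_def linner_def ract_def psrc_def cip_infsum fun_eq_iff)
     (simp add: norm_ell2_sq[symmetric])

lemma ainner_coord: "ainner (coord y) (coord z) = (\<lambda>v. cip (part v y) (z :: ('v \<times> 'e list) ell2))"
proof
  fix v
  show "ainner (coord y) (coord z) v = cip (part v y) z"
    unfolding ainner_def cip_infsum by (rule infsum_cong_neutral) (auto simp: psrc_def)
qed

definition op_of :: "('v, 'e list) rop \<Rightarrow> ('v, 'e) op" where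
  "op_of T = mkop sE rE (\<lambda>x. coord (T \<cdot> Abs_ell2 x))"

lemma op_of_coord: "y \<in> cvec \<Longrightarrow> op_of T (coord y) = coord (T \<cdot> y)"
  by (simp add: op_of_def mkop_def coord_l2 coord_inverse)

lemma op_of_out: "x \<notin> l2 sE rE \<Longrightarrow> op_of T x = coord 0"
  by (simp add: op_of_def mkop_def vec_simps)

lemma op_of_eqI:
  assumes "\<And>y. y \<in> cvec \<Longrightarrow> t (coord y) = coord (T \<cdot> y)" "\<And>x. x \<notin> l2 sE rE \<Longrightarrow> t x = coord 0"
  shows "t = op_of T"
proof
  fix x show "t x = op_of T x"
    using assms op_of_coord op_of_out by (cases "x \<in> l2 sE rE") (metis l2_coord, metis)
qed

text \<open>\<open>bounded_op\<close> asks for complex linearity only. Right linearity is what makes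
  an operator a copy of a \<open>rop\<close>, and it has to be established whenever an arbitrary
  bounded operator enters.\<close>

definition rlin :: "('v, 'e) op \<Rightarrow> bool" where
  "rlin t \<longleftrightarrow> bounded_op sE rE t \<and> (\<forall>x\<in>l2 sE rE. \<forall>a. t (ract x a) = ract (t x) a)"

lemma op_of_bounded: "T \<in> crn \<Longrightarrow> bounded_op sE rE (op_of T)"
  unfolding bounded_op_def
proof (intro conjI)
  assume T: "T \<in> crn"
  show "\<forall>x. x \<notin> l2 sE rE \<longrightarrow> op_of T x = vzero" by (simp add: op_of_out vec_simps)
  show "\<forall>x\<in>l2 sE rE. op_of T x \<in> l2 sE rE"
    using T by (metis l2_coord op_of_coord coord_l2 cvecI)
  show "\<forall>x\<in>l2 sE rE. \<forall>y\<in>l2 sE rE. \<forall>c. op_of T (vadd x y) = vadd (op_of T x) (op_of T y) \<and> op_of T (vsmul c x) = vsmul c (op_of T x)"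
  proof (intro ballI allI)
    fix x y c assume "x \<in> l2 sE rE" "y \<in> l2 sE rE"
    then obtain x' y' where "x' \<in> cvec" "x = coord x'" "y' \<in> cvec" "y = coord y'" by (metis l2_coord)
    then show "op_of T (vadd x y) = vadd (op_of T x) (op_of T y) \<and> op_of T (vsmul c x) = vsmul c (op_of T x)"
      by (simp add: vec_simps op_of_coord cvec_ops rapp_rmul)
  qed
  show "\<exists>C. \<forall>x\<in>l2 sE rE. lnorm (op_of T x) \<le> C * lnorm x"
  proof (rule exI[of _ "norm T"], rule ballI)
    fix x assume "x \<in> l2 sE rE"
    then obtain x' where "x' \<in> cvec" "x = coord x'" by (metis l2_coord)
    then show "lnorm (op_of T x) \<le> norm T * lnorm x" by (simp add: vec_simps op_of_coord norm_rapp)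
  qed
qed

text \<open>The operator is extended to all vectors by projecting with \<open>ee\<close> first,
  which puts the extension into the corner.\<close>

lemma op_of_surj: assumes "rlin t" obtains T where "T \<in> crn" "t = op_of T"
proof -
  have t: "\<And>x. x \<in> l2 sE rE \<Longrightarrow> t x \<in> l2 sE rE" "\<And>x. x \<notin> l2 sE rE \<Longrightarrow> t x = vzero"
    "\<And>x y. x \<in> l2 sE rE \<Longrightarrow> y \<in> l2 sE rE \<Longrightarrow> t (vadd x y) = vadd (t x) (t y)"
    "\<And>x c. x \<in> l2 sE rE \<Longrightarrow> t (vsmul c x) = vsmul c (t x)"
    "\<And>x a. x \<in> l2 sE rE \<Longrightarrow> t (ract x a) = ract (t x) a"
    using assms unfolding rlin_def bounded_op_def by blast+
  obtain C where C: "\<And>x. x \<in> l2 sE rE \<Longrightarrow> lnorm (t x) \<le> C * lnorm x"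
    using assms unfolding rlin_def bounded_op_def by blast
  have "\<exists>w\<in>cvec. coord w = t (coord (ee \<cdot> y))" for y
    using t(1)[OF coord_l2[OF ee_cvec]] by (metis l2_coord)
  then obtain f where f: "\<And>y. f y \<in> cvec" "\<And>y. coord (f y) = t (coord (ee \<cdot> y))" by metis
  have feq: "f y = w" if "t (coord (ee \<cdot> y)) = coord w" for y w using f(2)[of y] that by (simp add: coord_inject)
  note E = coord_l2[OF ee_cvec]
  have "bounded_linear f"
  proof (rule bounded_linear_intro[of _ "\<bar>C\<bar>"])
    show "f (x + y) = f x + f y" for x y
      by (rule feq) (simp add: t(3)[OF E E] f(2)[symmetric] vec_simps flip: vec_simps(1))
    show "f (r *\<^sub>R x) = r *\<^sub>R f x" for r x
    proof (rule feq)
      have s: "rmul (\<lambda>_. complex_of_real r) w = r *\<^sub>R w" for w :: "('v \<times> 'e list) ell2"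
        by (intro ell2_eqI) (simp add: scaleR_conv_of_real)
      have "t (coord (ee \<cdot> (r *\<^sub>R x))) = t (vsmul (complex_of_real r) (coord (ee \<cdot> x)))" by (simp add: vec_simps s)
      also have "\<dots> = vsmul (complex_of_real r) (coord (f x))" by (simp add: t(4)[OF E] f(2))
      finally show "t (coord (ee \<cdot> (r *\<^sub>R x))) = coord (r *\<^sub>R f x)" by (simp add: vec_simps s)
    qed
    show "norm (f x) \<le> norm x * \<bar>C\<bar>" for x
    proof -
      have "norm (f x) \<le> C * norm (ee \<cdot> x)" using C[OF E, of x] by (simp add: vec_simps flip: f(2))
      also have "\<dots> \<le> \<bar>C\<bar> * norm x"
        using norm_projection[OF star_simps'(1) ee_ee, of x] by (intro mult_mono) auto
      finally show ?thesis by (simp add: mult.commute)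
    qed
  qed
  moreover have "f (rmul a x) = rmul a (f x)" for a x
    by (rule feq) (simp add: rapp_rmul t(5)[OF E] f(2)[symmetric] vec_simps flip: vec_simps(6))
  ultimately obtain T where T: "\<And>y. T \<cdot> y = f y" using rop_exists[of f] by blast
  have "T \<in> crn"
  proof -
    have "ee * T = T" using f(1) by (intro rop_eqI) (simp add: T cvec_def)
    moreover have "f (ee \<cdot> y) = f y" for y by (rule feq) (simp add: f(2) flip: rapp_simps(6))
    then have "T * ee = T" by (intro rop_eqI) (simp add: T)
    ultimately show ?thesis by (simp add: crn_def)
  qed
  moreover have "t = op_of T"
    by (rule op_of_eqI) (use t(2) in \<open>auto simp: T f(2) cvec_def vec_simps\<close>)
  ultimately show ?thesis using that by blast
qed

lemma op_of_inj: assumes "S \<in> crn" "T \<in> crn" "op_of S = op_of T" shows "S = T"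
proof (rule rop_eqI)
  fix y
  have "coord (S \<cdot> ee \<cdot> y) = coord (T \<cdot> ee \<cdot> y)"
    using assms(3) by (metis op_of_coord ee_cvec)
  then show "S \<cdot> y = T \<cdot> y" using assms crn_app by (simp add: coord_inject)
qed

lemma op_of_simps:
  "oadd (op_of S) (op_of T) = op_of (S + T)" "osmul c (op_of T) = op_of (sc c * T)"
  "osub (op_of S) (op_of T) = op_of (S - T)" "ozero = op_of 0" "oid sE rE = op_of ee"
proof -
  show 1: "oadd (op_of S) (op_of T) = op_of (S + T)" for S T
    by (rule op_of_eqI) (simp_all add: oadd_def op_of_coord op_of_out vec_simps)
  show 2: "osmul c (op_of T) = op_of (sc c * T)" for c T
  proof (rule op_of_eqI)
    show "osmul c (op_of T) (coord y) = coord ((sc c * T) \<cdot> y)" if "y \<in> cvec" for y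
      using that by (simp add: osmul_def op_of_coord vec_simps rmul_def)
    show "osmul c (op_of T) x = coord 0" if "x \<notin> l2 sE rE" for x
      using that by (simp add: osmul_def op_of_out vec_simps rmul_linear)
  qed
  have "S + sc (- 1) * T = S - T" by (rule rop_coordI) (simp add: coord_diag)
  then show "osub (op_of S) (op_of T) = op_of (S - T)" unfolding osub_def by (simp only: 1 2)
  show "ozero = op_of 0" by (rule op_of_eqI) (simp_all add: ozero_def vec_simps)
  show "oid sE rE = op_of ee"
    by (rule op_of_eqI) (auto simp: oid_def mkop_def coord_l2 vec_simps, simp add: cvec_def)
qed

lemma op_of_comp: "T \<in> crn \<Longrightarrow> op_of S \<circ> op_of T = op_of (S * T)"
  by (rule op_of_eqI) (simp_all add: op_of_coord op_of_out cvecI cvec_ops(1))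

text \<open>T factors through \<open>ee\<close>, a contraction, so vectors of the Fock space already
  determine the norm of T on the larger space.\<close>

lemma opnorm_op_of: assumes T: "T \<in> crn" shows "opnorm sE rE (op_of T) = norm T"
proof -
  let ?A = "{lnorm (op_of T x) | x. x \<in> l2 sE rE \<and> lnorm x \<le> 1}"
  have eq: "?A = {norm (T \<cdot> y) | y. y \<in> cvec \<and> norm y \<le> 1}" (is "_ = ?B")
  proof (intro equalityI subsetI)
    fix r assume "r \<in> ?A"
    then obtain x where x: "x \<in> l2 sE rE" "lnorm x \<le> 1" "r = lnorm (op_of T x)" by blast
    obtain y where "y \<in> cvec" "x = coord y" using l2_coord[OF x(1)] by blast
    then show "r \<in> ?B" using x by (auto simp: vec_simps op_of_coord)
  next
    fix r assume "r \<in> ?B"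
    then obtain y where "y \<in> cvec" "norm y \<le> 1" "r = norm (T \<cdot> y)" by blast
    then show "r \<in> ?A" by (auto intro!: exI[of _ "coord y"] simp: vec_simps op_of_coord coord_l2)
  qed
  have le: "norm (T \<cdot> y) \<le> norm T" if "norm y \<le> 1" for y
    using norm_rapp[of T y] mult_left_mono[OF that, of "norm T"] by simp
  have bdd: "bdd_above ?B" by (rule bdd_aboveI[of _ "norm T"]) (use le in auto)
  have ne: "0 \<in> ?B" using cvec_ops(1) by (auto intro!: exI[of _ 0])
  have "Sup ?B \<le> norm T" by (rule cSup_least) (use ne le in auto)
  moreover have "norm T \<le> Sup ?B"
  proof (rule norm_rop_bound)
    show s0: "0 \<le> Sup ?B" using cSup_upper[OF ne bdd] .
    fix x
    let ?y = "ee \<cdot> x"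
    have "norm (T \<cdot> ?y) \<le> Sup ?B * norm ?y"
    proof (cases "?y = 0")
      case False
      have "norm (T \<cdot> ((1 / norm ?y) *\<^sub>R ?y)) \<le> Sup ?B"
      proof (rule cSup_upper[OF _ bdd])
        have "(1 / norm ?y) *\<^sub>R ?y \<in> cvec \<and> norm ((1 / norm ?y) *\<^sub>R ?y) \<le> 1"
          using False cvec_ops(5)[OF ee_cvec] by simp
        then show "norm (T \<cdot> ((1 / norm ?y) *\<^sub>R ?y)) \<in> ?B" by blast
      qed
      then show ?thesis using False by (simp add: field_simps)
    qed simp
    also have "\<dots> \<le> Sup ?B * norm x"
      using s0 norm_projection[OF star_simps'(1) ee_ee, of x] by (intro mult_left_mono) auto
    finally show "norm (T \<cdot> x) \<le> Sup ?B * norm x" by (simp add: crn_app[OF T])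
  qed
  ultimately show ?thesis unfolding opnorm_def eq by simp
qed

text \<open>The choice is determined: a candidate and the true adjoint value differ by a Fock space
  vector, and testing against that vector itself shows that it vanishes.\<close>

lemma oadj_op_of: assumes T: "T \<in> crn" shows "oadj sE rE (op_of T) = op_of (star T)"
proof (rule op_of_eqI)
  fix w assume w: "w \<in> cvec"
  have "(SOME z. z \<in> l2 sE rE \<and> (\<forall>x\<in>l2 sE rE. linner (op_of T x) (coord w) = linner x z)) = coord (star T \<cdot> w)"
  proof (rule some_equality)
    have "linner (op_of T x) (coord w) = linner x (coord (star T \<cdot> w))" if x: "x \<in> l2 sE rE" for x
    proof -
      obtain x' where "x' \<in> cvec" "x = coord x'" using l2_coord[OF x] by blast
      then show ?thesis using cip_rapp[of x' "star T" w] by (simp add: vec_simps op_of_coord)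
    qed
    then show "coord (star T \<cdot> w) \<in> l2 sE rE \<and> (\<forall>x\<in>l2 sE rE. linner (op_of T x) (coord w) = linner x (coord (star T \<cdot> w)))"
      using coord_l2[OF cvecI[OF crn_ops(7)[OF T]]] by blast
    fix z assume z: "z \<in> l2 sE rE \<and> (\<forall>x\<in>l2 sE rE. linner (op_of T x) (coord w) = linner x z)"
    then obtain z' where z': "z' \<in> cvec" "z = coord z'" using l2_coord by blast
    have "cip x z' = cip x (star T \<cdot> w)" if "x \<in> cvec" for x
      using z cip_rapp[of x "star T" w] coord_l2[OF that] by (auto simp: z'(2) vec_simps op_of_coord that)
    moreover have "z' - star T \<cdot> w \<in> cvec" using z' cvecI[OF crn_ops(7)[OF T]] cvec_ops(3) by blast
    ultimately have "(z' - star T \<cdot> w) \<bullet> z' = (z' - star T \<cdot> w) \<bullet> (star T \<cdot> w)" by (metis cip_def complex.sel(1))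
    then have "(z' - star T \<cdot> w) \<bullet> (z' - star T \<cdot> w) = 0" by (simp add: inner_diff_right)
    then show "z = coord (star T \<cdot> w)" using z' by simp
  qed
  then show "oadj sE rE (op_of T) (coord w) = coord (star T \<cdot> w)"
    by (simp add: oadj_def mkop_def coord_l2[OF w])
qed (simp add: oadj_def mkop_def vec_simps)

lemma bounded_op_opnorm:
  assumes "bounded_op sE rE t" "x \<in> l2 sE rE"
  shows "lnorm (t x) \<le> opnorm sE rE t * lnorm x"
proof -
  obtain C where C: "\<And>x. x \<in> l2 sE rE \<Longrightarrow> lnorm (t x) \<le> C * lnorm x"
    using assms unfolding bounded_op_def by blast
  let ?A = "{lnorm (t x) | x. x \<in> l2 sE rE \<and> lnorm x \<le> 1}"
  have bdd: "bdd_above ?A"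
  proof (rule bdd_aboveI[of _ "\<bar>C\<bar>"])
    fix r assume "r \<in> ?A"
    then obtain x where x: "x \<in> l2 sE rE" "lnorm x \<le> 1" "r = lnorm (t x)" by blast
    obtain y where y: "y \<in> cvec" "x = coord y" using l2_coord[OF x(1)] by blast
    have "r \<le> C * norm y" using C[OF x(1)] x y by (simp add: vec_simps)
    also have "\<dots> \<le> \<bar>C\<bar> * 1" using x y by (intro mult_mono) (auto simp: vec_simps)
    finally show "r \<le> \<bar>C\<bar>" by simp
  qed
  obtain y where y: "y \<in> cvec" "x = coord y" using l2_coord[OF assms(2)] by blast
  show ?thesis
  proof (cases "y = 0")
    case True
    then show ?thesis using C[OF assms(2)] y by (simp add: vec_simps)
  next
    case False
    let ?c = "complex_of_real (1 / norm y)"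
    have s: "rmul (\<lambda>_. ?c) y = (1 / norm y) *\<^sub>R y" by (intro ell2_eqI) (simp add: scaleR_conv_of_real)
    have sx: "vsmul ?c x \<in> l2 sE rE" "lnorm (vsmul ?c x) \<le> 1"
      unfolding y(2) vec_simps s using cvec_ops(5)[OF y(1)] False by (auto simp: coord_l2)
    have tx: "t (vsmul ?c x) = vsmul ?c (t x)" "t x \<in> l2 sE rE" using assms unfolding bounded_op_def by blast+
    obtain w where w: "w \<in> cvec" "t x = coord w" using l2_coord[OF tx(2)] by blast
    have s': "rmul (\<lambda>_. ?c) w = (1 / norm y) *\<^sub>R w" by (intro ell2_eqI) (simp add: scaleR_conv_of_real)
    have "lnorm (t (vsmul ?c x)) \<le> opnorm sE rE t"
      unfolding opnorm_def by (rule cSup_upper[OF _ bdd]) (use sx in blast)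
    then have "norm w / norm y \<le> opnorm sE rE t" unfolding tx w(2) vec_simps s' by simp
    moreover have "lnorm (t x) = norm w" "lnorm x = norm y" by (simp_all add: w(2), simp_all add: y(2) vec_simps)
    ultimately show ?thesis using False by (simp add: field_simps)
  qed
qed

lemma osub_bounded:
  assumes "bounded_op sE rE t" "T \<in> crn"
  shows "bounded_op sE rE (osub t (op_of T))"
proof -
  have u: "bounded_op sE rE (op_of T)" by (rule op_of_bounded[OF assms(2)])
  have at: "\<exists>w\<in>cvec. t x = coord w" if "x \<in> l2 sE rE" for x
    using assms(1) that l2_coord unfolding bounded_op_def by metis
  have val: "osub t (op_of T) x = coord (w - T \<cdot> y)" if "y \<in> cvec" "x = coord y" "t x = coord w" for x y w
  proof -
    have "rmul (\<lambda>_. - 1) v = - v" for v :: "('v \<times> 'e list) ell2" by (intro ell2_eqI) simp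
    then show ?thesis using that by (simp add: osub_def oadd_def osmul_def op_of_coord vec_simps)
  qed
  obtain C where C: "\<And>x. x \<in> l2 sE rE \<Longrightarrow> lnorm (t x) \<le> C * lnorm x"
    using assms unfolding bounded_op_def by blast
  show ?thesis unfolding bounded_op_def
  proof (intro conjI)
    show "\<forall>x. x \<notin> l2 sE rE \<longrightarrow> osub t (op_of T) x = vzero"
    proof (intro allI impI)
      fix x assume "x \<notin> l2 sE rE"
      then have "t x = vzero" "op_of T x = vzero" using assms(1) u unfolding bounded_op_def by blast+
      then show "osub t (op_of T) x = vzero" by (simp add: osub_def oadd_def osmul_def vadd_def vsmul_def vzero_def)
    qed
    show "\<forall>x\<in>l2 sE rE. osub t (op_of T) x \<in> l2 sE rE"
    proof
      fix x assume x: "x \<in> l2 sE rE"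
      obtain y where y: "y \<in> cvec" "x = coord y" using l2_coord[OF x] by blast
      obtain w where w: "w \<in> cvec" "t x = coord w" using at[OF x] by blast
      show "osub t (op_of T) x \<in> l2 sE rE"
        unfolding val[OF y w(2)] by (intro coord_l2 cvec_ops(3) w cvecI assms)
    qed
    show "\<forall>x\<in>l2 sE rE. \<forall>y\<in>l2 sE rE. \<forall>c. osub t (op_of T) (vadd x y) = vadd (osub t (op_of T) x) (osub t (op_of T) y) \<and>
        osub t (op_of T) (vsmul c x) = vsmul c (osub t (op_of T) x)"
    proof (intro ballI allI)
      fix x y c assume xy: "x \<in> l2 sE rE" "y \<in> l2 sE rE"
      have "t (vadd x y) = vadd (t x) (t y)" "t (vsmul c x) = vsmul c (t x)"
        "op_of T (vadd x y) = vadd (op_of T x) (op_of T y)" "op_of T (vsmul c x) = vsmul c (op_of T x)"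
        using assms(1) u xy unfolding bounded_op_def by blast+
      then show "osub t (op_of T) (vadd x y) = vadd (osub t (op_of T) x) (osub t (op_of T) y) \<and>
        osub t (op_of T) (vsmul c x) = vsmul c (osub t (op_of T) x)"
        by (simp add: osub_def oadd_def osmul_def vadd_def vsmul_def fun_eq_iff algebra_simps)
    qed
    show "\<exists>C. \<forall>x\<in>l2 sE rE. lnorm (osub t (op_of T) x) \<le> C * lnorm x"
    proof (rule exI[of _ "C + norm T"], rule ballI)
      fix x assume x: "x \<in> l2 sE rE"
      obtain y where y: "y \<in> cvec" "x = coord y" using l2_coord[OF x] by blast
      obtain w where w: "w \<in> cvec" "t x = coord w" using at[OF x] by blast
      have "norm (w - T \<cdot> y) \<le> norm w + norm (T \<cdot> y)" by (rule norm_triangle_ineq4)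
      also have "\<dots> \<le> C * norm y + norm T * norm y"
        using C[OF x] norm_rapp[of T y] unfolding w(2) by (intro add_mono) (simp_all add: y(2) vec_simps)
      finally have "norm (w - T \<cdot> y) \<le> (C + norm T) * norm y" by (simp add: distrib_right)
      moreover have "lnorm (osub t (op_of T) x) = norm (w - T \<cdot> y)" by (simp only: val[OF y w(2)] vec_simps)
      moreover have "lnorm x = norm y" by (simp only: y(2) vec_simps)
      ultimately show "lnorm (osub t (op_of T) x) \<le> (C + norm T) * lnorm x" by simp
    qed
  qed
qed

text \<open>The closures in the concrete definitions range over all bounded operators. A norm limit
  of right linear operators is right linear, so these closures contain nothing outside the image of
  the corner.\<close>

lemma approx_crn:
  assumes t: "bounded_op sE rE t" and A: "A \<subseteq> crn" and ap: "\<And>\<epsilon>. 0 < \<epsilon> \<Longrightarrow> \<exists>T\<in>A. opnorm sE rE (osub t (op_of T)) < \<epsilon>"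
  obtains S where "S \<in> crn" "t = op_of S" "S \<in> closure A"
proof -
  have near: "norm (w - T \<cdot> y) \<le> \<epsilon> * norm y"
    if "T \<in> A" "opnorm sE rE (osub t (op_of T)) < \<epsilon>" "y \<in> cvec" "t (coord y) = coord w" for T \<epsilon> y w
  proof -
    have T: "T \<in> crn" using that A by blast
    have m: "rmul (\<lambda>_. - 1) v = - v" for v :: "('v \<times> 'e list) ell2" by (intro ell2_eqI) simp
    have "osub t (op_of T) (coord y) = coord (w - T \<cdot> y)"
      using that m by (simp add: osub_def oadd_def osmul_def op_of_coord vec_simps)
    then have "norm (w - T \<cdot> y) \<le> opnorm sE rE (osub t (op_of T)) * norm y"
      using bounded_op_opnorm[OF osub_bounded[OF t T] coord_l2[OF that(3)]] by (simp add: vec_simps)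
    also have "\<dots> \<le> \<epsilon> * norm y" using that by (intro mult_right_mono) auto
    finally show ?thesis .
  qed
  have "rlin t"
    unfolding rlin_def
  proof (intro conjI ballI allI t)
    fix x a assume x: "x \<in> l2 sE rE"
    obtain y where y: "y \<in> cvec" "x = coord y" using l2_coord[OF x] by blast
    have tl: "t x \<in> l2 sE rE" if "x \<in> l2 sE rE" for x using t that unfolding bounded_op_def by blast
    obtain w where w: "t (coord y) = coord w" using l2_coord[OF tl[OF x]] y by metis
    obtain w' where w': "t (coord (rmul a y)) = coord w'" using l2_coord[OF tl[OF coord_l2[OF cvec_ops(4)[OF y(1)]]]] by metis
    obtain M where M: "\<And>v :: ('v \<times> 'e list) ell2. norm (rmul a v) \<le> norm v * M" "M > 0"
      using bounded_linear.pos_bounded[OF bounded_linear_rmul] by blast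
    have "norm (w' - rmul a w) \<le> e" if e: "e > 0" for e
    proof -
      \<comment> \<open>Each of the two error terms costs at most \<epsilon>M|y|; the added 1 keeps
        the denominator positive.\<close>
      define \<epsilon> where "\<epsilon> = e / (2 * M * norm y + 1)"
      have p: "0 < 2 * M * norm y + 1" using M(2) by (simp add: add_nonneg_pos)
      then obtain T where T: "T \<in> A" "opnorm sE rE (osub t (op_of T)) < \<epsilon>" using ap[of \<epsilon>] e by (auto simp: \<epsilon>_def)
      have e0: "0 < \<epsilon>" using e p by (simp add: \<epsilon>_def)
      have "w' - rmul a w = (w' - T \<cdot> rmul a y) - rmul a (w - T \<cdot> y)" by (simp add: rapp_rmul rmul_linear)
      then have "norm (w' - rmul a w) \<le> norm (w' - T \<cdot> rmul a y) + norm (rmul a (w - T \<cdot> y))"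
        by (metis norm_triangle_ineq4)
      also have "\<dots> \<le> \<epsilon> * norm (rmul a y) + norm (w - T \<cdot> y) * M"
        using near[OF T cvec_ops(4)[OF y(1)] w'] M(1) by (intro add_mono) auto
      also have "\<dots> \<le> \<epsilon> * (norm y * M) + (\<epsilon> * norm y) * M"
        using near[OF T y(1) w] M e0 by (intro add_mono mult_left_mono mult_right_mono) auto
      also have "\<dots> \<le> \<epsilon> * (2 * M * norm y + 1)" using e0 by (simp add: algebra_simps)
      also have "\<dots> = e" using p by (simp add: \<epsilon>_def)
      finally show ?thesis .
    qed
    then have "norm (w' - rmul a w) \<le> 0" by (rule field_le_epsilon) simp
    then show "t (ract x a) = ract (t x) a" using y w w' by (simp add: vec_simps)
  qed
  then obtain S where S: "S \<in> crn" "t = op_of S" by (rule op_of_surj)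
  moreover have "S \<in> closure A"
    unfolding closure_approachable
  proof (intro allI impI)
    fix e :: real assume "0 < e"
    then obtain T where T: "T \<in> A" "opnorm sE rE (osub t (op_of T)) < e" using ap by blast
    then have "norm (S - T) < e"
      using S A opnorm_op_of[OF crn_ops(4)[OF S(1), of T]] by (auto simp: op_of_simps)
    then show "\<exists>y\<in>A. dist y S < e" using T(1) by (auto simp: dist_norm norm_minus_commute)
  qed
  ultimately show ?thesis using that by blast
qed

end

context fock
begin

section \<open>The concrete edge, projection, gauge and path operators\<close>

lemma SE_crn: "SE e \<in> crn" and PV_crn: "PV v \<in> crn" and QK_crn: "QK k \<in> crn" and UT_crn: "UT t \<in> crn" and SP_crn: "SP \<alpha> \<in> crn"
  by (simp_all add: crn_def ee_SP)

lemma Sop_op_of: "Sop sE rE e = op_of (SE e)"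
  by (rule op_of_eqI) (auto simp: Sop_def mkop_def coord_l2 vec_simps coord_SE fun_eq_iff)

lemma Pv_op_of: "Pv sE rE v = op_of (PV v)"
proof (rule op_of_eqI)
  fix y assume y: "y \<in> cvec"
  then have "coord y \<alpha> = 0" if "\<not> is_path sE rE \<alpha>" for \<alpha> using coord_ee[of y \<alpha>] that by (simp add: cvec_def)
  then show "Pv sE rE v (coord y) = coord (PV v \<cdot> y)"
    using y by (auto simp: Pv_def mkop_def coord_l2 coord_PV fun_eq_iff simp del: split_paired_All)
qed (simp add: Pv_def mkop_def vec_simps)

lemma Qop_op_of: "Qop sE rE k = op_of (QK k)"
proof (rule op_of_eqI)
  fix y assume y: "y \<in> cvec"
  then have "coord y \<alpha> = 0" if "\<not> is_path sE rE \<alpha>" for \<alpha> using coord_ee[of y \<alpha>] that by (simp add: cvec_def)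
  then show "Qop sE rE k (coord y) = coord (QK k \<cdot> y)"
    using y by (auto simp: Qop_def mkop_def coord_l2 coord_QK fun_eq_iff simp del: split_paired_All)
qed (simp add: Qop_def mkop_def vec_simps)

lemma Ut_op_of: "Ut sE rE t = op_of (UT t)"
proof (rule op_of_eqI)
  fix y assume y: "y \<in> cvec"
  then have z: "coord y \<alpha> = 0" if "\<not> is_path sE rE \<alpha>" for \<alpha> using coord_ee[of y \<alpha>] that by (simp add: cvec_def)
  show "Ut sE rE t (coord y) = coord (UT t \<cdot> y)"
  proof
    fix \<alpha> show "Ut sE rE t (coord y) \<alpha> = coord (UT t \<cdot> y) \<alpha>"
      using y z[of \<alpha>] by (simp add: Ut_def mkop_def coord_l2 coord_UT cis_conv_exp)
  qed
qed (simp add: Ut_def mkop_def vec_simps)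

lemma gauge_op_of: "T \<in> crn \<Longrightarrow> gauge sE rE t (op_of T) = op_of (ga t T)"
  unfolding gauge_def Ut_op_of oadj_op_of[OF UT_crn]
  by (simp add: op_of_comp crn_ops UT_crn ga_def)

lemma SE_PV: "SE e * PV v = (if v = sE e then SE e else 0)"
proof -
  have 1: "SE e * PV (sE e) = SE e"
  proof (rule rop_coordI)
    fix x \<alpha>
    show "coord ((SE e * PV (sE e)) \<cdot> x) \<alpha> = coord (SE e \<cdot> x) \<alpha>"
      by (cases \<alpha>; cases "snd \<alpha>") (auto simp: coords)
  qed
  have "SE e * PV v = SE e * (PV (sE e) * PV v)" by (simp add: 1 flip: mult.assoc)
  then show ?thesis by (auto simp: PV_mult 1)
qed

text \<open>The two encodings place the vertex projection at opposite ends: \<open>Spath\<close> at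
  the range, \<open>SP\<close> at the source. They agree on genuine paths because an edge operator
  absorbs the projections of its range and of its source.\<close>

lemma Spath_op_of: assumes "is_path sE rE \<alpha>" shows "Spath sE rE \<alpha> = op_of (SP \<alpha>)"
proof -
  obtain v es where a: "\<alpha> = (v, es)" by fastforce
  define W where "W es = foldr (\<lambda>e x. SE e * x) es ee" for es
  have Wc: "W es \<in> crn" for es by (induction es) (auto simp: W_def crn_ops SE_crn)
  have f: "foldr (\<circ>) (map (Sop sE rE) es) (oid sE rE) = op_of (W es)" for es
  proof (induction es)
    case Nil then show ?case by (simp add: W_def op_of_simps)
  next
    case (Cons e es)
    have "foldr (\<circ>) (map (Sop sE rE) (e # es)) (oid sE rE) = op_of (SE e) \<circ> op_of (W es)"
      by (simp only: list.map foldr.simps comp_apply Cons.IH Sop_op_of)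
    also have "\<dots> = op_of (W (e # es))" using op_of_comp[OF Wc[of es], of "SE e"] by (simp add: W_def)
    finally show ?case .
  qed
  have SPW: "SP (v, es) = W es * PV v" for es
    by (induction es) (simp_all add: W_def mult.assoc)
  have WP: "es \<noteq> [] \<Longrightarrow> is_path sE rE (v, es) \<Longrightarrow> W es * PV v = W es" for es
  proof (induction es)
    case (Cons e es)
    show ?case
    proof (cases es)
      case Nil
      then show ?thesis using Cons.prems by (simp add: W_def SE_PV)
    next
      case (Cons f fs)
      then have "W es * PV v = W es" using Cons.IH Cons.prems by simp
      then show ?thesis by (simp add: W_def mult.assoc)
    qed
  qed simp
  have "PV (prng rE (v, es)) * W es = SP (v, es)"
  proof (cases es)
    case Nil then show ?thesis by (simp add: W_def)
  next
    case (Cons e fs)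
    have "PV (rE e) * W es = W es" by (simp add: W_def Cons PV_SE flip: mult.assoc)
    then show ?thesis using SPW[of es] WP[of es] assms a Cons by simp
  qed
  then show ?thesis unfolding Spath_def a prod.sel f Pv_op_of by (simp add: op_of_comp Wc)
qed

section \<open>Compact operators\<close>

lemma theta_op_of: "x \<in> cvec \<Longrightarrow> y \<in> cvec \<Longrightarrow> theta sE rE (coord x) (coord y) = op_of (rtheta x y)"
  by (rule op_of_eqI) (auto simp: theta_def mkop_def coord_l2 vec_simps ainner_coord rtheta_app)

lemma rtheta_crn: "x \<in> cvec \<Longrightarrow> y \<in> cvec \<Longrightarrow> rtheta x y \<in> crn"
  by (simp add: crn_def mult_rtheta rtheta_mult cvec_def)

lemma sc_rtheta: "sc c * rtheta x y = rtheta (rmul (\<lambda>_. c) x) y"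
  unfolding mult_rtheta by (simp add: rmul_def)

abbreviation "thetas \<equiv> {osmul c (theta sE rE x y) | c x y. x \<in> l2 sE rE \<and> y \<in> l2 sE rE}"

lemma finsums_op_of:
  assumes "t \<in> finsums thetas"
  shows "\<exists>T\<in>crn \<inter> rK. t = op_of T"
proof -
  obtain ts where ts: "t = foldr oadd ts ozero" "set ts \<subseteq> thetas" using assms unfolding finsums_def by blast
  have one: "\<exists>T\<in>crn \<inter> rK. s = op_of T" if "s \<in> thetas" for s
  proof -
    obtain c x y where s: "s = osmul c (theta sE rE x y)" "x \<in> l2 sE rE" "y \<in> l2 sE rE" using \<open>s \<in> thetas\<close> by blast
    obtain x' y' where "x' \<in> cvec" "x = coord x'" "y' \<in> cvec" "y = coord y'" using s by (metis l2_coord)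
    then have "s = op_of (rtheta (rmul (\<lambda>_. c) x') y')" "rtheta (rmul (\<lambda>_. c) x') y' \<in> crn"
      by (simp_all add: s theta_op_of op_of_simps sc_rtheta rtheta_crn cvec_ops)
    then show ?thesis using rtheta_in_rK by blast
  qed
  have "set ts \<subseteq> thetas \<Longrightarrow> \<exists>T\<in>crn \<inter> rK. foldr oadd ts ozero = op_of T"
  proof (induction ts)
    case Nil then show ?case using crn_ops(1) rK_zero by (auto simp: op_of_simps)
  next
    case (Cons s ts)
    then obtain S T where ST: "S \<in> crn" "S \<in> rK" "s = op_of S" "T \<in> crn" "T \<in> rK" "foldr oadd ts ozero = op_of T"
      using one[of s] by auto
    then show ?case by (intro bexI[of _ "S + T"]) (auto simp: op_of_simps crn_ops rK_add)
  qed
  then show ?thesis using ts by simp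
qed

lemma finsums_add: "s \<in> finsums A \<Longrightarrow> t \<in> finsums A \<Longrightarrow> oadd s t \<in> finsums A" if "\<And>a. a \<in> A \<Longrightarrow> \<exists>T. a = op_of T"
proof -
  assume "s \<in> finsums A" "t \<in> finsums A"
  then obtain ss ts where st: "s = foldr oadd ss ozero" "set ss \<subseteq> A" "t = foldr oadd ts ozero" "set ts \<subseteq> A" unfolding finsums_def by blast
  have "\<exists>T. t = op_of T"
    unfolding st(3) using st(4)
  proof (induction ts)
    case Nil then show ?case by (auto simp: op_of_simps)
  next
    case (Cons a ts)
    then show ?case using that[of a] by (auto simp: op_of_simps)
  qed
  then have z: "oadd ozero t = t" by (auto simp: op_of_simps)
  have "foldr oadd (ss @ ts) ozero = oadd s t"
  proof -
    have assoc: "oadd (oadd a b) c = oadd a (oadd b c)" for a b c :: "('v, 'e) op"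
      by (simp add: oadd_def vadd_def fun_eq_iff)
    show ?thesis unfolding st(1) by (induction ss) (simp_all add: z assoc flip: st(3))
  qed
  then show ?thesis unfolding finsums_def using st by (auto intro!: exI[of _ "ss @ ts"])
qed

text \<open>Elements of \<open>rK\<close> are limits of combinations of \<open>rtheta\<close> on
  arbitrary vectors. Compression by \<open>ee\<close> moves these vectors into the Fock space
  without affecting an operator of the corner or enlarging distances.\<close>

lemma compacts_op_of: "compacts sE rE = op_of ` (crn \<inter> rK)"
proof (intro equalityI subsetI)
  fix t assume t: "t \<in> compacts sE rE"
  then have b: "bounded_op sE rE t" and ap: "\<And>\<epsilon>. 0 < \<epsilon> \<Longrightarrow> \<exists>s\<in>finsums thetas. opnorm sE rE (osub t s) < \<epsilon>"
    unfolding compacts_def oclosure_def by auto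
  have "\<exists>T\<in>crn \<inter> rK. opnorm sE rE (osub t (op_of T)) < \<epsilon>" if "0 < \<epsilon>" for \<epsilon>
    using ap[OF that] finsums_op_of by blast
  then obtain S where "S \<in> crn" "t = op_of S" "S \<in> closure (crn \<inter> rK)"
    using approx_crn[OF b, of "crn \<inter> rK"] by blast
  moreover have "closure (crn \<inter> rK) = crn \<inter> rK" by (rule closure_closed[OF closed_Int[OF closed_crn closed_rK]])
  ultimately show "t \<in> op_of ` (crn \<inter> rK)" by blast
next
  fix t assume "t \<in> op_of ` (crn \<inter> rK)"
  then obtain T where T: "T \<in> crn" "T \<in> rK" "t = op_of T" by blast
  have th: "\<exists>T. a = op_of T" if "a \<in> thetas" for a
  proof -
    obtain c x y where s: "a = osmul c (theta sE rE x y)" "x \<in> l2 sE rE" "y \<in> l2 sE rE" using \<open>a \<in> thetas\<close> by blast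
    obtain x' y' where "x' \<in> cvec" "x = coord x'" "y' \<in> cvec" "y = coord y'" using s by (metis l2_coord)
    then show ?thesis by (auto simp: s theta_op_of op_of_simps)
  qed
  have fin: "op_of (ee * s * ee) \<in> finsums thetas" if "s \<in> span (range (case_prod rtheta))" for s
    using that
  proof (induction rule: span_induct_alt)
    case base
    show ?case unfolding finsums_def by (auto simp: op_of_simps intro!: exI[of _ "[]"])
  next
    case (step r x s)
    then obtain v w where x: "x = rtheta v w" by auto
    have "ee * rtheta v w * ee = rtheta (ee \<cdot> v) (ee \<cdot> w)" by (simp add: mult_rtheta rtheta_mult)
    then have "ee * (r *\<^sub>R x) * ee = sc (complex_of_real r) * rtheta (ee \<cdot> v) (ee \<cdot> w)"
      unfolding sc_real x by simp
    then have "op_of (ee * (r *\<^sub>R x) * ee) = osmul (complex_of_real r) (theta sE rE (coord (ee \<cdot> v)) (coord (ee \<cdot> w)))"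
      by (simp add: theta_op_of ee_cvec op_of_simps)
    then have "op_of (ee * (r *\<^sub>R x) * ee) \<in> thetas" using coord_l2[OF ee_cvec] by blast
    then have "op_of (ee * (r *\<^sub>R x) * ee) \<in> finsums thetas"
      unfolding finsums_def
      by (intro CollectI exI[of _ "[op_of (ee * (r *\<^sub>R x) * ee)]"]) (simp add: op_of_simps)
    moreover have "ee * (r *\<^sub>R x + s) * ee = ee * (r *\<^sub>R x) * ee + ee * s * ee" by (simp add: algebra_simps)
    ultimately show ?case using finsums_add[OF th _ step(2)] by (simp add: op_of_simps(1)[symmetric])
  qed
  have "\<exists>s\<in>finsums thetas. opnorm sE rE (osub t s) < \<epsilon>" if \<epsilon>: "0 < \<epsilon>" for \<epsilon>
  proof -
    obtain s where s: "s \<in> span (range (case_prod rtheta))" "dist s T < \<epsilon>"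
      using T(2) \<epsilon> unfolding rK_def closure_approachable by blast
    have "T - ee * s * ee = ee * (T - s) * ee" using T(1) by (simp add: crn_def algebra_simps)
    then have "norm (T - ee * s * ee) \<le> norm ee * norm (T - s) * norm ee"
      by (simp add: order_trans[OF norm_mult_ineq] mult_right_mono norm_mult_ineq)
    also have "\<dots> \<le> 1 * norm (T - s) * 1" using norm_ee by (intro mult_mono) auto
    finally have "norm (T - ee * s * ee) < \<epsilon>" using s(2) by (simp add: dist_norm norm_minus_commute)
    then have "opnorm sE rE (osub t (op_of (ee * s * ee))) < \<epsilon>"
      using T(1,3) by (simp add: op_of_simps opnorm_op_of crn_ops compress_crn)
    then show ?thesis using fin[OF s(1)] by blast
  qed
  then show "t \<in> compacts sE rE"
    unfolding compacts_def oclosure_def using T op_of_bounded by auto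
qed

section \<open>The quotient by the compact operators\<close>

definition kap :: "('v, 'e list) calq \<Rightarrow> ('v, 'e) calk" where
  "kap a = op_of ` {S \<in> crn. qq S = a}"

definition cq :: "('v, 'e list) calq set" where "cq = {a. qq ee * a * qq ee = a}"

lemma cq_lift: assumes "a \<in> cq" obtains T where "T \<in> crn" "qq T = a"
proof -
  obtain T where T: "a = qq T" using qq_surj by blast
  have "qq (ee * T * ee) = a" using assms by (simp add: qq_simps cq_def flip: T)
  then show ?thesis using that compress_crn by blast
qed

lemma qq_crn: "T \<in> crn \<Longrightarrow> qq T \<in> cq"
  by (simp add: cq_def crn_def flip: qq_simps)

text \<open>Identifies \<open>kap a\<close> with the concrete coset of any lift of a, so that
  \<open>kap\<close> embeds the corner \<open>cq\<close> into the concrete quotient.\<close>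

lemma qmap_kap: assumes T: "T \<in> crn" shows "qmap sE rE (op_of T) = kap (qq T)"
proof (intro equalityI subsetI)
  fix t assume "t \<in> qmap sE rE (op_of T)"
  then obtain K where K: "K \<in> crn" "K \<in> rK" "t = op_of (T + K)"
    unfolding qmap_def compacts_op_of by (auto simp: op_of_simps)
  then show "t \<in> kap (qq T)" unfolding kap_def using T by (intro image_eqI[of _ _ "T + K"]) (auto simp: crn_ops qq_eq_iff)
next
  fix t assume "t \<in> kap (qq T)"
  then obtain S where S: "S \<in> crn" "qq S = qq T" "t = op_of S" unfolding kap_def by blast
  have "op_of (S - T) \<in> compacts sE rE" unfolding compacts_op_of using S T by (auto simp: qq_eq_iff crn_ops)
  moreover have "t = oadd (op_of T) (op_of (S - T))" by (simp add: S op_of_simps)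
  ultimately show "t \<in> qmap sE rE (op_of T)" unfolding qmap_def by blast
qed

lemma crep_kap: assumes "a \<in> cq" shows "\<exists>S\<in>crn. qq S = a \<and> crep (kap a) = op_of S"
proof -
  obtain T where T: "T \<in> crn" "qq T = a" using cq_lift[OF assms] .
  then have "op_of T \<in> kap a" by (auto simp: kap_def)
  then have "crep (kap a) \<in> kap a" unfolding crep_def by (rule someI[of "\<lambda>T. T \<in> kap a"])
  then show ?thesis by (auto simp: kap_def)
qed

lemma kap_inj: assumes "a \<in> cq" "kap a = kap b" shows "a = b"
proof -
  obtain T where T: "T \<in> crn" "qq T = a" using cq_lift[OF assms(1)] .
  then have "op_of T \<in> kap b" using assms by (auto simp: kap_def)
  then show ?thesis using op_of_inj T by (auto simp: kap_def)
qed

lemma kap_simps: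
  assumes "a \<in> cq" "b \<in> cq"
  shows "cmul sE rE (kap a) (kap b) = kap (a * b)" "cadd sE rE (kap a) (kap b) = kap (a + b)"
    "csmul sE rE c (kap a) = kap (qsc c * a)" "cadj sE rE (kap a) = kap (qstar a)" "csub sE rE (kap a) (kap b) = kap (a - b)"
proof -
  obtain S where S: "S \<in> crn" "qq S = a" "crep (kap a) = op_of S" using crep_kap[OF assms(1)] by blast
  obtain T where T: "T \<in> crn" "qq T = b" "crep (kap b) = op_of T" using crep_kap[OF assms(2)] by blast
  show "cmul sE rE (kap a) (kap b) = kap (a * b)" "cadd sE rE (kap a) (kap b) = kap (a + b)"
    "csmul sE rE c (kap a) = kap (qsc c * a)" "cadj sE rE (kap a) = kap (qstar a)" "csub sE rE (kap a) (kap b) = kap (a - b)"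
    using S(1,2) T(1,2) unfolding cmul_def cadd_def csmul_def cadj_def csub_def S(3) T(3)
    by (simp_all add: op_of_comp op_of_simps oadj_op_of qmap_kap crn_ops qq_simps)
qed

lemma kap_unary:
  assumes "a \<in> cq"
  shows "csmul sE rE c (kap a) = kap (qsc c * a)" "cadj sE rE (kap a) = kap (qstar a)"
  by (rule kap_simps(3,4)[OF assms assms])+

lemma cq_ops: "0 \<in> cq" "a \<in> cq \<Longrightarrow> b \<in> cq \<Longrightarrow> a * b \<in> cq" "a \<in> cq \<Longrightarrow> b \<in> cq \<Longrightarrow> a + b \<in> cq"
  "a \<in> cq \<Longrightarrow> b \<in> cq \<Longrightarrow> a - b \<in> cq" "a \<in> cq \<Longrightarrow> qsc c * a \<in> cq" "a \<in> cq \<Longrightarrow> qstar a \<in> cq"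
proof -
  show "0 \<in> cq" by (simp add: cq_def)
  have *: "a * b \<in> cq" "a + b \<in> cq" "a - b \<in> cq" "qsc c * a \<in> cq" "qstar a \<in> cq" if ab: "a \<in> cq" "b \<in> cq" for a b c
  proof -
    obtain S where S: "S \<in> crn" "qq S = a" using cq_lift[OF ab(1)] .
    obtain T where T: "T \<in> crn" "qq T = b" using cq_lift[OF ab(2)] .
    have "qq (S * T) \<in> cq" "qq (S + T) \<in> cq" "qq (S - T) \<in> cq" "qq (sc c * S) \<in> cq" "qq (star S) \<in> cq"
      by (intro qq_crn crn_ops S(1) T(1))+
    then show "a * b \<in> cq" "a + b \<in> cq" "a - b \<in> cq" "qsc c * a \<in> cq" "qstar a \<in> cq"
      by (simp_all add: qq_simps S(2) T(2))
  qed
  show "a * b \<in> cq" "a + b \<in> cq" "a - b \<in> cq" if "a \<in> cq" "b \<in> cq" by (rule *[OF that])+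
  show "qsc c * a \<in> cq" "qstar a \<in> cq" if "a \<in> cq" by (rule *[OF that that])+
qed

lemma kap_calkin: "a \<in> cq \<Longrightarrow> kap a \<in> calkin sE rE"
  unfolding calkin_def by (metis cq_lift image_eqI mem_Collect_eq op_of_bounded qmap_kap)

text \<open>Convergence of lifts is first compressed into the corner. The quotient norm is an
  infimum over representatives, hence at most the operator norm of the compressed
  difference.\<close>

lemma cclosed_imp_closed:
  assumes "cclosed sE rE B"
  shows "closed {a \<in> cq. kap a \<in> B}"
  unfolding closed_calq
proof (rule closed_sequential_limits[THEN iffD2], intro allI impI, elim conjE)
  fix X T assume X: "\<forall>n. X n \<in> qq -` {a \<in> cq. kap a \<in> B}" "X \<longlonglongrightarrow> T"
  have "closed (qq -` cq)" using closed_corner[of "qq ee"] by (simp add: cq_def closed_calq)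
  then have TQ: "qq T \<in> cq" using closed_sequentially[of "qq -` cq" X T] X by auto
  let ?S = "ee * T * ee"
  have lim: "(\<lambda>n. ee * X n * ee) \<longlonglongrightarrow> ?S" by (intro tendsto_intros X(2))
  have q: "qq (ee * Y * ee) = qq Y" if "qq Y \<in> cq" for Y using that by (simp add: cq_def qq_simps)
  have "kap (qq T) \<in> B"
  proof (rule assms[unfolded cclosed_def, rule_format, OF kap_calkin[OF TQ]])
    fix \<epsilon> :: real assume "0 < \<epsilon>"
    then obtain n where n: "norm (ee * X n * ee - ?S) < \<epsilon>" using LIMSEQ_D[OF lim] by blast
    have Xn: "qq (X n) \<in> cq" "kap (qq (X n)) \<in> B" using X(1) by auto
    let ?D = "?S - ee * X n * ee"
    have D: "?D \<in> crn" by (intro crn_ops compress_crn)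
    have "op_of ?D \<in> kap (qq T - qq (X n))"
      unfolding kap_def using D q[OF TQ] q[OF Xn(1)] by (intro image_eqI[of _ _ ?D]) (auto simp: qq_simps(2))
    moreover have "bdd_below {opnorm sE rE t | t. t \<in> kap (qq T - qq (X n))}"
      by (rule bdd_belowI[of _ 0]) (auto simp: kap_def opnorm_op_of)
    ultimately have "cnorm sE rE (kap (qq T - qq (X n))) \<le> opnorm sE rE (op_of ?D)"
      unfolding cnorm_def by (intro cInf_lower) auto
    also have "\<dots> < \<epsilon>" using n D by (simp add: opnorm_op_of norm_minus_commute)
    finally show "\<exists>b\<in>B. cnorm sE rE (csub sE rE (kap (qq T)) b) < \<epsilon>"
      using Xn by (intro bexI[of _ "kap (qq (X n))"]) (auto simp: kap_simps TQ)
  qed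
  then show "T \<in> qq -` {a \<in> cq. kap a \<in> B}" using TQ by simp
qed

text \<open>A coset in \<open>calkin\<close> may come from an operator t that is not right linear.
  The infimum in \<open>cnorm\<close> provides representatives close to zero; moving their compact
  corrections into the lift of b approximates t itself by corner operators, and
  \<open>approx_crn\<close> forces t into the corner.\<close>

lemma closed_imp_cclosed:
  assumes B: "closed B" "B \<subseteq> cq"
  shows "cclosed sE rE (kap ` B)"
  unfolding cclosed_def
proof (intro ballI impI)
  fix a assume a: "a \<in> calkin sE rE" and ap: "\<forall>\<epsilon>>0. \<exists>b\<in>kap ` B. cnorm sE rE (csub sE rE a b) < \<epsilon>"
  obtain t where t: "bounded_op sE rE t" "a = qmap sE rE t" using a unfolding calkin_def by blast
  have "oadd t ozero \<in> a" unfolding t(2) qmap_def compacts_op_of op_of_simps(4) using crn_ops(1) rK_zero by blast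
  then have "crep a \<in> a" unfolding crep_def by (rule someI[of "\<lambda>T. T \<in> a"])
  then obtain K0 where K0: "K0 \<in> crn" "K0 \<in> rK" "crep a = oadd t (op_of K0)"
    unfolding t(2) qmap_def compacts_op_of by blast
  let ?A = "{S \<in> crn. qq S \<in> B}"
  have "\<exists>S\<in>?A. opnorm sE rE (osub t (op_of S)) < \<epsilon>" if \<epsilon>: "0 < \<epsilon>" for \<epsilon>
  proof -
    obtain b where b: "b \<in> B" "cnorm sE rE (csub sE rE a (kap b)) < \<epsilon>" using ap \<epsilon> by blast
    obtain S where S: "S \<in> crn" "qq S = b" "crep (kap b) = op_of S" using crep_kap[of b] b B by blast
    let ?N = "{opnorm sE rE T | T. T \<in> csub sE rE a (kap b)}"
    \<comment> \<open>Nonemptiness is the point: an infimum below \<epsilon> is witnessed by an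
      element only for a nonempty set.\<close>
    have "osub (crep a) (op_of S) \<in> csub sE rE a (kap b) \<or> csub sE rE a (kap b) \<noteq> {}"
      unfolding csub_def qmap_def compacts_op_of S(3) using crn_ops(1) rK_zero by blast
    then have "?N \<noteq> {}" by blast
    then obtain T where T: "T \<in> csub sE rE a (kap b)" "opnorm sE rE T < \<epsilon>"
      using cInf_lessD[of ?N \<epsilon>] b(2) unfolding cnorm_def by blast
    obtain K1 where K1: "K1 \<in> crn" "K1 \<in> rK" "T = oadd (osub (crep a) (op_of S)) (op_of K1)"
      using T(1) unfolding csub_def qmap_def compacts_op_of S(3) by blast
    let ?S = "S - K0 - K1"
    have S': "?S \<in> ?A"
    proof -
      have "qq K0 = 0" "qq K1 = 0" using K0(2) K1(2) qq_eq_iff[of _ 0] by (auto simp: qq_simps)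
      then show ?thesis using S b K0 K1 by (auto simp: crn_ops qq_simps)
    qed
    have "T = osub t (op_of ?S)"
      unfolding K1(3) K0(3) op_of_simps(3)[symmetric]
      by (simp add: osub_def oadd_def osmul_def vadd_def vsmul_def fun_eq_iff)
    then show ?thesis using S' T(2) by blast
  qed
  then obtain S where S: "S \<in> crn" "t = op_of S" "S \<in> closure ?A"
    using approx_crn[OF t(1), of ?A] by blast
  have "closed (crn \<inter> qq -` B)" using closed_crn B(1) by (simp add: closed_calq closed_Int)
  moreover have "?A = crn \<inter> qq -` B" by auto
  ultimately have "qq S \<in> B" using S(3) by (simp add: closure_closed)
  then show "a \<in> kap ` B" using S(1,2) t(2) qmap_kap by blast
qed

lemma kap_0: "qmap sE rE ozero = kap 0"
  unfolding op_of_simps(4) by (simp add: qmap_kap crn_ops qq_simps)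

section \<open>Generated algebras\<close>

lemma ccstar_sub_kap: assumes "qalg B" "B \<subseteq> cq" shows "ccstar_sub sE rE (kap ` B)"
proof -
  have "kap ` B \<subseteq> calkin sE rE" using assms kap_calkin by blast
  moreover have "qmap sE rE ozero \<in> kap ` B" using qalgD(1)[OF assms(1)] by (simp add: kap_0)
  moreover have "cclosed sE rE (kap ` B)" by (rule closed_imp_cclosed) (use assms qalgD in auto)
  moreover have "cadd sE rE (kap a) (kap b) \<in> kap ` B" "cmul sE rE (kap a) (kap b) \<in> kap ` B"
    "csmul sE rE c (kap a) \<in> kap ` B" "cadj sE rE (kap a) \<in> kap ` B" if "a \<in> B" "b \<in> B" for a b c
  proof -
    have "a \<in> cq" "b \<in> cq" using that assms(2) by auto
    then show "cadd sE rE (kap a) (kap b) \<in> kap ` B" "cmul sE rE (kap a) (kap b) \<in> kap ` B"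
      "csmul sE rE c (kap a) \<in> kap ` B" "cadj sE rE (kap a) \<in> kap ` B"
      using that qalgD(2-5)[OF assms(1)] by (simp_all add: kap_simps kap_unary)
  qed
  ultimately show ?thesis unfolding ccstar_sub_def by simp
qed

lemma qalg_of_ccstar_sub: assumes "ccstar_sub sE rE B" shows "qalg {a \<in> cq. kap a \<in> B}"
proof -
  have B: "qmap sE rE ozero \<in> B" "cclosed sE rE B"
    "\<And>a b. a \<in> B \<Longrightarrow> b \<in> B \<Longrightarrow> cadd sE rE a b \<in> B" "\<And>a b. a \<in> B \<Longrightarrow> b \<in> B \<Longrightarrow> cmul sE rE a b \<in> B"
    "\<And>a c. a \<in> B \<Longrightarrow> csmul sE rE c a \<in> B" "\<And>a. a \<in> B \<Longrightarrow> cadj sE rE a \<in> B"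
    using assms unfolding ccstar_sub_def by blast+
  let ?A = "{a \<in> cq. kap a \<in> B}"
  have "a + b \<in> ?A" "a * b \<in> ?A" if "a \<in> ?A" "b \<in> ?A" for a b
    using that B(3)[of "kap a" "kap b"] B(4)[of "kap a" "kap b"] by (simp_all add: kap_simps cq_ops)
  moreover have "qsc c * a \<in> ?A" "qstar a \<in> ?A" if "a \<in> ?A" for a c
    using that B(5)[of "kap a" c] B(6)[of "kap a"] by (simp_all add: kap_unary cq_ops)
  moreover have "0 \<in> ?A" using B(1) by (simp add: cq_ops kap_0)
  moreover note cclosed_imp_closed[OF B(2)]
  ultimately show ?thesis unfolding qalg_def by (intro conjI ballI allI)
qed

text \<open>A competing concrete algebra may contain cosets outside the image of \<open>kap\<close>,
  so it is pulled back to \<open>cq\<close> and compared there; in the other direction the generated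
  algebra is pushed forward.\<close>

lemma ccstar_gen_kap: assumes "X \<subseteq> cq" shows "ccstar_gen sE rE (kap ` X) = kap ` \<Inter>{B. qalg B \<and> X \<subseteq> B}"
proof (intro equalityI)
  let ?C = "\<Inter>{B. qalg B \<and> X \<subseteq> B}"
  have cq: "qalg cq"
    unfolding qalg_def using closed_corner[of "qq ee"] by (auto simp: cq_ops cq_def[symmetric])
  have "qalg ?C"
  proof -
    have "closed ?C" by (intro closed_Inter) (auto simp: qalgD)
    then show ?thesis unfolding qalg_def by (auto simp: qalgD)
  qed
  moreover have "?C \<subseteq> cq" using cq assms by blast
  ultimately have "ccstar_sub sE rE (kap ` ?C)" by (rule ccstar_sub_kap)
  then show "ccstar_gen sE rE (kap ` X) \<subseteq> kap ` ?C" unfolding ccstar_gen_def by blast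
  show "kap ` ?C \<subseteq> ccstar_gen sE rE (kap ` X)"
    unfolding ccstar_gen_def
  proof (intro subsetI InterI)
    fix b B assume b: "b \<in> kap ` ?C" and B: "B \<in> {B. ccstar_sub sE rE B \<and> kap ` X \<subseteq> B}"
    then have "qalg {a \<in> cq. kap a \<in> B}" "X \<subseteq> {a \<in> cq. kap a \<in> B}" using qalg_of_ccstar_sub assms by auto
    then have "?C \<subseteq> {a \<in> cq. kap a \<in> B}" by blast
    then show "b \<in> B" using b by auto
  qed
qed

text \<open>Same comparison for operators. That the pushed-forward algebra is closed among all
  bounded operators is \<open>approx_crn\<close>.\<close>

lemma cstar_gen_op_of: assumes "X \<subseteq> crn" shows "cstar_gen sE rE (op_of ` X) = op_of ` \<Inter>{B. csalg B \<and> X \<subseteq> B}"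
proof -
  define C where "C = \<Inter>{B. csalg B \<and> X \<subseteq> B}"
  have crn: "csalg crn" by (rule csalgI) (auto simp: crn_ops closed_crn)
  have C: "csalg C"
    unfolding C_def by (rule csalgI) (auto simp: csalg_ops csalgD intro!: closed_Inter)
  have sub: "C \<subseteq> crn" unfolding C_def using crn assms by blast
  have "cstar_sub sE rE (op_of ` C)"
    unfolding cstar_sub_def
  proof (intro conjI)
    show "op_of ` C \<subseteq> {T. bounded_op sE rE T}" using sub op_of_bounded by blast
    show "ozero \<in> op_of ` C" unfolding op_of_simps(4) using csalg_ops(1)[OF C] by blast
    show "\<forall>T\<in>op_of ` C. \<forall>S\<in>op_of ` C. oadd T S \<in> op_of ` C \<and> T \<circ> S \<in> op_of ` C"
    proof (intro ballI)
      fix s t assume "s \<in> op_of ` C" "t \<in> op_of ` C"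
      then obtain S T where ST: "S \<in> C" "s = op_of S" "T \<in> C" "t = op_of T" by blast
      then have "T \<in> crn" using sub by blast
      then have "oadd s t = op_of (S + T)" "s \<circ> t = op_of (S * T)" using ST by (simp_all add: op_of_simps op_of_comp)
      then show "oadd s t \<in> op_of ` C \<and> s \<circ> t \<in> op_of ` C"
        using csalg_ops(2,5)[OF C ST(1,3)] by simp
    qed
    show "\<forall>T\<in>op_of ` C. \<forall>c. osmul c T \<in> op_of ` C"
    proof (intro ballI allI)
      fix t c assume "t \<in> op_of ` C"
      then obtain T where T: "T \<in> C" "t = op_of T" by blast
      then show "osmul c t \<in> op_of ` C" using csalg_ops(7)[OF C T(1)] by (simp add: op_of_simps)
    qed
    show "\<forall>T\<in>op_of ` C. oadj sE rE T \<in> op_of ` C"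
    proof
      fix t assume "t \<in> op_of ` C"
      then obtain T where T: "T \<in> C" "t = op_of T" by blast
      then show "oadj sE rE t \<in> op_of ` C" using csalg_ops(6)[OF C T(1)] subsetD[OF sub T(1)] by (simp add: oadj_op_of)
    qed
    show "oclosure sE rE (op_of ` C) \<subseteq> op_of ` C"
    proof
      fix t assume "t \<in> oclosure sE rE (op_of ` C)"
      then have "bounded_op sE rE t" "\<And>\<epsilon>. 0 < \<epsilon> \<Longrightarrow> \<exists>T\<in>C. opnorm sE rE (osub t (op_of T)) < \<epsilon>"
        unfolding oclosure_def by blast+
      then obtain S where "t = op_of S" "S \<in> closure C" using approx_crn[OF _ sub] by blast
      then show "t \<in> op_of ` C" using csalgD(2)[OF C] by (simp add: closure_closed)
    qed
  qed
  moreover have "X \<subseteq> C" by (auto simp: C_def)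
  ultimately have "cstar_gen sE rE (op_of ` X) \<subseteq> op_of ` C" unfolding cstar_gen_def by blast
  moreover have "op_of ` C \<subseteq> cstar_gen sE rE (op_of ` X)"
    unfolding cstar_gen_def
  proof (intro subsetI InterI)
    fix b B assume b: "b \<in> op_of ` C" and "B \<in> {B. cstar_sub sE rE B \<and> op_of ` X \<subseteq> B}"
    then have B: "cstar_sub sE rE B" "op_of ` X \<subseteq> B" by auto
    have Bo: "ozero \<in> B" "\<And>s t. s \<in> B \<Longrightarrow> t \<in> B \<Longrightarrow> oadd s t \<in> B" "\<And>s t. s \<in> B \<Longrightarrow> t \<in> B \<Longrightarrow> s \<circ> t \<in> B"
      "\<And>t c. t \<in> B \<Longrightarrow> osmul c t \<in> B" "\<And>t. t \<in> B \<Longrightarrow> oadj sE rE t \<in> B" "oclosure sE rE B \<subseteq> B"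
      using B(1) unfolding cstar_sub_def by blast+
    have "csalg {T \<in> crn. op_of T \<in> B}"
    proof (rule csalgI)
      show "0 \<in> {T \<in> crn. op_of T \<in> B}" using Bo(1) by (simp add: crn_ops op_of_simps)
      show "S + T \<in> {T \<in> crn. op_of T \<in> B}" "S * T \<in> {T \<in> crn. op_of T \<in> B}"
        if "S \<in> {T \<in> crn. op_of T \<in> B}" "T \<in> {T \<in> crn. op_of T \<in> B}" for S T
        using that Bo(2)[of "op_of S" "op_of T"] Bo(3)[of "op_of S" "op_of T"] by (simp_all add: crn_ops op_of_simps op_of_comp)
      show "sc c * T \<in> {T \<in> crn. op_of T \<in> B}" if "T \<in> {T \<in> crn. op_of T \<in> B}" for c T
        using that Bo(4)[of "op_of T" c] by (simp add: crn_ops op_of_simps)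
      show "star T \<in> {T \<in> crn. op_of T \<in> B}" if "T \<in> {T \<in> crn. op_of T \<in> B}" for T
        using that Bo(5)[of "op_of T"] by (simp add: crn_ops oadj_op_of)
      show "closed {T \<in> crn. op_of T \<in> B}"
      proof (rule closed_sequential_limits[THEN iffD2], intro allI impI, elim conjE)
        fix X T assume X: "\<forall>n. X n \<in> {T \<in> crn. op_of T \<in> B}" "X \<longlonglongrightarrow> T"
        then have T: "T \<in> crn" using closed_sequentially[OF closed_crn, of X T] by auto
        have "op_of T \<in> oclosure sE rE B"
          unfolding oclosure_def
        proof (intro CollectI conjI allI impI op_of_bounded[OF T])
          fix \<epsilon> :: real assume "0 < \<epsilon>"
          then obtain n where "norm (X n - T) < \<epsilon>" using LIMSEQ_D[OF X(2)] by blast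
          then have "opnorm sE rE (osub (op_of T) (op_of (X n))) < \<epsilon>"
            using X(1) T by (simp add: op_of_simps opnorm_op_of crn_ops norm_minus_commute)
          then show "\<exists>S0\<in>B. opnorm sE rE (osub (op_of T) S0) < \<epsilon>" using X(1) by blast
        qed
        then show "T \<in> {T \<in> crn. op_of T \<in> B}" using T Bo(6) by blast
      qed
    qed
    moreover have "X \<subseteq> {T \<in> crn. op_of T \<in> B}" using B(2) assms by blast
    ultimately have "C \<subseteq> {T \<in> crn. op_of T \<in> B}" unfolding C_def by blast
    then show "b \<in> B" using b by blast
  qed
  ultimately show ?thesis unfolding C_def by (rule equalityI)
qed

end

context fock
begin

section \<open>Condition A(p) in coordinates and the weight sequence\<close>

lemma coord_star_SP:
  "is_path sE rE (v, es) \<Longrightarrow> coord (star (SP (v, es)) \<cdot> y) \<gamma> =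
    (if is_path sE rE \<gamma> \<and> prng rE \<gamma> = v then coord y (fst \<gamma>, es @ snd \<gamma>) else 0)"
proof (induction es arbitrary: y)
  case Nil
  then show ?case by (simp add: coord_PV)
next
  case (Cons e es)
  have p: "is_path sE rE (v, es)" "sE e = prng rE (v, es)" using Cons.prems by simp_all
  have "coord (star (SP (v, e # es)) \<cdot> y) \<gamma> = coord (star (SP (v, es)) \<cdot> (star (SE e) \<cdot> y)) \<gamma>" by simp
  also have "\<dots> = (if is_path sE rE \<gamma> \<and> prng rE \<gamma> = v then coord (star (SE e) \<cdot> y) (fst \<gamma>, es @ snd \<gamma>) else 0)"
    by (rule Cons.IH[OF p(1)])
  also have "\<dots> = (if is_path sE rE \<gamma> \<and> prng rE \<gamma> = v then coord y (fst \<gamma>, (e # es) @ snd \<gamma>) else 0)"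
  proof -
    have "is_path sE rE (fst \<gamma>, es @ snd \<gamma>)" "prng rE (fst \<gamma>, es @ snd \<gamma>) = sE e" if "is_path sE rE \<gamma>" "prng rE \<gamma> = v"
      using is_path_pcat[of sE rE "(v, es)" \<gamma>] prng_pcat[of "(v, es)" rE \<gamma>] p that by (simp_all add: pcat_def)
    then show ?thesis by (simp add: coord_star_SE)
  qed
  finally show ?case .
qed

lemma coord_SP:
  "coord (SP (v, es) \<cdot> w) (a, fs) = (if is_path sE rE (a, fs) \<and> take (length es) fs = es \<and>
     prng rE (a, drop (length es) fs) = v then coord w (a, drop (length es) fs) else 0)"
proof (induction es arbitrary: fs)
  case Nil
  then show ?case by (simp add: coord_PV)
next
  case (Cons e es)
  then show ?case by (cases fs) (auto simp: coord_SE)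
qed

lemma coord_sum: "coord (\<Sum>i\<in>I. f i) \<alpha> = (\<Sum>i\<in>I. coord (f i) \<alpha>)"
  by (induction I rule: infinite_finite_induct) auto

text \<open>A path of length p+k splits in exactly one way as \<beta>\<eta> with \<beta> of length
  p, so at this coordinate a single summand contributes, and it applies Z at level k to the tail. At
  all other coordinates both sides vanish.\<close>

lemma tensId_op_of:
  assumes Z: "T \<in> crn" "T * QK k = QK k * T"
  shows "tensId sE rE p (op_of T) k = op_of (\<Sum>\<beta>\<in>PK sE rE p. SP \<beta> * (T * QK k) * star (SP \<beta>))" (is "_ = op_of ?S")
proof (rule op_of_eqI)
  fix y assume y: "y \<in> cvec"
  show "tensId sE rE p (op_of T) k (coord y) = coord (?S \<cdot> y)"
  proof
    fix \<alpha> :: "('v, 'e) path"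
    obtain a fs where a: "\<alpha> = (a, fs)" by fastforce
    define \<eta> where "\<eta> = (a, drop p fs)"
    define \<beta> where "\<beta> = (prng rE \<eta>, take p fs)"
    let ?w = "\<lambda>\<beta>. (T * QK k) \<cdot> star (SP \<beta>) \<cdot> y"
    have S: "coord (?S \<cdot> y) \<alpha> = (\<Sum>\<beta>\<in>PK sE rE p. coord (SP \<beta> \<cdot> ?w \<beta>) \<alpha>)"
      by (simp add: rapp_sum coord_sum)
    have trm: "coord (SP \<gamma> \<cdot> ?w \<gamma>) \<alpha> = (if is_path sE rE \<alpha> \<and> \<gamma> = \<beta> then coord (?w \<beta>) \<eta> else 0)"
      if \<gamma>: "\<gamma> \<in> PK sE rE p" for \<gamma>
    proof -
      obtain v es where g: "\<gamma> = (v, es)" "length es = p" using \<gamma> by (cases \<gamma>) (auto simp: PK_def)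
      have "coord (SP \<gamma> \<cdot> w) \<alpha> = (if is_path sE rE \<alpha> \<and> take p fs = es \<and> prng rE \<eta> = v then coord w \<eta> else 0)" for w
        unfolding a g(1) coord_SP g(2) \<eta>_def ..
      moreover have "take p fs = es \<and> prng rE \<eta> = v \<longleftrightarrow> \<gamma> = \<beta>" by (auto simp: \<beta>_def g(1))
      ultimately show ?thesis by auto
    qed
    have lv: "coord (?w \<gamma>) \<eta> = (if is_path sE rE \<eta> \<and> plen \<eta> = k then coord (T \<cdot> star (SP \<gamma>) \<cdot> y) \<eta> else 0)" for \<gamma>
      unfolding Z(2) rapp_simps(6) coord_QK ..
    show "tensId sE rE p (op_of T) k (coord y) \<alpha> = coord (?S \<cdot> y) \<alpha>"
    proof (cases "is_path sE rE \<alpha> \<and> plen \<alpha> = p + k")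
      case True
      then have fs: "length fs = p + k" "is_path sE rE (a, fs)" by (auto simp: a)
      have pl: "is_path sE rE \<alpha>" "p \<le> plen \<alpha>" using True by auto
      obtain \<beta>' \<gamma>' where bg: "\<alpha> = pcat \<beta>' \<gamma>'" "is_path sE rE \<beta>'" "is_path sE rE \<gamma>'" "psrc \<beta>' = prng rE \<gamma>'" "plen \<beta>' = p" "plen \<gamma>' = plen \<alpha> - p"
        by (rule path_split[OF pl])
      then have "\<gamma>' = \<eta>" "\<beta>' = \<beta>" by (cases \<beta>'; cases \<gamma>'; auto simp: a pcat_def \<eta>_def \<beta>_def)+
      then have \<beta>: "is_path sE rE \<beta>" "\<beta> \<in> PK sE rE p" "is_path sE rE \<eta>" using bg by (auto simp: PK_def)
      let ?f = "\<lambda>\<gamma>. if is_path sE rE \<gamma> \<and> plen \<gamma> = k \<and> prng rE \<gamma> = psrc \<beta> then coord y (pcat \<beta> \<gamma>) else 0"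
      have f: "?f = coord (QK k \<cdot> star (SP \<beta>) \<cdot> y)"
      proof
        fix \<gamma>
        have "coord (star (SP \<beta>) \<cdot> y) \<gamma> = (if is_path sE rE \<gamma> \<and> prng rE \<gamma> = prng rE \<eta> then coord y (fst \<gamma>, take p fs @ snd \<gamma>) else 0)"
          using coord_star_SP[of "prng rE \<eta>" "take p fs" y \<gamma>] \<beta>(1) by (simp add: \<beta>_def)
        then show "?f \<gamma> = coord (QK k \<cdot> star (SP \<beta>) \<cdot> y) \<gamma>"
          unfolding coord_QK by (auto simp: \<beta>_def pcat_def)
      qed
      have "tensId sE rE p (op_of T) k (coord y) \<alpha> = op_of T ?f \<eta>"
        using True coord_l2[OF y] 
        unfolding tensId_def mkop_def by (simp add: a \<beta>_def \<eta>_def Let_def cong: if_cong)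
      also have "\<dots> = coord (?w \<beta>) \<eta>"
        unfolding f using op_of_coord[OF cvecI[OF QK_crn], of T k "star (SP \<beta>) \<cdot> y"] by simp
      also have "\<dots> = (\<Sum>\<gamma>\<in>PK sE rE p. if \<gamma> = \<beta> then coord (?w \<beta>) \<eta> else 0)"
        using \<beta>(2) finite_PK[of sE rE p] by (simp only: sum.delta if_True)
      also have "\<dots> = coord (?S \<cdot> y) \<alpha>"
        unfolding S by (rule sum.cong[OF refl], subst trm) (use True in simp_all)
      finally show ?thesis .
    next
      case False
      have "coord (SP \<gamma> \<cdot> ?w \<gamma>) \<alpha> = 0" if g: "\<gamma> \<in> PK sE rE p" for \<gamma>
      proof (cases "is_path sE rE \<alpha> \<and> \<gamma> = \<beta>")
        case True
        then have "length (take p fs) = p" using g by (simp add: PK_def \<beta>_def)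
        then have "plen \<eta> \<noteq> k" using False True by (auto simp: a \<eta>_def)
        then show ?thesis unfolding trm[OF g] lv by simp
      qed (use trm[OF g] in auto)
      then show ?thesis unfolding S using False coord_l2[OF y] by (simp add: tensId_def mkop_def) blast
    qed
  qed
qed (simp add: tensId_def mkop_def vec_simps)

lemma weighted_fockI:
  assumes no_sinks: "\<forall>v. \<exists>e. sE e = v" and w: "weight_seq sE rE Z" and p: "1 \<le> p" and cA: "condA sE rE p Z"
  obtains ZZ where "Z = op_of ZZ" "weighted_fock sE rE ZZ p"
proof -
  \<comment> \<open>The clause on \<open>ract\<close> in the weight sequence is right linearity,
    which makes Z a copy of a corner operator.\<close>
  have "rlin Z" using w unfolding weight_seq_def rlin_def by blast
  then obtain ZZ where ZZ: "ZZ \<in> crn" "Z = op_of ZZ" by (rule op_of_surj)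
  note w' = w[unfolded weight_seq_def, THEN conjunct2]
  note wc = w' w'[THEN conjunct2, THEN conjunct2] w'[THEN conjunct2, THEN conjunct2, THEN conjunct2, THEN conjunct2]
  have Q: "Z \<circ> Qop sE rE k = Qop sE rE k \<circ> Z" and P: "Z \<circ> Pv sE rE v = Pv sE rE v \<circ> Z" and st: "oadj sE rE Z = Z" for k v
    by (rule wc(1)[THEN conjunct1, rule_format], rule wc(2)[THEN conjunct1, rule_format], rule wc(3)[THEN conjunct1])
  obtain \<epsilon> where e: "\<epsilon> > 0" "\<And>k x. 1 \<le> k \<Longrightarrow> x \<in> l2 sE rE \<Longrightarrow> Qop sE rE k x = x \<Longrightarrow> Re (linner x (Z x)) \<ge> \<epsilon> * (lnorm x)\<^sup>2"
    using wc(3)[THEN conjunct2, THEN conjunct2] by blast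
  have ZQ: "ZZ * QK k = QK k * ZZ" for k
    using Q[of k] by (intro op_of_inj crn_ops ZZ QK_crn) (simp add: ZZ Qop_op_of op_of_comp QK_crn)
  have ZP: "ZZ * PV v = PV v * ZZ" for v
    using P[of v] by (intro op_of_inj crn_ops ZZ PV_crn) (simp add: ZZ Pv_op_of op_of_comp PV_crn)
  have "star ZZ = ZZ"
    using st by (intro op_of_inj crn_ops ZZ) (simp add: ZZ oadj_op_of)
  moreover have "\<exists>\<epsilon>>0. \<forall>k\<ge>1. \<forall>x. QK k \<cdot> x = x \<longrightarrow> \<epsilon> * (norm x)\<^sup>2 \<le> x \<bullet> (ZZ \<cdot> x)"
  proof (intro exI[of _ \<epsilon>] conjI allI impI e(1))
    fix k :: nat and x assume k: "1 \<le> k" and x: "QK k \<cdot> x = x"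
    then have xc: "x \<in> cvec" using cvecI[OF QK_crn, of k x] by simp
    have "Qop sE rE k (coord x) = coord x" by (simp add: Qop_op_of op_of_coord xc x)
    then have "\<epsilon> * (lnorm (coord x))\<^sup>2 \<le> Re (linner (coord x) (Z (coord x)))"
      by (rule e(2)[OF k coord_l2[OF xc]])
    then show "\<epsilon> * (norm x)\<^sup>2 \<le> x \<bullet> (ZZ \<cdot> x)" by (simp add: ZZ(2) op_of_coord xc vec_simps cip_def)
  qed
  moreover have "(\<lambda>k. norm ((\<Sum>\<beta>\<in>PK sE rE p. SP \<beta> * (ZZ * QK k) * star (SP \<beta>)) - ZZ * QK (k + p))) \<longlonglongrightarrow> 0"
  proof -
    have crn_sum: "(\<And>i. i \<in> I \<Longrightarrow> f i \<in> crn) \<Longrightarrow> (\<Sum>i\<in>I. f i) \<in> crn" for f and I :: "('v, 'e) path set"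
      by (induction I rule: infinite_finite_induct) (auto simp: crn_ops)
    have "opnorm sE rE (osub (tensId sE rE p Z k) (Z \<circ> Qop sE rE (k + p))) =
      norm ((\<Sum>\<beta>\<in>PK sE rE p. SP \<beta> * (ZZ * QK k) * star (SP \<beta>)) - ZZ * QK (k + p))" for k
      unfolding ZZ(2) tensId_op_of[OF ZZ(1) ZQ] Qop_op_of op_of_comp[OF QK_crn] op_of_simps(3)
      by (intro opnorm_op_of crn_ops crn_sum ZZ SP_crn QK_crn)
    then show ?thesis using cA unfolding condA_def by simp
  qed
  ultimately have "weighted_fock sE rE ZZ p"
    using no_sinks p ZQ ZP ZZ(1) by unfold_locales (auto simp: crn_def)
  then show ?thesis using that ZZ(2) by blast
qed

lemma kap_mem: "B \<subseteq> cq \<Longrightarrow> a \<in> cq \<Longrightarrow> kap a \<in> kap ` B \<longleftrightarrow> a \<in> B"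
  using kap_inj by blast

lemma inj_on_kap: "inj_on kap cq" using kap_inj by (intro inj_onI)

lemma ue_kap: "ue sE rE e = kap (qq (SE e))"
  by (simp add: ue_def Sop_op_of qmap_kap SE_crn)

lemma u_kap: "is_path sE rE \<alpha> \<Longrightarrow> u sE rE \<alpha> = kap (qq (SP \<alpha>))"
  by (simp add: u_def Spath_op_of qmap_kap SP_crn)

lemma ga_crn: "T \<in> crn \<Longrightarrow> ga t T \<in> crn" unfolding ga_def by (intro crn_ops UT_crn)

end

context weighted_fock
begin

section \<open>Translation of the statement into the corner\<close>

lemma ZZ_crn: "ZZ \<in> crn" by (simp add: crn_def Z_ee Z_ee')

lemma TT_crn: "TT \<subseteq> crn" using TT_corner by (auto simp: crn_def)

lemma toeplitz_op_of: "toeplitz sE rE (op_of ZZ) = op_of ` TT"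
proof -
  have "{op_of ZZ \<circ> Sop sE rE e | e. True} = op_of ` range (\<lambda>e. ZZ * SE e)"
    by (auto simp: Sop_op_of op_of_comp SE_crn)
  moreover have "range (\<lambda>e. ZZ * SE e) \<subseteq> crn" using crn_ops(5)[OF ZZ_crn SE_crn] by blast
  moreover have "TT = \<Inter>{B. csalg B \<and> range (\<lambda>e. ZZ * SE e) \<subseteq> B}" by (simp add: TT_def image_subset_iff)
  ultimately show ?thesis unfolding toeplitz_def by (simp only: cstar_gen_op_of)
qed

lemma fixD_op_of: "fixD sE rE (op_of ZZ) = op_of ` DD"
proof -
  have "gauge sE rE t (op_of T) = op_of T \<longleftrightarrow> ga t T = T" if "T \<in> TT" for t T
    using that TT_crn op_of_inj[OF ga_crn] by (auto simp: gauge_op_of subset_iff)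
  then show ?thesis unfolding fixD_def toeplitz_op_of DD_def by auto
qed

lemma deg1F_op_of: "deg1F sE rE (op_of ZZ) = op_of ` FF"
proof -
  have "gauge sE rE t (op_of T) = osmul (exp (\<i> * complex_of_real t)) (op_of T) \<longleftrightarrow> ga t T = sc (cis t) * T" if "T \<in> TT" for t T
  proof -
    have T: "T \<in> crn" using that TT_crn by blast
    show ?thesis using op_of_inj[OF ga_crn[OF T] crn_ops(6)[OF T]]
      by (auto simp: gauge_op_of[OF T] op_of_simps cis_conv_exp)
  qed
  then show ?thesis unfolding deg1F_def toeplitz_op_of FF_def by auto
qed

lemma qmap_image: "A \<subseteq> crn \<Longrightarrow> qmap sE rE ` op_of ` A = kap ` qq ` A"
  unfolding image_image by (intro image_cong refl qmap_kap) blast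

lemma DD_FF_crn: "DD \<subseteq> crn" "FF \<subseteq> crn" using TT_crn by (auto simp: DD_def FF_def)

lemma DD_FF_cq: "qq ` DD \<subseteq> cq" "qq ` FF \<subseteq> cq" using DD_FF_crn qq_crn by auto

lemma zpow_kap: "zpow sE rE (op_of ZZ) l = kap (ck.zp l)" "ck.zp l \<in> cq"
proof -
  show cq: "ck.zp l \<in> cq" for l
    unfolding cq_def mem_Collect_eq ck.zp_E by (simp add: ck.zp_E')
  show "zpow sE rE (op_of ZZ) l = kap (ck.zp l)"
    by (induction l) (simp_all add: op_of_simps qmap_kap crn_ops ZZ_crn ck.zp_Suc kap_simps cq qq_crn)
qed

lemma SP_cq: "qq (SP \<alpha>) \<in> cq" "qstar (qq (SP \<alpha>)) \<in> cq" by (intro cq_ops qq_crn SP_crn)+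

lemma C_cq: "ck.C n \<subseteq> cq" using ck.C_corner by (auto simp: cq_def)

lemma Cn_kap: "Cn sE rE p (op_of ZZ) n = kap ` ck.C n"
proof -
  have g: "cmul sE rE (cmul sE rE (u sE rE \<alpha>) (zpow sE rE (op_of ZZ) l)) (cadj sE rE (u sE rE \<beta>)) =
      kap (qq (SP \<alpha>) * ck.zp l * qstar (qq (SP \<beta>)))" if "is_path sE rE \<alpha>" "is_path sE rE \<beta>" for \<alpha> \<beta> l
    using that by (simp add: u_kap zpow_kap kap_simps kap_unary cq_ops SP_cq)
  have "{cmul sE rE (cmul sE rE (u sE rE \<alpha>) (zpow sE rE (op_of ZZ) l)) (cadj sE rE (u sE rE \<beta>)) | \<alpha> \<beta> l.
        is_path sE rE \<alpha> \<and> is_path sE rE \<beta> \<and> n * p \<le> plen \<alpha> \<and> plen \<alpha> = plen \<beta> \<and>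
        plen \<alpha> < (n + 1) * p \<and> psrc \<alpha> = psrc \<beta>} = kap ` ck.gens n"
  proof (intro equalityI subsetI)
    fix x assume "x \<in> {cmul sE rE (cmul sE rE (u sE rE \<alpha>) (zpow sE rE (op_of ZZ) l)) (cadj sE rE (u sE rE \<beta>)) | \<alpha> \<beta> l.
        is_path sE rE \<alpha> \<and> is_path sE rE \<beta> \<and> n * p \<le> plen \<alpha> \<and> plen \<alpha> = plen \<beta> \<and>
        plen \<alpha> < (n + 1) * p \<and> psrc \<alpha> = psrc \<beta>}"
    then obtain \<alpha> \<beta> l where x: "x = kap (qq (SP \<alpha>) * ck.zp l * qstar (qq (SP \<beta>)))" "is_path sE rE \<alpha>" "is_path sE rE \<beta>"
      "n * p \<le> plen \<alpha>" "plen \<alpha> = plen \<beta>" "plen \<alpha> < (n + 1) * p" "psrc \<alpha> = psrc \<beta>" using g by blast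
    then show "x \<in> kap ` ck.gens n" unfolding ck.gens_def by blast
  next
    fix x assume "x \<in> kap ` ck.gens n"
    then obtain \<alpha> \<beta> l where x: "x = kap (qq (SP \<alpha>) * ck.zp l * qstar (qq (SP \<beta>)))" "is_path sE rE \<alpha>" "is_path sE rE \<beta>"
      "n * p \<le> plen \<alpha>" "plen \<alpha> = plen \<beta>" "plen \<alpha> < (n + 1) * p" "psrc \<alpha> = psrc \<beta>" unfolding ck.gens_def by blast
    show "x \<in> {cmul sE rE (cmul sE rE (u sE rE \<alpha>) (zpow sE rE (op_of ZZ) l)) (cadj sE rE (u sE rE \<beta>)) | \<alpha> \<beta> l.
        is_path sE rE \<alpha> \<and> is_path sE rE \<beta> \<and> n * p \<le> plen \<alpha> \<and> plen \<alpha> = plen \<beta> \<and>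
        plen \<alpha> < (n + 1) * p \<and> psrc \<alpha> = psrc \<beta>}"
      unfolding x(1) g[OF x(2,3), symmetric] using x(2-) by blast
  qed
  moreover have "ck.gens n \<subseteq> cq" using C_cq ck.gens_C by blast
  ultimately show ?thesis unfolding Cn_def ck.C_def by (simp only: ccstar_gen_kap)
qed

text \<open>J is contained in the image of \<open>kap\<close>, hence equals the image of its
  preimage \<open>I\<close>. As \<open>kap\<close> is injective on \<open>cq\<close> and respects
  the operations, every quantifier and every equality of sets moves to the quotient of the operator
  algebra, where \<open>K.fully_invariant_iff\<close> applies.\<close>

lemma fully_invariant_op_of_iff:
  assumes xi: "\<forall>v. is_path sE rE (\<xi> v) \<and> plen (\<xi> v) = p - 1 \<and> psrc (\<xi> v) = v"
    and J: "closed_ideal sE rE (qmap sE rE ` fixD sE rE (op_of ZZ)) J"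
  shows "fully_invariant sE rE (op_of ZZ) J \<longleftrightarrow>
    ((\<forall>v n \<mu>1 \<mu>2 \<nu>1 \<nu>2.
        is_path sE rE \<mu>1 \<and> plen \<mu>1 = n * p + p - 1 \<and> psrc \<mu>1 = v \<and>
        is_path sE rE \<mu>2 \<and> plen \<mu>2 = n * p + p - 1 \<and> psrc \<mu>2 = v \<and>
        is_path sE rE \<nu>1 \<and> plen \<nu>1 = p - 1 \<and> psrc \<nu>1 = v \<and>
        is_path sE rE \<nu>2 \<and> plen \<nu>2 = p - 1 \<and> psrc \<nu>2 = v \<longrightarrow>
        Jnv sE rE p (op_of ZZ) J 0 (\<xi> v) \<nu>1 \<nu>2 = Jnv sE rE p (op_of ZZ) J n (\<xi> v) \<mu>1 \<mu>2) \<and>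
     (\<forall>e f. \<forall>a\<in>J \<inter> Cn sE rE p (op_of ZZ) 0.
        cmul sE rE (cmul sE rE (cadj sE rE (ue sE rE e)) a) (ue sE rE f) \<in> J \<inter> Cn sE rE p (op_of ZZ) 0))"
proof -
  define I where "I = {a \<in> cq. kap a \<in> J}"
  have qD: "qmap sE rE ` fixD sE rE (op_of ZZ) = kap ` qq ` DD" and qF: "qmap sE rE ` deg1F sE rE (op_of ZZ) = kap ` qq ` FF"
    by (simp_all add: fixD_op_of deg1F_op_of qmap_image DD_FF_crn)
  have Jp: "J \<subseteq> kap ` qq ` DD" "kap 0 \<in> J" "\<And>a b. a \<in> J \<Longrightarrow> b \<in> J \<Longrightarrow> cadd sE rE a b \<in> J"
    "\<And>a c. a \<in> J \<Longrightarrow> csmul sE rE c a \<in> J" "\<And>a b. a \<in> J \<Longrightarrow> b \<in> kap ` qq ` DD \<Longrightarrow> cmul sE rE a b \<in> J"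
    "\<And>a b. a \<in> J \<Longrightarrow> b \<in> kap ` qq ` DD \<Longrightarrow> cmul sE rE b a \<in> J" "cclosed sE rE J"
    using J unfolding closed_ideal_def qD kap_0 by blast+
  have JI: "J = kap ` I" using Jp(1) DD_FF_cq(1) unfolding I_def by blast
  have Icq: "I \<subseteq> cq" by (auto simp: I_def)
  have ID: "I \<subseteq> qq ` DD"
  proof
    fix a assume "a \<in> I"
    then have "a \<in> cq" "kap a \<in> kap ` qq ` DD" using Jp(1) by (auto simp: I_def)
    then show "a \<in> qq ` DD" using kap_mem DD_FF_cq(1) by blast
  qed
  interpret K: ck_ideal sE rE "\<lambda>e. qq (SE e)" "\<lambda>v. qq (PV v)" "qq ZZ" "qq ee" p "\<lambda>\<alpha>. qq (SP \<alpha>)" "qq ` DD" "qq ` FF" I \<xi>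
  proof -
    show "ck_ideal sE rE (\<lambda>e. qq (SE e)) (\<lambda>v. qq (PV v)) (qq ZZ) (qq ee) p (qq ` DD) (qq ` FF) I \<xi>"
    proof (rule ck_idealI)
      show "\<xi> v \<in> PK sE rE (p - 1)" "psrc (\<xi> v) = v" for v using xi by (auto simp: PK_def)
      show "I \<subseteq> qq ` DD" by (rule ID)
      show "0 \<in> I" using Jp(2) cq_ops(1) by (simp add: I_def)
      show "a + b \<in> I" if "a \<in> I" "b \<in> I" for a b
        using that Jp(3)[of "kap a" "kap b"] by (simp add: I_def kap_simps cq_ops)
      show "qsc c * a \<in> I" if "a \<in> I" for a c
        using that Jp(4)[of "kap a" c] by (simp add: I_def kap_unary cq_ops)
      show "a * d \<in> I" "d * a \<in> I" if "a \<in> I" "d \<in> qq ` DD" for a d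
        using that Jp(5,6)[of "kap a" "kap d"] subsetD[OF DD_FF_cq(1) that(2)] by (simp_all add: I_def kap_simps cq_ops)
      show "closed I" unfolding I_def by (rule cclosed_imp_closed[OF Jp(7)])
    qed
  qed (rule eq_reflection, rule qq_SP)
  have sand: "cmul sE rE (cmul sE rE (cadj sE rE (kap x)) (kap a)) (kap y) = kap (qstar x * a * y)"
    if "x \<in> cq" "a \<in> cq" "y \<in> cq" for x a y
    using that by (simp add: kap_simps kap_unary cq_ops)
  have mem: "cmul sE rE (cmul sE rE (cadj sE rE (kap x)) (kap a)) (kap y) \<in> J \<longleftrightarrow> qstar x * a * y \<in> I"
    if "x \<in> cq" "a \<in> cq" "y \<in> cq" for x a y
    unfolding sand[OF that] using that by (simp add: I_def cq_ops)
  have FI: "fully_invariant sE rE (op_of ZZ) J \<longleftrightarrow>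
      (\<forall>a\<in>I. \<forall>x\<in>qq ` FF. \<forall>y\<in>qq ` FF. qstar x * a * y \<in> I) \<and>
      (\<forall>a\<in>qq ` DD. (\<forall>x\<in>qq ` FF. \<forall>y\<in>qq ` FF. qstar x * a * y \<in> I) \<longrightarrow> a \<in> I)"
  proof -
    define D F where "D = qq ` DD" and "F = qq ` FF"
    have DF: "D \<subseteq> cq" "F \<subseteq> cq" using DD_FF_cq by (simp_all add: D_def F_def)
    have 1: "(\<forall>x\<in>kap ` F. \<forall>y\<in>kap ` F. cmul sE rE (cmul sE rE (cadj sE rE x) (kap a)) y \<in> J) \<longleftrightarrow>
        (\<forall>x\<in>F. \<forall>y\<in>F. qstar x * a * y \<in> I)" if "a \<in> cq" for a
      unfolding ball_simps using DF(2) that by (intro ball_cong refl mem) auto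
    have 2: "(\<forall>a\<in>J. \<forall>x\<in>kap ` F. \<forall>y\<in>kap ` F. cmul sE rE (cmul sE rE (cadj sE rE x) a) y \<in> J) \<longleftrightarrow>
        (\<forall>a\<in>I. \<forall>x\<in>F. \<forall>y\<in>F. qstar x * a * y \<in> I)"
    proof -
      have "(\<forall>a\<in>kap ` I. \<forall>x\<in>kap ` F. \<forall>y\<in>kap ` F. cmul sE rE (cmul sE rE (cadj sE rE x) a) y \<in> J) \<longleftrightarrow>
        (\<forall>a\<in>I. \<forall>x\<in>kap ` F. \<forall>y\<in>kap ` F. cmul sE rE (cmul sE rE (cadj sE rE x) (kap a)) y \<in> J)" by blast
      also have "\<dots> \<longleftrightarrow> (\<forall>a\<in>I. \<forall>x\<in>F. \<forall>y\<in>F. qstar x * a * y \<in> I)"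
        using Icq by (intro ball_cong refl 1) auto
      finally show ?thesis unfolding JI[symmetric] .
    qed
    have 3: "(\<forall>a\<in>kap ` D. (\<forall>x\<in>kap ` F. \<forall>y\<in>kap ` F. cmul sE rE (cmul sE rE (cadj sE rE x) a) y \<in> J) \<longrightarrow> a \<in> J) \<longleftrightarrow>
        (\<forall>a\<in>D. (\<forall>x\<in>F. \<forall>y\<in>F. qstar x * a * y \<in> I) \<longrightarrow> a \<in> I)"
    proof -
      have "(\<forall>a\<in>kap ` D. (\<forall>x\<in>kap ` F. \<forall>y\<in>kap ` F. cmul sE rE (cmul sE rE (cadj sE rE x) a) y \<in> J) \<longrightarrow> a \<in> J) \<longleftrightarrow>
        (\<forall>a\<in>D. (\<forall>x\<in>kap ` F. \<forall>y\<in>kap ` F. cmul sE rE (cmul sE rE (cadj sE rE x) (kap a)) y \<in> J) \<longrightarrow> kap a \<in> J)" by blast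
      also have "\<dots> \<longleftrightarrow> (\<forall>a\<in>D. (\<forall>x\<in>F. \<forall>y\<in>F. qstar x * a * y \<in> I) \<longrightarrow> a \<in> I)"
      proof (intro ball_cong refl)
        fix a assume "a \<in> D"
        then have a: "a \<in> cq" using DF by blast
        then have "kap a \<in> J \<longleftrightarrow> a \<in> I" by (simp add: I_def)
        then show "((\<forall>x\<in>kap ` F. \<forall>y\<in>kap ` F. cmul sE rE (cmul sE rE (cadj sE rE x) (kap a)) y \<in> J) \<longrightarrow> kap a \<in> J) =
          ((\<forall>x\<in>F. \<forall>y\<in>F. qstar x * a * y \<in> I) \<longrightarrow> a \<in> I)" unfolding 1[OF a] by simp
      qed
      finally show ?thesis .
    qed
    show ?thesis
      unfolding fully_invariant_def using J unfolding qD qF D_def[symmetric] F_def[symmetric] 2 3 by blast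
  qed
  have JC: "J \<inter> Cn sE rE p (op_of ZZ) n = kap ` (I \<inter> ck.C n)" for n
    unfolding Cn_kap JI by (rule inj_on_image_Int[OF inj_on_kap Icq C_cq, symmetric])
  have ICq: "I \<inter> ck.C n \<subseteq> cq" for n using Icq by blast
  have Jcq: "K.Jn n \<zeta> \<mu>1 \<mu>2 \<subseteq> cq" for n \<zeta> \<mu>1 \<mu>2
    unfolding K.Jn_def using Icq by (auto intro!: cq_ops(2) SP_cq)
  have Jnv: "Jnv sE rE p (op_of ZZ) J n \<zeta> \<mu>1 \<mu>2 = kap ` K.Jn n \<zeta> \<mu>1 \<mu>2"
    if "is_path sE rE \<zeta>" "is_path sE rE \<mu>1" "is_path sE rE \<mu>2" for n \<zeta> \<mu>1 \<mu>2
  proof -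
    have eq: "cmul sE rE (cmul sE rE (cmul sE rE (cmul sE rE (u sE rE \<zeta>) (cadj sE rE (u sE rE \<mu>1))) (kap a))
        (u sE rE \<mu>2)) (cadj sE rE (u sE rE \<zeta>)) = kap (qq (SP \<zeta>) * qstar (qq (SP \<mu>1)) * a * qq (SP \<mu>2) * qstar (qq (SP \<zeta>)))"
      if "a \<in> cq" for a
      using \<open>is_path sE rE \<zeta>\<close> \<open>is_path sE rE \<mu>1\<close> \<open>is_path sE rE \<mu>2\<close> that
      by (simp add: u_kap kap_simps kap_unary cq_ops SP_cq)
    have "Jnv sE rE p (op_of ZZ) J n \<zeta> \<mu>1 \<mu>2 = (\<lambda>a. cmul sE rE (cmul sE rE (cmul sE rE (cmul sE rE (u sE rE \<zeta>) (cadj sE rE (u sE rE \<mu>1))) (kap a))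
        (u sE rE \<mu>2)) (cadj sE rE (u sE rE \<zeta>))) ` (I \<inter> ck.C n)"
      unfolding Jnv_def JC by blast
    also have "\<dots> = (\<lambda>a. kap (qq (SP \<zeta>) * qstar (qq (SP \<mu>1)) * a * qq (SP \<mu>2) * qstar (qq (SP \<zeta>)))) ` (I \<inter> ck.C n)"
      using ICq by (intro image_cong refl eq) blast
    also have "\<dots> = kap ` K.Jn n \<zeta> \<mu>1 \<mu>2" unfolding K.Jn_def by blast
    finally show ?thesis .
  qed
  have c1: "K.cond1 \<longleftrightarrow> (\<forall>v n \<mu>1 \<mu>2 \<nu>1 \<nu>2.
        is_path sE rE \<mu>1 \<and> plen \<mu>1 = n * p + p - 1 \<and> psrc \<mu>1 = v \<and>
        is_path sE rE \<mu>2 \<and> plen \<mu>2 = n * p + p - 1 \<and> psrc \<mu>2 = v \<and>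
        is_path sE rE \<nu>1 \<and> plen \<nu>1 = p - 1 \<and> psrc \<nu>1 = v \<and>
        is_path sE rE \<nu>2 \<and> plen \<nu>2 = p - 1 \<and> psrc \<nu>2 = v \<longrightarrow>
        Jnv sE rE p (op_of ZZ) J 0 (\<xi> v) \<nu>1 \<nu>2 = Jnv sE rE p (op_of ZZ) J n (\<xi> v) \<mu>1 \<mu>2)"
  proof -
    have eq: "Jnv sE rE p (op_of ZZ) J 0 (\<xi> v) \<nu>1 \<nu>2 = Jnv sE rE p (op_of ZZ) J n (\<xi> v) \<mu>1 \<mu>2 \<longleftrightarrow>
        K.Jn 0 (\<xi> v) \<nu>1 \<nu>2 = K.Jn n (\<xi> v) \<mu>1 \<mu>2"
      if "is_path sE rE \<mu>1" "is_path sE rE \<mu>2" "is_path sE rE \<nu>1" "is_path sE rE \<nu>2" for v n \<mu>1 \<mu>2 \<nu>1 \<nu>2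
      using that xi by (simp only: Jnv inj_on_image_eq_iff[OF inj_on_kap Jcq Jcq])
    show ?thesis unfolding K.cond1_def PK_def mem_Collect_eq
      by (intro arg_cong[where f = All] ext) (use eq in blast)
  qed
  have c2: "K.cond2 \<longleftrightarrow> (\<forall>e f. \<forall>a\<in>J \<inter> Cn sE rE p (op_of ZZ) 0.
        cmul sE rE (cmul sE rE (cadj sE rE (ue sE rE e)) a) (ue sE rE f) \<in> J \<inter> Cn sE rE p (op_of ZZ) 0)"
  proof -
    have "cmul sE rE (cmul sE rE (cadj sE rE (ue sE rE e)) (kap a)) (ue sE rE f) \<in> kap ` (I \<inter> ck.C 0) \<longleftrightarrow>
        qstar (qq (SE e)) * a * qq (SE f) \<in> I \<inter> ck.C 0" if "a \<in> I \<inter> ck.C 0" for a e f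
    proof -
      have a: "a \<in> cq" using that ICq by blast
      show ?thesis unfolding ue_kap sand[OF qq_crn[OF SE_crn] a qq_crn[OF SE_crn]]
        by (rule kap_mem[OF ICq]) (intro cq_ops a qq_crn SE_crn)
    qed
    then show ?thesis unfolding K.cond2_def JC by blast
  qed
  show ?thesis unfolding FI K.fully_invariant_iff c1 c2 ..
qed

end

theorem mainTheorem15:
  fixes sE rE :: "'e::finite \<Rightarrow> 'v::finite"
    and Z :: "('v,'e) op" and p :: nat
    and J :: "('v,'e) calk set"
    and \<xi> :: "'v \<Rightarrow> ('v,'e) path"
  assumes no_sources: "\<forall>v. \<exists>e. rE e = v"
    and no_sinks: "\<forall>v. \<exists>e. sE e = v"
    and weight: "weight_seq sE rE Z"
    and p_pos: "p \<ge> 1"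
    and condA: "condA sE rE p Z"
    and xi: "\<forall>v. is_path sE rE (\<xi> v) \<and> plen (\<xi> v) = p - 1 \<and> psrc (\<xi> v) = v"
    and J_ideal: "closed_ideal sE rE (qmap sE rE ` fixD sE rE Z) J"
  shows "fully_invariant sE rE Z J \<longleftrightarrow>
    ((\<forall>v n \<mu>1 \<mu>2 \<nu>1 \<nu>2.
        is_path sE rE \<mu>1 \<and> plen \<mu>1 = n * p + p - 1 \<and> psrc \<mu>1 = v \<and>
        is_path sE rE \<mu>2 \<and> plen \<mu>2 = n * p + p - 1 \<and> psrc \<mu>2 = v \<and>
        is_path sE rE \<nu>1 \<and> plen \<nu>1 = p - 1 \<and> psrc \<nu>1 = v \<and>
        is_path sE rE \<nu>2 \<and> plen \<nu>2 = p - 1 \<and> psrc \<nu>2 = v \<longrightarrow>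
        Jnv sE rE p Z J 0 (\<xi> v) \<nu>1 \<nu>2 = Jnv sE rE p Z J n (\<xi> v) \<mu>1 \<mu>2) \<and>
     (\<forall>e f. \<forall>a\<in>J \<inter> Cn sE rE p Z 0.
        cmul sE rE (cmul sE rE (cadj sE rE (ue sE rE e)) a) (ue sE rE f) \<in> J \<inter> Cn sE rE p Z 0))"
proof -
  obtain ZZ where ZZ: "Z = fock.op_of sE rE ZZ" "weighted_fock sE rE ZZ p"
    by (rule fock.weighted_fockI[OF no_sinks weight p_pos condA])
  show ?thesis
    unfolding ZZ(1) by (rule weighted_fock.fully_invariant_op_of_iff[OF ZZ(2) xi J_ideal[unfolded ZZ(1)]])
qed

end
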